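(* Let $d\ge 2$ and let $X=\{X(t):t\in\mathbb{R}^d\}$ be an isotropic random field satisfying Assumption (A0) of the context. Fix $\mathbf{w}\in\partial B_1^d$ and $u\in\mathbb{R}$, and let $$\beta_d=\frac{2\sqrt{\pi}\,\Gamma(\frac{d+1}{2})}{\Gamma(\frac d2)}.$$ Then $$\lim_{q\to 0^+}\frac1q\,\mathbb{P}\big(X(\mathbf 0)\le u<X(q\mathbf w)\big)=\frac{C_{d-1}^*(u)}{\beta_d},$$ and this limit is approached from below, i.e. $\frac1q\mathbb{P}(X(\mathbf 0)\le u<X(q\mathbf w))\le C^*_{d-1}(u)/\beta_d$ for $q>0$. Moreover, if $X$ also satisfies, for this $\mathbf w$, this $u$ and some $\varepsilon\in(0,1)$, Assumptions (A1) and (A2) of the context, then there exists a constant $K\in\mathbb{R}^+$ such that for all $q\in\mathbb{R}^+$, $$0\le \frac{C_{d-1}^*(u)}{\beta_d}\,q-\mathbb{P}\big(X(\mathbf 0)\le u<X(q\mathbf w)\big)\le K q^{2-\varepsilon}.$$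
   Context: Notation: $\sigma_k$ is the $k$-dimensional Hausdorff measure on $\mathbb{R}^d$, normalized to agree with $k$-dimensional Lebesgue measure ($\sigma_0$ is the counting measure). $B_1^d$ is the closed Euclidean unit ball of $\mathbb{R}^d$, $\partial B_1^d$ the unit sphere. Isotropic means that the law of the field is invariant under rotations about the origin. Assumption (A0): $X$ is a real-valued stationary random field on $\mathbb{R}^d$ with positive finite variance, almost surely of class $C^2$, and the probability density of $(X(\mathbf 0),\nabla X(\mathbf 0))$ is bounded uniformly on $\mathbb{R}^{d+1}$. Level sets and surface area density: $L_X(u)=\{t\in\mathbb{R}^d:X(t)=u\}$. For a bounded closed hypercube $T\subset\mathbb{R}^d$ with non-empty interior, $L_X^T(u)=T\cap L_X(u)$, $C_{d-1}^T(u)=\sigma_{d-1}(L_X^T(u))/\sigma_d(T)$, and $C_{d-1}^*(u)=\mathbb{E}[C_{d-1}^T(u)]$, which does not depend on $T$. Assumption (A1) (for $\mathbf w\in\partial B_1^d$): the process $Y=\{X(t\mathbf w):t\in\mathbb{R}\}$ is such that the conditional distribution of $Y(0)$ given $Y'(0)=0$ has a bounded density, and $\sup_{t\in[0,1]}|Y''(t)|\in L^2$. Assumption (A2) (for $\mathbf w\in\partial B_1^d$, $\varepsilon\in(0,1)$ and level $u$): $\mathbb{E}\big[\sigma_0(L_X(u)\cap l_{\mathbf w,\mathbf 0}\cap[0,1]^d)^{1/\varepsilon}\big]<\infty$, where $l_{\mathbf w,\mathbf 0}=\{\lambda\mathbf w:\lambda\in\mathbb{R}\}$.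
   Formalization: (A2) is assumed for a closed hypercube that the line l_{w,0} meets in more than one point, in place of [0,1]^d; if w has coordinates of both strict signs, l_{w,0} meets [0,1]^d only at 0, (A2) is void, and the second bound can fail. *)

theory Defs
  imports "HOL-Probability.Probability"
begin

section \<open>Hausdorff measure\<close>

text \<open>The factor is the volume of a \<open>k\<close>-dimensional ball of the same diameter, so that the measure
  agrees with \<open>k\<close>-dimensional Lebesgue measure. The case distinction matters only for \<open>k = 0\<close>:
  a one-point set of the cover has weight \<open>0 ^ 0 = 1\<close> and the empty set must have weight \<open>0\<close>,
  which makes \<open>hausdorff_measure 0\<close> the counting measure.\<close>

definition hausdorff_weight :: "nat \<Rightarrow> 'a::metric_space set \<Rightarrow> ennreal" where
  "hausdorff_weight k U =
     (if U = {} then 0 else ennreal (unit_ball_vol (real k) * (diameter U / 2) ^ k))"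

definition hausdorff_premeasure :: "nat \<Rightarrow> real \<Rightarrow> 'a::metric_space set \<Rightarrow> ennreal" where
  "hausdorff_premeasure k \<delta> S =
     (INF U \<in> {U :: nat \<Rightarrow> 'a set. S \<subseteq> (\<Union>n. U n) \<and> (\<forall>n. bounded (U n) \<and> diameter (U n) \<le> \<delta>)}.
        (\<Sum>n. hausdorff_weight k (U n)))"

definition hausdorff_measure :: "nat \<Rightarrow> 'a::metric_space set \<Rightarrow> ennreal" where
  "hausdorff_measure k S = (SUP \<delta> \<in> {0<..}. hausdorff_premeasure k \<delta> S)"

section \<open>Random fields\<close>

text \<open>A field on \<open>real ^ 'n\<close> over a probability space \<open>M\<close> is a function \<open>X\<close> with \<open>X t\<close> a random
  variable for every \<open>t\<close>. Its law is the image measure on the product space, i.e. it is given by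
  the finite-dimensional distributions.\<close>

definition random_field :: "'w measure \<Rightarrow> (real^'n \<Rightarrow> 'w \<Rightarrow> real) \<Rightarrow> bool" where
  "random_field M X \<longleftrightarrow> prob_space M \<and> (\<forall>t. X t \<in> borel_measurable M)"

definition field_law :: "'w measure \<Rightarrow> (real^'n \<Rightarrow> 'w \<Rightarrow> real) \<Rightarrow> (real^'n \<Rightarrow> real) measure" where
  "field_law M X = distr M (Pi\<^sub>M UNIV (\<lambda>_. borel)) (\<lambda>\<omega> t. X t \<omega>)"

definition stationary_field :: "'w measure \<Rightarrow> (real^'n \<Rightarrow> 'w \<Rightarrow> real) \<Rightarrow> bool" where
  "stationary_field M X \<longleftrightarrow> (\<forall>s. field_law M (\<lambda>t. X (t + s)) = field_law M X)"

definition isotropic_field :: "'w measure \<Rightarrow> (real^'n \<Rightarrow> 'w \<Rightarrow> real) \<Rightarrow> bool" where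
  "isotropic_field M X \<longleftrightarrow>
     (\<forall>Q :: real^'n^'n. rotation_matrix Q \<longrightarrow> field_law M (\<lambda>t. X (Q *v t)) = field_law M X)"

definition class_C2 :: "(real^'n \<Rightarrow> real) \<Rightarrow> bool" where
  "class_C2 f \<longleftrightarrow>
     (\<exists>(G :: real^'n \<Rightarrow> real^'n) (H :: real^'n \<Rightarrow> real^'n^'n).
        (\<forall>x. GDERIV f x :> G x) \<and>
        (\<forall>x. (G has_derivative (\<lambda>h. H x *v h)) (at x)) \<and>
        continuous_on UNIV H)"

text \<open>Paths are only almost surely differentiable and \<open>M\<close> need not be complete, so derivatives at
  a point enter through a measurable version \<open>Z\<close>, determined up to a null set.\<close>

definition assumption_A0 :: "'w measure \<Rightarrow> (real^'n \<Rightarrow> 'w \<Rightarrow> real) \<Rightarrow> bool" where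
  "assumption_A0 M X \<longleftrightarrow>
     random_field M X \<and> stationary_field M X \<and>
     integrable M (\<lambda>\<omega>. (X 0 \<omega>)\<^sup>2) \<and>
     0 < (LINT \<omega>|M. (X 0 \<omega> - (LINT \<omega>'|M. X 0 \<omega>'))\<^sup>2) \<and>
     (AE \<omega> in M. class_C2 (\<lambda>t. X t \<omega>)) \<and>
     (\<exists>Z \<in> borel_measurable M.
        (AE \<omega> in M. GDERIV (\<lambda>t. X t \<omega>) 0 :> Z \<omega>) \<and>
        (\<exists>(p :: real \<times> (real^'n) \<Rightarrow> ennreal) (B :: real).
           distributed M lborel (\<lambda>\<omega>. (X 0 \<omega>, Z \<omega>)) p \<and> (\<forall>z. p z \<le> ennreal B)))"

section \<open>Level sets\<close>

definition level_set :: "(real^'n \<Rightarrow> real) \<Rightarrow> real \<Rightarrow> (real^'n) set" where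
  "level_set f u = {t. f t = u}"

definition hypercube :: "(real^'n) set \<Rightarrow> bool" where
  "hypercube T \<longleftrightarrow>
     (\<exists>(a :: real^'n) r (f :: real^'n \<Rightarrow> real^'n). 0 < r \<and> orthogonal_transformation f \<and>
        T = (\<lambda>x. a + f x) ` cbox 0 (\<chi> i. r))"

definition C_dens ::
  "(real^'n \<Rightarrow> 'w \<Rightarrow> real) \<Rightarrow> (real^'n) set \<Rightarrow> real \<Rightarrow> 'w \<Rightarrow> ennreal" where
  "C_dens X T u \<omega> =
     hausdorff_measure (CARD('n) - 1) (T \<inter> level_set (\<lambda>t. X t \<omega>) u) / hausdorff_measure CARD('n) T"

text \<open>For a field with almost surely continuous paths the integrand coincides almost everywhere
  with a measurable function; \<open>nn_integral\<close> is insensitive to null sets, also for non-measurable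
  integrands, so this is the expectation. The value may be infinite.\<close>

definition C_star ::
  "'w measure \<Rightarrow> (real^'n \<Rightarrow> 'w \<Rightarrow> real) \<Rightarrow> (real^'n) set \<Rightarrow> real \<Rightarrow> ennreal" where
  "C_star M X T u = (\<integral>\<^sup>+ \<omega>. C_dens X T u \<omega> \<partial>M)"

section \<open>Assumptions on a line\<close>

text \<open>Conditioning on the null event \<open>W = c\<close>: the conditional laws of \<open>V\<close> given \<open>\<bar>W - c\<bar> \<le> \<delta>\<close>
  converge weakly, as \<open>\<delta>\<close> tends to \<open>0\<close>, to the law with density \<open>p\<close>. The limit distribution
  function is continuous, so convergence is required at every point. Degenerate conditioning is
  excluded, as \<open>cond_prob\<close> would then be constantly \<open>0\<close>.\<close>

definition has_cond_density ::
  "'w measure \<Rightarrow> ('w \<Rightarrow> real) \<Rightarrow> ('w \<Rightarrow> real) \<Rightarrow> real \<Rightarrow> (real \<Rightarrow> ennreal) \<Rightarrow> bool" where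
  "has_cond_density M V W c p \<longleftrightarrow>
     p \<in> borel_measurable borel \<and> prob_space (density lborel p) \<and>
     (\<forall>x. ((\<lambda>\<delta>. cond_prob M (\<lambda>\<omega>. V \<omega> \<le> x) (\<lambda>\<omega>. \<bar>W \<omega> - c\<bar> \<le> \<delta>))
              \<longlongrightarrow> measure (density lborel p) {..x}) (at_right 0))"

definition line_process :: "(real^'n \<Rightarrow> 'w \<Rightarrow> real) \<Rightarrow> real^'n \<Rightarrow> real \<Rightarrow> 'w \<Rightarrow> real" where
  "line_process X w t \<omega> = X (t *\<^sub>R w) \<omega>"

definition assumption_A1 :: "'w measure \<Rightarrow> (real^'n \<Rightarrow> 'w \<Rightarrow> real) \<Rightarrow> real^'n \<Rightarrow> bool" where
  "assumption_A1 M X w \<longleftrightarrow>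
     (let Y = line_process X w in
       (\<exists>Z \<in> borel_measurable M.
          (AE \<omega> in M. ((\<lambda>t. Y t \<omega>) has_real_derivative Z \<omega>) (at 0)) \<and>
          (\<exists>(p :: real \<Rightarrow> ennreal) (B :: real).
             has_cond_density M (Y 0) Z 0 p \<and> (\<forall>x. p x \<le> ennreal B))) \<and>
       (\<integral>\<^sup>+ \<omega>. (SUP t \<in> {0..1}. ennreal \<bar>deriv (deriv (\<lambda>s. Y s \<omega>)) t\<bar>)\<^sup>2 \<partial>M) < \<infinity>)"

definition line0 :: "real^'n \<Rightarrow> (real^'n) set" where
  "line0 w = {l *\<^sub>R w | l. True}"

definition ennpowr :: "ennreal \<Rightarrow> real \<Rightarrow> ennreal" where
  "ennpowr x a = (if x = \<infinity> then \<infinity> else ennreal (enn2real x powr a))"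

text \<open>The usual choice of \<open>Q\<close> is the unit cube \<open>cbox 0 1\<close>. If \<open>w\<close> has coordinates of both signs,
  that cube meets the line only in the origin and the condition is void; hence the cube is a
  parameter, to be chosen such that the line meets it in a segment. For a stationary field
  the condition does not depend on which such cube is chosen.\<close>

definition assumption_A2 ::
  "'w measure \<Rightarrow> (real^'n \<Rightarrow> 'w \<Rightarrow> real) \<Rightarrow> (real^'n) set \<Rightarrow> real^'n \<Rightarrow> real \<Rightarrow> real \<Rightarrow> bool" where
  "assumption_A2 M X Q w \<epsilon> u \<longleftrightarrow>
     (\<integral>\<^sup>+ \<omega>. ennpowr (hausdorff_measure 0 (level_set (\<lambda>t. X t \<omega>) u \<inter> line0 w \<inter> Q)) (1 / \<epsilon>) \<partial>M) < \<infinity>"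

section \<open>The two sides of the limit\<close>

definition cross_prob :: "'w measure \<Rightarrow> (real^'n \<Rightarrow> 'w \<Rightarrow> real) \<Rightarrow> real^'n \<Rightarrow> real \<Rightarrow> real \<Rightarrow> real" where
  "cross_prob M X w u q = \<P>(\<omega> in M. X 0 \<omega> \<le> u \<and> u < X (q *\<^sub>R w) \<omega>)"

definition beta_const :: "nat \<Rightarrow> real" where
  "beta_const d = 2 * sqrt pi * Gamma ((real d + 1) / 2) / Gamma (real d / 2)"

end

theory Submission imports Defs begin

text \<open>
  For a stationary field an upcrossing of the level over a step \<open>v + v'\<close> forces one over \<open>v\<close> or
  over the shifted step \<open>v'\<close>. Hence \<open>P (X 0 \<le> u < X v)\<close> is subadditive in \<open>v\<close>, and it tends to \<open>0\<close>
  with \<open>v\<close>. By isotropy it depends on \<open>norm v\<close> only. By Fekete's argument the quotient by the step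
  length converges, as the length tends to \<open>0\<close>, to its supremum over all lengths
  (\<open>rate_tendsto\<close>). So the limit exists and is approached from below, and the first part reduces to
  identifying the supremum, called \<open>rate\<close> below, with \<open>C\<^sup>* / \<beta>\<close> (\<open>rate_eq\<close>).

  The identification is a Crofton argument. Let \<open>crossing_volume\<close> be the volume of the pairs
  \<open>(t, v)\<close>, \<open>t\<close> in a window and \<open>norm v \<le> q\<close>, for which the path takes values on different sides of
  the level at \<open>t\<close> and \<open>t + v\<close>. Its expectation is the volume of the window times an average of twice the
  upcrossing probability, hence comparable with \<open>rate\<close> times \<open>2 * norm_const d * q ^ (d + 1)\<close>.
  On the other hand the points \<open>t\<close> whose segment to \<open>t + v\<close> passes through a surface element with unit
  normal \<open>n\<close> have a volume of \<open>\<bar>v \<bullet> n\<bar>\<close> times its area, which after integration over \<open>v\<close> gives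
  \<open>abs_proj_const d * q ^ (d + 1)\<close> times the area; and \<open>2 * norm_const d / abs_proj_const d = \<beta>\<close>.
  For a \<open>C\<^sup>1\<close> path without critical points on the level the area bounds the crossing volume for every
  \<open>q\<close> (\<open>crossing_volume_le\<close>), and the normalised crossing volumes bound the area in the limit
  (\<open>hausdorff_le_liminf_crossing_volume\<close>), which by Fatou's lemma is enough. Almost surely there is no
  critical point on the level, as the density of the value and the gradient is bounded
  (\<open>no_critical_points\<close>).

  The two geometric inequalities compare the Hausdorff measure of a nearly flat piece of the
  level set with the Lebesgue measure of its projection to a hyperplane. One direction rests on the
  isodiametric inequality, proved by Steiner symmetrisation, the other on an
  efficient covering by balls, obtained from Vitali's theorem. Projections are measured inside a slab
  of unit thickness, so that only Lebesgue measure of the full space occurs.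

  For the second part, divide a segment of length \<open>q\<close> into \<open>m\<close> steps. The expected
  number of upcrossings over the steps tends to \<open>rate * q\<close>, while the probability of an upcrossing over
  the whole segment is to be compared with it. More upcrossings on the grid than over the segment
  force a turning point of the path next to a point of the level. If the derivative along the line has
  Lipschitz constant \<open>q powr (- 1 / 2)\<close>, then \<open>\<bar>X - u\<bar> \<le> q powr (3 / 2)\<close> and
  \<open>\<bar>\<partial>X\<bar> \<le> q powr (1 / 2)\<close> at the beginning of the segment, an event of probability \<open>O (q\<^sup>2)\<close> by
  \<open>small_ball\<close>. The Lipschitz constant is exceeded with probability \<open>O (q)\<close> by Markov's inequality.
  The number of upcrossings is truncated at \<open>q powr (- \<epsilon>)\<close>, the excess being controlled
  by its moment of order \<open>1 / \<epsilon>\<close>. Summing over the disjoint segments of length \<open>q\<close> that fit in a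
  segment of fixed length gives an error \<open>O (q powr (1 - \<epsilon>))\<close>, that is \<open>O (q powr (2 - \<epsilon>))\<close> for each
  (\<open>grid_excess\<close>, \<open>refined_rate\<close>).

  The bound \<open>small_ball\<close> uses isotropy: given the value and the length of the gradient, the
  direction of the gradient is uniformly distributed, so the probability of a small component along
  \<open>w\<close> scales linearly in all ranges. This transports the bounded conditional density, which
  concerns vanishing components only, to components of positive size.
\<close>

section \<open>Fubini along a direction\<close>

lemma nn_integral_lborel_shift:
  fixes f :: "'a::euclidean_space \<Rightarrow> ennreal"
  assumes [measurable]: "f \<in> borel_measurable borel"
  shows "(\<integral>\<^sup>+x. f (x + c) \<partial>lborel) = (\<integral>\<^sup>+x. f x \<partial>lborel)"
proof -
  have "(\<integral>\<^sup>+x. f x \<partial>lborel) = (\<integral>\<^sup>+x. f x \<partial>(distr lborel borel ((+) c)))"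
    by (simp add: lborel_distr_plus)
  also have "\<dots> = (\<integral>\<^sup>+x. f (c + x) \<partial>lborel)"
    by (subst nn_integral_distr) auto
  finally show ?thesis by (simp add: add.commute)
qed

lemma emeasure_lborel_preimage:
  assumes [measurable]: "g \<in> borel_measurable (borel :: 'b::euclidean_space measure)" "A \<in> sets borel"
  shows "emeasure lborel {x. g x \<in> A} = (\<integral>\<^sup>+x. indicator A (g x) \<partial>lborel)"
proof -
  have "indicator A (g x) = (indicator {x. g x \<in> A} x :: ennreal)" for x
    by (simp add: indicator_def)
  then show ?thesis by simp
qed

lemma emeasure_lborel_shift:
  fixes A :: "'a::euclidean_space set"
  assumes [measurable]: "A \<in> sets borel"
  shows "emeasure lborel {x. x + c \<in> A} = emeasure lborel A"
proof -
  have "emeasure lborel {x. x + c \<in> A} = (\<integral>\<^sup>+x. indicator A (x + c) \<partial>lborel)"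
    by (rule emeasure_lborel_preimage) measurable
  also have "\<dots> = (\<integral>\<^sup>+x. indicator A x \<partial>lborel)"
    by (rule nn_integral_lborel_shift) simp
  finally show ?thesis by simp
qed

text \<open>A set in the hyperplane orthogonal to \<open>n\<close> is represented by the cylinder over it in this slab. As
  the slab has thickness one, the volume of the cylinder is the measure of the set in the hyperplane.\<close>

definition slab :: "'a::euclidean_space \<Rightarrow> 'a set" where
  "slab n = {x. 0 \<le> x \<bullet> n \<and> x \<bullet> n \<le> 1}"

definition pr :: "'a::euclidean_space \<Rightarrow> 'a \<Rightarrow> 'a" where
  "pr n x = x - (x \<bullet> n) *\<^sub>R n"

lemma slab_borel [measurable]: "slab n \<in> sets borel"
  unfolding slab_def by measurable

lemma closed_slab: "closed (slab n)"
  unfolding slab_def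
  by (intro closed_Collect_conj closed_Collect_le continuous_intros)

lemma pr_borel [measurable]: "pr n \<in> borel_measurable borel"
  unfolding pr_def by measurable

lemma continuous_on_pr [continuous_intros]: "continuous_on S (pr n)"
  unfolding pr_def by (intro continuous_intros)

lemma pr_add: "pr n (x + y) = pr n x + pr n y"
  by (simp add: pr_def inner_add_left scaleR_add_left)

lemma pr_diff: "pr n (x - y) = pr n x - pr n y"
  by (simp add: pr_def inner_diff_left scaleR_diff_left)

lemma pr_scale: "pr n (c *\<^sub>R x) = c *\<^sub>R pr n x"
  by (simp add: pr_def scaleR_diff_right)

lemma pr_self: "norm n = 1 \<Longrightarrow> pr n n = 0"
  by (simp add: pr_def dot_square_norm)

lemma pr_inner: "norm n = 1 \<Longrightarrow> pr n x \<bullet> n = 0"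
  by (simp add: pr_def inner_diff_left dot_square_norm)

lemma pr_decomp: "x = pr n x + (x \<bullet> n) *\<^sub>R n"
  by (simp add: pr_def)

lemma norm_pr_sq:
  assumes "norm n = 1" shows "(norm x)\<^sup>2 = (norm (pr n x))\<^sup>2 + (x \<bullet> n)\<^sup>2"
proof -
  have "n \<bullet> n = 1" using assms by (simp add: dot_square_norm)
  then show ?thesis
    by (simp only: power2_norm_eq_inner pr_def) (simp add: inner_diff_left inner_diff_right inner_commute power2_eq_square)
qed

lemma norm_pr_le: "norm n = 1 \<Longrightarrow> norm (pr n x) \<le> norm x"
  using norm_pr_sq[of n x] by (metis abs_norm_cancel le_add_same_cancel1 power2_le_iff_abs_le norm_ge_zero zero_le_power2)

text \<open>Every line in direction \<open>n\<close> meets the slab in a segment of length one. Inserting this length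
  and exchanging the integrals gives Fubini's theorem for the direction \<open>n\<close> without a choice of coordinates.\<close>

lemma nn_integral_along_direction:
  fixes f :: "'a::euclidean_space \<Rightarrow> ennreal" and n :: 'a
  assumes [measurable]: "f \<in> borel_measurable borel" and n: "norm n = 1"
  shows "(\<integral>\<^sup>+x. f x \<partial>lborel)
       = (\<integral>\<^sup>+x. indicator (slab n) x * (\<integral>\<^sup>+s. f (x + s *\<^sub>R n) \<partial>lborel) \<partial>lborel)"
proof -
  have nn: "n \<bullet> n = 1" using n by (simp add: dot_square_norm)
  have len: "(\<integral>\<^sup>+s. indicator (slab n) (x + (- s) *\<^sub>R n) \<partial>(lborel::real measure)) = 1" for x :: 'a
  proof -
    have "(\<integral>\<^sup>+s. indicator (slab n) (x + (- s) *\<^sub>R n) \<partial>(lborel::real measure))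
        = (\<integral>\<^sup>+s. indicator {x \<bullet> n - 1 .. x \<bullet> n} s \<partial>(lborel::real measure))"
      by (intro nn_integral_cong) (auto simp: indicator_def slab_def inner_diff_left nn)
    also have "\<dots> = 1" by simp
    finally show ?thesis .
  qed
  have "(\<integral>\<^sup>+x. indicator (slab n) x * (\<integral>\<^sup>+s. f (x + s *\<^sub>R n) \<partial>lborel) \<partial>lborel)
      = (\<integral>\<^sup>+x. (\<integral>\<^sup>+s. indicator (slab n) x * f (x + s *\<^sub>R n) \<partial>(lborel::real measure)) \<partial>lborel)"
    by (intro nn_integral_cong nn_integral_cmult[symmetric]) auto
  also have "\<dots> = (\<integral>\<^sup>+s. (\<integral>\<^sup>+x. indicator (slab n) x * f (x + s *\<^sub>R n) \<partial>lborel) \<partial>(lborel::real measure))"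
    by (rule lborel_pair.Fubini'[symmetric]) measurable
  also have "\<dots> = (\<integral>\<^sup>+s. (\<integral>\<^sup>+x. indicator (slab n) (x + (- s) *\<^sub>R n) * f x \<partial>lborel) \<partial>(lborel::real measure))"
  proof (rule nn_integral_cong)
    fix s :: real
    show "(\<integral>\<^sup>+x. indicator (slab n) x * f (x + s *\<^sub>R n) \<partial>lborel)
        = (\<integral>\<^sup>+x. indicator (slab n) (x + (- s) *\<^sub>R n) * f x \<partial>lborel)"
      using nn_integral_lborel_shift[of "\<lambda>x. indicator (slab n) x * f (x + s *\<^sub>R n)" "(- s) *\<^sub>R n"]
      by simp
  qed
  also have "\<dots> = (\<integral>\<^sup>+x. (\<integral>\<^sup>+s. indicator (slab n) (x + (- s) *\<^sub>R n) * f x \<partial>(lborel::real measure)) \<partial>lborel)"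
    by (rule lborel_pair.Fubini') measurable
  also have "\<dots> = (\<integral>\<^sup>+x. f x \<partial>lborel)"
    by (intro nn_integral_cong, subst nn_integral_multc) (measurable, use len in simp)
  finally show ?thesis by simp
qed

lemma emeasure_along_direction:
  fixes A :: "'a::euclidean_space set" and n :: 'a
  assumes [measurable]: "A \<in> sets borel" and n: "norm n = 1"
  shows "emeasure lborel A
       = (\<integral>\<^sup>+x. indicator (slab n) x * emeasure lborel {s. x + s *\<^sub>R n \<in> A} \<partial>lborel)"
proof -
  have "emeasure lborel {s. x + s *\<^sub>R n \<in> A} = (\<integral>\<^sup>+s. indicator A (x + s *\<^sub>R n) \<partial>lborel)" for x
    by (rule emeasure_lborel_preimage) measurable
  then show ?thesis
    using nn_integral_along_direction[of "indicator A" n] n by simp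
qed

text \<open>The measure of the disc of radius \<open>r\<close> in the hyperplane orthogonal to \<open>n\<close>.\<close>

definition disc_vol :: "'a::euclidean_space \<Rightarrow> real \<Rightarrow> ennreal" where
  "disc_vol n r = emeasure lborel {x \<in> slab n. norm (pr n x) \<le> r}"

lemma emeasure_lborel_scale:
  fixes A :: "'a::euclidean_space set"
  assumes [measurable]: "A \<in> sets borel" and r: "r > 0"
  shows "emeasure lborel {x. (1 / r) *\<^sub>R x \<in> A} = ennreal (r ^ DIM('a)) * emeasure lborel A"
proof -
  have "emeasure lborel {x. (1 / r) *\<^sub>R x \<in> A} = (\<integral>\<^sup>+x. indicator A ((1 / r) *\<^sub>R x) \<partial>lborel)"
    by (rule emeasure_lborel_preimage) measurable
  also have "\<dots> = (\<integral>\<^sup>+x. indicator A ((1 / r) *\<^sub>R x) \<partial>(density (distr lborel borel (\<lambda>x. 0 + r *\<^sub>R x)) (\<lambda>_. \<bar>r\<bar>^DIM('a))))"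
    by (rule arg_cong[where f="\<lambda>M. nn_integral M _"], rule lborel_affine) (use r in auto)
  also have "\<dots> = (\<integral>\<^sup>+x. ennreal (r ^ DIM('a)) * indicator A x \<partial>lborel)"
    using r by (subst nn_integral_density, simp, simp, subst nn_integral_distr) auto
  also have "\<dots> = ennreal (r ^ DIM('a)) * emeasure lborel A"
    by (subst nn_integral_cmult) auto
  finally show ?thesis by simp
qed

text \<open>By Fubini along \<open>n\<close> each fibre of the layer has length \<open>b - a\<close> or is empty.\<close>

lemma emeasure_layer:
  fixes n :: "'a::euclidean_space"
  assumes n: "norm n = 1" and ab: "a \<le> b"
    and [measurable]: "C \<in> sets borel"
  shows "emeasure lborel {x. pr n x \<in> C \<and> a \<le> x \<bullet> n \<and> x \<bullet> n \<le> b}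
       = ennreal (b - a) * emeasure lborel {x \<in> slab n. pr n x \<in> C}"
proof -
  have nn: "n \<bullet> n = 1" using n by (simp add: dot_square_norm)
  have pn: "pr n (x + s *\<^sub>R n) = pr n x" for x s using n by (simp add: pr_add pr_scale pr_self)
  have "emeasure lborel {s. x + s *\<^sub>R n \<in> {x. pr n x \<in> C \<and> a \<le> x \<bullet> n \<and> x \<bullet> n \<le> b}}
      = ennreal (b - a) * indicator {x. pr n x \<in> C} x" for x
  proof (cases "pr n x \<in> C")
    case True
    then have "{s. x + s *\<^sub>R n \<in> {x. pr n x \<in> C \<and> a \<le> x \<bullet> n \<and> x \<bullet> n \<le> b}} = {a - x \<bullet> n .. b - x \<bullet> n}"
      by (auto simp: pn inner_add_left nn)
    then show ?thesis using True ab by simp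
  qed (simp add: pn)
  moreover have "{x. pr n x \<in> C \<and> a \<le> x \<bullet> n \<and> x \<bullet> n \<le> b} \<in> sets borel" by measurable
  ultimately have "emeasure lborel {x. pr n x \<in> C \<and> a \<le> x \<bullet> n \<and> x \<bullet> n \<le> b}
     = (\<integral>\<^sup>+x. ennreal (b - a) * indicator {x \<in> slab n. pr n x \<in> C} x \<partial>lborel)"
    by (subst emeasure_along_direction[OF _ n])
       (auto intro!: nn_integral_cong simp: indicator_def)
  also have "\<dots> = ennreal (b - a) * emeasure lborel {x \<in> slab n. pr n x \<in> C}"
    by (subst nn_integral_cmult) auto
  finally show ?thesis .
qed

text \<open>Scaling the full space by \<open>r\<close> multiplies volumes by \<open>r ^ d\<close> and the thickness of the slab by
  \<open>r\<close>, which leaves the exponent \<open>d - 1\<close>.\<close>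

lemma disc_vol_homogeneous:
  fixes n :: "'a::euclidean_space"
  assumes n: "norm n = 1" and r: "r > 0"
  shows "disc_vol n r = ennreal (r ^ (DIM('a) - 1)) * disc_vol n 1"
proof -
  have "ennreal (r ^ DIM('a)) * disc_vol n 1
      = emeasure lborel {x. (1 / r) *\<^sub>R x \<in> {x \<in> slab n. norm (pr n x) \<le> 1}}"
    unfolding disc_vol_def by (subst emeasure_lborel_scale[OF _ r]) auto
  also have "{x. (1 / r) *\<^sub>R x \<in> {x \<in> slab n. norm (pr n x) \<le> 1}}
      = {x. pr n x \<in> cball 0 r \<and> 0 \<le> x \<bullet> n \<and> x \<bullet> n \<le> r}"
    using r by (auto simp: slab_def pr_scale field_simps)
  also have "emeasure lborel \<dots> = ennreal r * disc_vol n r"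
    using emeasure_layer[OF n, of 0 r "cball 0 r"] r by (simp add: disc_vol_def)
  finally have "ennreal r * disc_vol n r = ennreal (r * r ^ (DIM('a) - 1)) * disc_vol n 1"
    by (metis DIM_positive power_eq_if neq0_conv)
  also have "\<dots> = ennreal r * (ennreal (r ^ (DIM('a) - 1)) * disc_vol n 1)"
    using r by (simp add: ennreal_mult' mult.assoc)
  finally show ?thesis
    using r by (simp add: ennreal_mult_cancel_left)
qed

lemma nn_integral_cball_height:
  fixes n :: "'a::euclidean_space" and \<phi> :: "real \<Rightarrow> ennreal"
  assumes n: "norm n = 1" and q: "q > 0" and [measurable]: "\<phi> \<in> borel_measurable borel"
  shows "(\<integral>\<^sup>+v\<in>cball 0 q. \<phi> (v \<bullet> n) \<partial>lborel)
       = (\<integral>\<^sup>+s\<in>{-q..q}. \<phi> s * disc_vol n (sqrt (q\<^sup>2 - s\<^sup>2)) \<partial>lborel)"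
proof -
  have nn: "n \<bullet> n = 1" using n by (simp add: dot_square_norm)
  have pn: "pr n (x + s *\<^sub>R n) = pr n x" for x s using n by (simp add: pr_add pr_scale pr_self)
  have [measurable]: "cball (0::'a) q \<in> sets borel" by simp
  have iff: "x + (s - x \<bullet> n) *\<^sub>R n \<in> cball 0 q \<longleftrightarrow> s \<in> {-q..q} \<and> norm (pr n x) \<le> sqrt (q\<^sup>2 - s\<^sup>2)" for x s
  proof -
    have "x + (s - x \<bullet> n) *\<^sub>R n \<in> cball 0 q \<longleftrightarrow> (norm (x + (s - x \<bullet> n) *\<^sub>R n))\<^sup>2 \<le> q\<^sup>2"
      using q by (simp add: abs_le_square_iff[symmetric])
    also have "(norm (x + (s - x \<bullet> n) *\<^sub>R n))\<^sup>2 = (norm (pr n x))\<^sup>2 + s\<^sup>2"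
      by (subst norm_pr_sq[OF n]) (simp add: pn inner_add_left nn)
    also have "\<dots> \<le> q\<^sup>2 \<longleftrightarrow> s \<in> {-q..q} \<and> norm (pr n x) \<le> sqrt (q\<^sup>2 - s\<^sup>2)"
    proof
      assume *: "(norm (pr n x))\<^sup>2 + s\<^sup>2 \<le> q\<^sup>2"
      then have "s\<^sup>2 \<le> q\<^sup>2" by (smt (verit) zero_le_power2)
      then have "\<bar>s\<bar> \<le> q" using q abs_le_square_iff[of s q] by simp
      moreover have "norm (pr n x) \<le> sqrt (q\<^sup>2 - s\<^sup>2)" using * by (intro real_le_rsqrt) simp
      ultimately show "s \<in> {-q..q} \<and> norm (pr n x) \<le> sqrt (q\<^sup>2 - s\<^sup>2)" by auto
    next
      assume *: "s \<in> {-q..q} \<and> norm (pr n x) \<le> sqrt (q\<^sup>2 - s\<^sup>2)"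
      then have "s\<^sup>2 \<le> q\<^sup>2" using q abs_le_square_iff[of s q] by auto
      then have "(norm (pr n x))\<^sup>2 \<le> q\<^sup>2 - s\<^sup>2"
        using * by (metis diff_ge_0_iff_ge norm_ge_zero power_mono real_sqrt_pow2)
      then show "(norm (pr n x))\<^sup>2 + s\<^sup>2 \<le> q\<^sup>2" by simp
    qed
    finally show ?thesis .
  qed
  have "(\<integral>\<^sup>+v\<in>cball 0 q. \<phi> (v \<bullet> n) \<partial>lborel)
     = (\<integral>\<^sup>+x. indicator (slab n) x * (\<integral>\<^sup>+s. \<phi> ((x + s *\<^sub>R n) \<bullet> n) * indicator (cball 0 q) (x + s *\<^sub>R n) \<partial>lborel) \<partial>lborel)"
    by (rule nn_integral_along_direction[OF _ n]) measurable
  also have "\<dots> = (\<integral>\<^sup>+x. indicator (slab n) x * (\<integral>\<^sup>+s. \<phi> s * indicator (cball 0 q) (x + (s - x \<bullet> n) *\<^sub>R n) \<partial>lborel) \<partial>lborel)"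
  proof (rule nn_integral_cong)
    fix x :: 'a
    have "(\<integral>\<^sup>+s. \<phi> s * indicator (cball 0 q) (x + (s - x \<bullet> n) *\<^sub>R n) \<partial>lborel)
       = (\<integral>\<^sup>+s. \<phi> (s + x \<bullet> n) * indicator (cball 0 q) (x + (s + x \<bullet> n - x \<bullet> n) *\<^sub>R n) \<partial>lborel)"
      by (rule nn_integral_lborel_shift[symmetric]) measurable
    also have "\<dots> = (\<integral>\<^sup>+s. \<phi> ((x + s *\<^sub>R n) \<bullet> n) * indicator (cball 0 q) (x + s *\<^sub>R n) \<partial>lborel)"
      by (intro nn_integral_cong) (simp add: inner_add_left nn add.commute)
    finally show "indicator (slab n) x * (\<integral>\<^sup>+s. \<phi> ((x + s *\<^sub>R n) \<bullet> n) * indicator (cball 0 q) (x + s *\<^sub>R n) \<partial>lborel)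
      = indicator (slab n) x * (\<integral>\<^sup>+s. \<phi> s * indicator (cball 0 q) (x + (s - x \<bullet> n) *\<^sub>R n) \<partial>lborel)" by simp
  qed
  also have "\<dots> = (\<integral>\<^sup>+x. (\<integral>\<^sup>+s. (\<phi> s * indicator {-q..q} s) * indicator {x \<in> slab n. norm (pr n x) \<le> sqrt (q\<^sup>2 - s\<^sup>2)} x \<partial>lborel) \<partial>lborel)"
  proof (rule nn_integral_cong)
    fix x :: 'a
    have "indicator (slab n) x * (\<integral>\<^sup>+s. \<phi> s * indicator (cball 0 q) (x + (s - x \<bullet> n) *\<^sub>R n) \<partial>lborel)
      = (\<integral>\<^sup>+s. indicator (slab n) x * (\<phi> s * indicator (cball 0 q) (x + (s - x \<bullet> n) *\<^sub>R n)) \<partial>lborel)"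
      by (rule nn_integral_cmult[symmetric]) measurable
    also have "\<dots> = (\<integral>\<^sup>+s. (\<phi> s * indicator {-q..q} s) * indicator {x \<in> slab n. norm (pr n x) \<le> sqrt (q\<^sup>2 - s\<^sup>2)} x \<partial>lborel)"
      by (intro nn_integral_cong) (auto simp: iff indicator_def simp del: mem_cball mem_cball_0)
    finally show "indicator (slab n) x * (\<integral>\<^sup>+s. \<phi> s * indicator (cball 0 q) (x + (s - x \<bullet> n) *\<^sub>R n) \<partial>lborel)
      = (\<integral>\<^sup>+s. (\<phi> s * indicator {-q..q} s) * indicator {x \<in> slab n. norm (pr n x) \<le> sqrt (q\<^sup>2 - s\<^sup>2)} x \<partial>lborel)" .
  qed
  also have "\<dots> = (\<integral>\<^sup>+s. (\<integral>\<^sup>+x. (\<phi> s * indicator {-q..q} s) * indicator {x \<in> slab n. norm (pr n x) \<le> sqrt (q\<^sup>2 - s\<^sup>2)} x \<partial>lborel) \<partial>lborel)"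
    by (rule lborel_pair.Fubini'[symmetric]) measurable
  also have "\<dots> = (\<integral>\<^sup>+s\<in>{-q..q}. \<phi> s * disc_vol n (sqrt (q\<^sup>2 - s\<^sup>2)) \<partial>lborel)"
    by (intro nn_integral_cong, subst nn_integral_cmult)
       (auto simp: disc_vol_def mult_ac)
  finally show ?thesis .
qed

lemma unit_ball_vol_Beta:
  "unit_ball_vol (real k) * Beta (1/2) (real k / 2 + 1) = unit_ball_vol (real (Suc k))"
  by (auto simp: unit_ball_vol_def Beta_def Gamma_eq_zero_iff field_simps
          Gamma_one_half_real powr_half_sqrt [symmetric] powr_add [symmetric])

text \<open>The volume of the unit ball is computed twice, by slicing and from the recursion
  for \<open>unit_ball_vol\<close>; comparing the two determines the disc.\<close>

lemma disc_vol_one: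
  fixes n :: "'a::euclidean_space"
  assumes n: "norm n = 1"
  shows "disc_vol n 1 = ennreal (unit_ball_vol (real (DIM('a) - 1)))"
proof -
  let ?k = "DIM('a) - 1"
  have d: "Suc ?k = DIM('a)" using DIM_positive[where 'a='a] by simp
  have B: "Beta (1/2) (real ?k / 2 + 1) > 0"
    unfolding Beta_def by (intro divide_pos_pos mult_pos_pos Gamma_real_pos) (use DIM_positive[where 'a='a] in \<open>auto simp: field_simps\<close>)
  have "ennreal (unit_ball_vol (real DIM('a))) = (\<integral>\<^sup>+v\<in>cball 0 1. 1 \<partial>(lborel::'a measure))"
    using emeasure_cball[of 1 "0::'a"] by simp
  also have "\<dots> = (\<integral>\<^sup>+s\<in>{-1..1}. 1 * disc_vol n (sqrt (1\<^sup>2 - s\<^sup>2)) \<partial>lborel)"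
    by (rule nn_integral_cball_height[OF n]) auto
  also have "\<dots> = (\<integral>\<^sup>+s. (indicator {-1..1} s * ennreal (sqrt (1 - s\<^sup>2) ^ ?k)) * disc_vol n 1 \<partial>lborel)"
  proof (intro nn_integral_cong_AE)
    have "AE s in lborel. s \<notin> {-1, 1::real}"
      by (intro AE_not_in countable_imp_null_set_lborel) auto
    then show "AE s in lborel. 1 * disc_vol n (sqrt (1\<^sup>2 - s\<^sup>2)) * indicator {-1..1} s
      = (indicator {-1..1} s * ennreal (sqrt (1 - s\<^sup>2) ^ ?k)) * disc_vol n 1"
    proof eventually_elim
      case (elim s)
      show ?case
      proof (cases "s \<in> {-1..1}")
        case True
        with elim have "s\<^sup>2 < 1" by (auto simp: abs_square_less_1)
        then have "sqrt (1 - s\<^sup>2) > 0" by simp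
        from disc_vol_homogeneous[OF n this] True show ?thesis by (simp add: mult_ac)
      qed simp
    qed
  qed
  also have "\<dots> = (\<integral>\<^sup>+s. indicator {-1..1} s * sqrt (1 - s\<^sup>2) ^ ?k \<partial>lborel) * disc_vol n 1"
    by (subst nn_integral_multc) (auto intro!: arg_cong2[where f="(*)"] nn_integral_cong simp: indicator_def)
  also have "\<dots> = ennreal (Beta (1/2) (real ?k / 2 + 1)) * disc_vol n 1"
    by (simp only: emeasure_cball_aux_integral)
  finally have "ennreal (Beta (1/2) (real ?k / 2 + 1)) * disc_vol n 1
      = ennreal (Beta (1/2) (real ?k / 2 + 1)) * ennreal (unit_ball_vol (real ?k))"
    using unit_ball_vol_Beta[of ?k] B unfolding d
    by (subst ennreal_mult'[symmetric]) (auto simp: mult.commute)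
  then show ?thesis using B by (simp add: ennreal_mult_cancel_left)
qed

lemma disc_vol_eq:
  fixes n :: "'a::euclidean_space"
  assumes n: "norm n = 1" and r: "r > 0"
  shows "disc_vol n r = ennreal (unit_ball_vol (real (DIM('a) - 1)) * r ^ (DIM('a) - 1))"
  using disc_vol_homogeneous[OF n r] r
  by (simp add: disc_vol_one[OF n] ennreal_mult' mult.commute)

section \<open>Ball integrals and the isodiametric inequality\<close>

text \<open>The integral of \<open>\<bar>v \<bullet> n\<bar>\<close> over the unit ball, for a unit vector \<open>n\<close>.\<close>

definition abs_proj_const :: "nat \<Rightarrow> real" where
  "abs_proj_const d = 2 * unit_ball_vol (real (d - 1)) / (real d + 1)"

text \<open>The integral of \<open>norm v\<close> over the unit ball.\<close>

definition norm_const :: "nat \<Rightarrow> real" where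
  "norm_const d = real d * unit_ball_vol (real d) / (real d + 1)"

lemma abs_proj_const_pos: "abs_proj_const d > 0"
  unfolding abs_proj_const_def by (intro divide_pos_pos mult_pos_pos unit_ball_vol_pos) auto

lemma norm_const_pos: "d > 0 \<Longrightarrow> norm_const d > 0"
  unfolding norm_const_def by (intro divide_pos_pos mult_pos_pos unit_ball_vol_pos) auto

text \<open>The constant \<open>\<beta>\<close> is thus twice the ratio of the mean length of a random vector to the
  mean length of its projection to a line.\<close>

lemma beta_const_eq:
  assumes "d > 0" shows "beta_const d = 2 * norm_const d / abs_proj_const d"
proof -
  have d: "real (d - 1) = real d - 1" using assms by simp
  have g: "Gamma (real d / 2 + 1) = real d / 2 * Gamma (real d / 2)"
    using assms by (subst Gamma_plus1) (auto simp: nonpos_Ints_def)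
  have p: "pi powr (real d / 2) = sqrt pi * pi powr ((real d - 1) / 2)"
  proof -
    have "sqrt pi * pi powr ((real d - 1) / 2) = pi powr (1 / 2 + (real d - 1) / 2)"
      by (simp add: powr_half_sqrt powr_add)
    also have "1 / 2 + (real d - 1) / 2 = real d / 2" by (simp add: field_simps)
    finally show ?thesis by simp
  qed
  have h: "(real d - 1) / 2 + 1 = (real d + 1) / 2" by (simp add: field_simps)
  have pos: "Gamma ((real d + 1) / 2) > 0" "Gamma (real d / 2) > 0"
    using assms by (auto intro!: Gamma_real_pos)
  have alg: "2 * s * a / b = 2 * (D * (s * c / (D / 2 * b)) / (D + 1)) / (2 * (c / a) / (D + 1))"
    if "a > 0" "b > 0" "c > 0" "D > 0" for a b c s D :: real
  proof -
    have "D + 1 \<noteq> 0" using that by linarith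
    then show ?thesis using that by (simp add: divide_simps)
  qed
  show ?thesis
    unfolding beta_const_def norm_const_def abs_proj_const_def unit_ball_vol_def d g p h
    by (rule alg) (use pos assms in auto)
qed

lemma beta_const_pos: "d > 0 \<Longrightarrow> beta_const d > 0"
  by (simp add: beta_const_eq norm_const_pos abs_proj_const_pos)

lemma nn_integral_cball_abs_inner:
  fixes n :: "'a::euclidean_space"
  assumes n: "norm n = 1" and q: "q > 0"
  shows "(\<integral>\<^sup>+v\<in>cball 0 q. ennreal \<bar>v \<bullet> n\<bar> \<partial>lborel)
       = ennreal (abs_proj_const DIM('a) * q ^ (DIM('a) + 1))"
proof -
  define k where "k = DIM('a) - 1"
  define w where "w = unit_ball_vol (real k)"
  have d: "DIM('a) = Suc k" unfolding k_def using DIM_positive[where 'a='a] by simp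
  have w: "w > 0" unfolding w_def by simp
  define g where "g s = \<bar>s\<bar> * (w * sqrt (q\<^sup>2 - s\<^sup>2) ^ k)" for s
  define F where "F s = (w / real (k + 2)) * sqrt (q\<^sup>2 - s\<^sup>2) ^ (k + 2)" for s
  have dF: "(F has_real_derivative - (s * (w * sqrt (q\<^sup>2 - s\<^sup>2) ^ k))) (at s)" if "s\<^sup>2 < q\<^sup>2" for s
  proof -
    have pos: "sqrt (q\<^sup>2 - s\<^sup>2) > 0" using that by simp
    show ?thesis
      unfolding F_def
      by (rule derivative_eq_intros refl | use that in simp)+
  qed
  have cF: "continuous_on S F" for S unfolding F_def by (intro continuous_intros) auto
  have "((\<lambda>s. s * (w * sqrt (q\<^sup>2 - s\<^sup>2) ^ k)) has_integral (- F q - - F 0)) {0..q}"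
  proof (rule fundamental_theorem_of_calculus_interior)
    show "continuous_on {0..q} (\<lambda>s. - F s)" by (intro continuous_intros cF)
    fix s assume "s \<in> {0<..<q}"
    then have "s\<^sup>2 < q\<^sup>2" by (intro power_strict_mono) auto
    from DERIV_minus[OF dF[OF this]]
    show "((\<lambda>s. - F s) has_vector_derivative s * (w * sqrt (q\<^sup>2 - s\<^sup>2) ^ k)) (at s)"
      by (simp add: has_real_derivative_iff_has_vector_derivative)
  qed (use q in simp)
  then have 1: "(g has_integral F 0) {0..q}"
    by (rule has_integral_eq[rotated, THEN has_integral_eq_rhs]) (auto simp: g_def F_def)
  have "((\<lambda>s. - (s * (w * sqrt (q\<^sup>2 - s\<^sup>2) ^ k))) has_integral (F 0 - F (-q))) {-q..0}"
  proof (rule fundamental_theorem_of_calculus_interior)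
    show "continuous_on {-q..0} F" by (intro cF)
    fix s assume "s \<in> {-q<..<0}"
    then have "(-s)\<^sup>2 < q\<^sup>2" by (intro power_strict_mono) auto
    then show "(F has_vector_derivative - (s * (w * sqrt (q\<^sup>2 - s\<^sup>2) ^ k))) (at s)"
      using dF[of s] by (simp add: has_real_derivative_iff_has_vector_derivative)
  qed (use q in simp)
  then have 2: "(g has_integral F 0) {-q..0}"
    by (rule has_integral_eq[rotated, THEN has_integral_eq_rhs]) (auto simp: g_def F_def)
  have "(g has_integral (F 0 + F 0)) {-q..q}"
    by (rule has_integral_combine[OF _ _ 2 1]) (use q in auto)
  then have gi: "(g has_integral (abs_proj_const DIM('a) * q ^ (DIM('a) + 1))) {-q..q}"
  proof (rule has_integral_eq_rhs)
    have "F 0 = w / (real DIM('a) + 1) * q ^ (DIM('a) + 1)"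
      unfolding F_def using q by (simp add: d add_ac)
    then show "abs_proj_const DIM('a) * q ^ (DIM('a) + 1) = F 0 + F 0"
      unfolding abs_proj_const_def k_def[symmetric] w_def[symmetric] by simp
  qed
  have "(\<integral>\<^sup>+v\<in>cball 0 q. ennreal \<bar>v \<bullet> n\<bar> \<partial>lborel)
     = (\<integral>\<^sup>+s\<in>{-q..q}. ennreal \<bar>s\<bar> * disc_vol n (sqrt (q\<^sup>2 - s\<^sup>2)) \<partial>lborel)"
    by (rule nn_integral_cball_height[OF n q]) measurable
  also have "\<dots> = (\<integral>\<^sup>+s. ennreal (indicator {-q..q} s * g s) \<partial>lborel)"
  proof (intro nn_integral_cong_AE)
    have "AE s in lborel. s \<notin> {-q, q::real}"
      by (intro AE_not_in countable_imp_null_set_lborel) auto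
    then show "AE s in lborel. ennreal \<bar>s\<bar> * disc_vol n (sqrt (q\<^sup>2 - s\<^sup>2)) * indicator {-q..q} s
      = ennreal (indicator {-q..q} s * g s)"
    proof eventually_elim
      case (elim s)
      show ?case
      proof (cases "s \<in> {-q..q}")
        case True
        with elim have "\<bar>s\<bar> < q" by auto
        then have "s\<^sup>2 < q\<^sup>2" by (metis abs_ge_zero power2_abs power_strict_mono zero_less_numeral)
        then have "sqrt (q\<^sup>2 - s\<^sup>2) > 0" by simp
        from disc_vol_eq[OF n this] True w show ?thesis
          unfolding k_def[symmetric] w_def[symmetric] by (simp add: g_def ennreal_mult')
      qed simp
    qed
  qed
  also have "\<dots> = ennreal (abs_proj_const DIM('a) * q ^ (DIM('a) + 1))"
    by (rule nn_integral_has_integral_lebesgue[OF _ gi]) (use w in \<open>auto simp: g_def intro!: mult_nonneg_nonneg real_sqrt_ge_zero zero_le_power simp: abs_le_square_iff[symmetric]\<close>)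
  finally show ?thesis .
qed

text \<open>The layer cake formula applied to the complements of concentric balls.\<close>

lemma nn_integral_cball_norm:
  assumes q: "q > 0"
  shows "(\<integral>\<^sup>+v\<in>cball (0::'a::euclidean_space) q. ennreal (norm v) \<partial>lborel)
       = ennreal (norm_const DIM('a) * q ^ (DIM('a) + 1))"
proof -
  let ?d = "DIM('a)"
  let ?w = "unit_ball_vol (real ?d)"
  have d1: "real ?d + 1 \<noteq> 0" "1 + real ?d \<noteq> 0" by linarith+
  have "(\<integral>\<^sup>+v\<in>cball (0::'a) q. ennreal (norm v) \<partial>lborel)
     = (\<integral>\<^sup>+v. (\<integral>\<^sup>+r. indicator {0..q} r * indicator (cball (0::'a) q - cball 0 r) v \<partial>(lborel::real measure)) \<partial>lborel)"
  proof (rule nn_integral_cong)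
    fix v :: 'a
    show "ennreal (norm v) * indicator (cball 0 q) v
      = (\<integral>\<^sup>+r. indicator {0..q} r * indicator (cball (0::'a) q - cball 0 r) v \<partial>(lborel::real measure))"
    proof (cases "norm v \<le> q")
      case True
      then have "(\<integral>\<^sup>+r. indicator {0..q} r * indicator (cball (0::'a) q - cball 0 r) v \<partial>(lborel::real measure))
        = (\<integral>\<^sup>+r. indicator {0..<norm v} r \<partial>(lborel::real measure))"
        by (intro nn_integral_cong) (auto simp: indicator_def)
      then show ?thesis using True by simp
    qed simp
  qed
  also have "\<dots> = (\<integral>\<^sup>+r. (\<integral>\<^sup>+v. indicator {0..q} r * indicator (cball (0::'a) q - cball 0 r) v \<partial>lborel) \<partial>(lborel::real measure))"
  proof (rule lborel_pair.Fubini'[symmetric])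
    have "(\<lambda>(v, r). indicator {0..q} r * indicator (cball (0::'a) q - cball 0 r) v :: ennreal)
       = (\<lambda>(v, r). indicator {0..q} r * (if norm v \<le> q \<and> r < norm v then 1 else 0))"
      by (auto simp: fun_eq_iff indicator_def)
    then show "(\<lambda>(v, r). indicator {0..q} r * indicator (cball (0::'a) q - cball 0 r) v :: ennreal)
        \<in> borel_measurable (lborel \<Otimes>\<^sub>M lborel)"
      by (simp only:) measurable
  qed
  also have "\<dots> = (\<integral>\<^sup>+r. ennreal (?w * q ^ ?d - ?w * r ^ ?d) * indicator {0..q} r \<partial>(lborel::real measure))"
  proof (rule nn_integral_cong)
    fix r :: real
    show "(\<integral>\<^sup>+v. indicator {0..q} r * indicator (cball (0::'a) q - cball 0 r) v \<partial>lborel)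
      = ennreal (?w * q ^ ?d - ?w * r ^ ?d) * indicator {0..q} r"
    proof (cases "r \<in> {0..q}")
      case True
      have "emeasure lborel (cball (0::'a) q - cball 0 r) = emeasure lborel (cball (0::'a) q) - emeasure lborel (cball (0::'a) r)"
        by (rule emeasure_Diff) (use True in \<open>auto simp: emeasure_cball\<close>)
      then show ?thesis
        using True by (simp add: emeasure_cball ennreal_minus)
    qed simp
  qed
  also have "\<dots> = ennreal ((?w * q ^ ?d * q - ?w * q ^ (?d + 1) / (real ?d + 1)) - (?w * q ^ ?d * 0 - ?w * 0 ^ (?d + 1) / (real ?d + 1)))"
  proof (rule nn_integral_FTC_Icc[where F="\<lambda>r. ?w * q ^ ?d * r - ?w * r ^ (?d + 1) / (real ?d + 1)"])
    fix r assume "r \<in> {0..q}"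
    then have "r ^ ?d \<le> q ^ ?d" by (intro power_mono) auto
    then show "0 \<le> ?w * q ^ ?d - ?w * r ^ ?d" by (simp add: mult_left_mono)
  next
    fix r
    show "((\<lambda>r. ?w * q ^ ?d * r - ?w * r ^ (?d + 1) / (real ?d + 1)) has_real_derivative ?w * q ^ ?d - ?w * r ^ ?d) (at r)"
      by (rule derivative_eq_intros refl | simp)+ (use d1 in \<open>simp add: field_simps\<close>)
  qed (use q in auto)
  also have "(?w * q ^ ?d * q - ?w * q ^ (?d + 1) / (real ?d + 1)) - (?w * q ^ ?d * 0 - ?w * 0 ^ (?d + 1) / (real ?d + 1))
     = norm_const ?d * q ^ (?d + 1)"
    using d1 by (simp add: norm_const_def field_simps)
  finally show ?thesis .
qed

text \<open>Steiner symmetrisation: the fibres in direction \<open>b\<close> are replaced by centred open intervals of the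
  same length.\<close>

definition steiner :: "'a::euclidean_space \<Rightarrow> 'a set \<Rightarrow> 'a set" where
  "steiner b A = {x. ennreal (2 * \<bar>x \<bullet> b\<bar>) < emeasure lborel {s. x + s *\<^sub>R b \<in> A}}"

lemma fibre_measurable:
  assumes [measurable]: "A \<in> sets borel"
  shows "(\<lambda>x::'a::euclidean_space. emeasure lborel {s. x + s *\<^sub>R b \<in> A}) \<in> borel_measurable borel"
  by (subst emeasure_lborel_preimage) measurable

lemma steiner_borel: "A \<in> sets borel \<Longrightarrow> steiner b A \<in> sets borel"
proof -
  assume A: "A \<in> sets borel"
  note [measurable] = fibre_measurable[OF A]
  show ?thesis unfolding steiner_def by measurable
qed

lemma fibre_shift:
  fixes A :: "'a::euclidean_space set"
  assumes [measurable]: "A \<in> sets borel"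
  shows "emeasure lborel {s. x + t *\<^sub>R b + s *\<^sub>R b \<in> A} = emeasure lborel {s::real. x + s *\<^sub>R b \<in> A}"
proof -
  have "x + t *\<^sub>R b + s *\<^sub>R b = x + (s + t) *\<^sub>R b" for s
    by (simp add: scaleR_left_distrib add_ac)
  then have "{s::real. x + t *\<^sub>R b + s *\<^sub>R b \<in> A} = {s. s + t \<in> {s. x + s *\<^sub>R b \<in> A}}"
    by (simp add: scaleR_left_distrib add_ac)
  then show ?thesis by (simp only:) (rule emeasure_lborel_shift, measurable)
qed

lemma steiner_fibre_nonempty:
  fixes x :: "'a::euclidean_space"
  assumes "x \<in> steiner b A" shows "\<exists>s. x + s *\<^sub>R b \<in> A"
proof (rule ccontr)
  assume "\<nexists>s. x + s *\<^sub>R b \<in> A"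
  then show False using assms by (simp add: steiner_def)
qed

lemma emeasure_real_le:
  fixes S :: "real set"
  assumes "S \<subseteq> {a..b}" "a \<le> b" shows "emeasure lborel S \<le> ennreal (b - a)"
proof -
  have "emeasure lborel S \<le> emeasure lborel {a..b}" by (rule emeasure_mono) (use assms in auto)
  then show ?thesis using assms by simp
qed

lemma emeasure_steiner:
  fixes A :: "'a::euclidean_space set"
  assumes [measurable]: "A \<in> sets borel" and b: "norm b = 1"
    and fib: "\<And>x s s'. x + s *\<^sub>R b \<in> A \<Longrightarrow> x + s' *\<^sub>R b \<in> A \<Longrightarrow> \<bar>s - s'\<bar> \<le> R"
  shows "emeasure lborel (steiner b A) = emeasure lborel A"
proof -
  have bb: "b \<bullet> b = 1" using b by (simp add: dot_square_norm)
  note [measurable] = steiner_borel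
  have "emeasure lborel {s. x + s *\<^sub>R b \<in> steiner b A} = emeasure lborel {s. x + s *\<^sub>R b \<in> A}" for x
  proof -
    let ?m = "emeasure lborel {s. x + s *\<^sub>R b \<in> A}"
    have "?m < \<infinity>"
    proof (cases "\<exists>s. x + s *\<^sub>R b \<in> A")
      case True
      then obtain s where s: "x + s *\<^sub>R b \<in> A" by auto
      have "{s. x + s *\<^sub>R b \<in> A} \<subseteq> {s - \<bar>R\<bar> .. s + \<bar>R\<bar>}"
        using fib[OF s] by force
      then have "?m \<le> ennreal (s + \<bar>R\<bar> - (s - \<bar>R\<bar>))" by (rule emeasure_real_le) auto
      then show ?thesis by (simp add: le_less_trans)
    qed simp
    then obtain \<mu> where \<mu>: "\<mu> \<ge> 0" "?m = ennreal \<mu>" by (cases ?m) auto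
    have abs: "2 * \<bar>x \<bullet> b + s\<bar> < \<mu> \<longleftrightarrow> s \<in> {- (x \<bullet> b) - \<mu>/2 <..< - (x \<bullet> b) + \<mu>/2}" for s
      using abs_less_iff[of "x \<bullet> b + s" "\<mu> / 2"] by auto
    have "{s. x + s *\<^sub>R b \<in> steiner b A} = {- (x \<bullet> b) - \<mu>/2 <..< - (x \<bullet> b) + \<mu>/2}"
      unfolding steiner_def mem_Collect_eq fibre_shift[OF assms(1)] \<mu>(2)
      using abs by (auto simp: ennreal_less_iff inner_add_left bb simp del: greaterThanLessThan_iff)
    then show ?thesis using \<mu> by simp
  qed
  then show ?thesis
    by (subst (1 2) emeasure_along_direction[OF _ b]) (auto simp: assms(1) steiner_borel)
qed

text \<open>If all points of two fibres were closer in direction \<open>b\<close> than the given pair of the symmetrised set,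
  then each fibre would be confined by the extremes of the other, and the two lengths together would be
  too small to admit the pair. This is why symmetrisation does not increase the diameter.\<close>

lemma steiner_pair:
  fixes A :: "'a::euclidean_space set"
  assumes [measurable]: "A \<in> sets borel" and b: "norm b = 1"
    and x: "x \<in> steiner b A" and y: "y \<in> steiner b A"
  shows "\<exists>s s'. x + s *\<^sub>R b \<in> A \<and> y + s' *\<^sub>R b \<in> A \<and>
    \<bar>(x - y) \<bullet> b\<bar> \<le> \<bar>((x + s *\<^sub>R b) - (y + s' *\<^sub>R b)) \<bullet> b\<bar>"
proof (rule ccontr)
  assume neg: "\<not> ?thesis"
  have bb: "b \<bullet> b = 1" using b by (simp add: dot_square_norm)
  define D where "D = \<bar>(x - y) \<bullet> b\<bar>"
  define S where "S z = {\<tau>. z + (\<tau> - z \<bullet> b) *\<^sub>R b \<in> A}" for z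
  have mS: "emeasure lborel (S z) = emeasure lborel {s. z + s *\<^sub>R b \<in> A}" for z
    using fibre_shift[OF assms(1), of z "- (z \<bullet> b)" b] by (simp add: S_def algebra_simps)
  have lt: "\<bar>\<tau> - \<tau>'\<bar> < D" if "\<tau> \<in> S x" "\<tau>' \<in> S y" for \<tau> \<tau>'
  proof -
    have "\<not> D \<le> \<bar>((x + (\<tau> - x \<bullet> b) *\<^sub>R b) - (y + (\<tau>' - y \<bullet> b) *\<^sub>R b)) \<bullet> b\<bar>"
      using neg that unfolding D_def S_def by blast
    then show ?thesis by (simp add: inner_add_left inner_diff_left bb)
  qed
  have ne: "S z \<noteq> {}" if "z \<in> steiner b A" for z
    using that mS[of z] unfolding steiner_def by auto
  obtain t where t: "t \<in> S x" using ne[OF x] by auto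
  define p q where "p = Inf (S y)" and "q = Sup (S y)"
  have bdd: "bdd_above (S y)" "bdd_below (S y)"
  proof -
    have "t - D \<le> x \<and> x \<le> t + D" if "x \<in> S y" for x using lt[OF t that] by linarith
    then show "bdd_above (S y)" "bdd_below (S y)"
      using bdd_aboveI[of "S y" "t + D"] bdd_belowI[of "S y" "t - D"] by metis+
  qed
  have Sy: "S y \<subseteq> {p..q}"
    unfolding p_def q_def using bdd by (auto intro: cInf_lower cSup_upper)
  then have pq: "p \<le> q" using ne[OF y] by force
  have Sx: "S x \<subseteq> {q - D..p + D}"
  proof
    fix \<tau> assume \<tau>: "\<tau> \<in> S x"
    have "q \<le> \<tau> + D" unfolding q_def
      by (rule cSup_least[OF ne[OF y]]) (use lt[OF \<tau>] in force)
    moreover have "\<tau> - D \<le> p" unfolding p_def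
      by (rule cInf_greatest[OF ne[OF y]]) (use lt[OF \<tau>] in force)
    ultimately show "\<tau> \<in> {q - D..p + D}" by auto
  qed
  then have qp: "q - D \<le> p + D" using t by auto
  have "ennreal (2 * \<bar>x \<bullet> b\<bar>) < ennreal (p + D - (q - D))"
    using x emeasure_real_le[OF Sx qp] unfolding steiner_def mS by (auto intro: less_le_trans)
  then have 1: "2 * \<bar>x \<bullet> b\<bar> < p + D - (q - D)" by (simp add: ennreal_less_iff)
  have "ennreal (2 * \<bar>y \<bullet> b\<bar>) < ennreal (q - p)"
    using y emeasure_real_le[OF Sy pq] unfolding steiner_def mS by (auto intro: less_le_trans)
  then have 2: "2 * \<bar>y \<bullet> b\<bar> < q - p" by (simp add: ennreal_less_iff)
  have "D \<le> \<bar>x \<bullet> b\<bar> + \<bar>y \<bullet> b\<bar>" unfolding D_def by (simp add: inner_diff_left)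
  with 1 2 show False by linarith
qed

text \<open>Symmetrising successively in the directions of \<open>B\<close> keeps volume and diameter bound and makes the set
  invariant under the reflections in these directions, as the directions are orthogonal. A set that
  is invariant under all of them contains with each point its mirror image, so it lies in a
  ball of radius \<open>r\<close>. Only the components along \<open>B\<close> enter, so that the statement covers
  the full space as well as cylinders over a hyperplane; the set \<open>Z\<close> is the whole space or the slab.\<close>

lemma isodiametric_orthonormal:
  fixes A Z :: "'a::euclidean_space set"
  assumes A[measurable]: "A \<in> sets borel" and Z[measurable]: "Z \<in> sets borel" and AZ: "A \<subseteq> Z"
    and B: "finite B" "pairwise orthogonal B" "\<And>b. b \<in> B \<Longrightarrow> norm b = 1"
    and Zb: "\<And>b x s. b \<in> B \<Longrightarrow> x + s *\<^sub>R b \<in> Z \<Longrightarrow> x \<in> Z"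
    and diam: "\<And>x y. x \<in> A \<Longrightarrow> y \<in> A \<Longrightarrow> (\<Sum>b\<in>B. ((x - y) \<bullet> b)\<^sup>2) \<le> (2 * r)\<^sup>2"
  shows "emeasure lborel A \<le> emeasure lborel {x \<in> Z. (\<Sum>b\<in>B. (x \<bullet> b)\<^sup>2) \<le> r\<^sup>2}"
proof -
  define \<sigma> where "\<sigma> b x = x - (2 * (x \<bullet> b)) *\<^sub>R b" for b x :: 'a
  have orth: "b \<bullet> c = 0" if "b \<in> B" "c \<in> B" "b \<noteq> c" for b c
    using B(2) that by (auto simp: pairwise_def orthogonal_def)
  have one: "b \<bullet> b = 1" if "b \<in> B" for b
    using B(3)[OF that] by (simp add: dot_square_norm)
  have "C \<subseteq> B \<longrightarrow> (\<exists>A'. A' \<in> sets borel \<and> emeasure lborel A' = emeasure lborel A \<and> A' \<subseteq> Z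
      \<and> (\<forall>x\<in>A'. \<forall>y\<in>A'. (\<Sum>b\<in>B. ((x - y) \<bullet> b)\<^sup>2) \<le> (2 * r)\<^sup>2)
      \<and> (\<forall>b\<in>C. \<forall>x. \<sigma> b x \<in> A' \<longleftrightarrow> x \<in> A'))" if "finite C" for C
    using that
  proof (induction C)
    case empty
    have "\<forall>x\<in>A. \<forall>y\<in>A. (\<Sum>b\<in>B. ((x - y) \<bullet> b)\<^sup>2) \<le> (2 * r)\<^sup>2" using diam by blast
    then show ?case by (intro impI exI[of _ A] conjI A AZ) simp_all
  next
    case (insert c C)
    show ?case
    proof
      assume sub: "insert c C \<subseteq> B"
      then obtain A' where A': "A' \<in> sets borel" "emeasure lborel A' = emeasure lborel A" "A' \<subseteq> Z"
        and dA': "\<And>x y. x \<in> A' \<Longrightarrow> y \<in> A' \<Longrightarrow> (\<Sum>b\<in>B. ((x - y) \<bullet> b)\<^sup>2) \<le> (2 * r)\<^sup>2"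
        and sA': "\<And>b x. b \<in> C \<Longrightarrow> \<sigma> b x \<in> A' \<longleftrightarrow> x \<in> A'"
        using insert.IH by auto
      have c: "c \<in> B" using sub by auto
      have nc: "norm c = 1" by (rule B(3)[OF c])
      have fib: "\<bar>s - s'\<bar> \<le> \<bar>2 * r\<bar>" if "x + s *\<^sub>R c \<in> A'" "x + s' *\<^sub>R c \<in> A'" for x s s'
      proof -
        have "(s - s')\<^sup>2 = (((x + s *\<^sub>R c) - (x + s' *\<^sub>R c)) \<bullet> c)\<^sup>2"
          by (simp add: inner_diff_left one[OF c] inner_add_left)
        also have "\<dots> \<le> (\<Sum>b\<in>B. (((x + s *\<^sub>R c) - (x + s' *\<^sub>R c)) \<bullet> b)\<^sup>2)"
          by (rule member_le_sum) (use c B in auto)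
        also have "\<dots> \<le> (2 * r)\<^sup>2" by (rule dA'[OF that])
        finally show ?thesis by (simp only: abs_le_square_iff)
      qed
      let ?S = "steiner c A'"
      have 1: "?S \<in> sets borel" by (rule steiner_borel[OF A'(1)])
      have 2: "emeasure lborel ?S = emeasure lborel A"
        using emeasure_steiner[OF A'(1) nc fib] A'(2) by simp
      have 3: "?S \<subseteq> Z"
        using steiner_fibre_nonempty Zb[OF c] A'(3) by blast
      have 4: "(\<Sum>b\<in>B. ((x - y) \<bullet> b)\<^sup>2) \<le> (2 * r)\<^sup>2" if xy: "x \<in> ?S" "y \<in> ?S" for x y
      proof -
        obtain s s' where s: "x + s *\<^sub>R c \<in> A'" "y + s' *\<^sub>R c \<in> A'"
          and le: "\<bar>(x - y) \<bullet> c\<bar> \<le> \<bar>((x + s *\<^sub>R c) - (y + s' *\<^sub>R c)) \<bullet> c\<bar>"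
          using steiner_pair[OF A'(1) nc xy] by blast
        have "(\<Sum>b\<in>B. ((x - y) \<bullet> b)\<^sup>2) \<le> (\<Sum>b\<in>B. (((x + s *\<^sub>R c) - (y + s' *\<^sub>R c)) \<bullet> b)\<^sup>2)"
        proof (rule sum_mono)
          fix b assume b: "b \<in> B"
          show "((x - y) \<bullet> b)\<^sup>2 \<le> (((x + s *\<^sub>R c) - (y + s' *\<^sub>R c)) \<bullet> b)\<^sup>2"
          proof (cases "b = c")
            case True
            then show ?thesis using le by (simp only: abs_le_square_iff)
          next
            case False
            then show ?thesis using orth[OF c b] by (simp add: inner_diff_left inner_add_left)
          qed
        qed
        also have "\<dots> \<le> (2 * r)\<^sup>2" by (rule dA'[OF s])
        finally show ?thesis .
      qed
      have 5: "\<sigma> b x \<in> ?S \<longleftrightarrow> x \<in> ?S" if "b \<in> insert c C" for b x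
      proof (cases "b = c")
        case True
        have e: "\<sigma> c x = x + (- (2 * (x \<bullet> c))) *\<^sub>R c" by (simp add: \<sigma>_def)
        have a: "\<bar>\<sigma> c x \<bullet> c\<bar> = \<bar>x \<bullet> c\<bar>" by (simp add: \<sigma>_def inner_diff_left one[OF c])
        show ?thesis unfolding True steiner_def mem_Collect_eq a
          by (subst e, subst fibre_shift[OF A'(1)]) simp
      next
        case False
        then have b: "b \<in> C" "b \<in> B" using that sub by auto
        have o: "b \<bullet> c = 0" "c \<bullet> b = 0" using orth[OF b(2) c False] by (auto simp: inner_commute)
        have a: "\<sigma> b x \<bullet> c = x \<bullet> c" by (simp add: \<sigma>_def inner_diff_left o)
        have e: "\<sigma> b x + s *\<^sub>R c = \<sigma> b (x + s *\<^sub>R c)" for s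
          by (simp add: \<sigma>_def inner_add_left o)
        show ?thesis unfolding steiner_def mem_Collect_eq a e sA'[OF b(1)] ..
      qed
      show "\<exists>A'. A' \<in> sets borel \<and> emeasure lborel A' = emeasure lborel A \<and> A' \<subseteq> Z
        \<and> (\<forall>x\<in>A'. \<forall>y\<in>A'. (\<Sum>b\<in>B. ((x - y) \<bullet> b)\<^sup>2) \<le> (2 * r)\<^sup>2)
        \<and> (\<forall>b\<in>insert c C. \<forall>x. \<sigma> b x \<in> A' \<longleftrightarrow> x \<in> A')"
        by (rule exI[of _ ?S], intro conjI ballI allI 1 2 3 4 5)
    qed
  qed
  from this[OF B(1)] obtain A' where A': "A' \<in> sets borel" "emeasure lborel A' = emeasure lborel A" "A' \<subseteq> Z"
        and dA': "\<And>x y. x \<in> A' \<Longrightarrow> y \<in> A' \<Longrightarrow> (\<Sum>b\<in>B. ((x - y) \<bullet> b)\<^sup>2) \<le> (2 * r)\<^sup>2"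
        and sA': "\<And>b x. b \<in> B \<Longrightarrow> \<sigma> b x \<in> A' \<longleftrightarrow> x \<in> A'"
    by auto
  \<comment> \<open>The composition of the reflections in the directions of \<open>C\<close> maps \<open>x\<close> to \<open>x - 2 * P x\<close>, where \<open>P\<close> is the projection to their span.\<close>
  have refl: "x - 2 *\<^sub>R (\<Sum>b\<in>C. (x \<bullet> b) *\<^sub>R b) \<in> A'" if "C \<subseteq> B" "x \<in> A'" for C x
    using finite_subset[OF that(1) B(1)] that
  proof (induction C)
    case (insert c C)
    let ?y = "x - 2 *\<^sub>R (\<Sum>b\<in>C. (x \<bullet> b) *\<^sub>R b)"
    have "(\<Sum>b\<in>C. (x \<bullet> b) *\<^sub>R b) \<bullet> c = 0"
      unfolding inner_sum_left using insert.hyps insert.prems orth by (intro sum.neutral) fastforce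
    then have "?y \<bullet> c = x \<bullet> c" by (simp add: inner_diff_left)
    then have "\<sigma> c ?y = x - 2 *\<^sub>R (\<Sum>b\<in>insert c C. (x \<bullet> b) *\<^sub>R b)"
      using insert.hyps by (simp add: \<sigma>_def algebra_simps)
    then show ?case using sA'[of c ?y] insert by auto
  qed simp
  have "A' \<subseteq> {x \<in> Z. (\<Sum>b\<in>B. (x \<bullet> b)\<^sup>2) \<le> r\<^sup>2}"
  proof
    fix x assume x: "x \<in> A'"
    let ?P = "\<Sum>b\<in>B. (x \<bullet> b) *\<^sub>R b"
    have Pb: "?P \<bullet> b = x \<bullet> b" if b: "b \<in> B" for b
    proof -
      have "?P \<bullet> b = (\<Sum>c\<in>B. if c = b then x \<bullet> b else 0)"
        unfolding inner_sum_left by (rule sum.cong) (use orth one b in auto)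
      then show ?thesis using b B(1) by simp
    qed
    have "(\<Sum>b\<in>B. ((x - (x - 2 *\<^sub>R ?P)) \<bullet> b)\<^sup>2) \<le> (2 * r)\<^sup>2"
      by (rule dA'[OF x refl[OF subset_refl x]])
    moreover have "(\<Sum>b\<in>B. ((x - (x - 2 *\<^sub>R ?P)) \<bullet> b)\<^sup>2) = (\<Sum>b\<in>B. 4 * (x \<bullet> b)\<^sup>2)"
      by (rule sum.cong) (auto simp: Pb power_mult_distrib)
    ultimately show "x \<in> {x \<in> Z. (\<Sum>b\<in>B. (x \<bullet> b)\<^sup>2) \<le> r\<^sup>2}"
      using A'(3) x by (auto simp: sum_distrib_left[symmetric] power_mult_distrib)
  qed
  then have "emeasure lborel A' \<le> emeasure lborel {x \<in> Z. (\<Sum>b\<in>B. (x \<bullet> b)\<^sup>2) \<le> r\<^sup>2}"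
    by (rule emeasure_mono) simp
  then show ?thesis using A'(2) by simp
qed

theorem isodiametric:
  fixes U :: "'a::euclidean_space set"
  assumes [measurable]: "U \<in> sets borel" and r: "r \<ge> 0"
    and diam: "\<And>x y. x \<in> U \<Longrightarrow> y \<in> U \<Longrightarrow> dist x y \<le> 2 * r"
  shows "emeasure lborel U \<le> ennreal (unit_ball_vol (real DIM('a)) * r ^ DIM('a))"
proof -
  have n2: "(\<Sum>b\<in>Basis. (x \<bullet> b)\<^sup>2) = (norm x)\<^sup>2" for x :: 'a
    unfolding power2_norm_eq_inner by (subst euclidean_inner) (simp add: power2_eq_square)
  have "emeasure lborel U \<le> emeasure lborel {x \<in> (UNIV::'a set). (\<Sum>b\<in>Basis. (x \<bullet> b)\<^sup>2) \<le> r\<^sup>2}"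
  proof (rule isodiametric_orthonormal)
    show "pairwise orthogonal (Basis :: 'a set)"
      by (auto simp: pairwise_def orthogonal_def inner_Basis)
    fix x y assume "x \<in> U" "y \<in> U"
    from diam[OF this] show "(\<Sum>b\<in>Basis. ((x - y) \<bullet> b)\<^sup>2) \<le> (2 * r)\<^sup>2"
      unfolding n2 dist_norm by (intro power_mono) auto
  qed auto
  also have "{x \<in> (UNIV::'a set). (\<Sum>b\<in>Basis. (x \<bullet> b)\<^sup>2) \<le> r\<^sup>2} = cball 0 r"
    unfolding n2 using r by (auto simp: abs_le_square_iff[symmetric])
  finally show ?thesis using r by (simp add: emeasure_cball)
qed

definition cyl :: "'a::euclidean_space \<Rightarrow> 'a set \<Rightarrow> 'a set" where
  "cyl n E = {x \<in> slab n. pr n x \<in> pr n ` E}"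

text \<open>The measure of the orthogonal projection of \<open>E\<close> to the hyperplane with normal \<open>n\<close>.\<close>

definition shadow :: "'a::euclidean_space \<Rightarrow> 'a set \<Rightarrow> ennreal" where
  "shadow n E = emeasure lborel (cyl n E)"

lemma disc_vol_le:
  fixes n :: "'a::euclidean_space"
  assumes n: "norm n = 1" and r: "r \<ge> 0" and d: "DIM('a) \<ge> 2"
  shows "disc_vol n r \<le> ennreal (unit_ball_vol (real (DIM('a) - 1)) * r ^ (DIM('a) - 1))"
proof -
  have "disc_vol n r \<le> ennreal (unit_ball_vol (real (DIM('a) - 1)) * (r + 1 / real (Suc k)) ^ (DIM('a) - 1))" for k
  proof -
    have "disc_vol n r \<le> disc_vol n (r + 1 / real (Suc k))"
      unfolding disc_vol_def by (rule emeasure_mono) (auto intro: order_trans)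
    also have "\<dots> = ennreal (unit_ball_vol (real (DIM('a) - 1)) * (r + 1 / real (Suc k)) ^ (DIM('a) - 1))"
      by (rule disc_vol_eq[OF n]) (use r in \<open>simp add: add_nonneg_pos\<close>)
    finally show ?thesis .
  qed
  moreover have "(\<lambda>k. ennreal (unit_ball_vol (real (DIM('a) - 1)) * (r + 1 / real (Suc k)) ^ (DIM('a) - 1)))
     \<longlonglongrightarrow> ennreal (unit_ball_vol (real (DIM('a) - 1)) * (r + 0) ^ (DIM('a) - 1))"
    by (intro tendsto_ennrealI tendsto_intros LIMSEQ_Suc lim_1_over_n)
  ultimately show ?thesis
    by (intro LIMSEQ_le_const[where a="disc_vol n r"]) auto
qed

text \<open>The isodiametric inequality in the hyperplane orthogonal to \<open>n\<close>: the cylinder over the projection is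
  symmetrised in the directions of an orthonormal basis of the hyperplane.\<close>

theorem isodiametric_shadow:
  fixes U :: "'a::euclidean_space set"
  assumes n: "norm n = 1" and U: "cyl n U \<in> sets borel" and r: "r \<ge> 0" and d: "DIM('a) \<ge> 2"
    and diam: "\<And>x y. x \<in> U \<Longrightarrow> y \<in> U \<Longrightarrow> dist x y \<le> 2 * r"
  shows "shadow n U \<le> ennreal (unit_ball_vol (real (DIM('a) - 1)) * r ^ (DIM('a) - 1))"
proof -
  let ?S = "{x::'a. x \<bullet> n = 0}"
  have "subspace ?S" by (auto simp: subspace_def inner_add_left)
  then obtain B where B: "B \<subseteq> ?S" "pairwise orthogonal B" "\<And>b. b \<in> B \<Longrightarrow> norm b = 1"
    "independent B" "span B = ?S"
    using orthonormal_basis_subspace by metis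
  have fin: "finite B" using B(4) by (rule independent_imp_finite)
  have bn: "b \<bullet> n = 0" "n \<bullet> b = 0" if "b \<in> B" for b using B(1) that by (auto simp: inner_commute)
  have Q: "(\<Sum>b\<in>B. (x \<bullet> b)\<^sup>2) = (norm (pr n x))\<^sup>2" for x
  proof -
    have xb: "pr n x \<bullet> b = x \<bullet> b" if "b \<in> B" for b
      using bn[OF that] by (simp add: pr_def inner_diff_left)
    have "pr n x \<in> span B" using B(5) pr_inner[OF n] by simp
    then have "(\<Sum>b\<in>B. (pr n x \<bullet> b) *\<^sub>R b) = pr n x"
      by (intro orthonormal_basis_expand[OF B(2,3) _ fin])
    then have "(norm (pr n x))\<^sup>2 = (\<Sum>b\<in>B. (pr n x \<bullet> b) *\<^sub>R b) \<bullet> pr n x"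
      by (simp add: power2_norm_eq_inner)
    also have "\<dots> = (\<Sum>b\<in>B. (x \<bullet> b)\<^sup>2)"
      unfolding inner_sum_left inner_scaleR_left
      by (intro sum.cong refl) (simp add: inner_commute[of _ "pr n x"] xb power2_eq_square)
    finally show ?thesis by simp
  qed
  have "shadow n U \<le> emeasure lborel {x \<in> slab n. (\<Sum>b\<in>B. (x \<bullet> b)\<^sup>2) \<le> r\<^sup>2}"
    unfolding shadow_def
  proof (rule isodiametric_orthonormal[OF U slab_borel _ fin B(2,3)])
    show "cyl n U \<subseteq> slab n" by (auto simp: cyl_def)
    show "x \<in> slab n" if "b \<in> B" "x + s *\<^sub>R b \<in> slab n" for b x s
      using that bn[OF that(1)] by (simp add: slab_def inner_add_left)
    fix x y assume "x \<in> cyl n U" "y \<in> cyl n U"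
    then obtain z z' where z: "z \<in> U" "z' \<in> U" "pr n x = pr n z" "pr n y = pr n z'"
      by (auto simp: cyl_def)
    have "norm (pr n (x - y)) \<le> norm (z - z')"
      using norm_pr_le[OF n, of "z - z'"] z by (simp add: pr_diff)
    also have "\<dots> \<le> 2 * r" using diam[OF z(1,2)] by (simp add: dist_norm)
    finally show "(\<Sum>b\<in>B. ((x - y) \<bullet> b)\<^sup>2) \<le> (2 * r)\<^sup>2"
      unfolding Q by (intro power_mono) auto
  qed
  also have "{x \<in> slab n. (\<Sum>b\<in>B. (x \<bullet> b)\<^sup>2) \<le> r\<^sup>2} = {x \<in> slab n. norm (pr n x) \<le> r}"
    unfolding Q using r by (auto simp: abs_le_square_iff[symmetric])
  also have "emeasure lborel \<dots> \<le> ennreal (unit_ball_vol (real (DIM('a) - 1)) * r ^ (DIM('a) - 1))"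
    using disc_vol_le[OF n r d] by (simp add: disc_vol_def)
  finally show ?thesis .
qed

section \<open>Hausdorff measure and projections\<close>

lemma suminf_interleave_le:
  fixes f g :: "nat \<Rightarrow> ennreal"
  shows "(\<Sum>i. if even i then f (i div 2) else g (i div 2)) \<le> suminf f + suminf g"
proof -
  let ?h = "\<lambda>i. if even i then f (i div 2) else g (i div 2)"
  have e: "(\<Sum>i<2*n. ?h i) = (\<Sum>i<n. f i) + (\<Sum>i<n. g i)" for n
    by (induction n) (auto simp: add_ac)
  have "(\<Sum>i<n. ?h i) \<le> suminf f + suminf g" for n
  proof -
    have "(\<Sum>i<n. ?h i) \<le> (\<Sum>i<2*n. ?h i)" by (rule sum_mono2) auto
    also have "\<dots> \<le> suminf f + suminf g"
      unfolding e by (intro add_mono sum_le_suminf) auto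
    finally show ?thesis .
  qed
  then show ?thesis unfolding suminf_eq_SUP by (intro SUP_least)
qed

lemma hausdorff_premeasure_le:
  assumes "S \<subseteq> (\<Union>n. U n)" "\<And>n. bounded (U n)" "\<And>n. diameter (U n) \<le> \<delta>"
  shows "hausdorff_premeasure k \<delta> S \<le> (\<Sum>n. hausdorff_weight k (U n))"
  unfolding hausdorff_premeasure_def by (rule INF_lower) (use assms in auto)

lemma hausdorff_premeasure_le_measure:
  "\<delta> > 0 \<Longrightarrow> hausdorff_premeasure k \<delta> S \<le> hausdorff_measure k S"
  unfolding hausdorff_measure_def by (rule SUP_upper) auto

lemma hausdorff_measure_leI:
  "(\<And>\<delta>. \<delta> > 0 \<Longrightarrow> hausdorff_premeasure k \<delta> S \<le> c) \<Longrightarrow> hausdorff_measure k S \<le> c"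
  unfolding hausdorff_measure_def by (rule SUP_least) auto

lemma hausdorff_premeasure_mono:
  "S \<subseteq> T \<Longrightarrow> hausdorff_premeasure k \<delta> S \<le> hausdorff_premeasure k \<delta> T"
  unfolding hausdorff_premeasure_def by (rule INF_superset_mono) auto

lemma hausdorff_measure_mono:
  "S \<subseteq> T \<Longrightarrow> hausdorff_measure k S \<le> hausdorff_measure k T"
  by (rule hausdorff_measure_leI)
     (rule order_trans[OF hausdorff_premeasure_mono hausdorff_premeasure_le_measure])

text \<open>Two infima are attained up to an arbitrarily small error, independently of each other.\<close>

lemma le_INF_add:
  fixes f :: "'i \<Rightarrow> ennreal" and g :: "'j \<Rightarrow> ennreal"
  assumes le: "\<And>i j. i \<in> I \<Longrightarrow> j \<in> J \<Longrightarrow> x \<le> f i + g j"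
  shows "x \<le> (INF i\<in>I. f i) + (INF j\<in>J. g j)"
proof (rule ennreal_le_epsilon)
  fix e :: real assume fin: "(INF i\<in>I. f i) + (INF j\<in>J. g j) < top" and e: "e > 0"
  have step: "a < a + ennreal (e / 2)" if "a < top" for a
    using that e by (cases a) (auto simp: ennreal_less_iff simp flip: ennreal_plus)
  from fin have "(INF i\<in>I. f i) < top" "(INF j\<in>J. g j) < top"
    by (auto simp: less_top[symmetric] top_add)
  from step[OF this(1)] step[OF this(2)] obtain i j where ij: "i \<in> I" "j \<in> J"
      "f i < (INF i\<in>I. f i) + ennreal (e / 2)" "g j < (INF j\<in>J. g j) + ennreal (e / 2)"
    unfolding INF_less_iff by blast
  have "x \<le> f i + g j" by (rule le[OF ij(1,2)])
  also have "\<dots> \<le> ((INF i\<in>I. f i) + ennreal (e / 2)) + ((INF j\<in>J. g j) + ennreal (e / 2))"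
    using ij(3,4) by (intro add_mono less_imp_le)
  also have "\<dots> = (INF i\<in>I. f i) + (INF j\<in>J. g j) + (ennreal (e / 2) + ennreal (e / 2))"
    by (simp add: ac_simps)
  also have "ennreal (e / 2) + ennreal (e / 2) = ennreal e"
    using e by (simp flip: ennreal_plus)
  finally show "x \<le> (INF i\<in>I. f i) + (INF j\<in>J. g j) + ennreal e" .
qed

text \<open>Interleaving a cover of \<open>S\<close> with a cover of \<open>T\<close> covers the union.\<close>

lemma hausdorff_premeasure_Un:
  "hausdorff_premeasure k \<delta> (S \<union> T) \<le> hausdorff_premeasure k \<delta> S + hausdorff_premeasure k \<delta> T"
proof -
  let ?C = "\<lambda>S. {U :: nat \<Rightarrow> 'a set. S \<subseteq> (\<Union>n. U n) \<and> (\<forall>n. bounded (U n) \<and> diameter (U n) \<le> \<delta>)}"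
  let ?s = "\<lambda>U. (\<Sum>n. hausdorff_weight k (U n))"
  let ?x = "hausdorff_premeasure k \<delta> (S \<union> T)"
  have le: "?x \<le> ?s U + ?s V" if U: "U \<in> ?C S" and V: "V \<in> ?C T" for U V
  proof -
    let ?W = "\<lambda>i. if even i then U (i div 2) else V (i div 2)"
    have W: "?W (2 * n) = U n" "?W (2 * n + 1) = V n" for n by auto
    have "S \<union> T \<subseteq> (\<Union>n. ?W n)"
    proof
      fix x assume "x \<in> S \<union> T"
      then consider n where "x \<in> U n" | n where "x \<in> V n" using U V by blast
      then show "x \<in> (\<Union>n. ?W n)"
      proof cases
        case (1 n)
        show ?thesis by (rule UN_I[of "2 * n"]) (use 1 in auto)
      next
        case (2 n)
        show ?thesis by (rule UN_I[of "2 * n + 1"]) (use 2 in auto)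
      qed
    qed
    then have "?x \<le> (\<Sum>n. hausdorff_weight k (?W n))"
      by (rule hausdorff_premeasure_le) (use U V in auto)
    also have "(\<lambda>n. hausdorff_weight k (?W n))
      = (\<lambda>i. if even i then hausdorff_weight k (U (i div 2)) else hausdorff_weight k (V (i div 2)))"
      by auto
    also have "suminf \<dots> \<le> ?s U + ?s V" by (rule suminf_interleave_le)
    finally show ?thesis .
  qed
  show ?thesis
    unfolding hausdorff_premeasure_def[of k \<delta> S] hausdorff_premeasure_def[of k \<delta> T]
    by (rule le_INF_add) (rule le)
qed

lemma hausdorff_measure_Un:
  "hausdorff_measure k (S \<union> T) \<le> hausdorff_measure k S + hausdorff_measure k T"
  by (rule hausdorff_measure_leI)
     (rule order_trans[OF hausdorff_premeasure_Un add_mono[OF hausdorff_premeasure_le_measure hausdorff_premeasure_le_measure]])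

lemma hausdorff_measure_empty: "hausdorff_measure k {} = 0"
proof -
  have "hausdorff_measure k ({} :: 'a set) \<le> 0"
  proof (rule hausdorff_measure_leI)
    fix \<delta> :: real assume "\<delta> > 0"
    then have "hausdorff_premeasure k \<delta> ({}::'a set) \<le> (\<Sum>n. hausdorff_weight k ((\<lambda>n::nat. {}::'a set) n))"
      by (intro hausdorff_premeasure_le) auto
    then show "hausdorff_premeasure k \<delta> ({}::'a set) \<le> 0" by (simp add: hausdorff_weight_def)
  qed
  then show ?thesis by simp
qed

lemma hausdorff_measure_UN:
  "finite I \<Longrightarrow> hausdorff_measure k (\<Union>i\<in>I. S i) \<le> (\<Sum>i\<in>I. hausdorff_measure k (S i))"
proof (induction I rule: finite_induct)
  case (insert i I)
  then show ?case
    using hausdorff_measure_Un[of k "S i" "\<Union>i\<in>I. S i"] by (auto intro: order_trans add_left_mono)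
qed (simp add: hausdorff_measure_empty)

lemma enumerate_disjoint_balls:
  fixes C :: "('a::euclidean_space \<times> real) set"
  assumes C: "countable C" "\<And>p. p \<in> C \<Longrightarrow> 0 < snd p \<and> snd p \<le> \<delta> \<and> ball (fst p) (snd p) \<subseteq> W"
    and dis: "pairwise (\<lambda>i j. disjnt (ball (fst i) (snd i)) (ball (fst j) (snd j))) C"
    and W: "W \<in> sets borel" and \<delta>: "0 \<le> \<delta>"
  shows "\<exists>(a :: nat \<Rightarrow> 'a) r. (\<forall>i. 0 \<le> r i \<and> r i \<le> \<delta>) \<and> (\<forall>p\<in>C. \<exists>i. p = (a i, r i)) \<and>
     (\<Sum>i. ennreal (unit_ball_vol (real DIM('a)) * r i ^ DIM('a))) \<le> emeasure lborel W"
proof -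
  define I where "I = to_nat_on C ` C"
  define P where "P i = (if i \<in> I then from_nat_into C i else (0, 0))" for i
  have PC: "P i \<in> C" if "i \<in> I" for i
    using that C(1) by (auto simp: P_def I_def)
  have cov: "\<exists>i. p = P i" if "p \<in> C" for p
    using that C(1) by (intro exI[of _ "to_nat_on C p"]) (auto simp: P_def I_def)
  have inj: "P i \<noteq> P j" if "i \<in> I" "j \<in> I" "i \<noteq> j" for i j
    using that C(1) by (auto simp: P_def I_def)
  have sub: "ball (fst (P i)) (snd (P i)) \<subseteq> W" for i
    using C(2)[OF PC] by (cases "i \<in> I") (auto simp: P_def)
  have disj: "disjoint_family (\<lambda>i. ball (fst (P i)) (snd (P i)))"
    unfolding disjoint_family_on_def
  proof (intro ballI impI)
    fix i j :: nat assume "i \<noteq> j"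
    show "ball (fst (P i)) (snd (P i)) \<inter> ball (fst (P j)) (snd (P j)) = {}"
    proof (cases "i \<in> I \<and> j \<in> I")
      case True
      with inj[of i j] \<open>i \<noteq> j\<close> PC dis show ?thesis by (auto simp: pairwise_def disjnt_def)
    qed (auto simp: P_def)
  qed
  have pos: "0 \<le> snd (P i) \<and> snd (P i) \<le> \<delta>" for i
    using C(2)[OF PC] \<delta> by (cases "i \<in> I") (force simp: P_def)+
  have "(\<Sum>i. ennreal (unit_ball_vol (real DIM('a)) * snd (P i) ^ DIM('a)))
      = (\<Sum>i. emeasure lborel (ball (fst (P i)) (snd (P i))))"
    using pos by (simp add: emeasure_ball)
  also have "\<dots> = emeasure lborel (\<Union>i. ball (fst (P i)) (snd (P i)))"
    by (rule suminf_emeasure) (use disj in auto)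
  also have "\<dots> \<le> emeasure lborel W"
    by (rule emeasure_mono) (use sub W in auto)
  finally show ?thesis
    using pos cov by (intro exI[of _ "\<lambda>i. fst (P i)"] exI[of _ "\<lambda>i. snd (P i)"]) auto
qed

text \<open>Vitali's theorem covers \<open>A\<close> up to a null set by disjoint balls inside an open set of almost the
  same volume. The remaining null set is covered by balls whose total volume is as
  small as desired, by the \<open>5\<close>-times covering lemma.\<close>

lemma efficient_ball_cover:
  fixes A :: "'a::euclidean_space set"
  assumes A[measurable]: "A \<in> sets borel" and fin: "emeasure lborel A < \<infinity>" and \<delta>: "\<delta> > 0" and \<eta>: "\<eta> > 0"
  shows "\<exists>(a :: nat \<Rightarrow> 'a) r. (\<forall>i. 0 \<le> r i \<and> r i \<le> \<delta>) \<and> A \<subseteq> (\<Union>i. cball (a i) (r i)) \<and>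
     (\<Sum>i. ennreal (unit_ball_vol (real DIM('a)) * r i ^ DIM('a))) \<le> emeasure lborel A + ennreal \<eta>"
proof -
  let ?d = "DIM('a)"
  let ?w = "unit_ball_vol (real ?d)"
  have outer: "\<exists>W. open W \<and> B \<subseteq> W \<and> emeasure lborel W \<le> emeasure lborel B + ennreal e"
    if B: "B \<in> sets borel" and e: "e > 0" for B :: "'a set" and e
  proof -
    obtain W where W: "open W" "B \<subseteq> W" "emeasure lborel (W - B) < ennreal e"
      using outer_regular_lborel[OF B, of e] e by auto
    have "emeasure lborel W = emeasure lborel B + emeasure lborel (W - B)"
      using W B by (subst plus_emeasure) (auto intro!: arg_cong[where f="emeasure lborel"])
    also have "\<dots> \<le> emeasure lborel B + ennreal e"
      using W by (intro add_left_mono less_imp_le)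
    finally show ?thesis using W by blast
  qed
  have small: "\<exists>\<rho>. 0 < \<rho> \<and> \<rho> \<le> \<delta>' \<and> \<rho> < e \<and> ball x \<rho> \<subseteq> W"
    if W: "open W" "x \<in> W" "\<delta>' > 0" "e > 0" for x :: 'a and W \<delta>' e
  proof -
    obtain \<rho> where "\<rho> > 0" "ball x \<rho> \<subseteq> W" using openE[OF W(1,2)] by blast
    then show ?thesis using W
      by (intro exI[of _ "min \<rho> (min \<delta>' (e/2))"]) (auto simp: subset_eq)
  qed
  obtain W where W: "open W" "A \<subseteq> W" "emeasure lborel W \<le> emeasure lborel A + ennreal (\<eta> / 2)"
    using outer[OF A, of "\<eta>/2"] \<eta> by auto
  let ?K = "\<lambda>W \<delta>. {p::'a \<times> real. 0 < snd p \<and> snd p \<le> \<delta> \<and> ball (fst p) (snd p) \<subseteq> W}"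
  obtain C where C: "countable C" "C \<subseteq> ?K W \<delta>"
     "pairwise (\<lambda>i j. disjnt (ball (fst i) (snd i)) (ball (fst j) (snd j))) C"
     "negligible (A - (\<Union>i\<in>C. ball (fst i) (snd i)))"
  proof (rule Vitali_covering_theorem_balls[of A "?K W \<delta>" fst snd])
    fix x :: 'a and e :: real assume "x \<in> A" "0 < e"
    then obtain \<rho> where "0 < \<rho> \<and> \<rho> \<le> \<delta> \<and> \<rho> < e \<and> ball x \<rho> \<subseteq> W"
      using small[OF W(1) _ \<delta>] W(2) by blast
    then show "\<exists>i. i \<in> ?K W \<delta> \<and> x \<in> ball (fst i) (snd i) \<and> snd i < e"
      by (intro exI[of _ "(x, \<rho>)"]) auto
  qed auto
  define N where "N = A - (\<Union>i\<in>C. ball (fst i) (snd i))"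
  have "open (\<Union>i\<in>C. ball (fst i) (snd i))" by auto
  then have Nb: "N \<in> sets borel" unfolding N_def by auto
  have N0: "emeasure lborel N = 0"
    using C(4) Nb unfolding N_def[symmetric] negligible_iff_null_sets
    by (subst (asm) null_sets_completion_iff) auto
  obtain W' where W': "open W'" "N \<subseteq> W'" "emeasure lborel W' \<le> emeasure lborel N + ennreal (\<eta> / (2 * 5 ^ ?d))"
    using outer[OF Nb, of "\<eta> / (2 * 5 ^ ?d)"] \<eta> by auto
  have Ncov: "N \<subseteq> (\<Union>i\<in>?K W' (\<delta>/5). ball (fst i) (snd i))"
  proof
    fix x assume "x \<in> N"
    then obtain \<rho> where "0 < \<rho> \<and> \<rho> \<le> \<delta>/5 \<and> \<rho> < 1 \<and> ball x \<rho> \<subseteq> W'"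
      using small[OF W'(1), of x "\<delta>/5" 1] W'(2) \<delta> by auto
    then show "x \<in> (\<Union>i\<in>?K W' (\<delta>/5). ball (fst i) (snd i))"
      by (intro UN_I[of "(x, \<rho>)"]) auto
  qed
  obtain C' where C': "countable C'" "C' \<subseteq> ?K W' (\<delta>/5)"
     "pairwise (\<lambda>i j. disjnt (ball (fst i) (snd i)) (ball (fst j) (snd j))) C'"
     "N \<subseteq> (\<Union>i\<in>C'. ball (fst i) (5 * snd i))"
    by (rule Vitali_covering_lemma_balls[OF Ncov, of "\<delta>/5"]) auto
  have "\<exists>(a :: nat \<Rightarrow> 'a) r. (\<forall>i. 0 \<le> r i \<and> r i \<le> \<delta>) \<and> (\<forall>p\<in>C. \<exists>i. p = (a i, r i)) \<and>
     (\<Sum>i. ennreal (?w * r i ^ ?d)) \<le> emeasure lborel W"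
    by (rule enumerate_disjoint_balls) (use C W \<delta> in auto)
  then obtain a r where ar: "\<And>i. 0 \<le> r i \<and> r i \<le> \<delta>" "\<And>p. p\<in>C \<Longrightarrow> \<exists>i. p = (a i, r i)"
     "(\<Sum>i. ennreal (?w * r i ^ ?d)) \<le> emeasure lborel W" by blast
  have "\<exists>(a :: nat \<Rightarrow> 'a) r. (\<forall>i. 0 \<le> r i \<and> r i \<le> \<delta>/5) \<and> (\<forall>p\<in>C'. \<exists>i. p = (a i, r i)) \<and>
     (\<Sum>i. ennreal (?w * r i ^ ?d)) \<le> emeasure lborel W'"
    by (rule enumerate_disjoint_balls) (use C' W' \<delta> in auto)
  then obtain a' r' where ar': "\<And>i. 0 \<le> r' i \<and> r' i \<le> \<delta>/5" "\<And>p. p\<in>C' \<Longrightarrow> \<exists>i. p = (a' i, r' i)"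
     "(\<Sum>i. ennreal (?w * r' i ^ ?d)) \<le> emeasure lborel W'" by blast
  define c where "c i = (if even i then a (i div 2) else a' (i div 2))" for i :: nat
  define q where "q i = (if even i then r (i div 2) else 5 * r' (i div 2))" for i :: nat
  have q: "0 \<le> q i \<and> q i \<le> \<delta>" for i
    using ar(1)[of "i div 2"] ar'(1)[of "i div 2"] by (auto simp: q_def)
  have cov: "A \<subseteq> (\<Union>i. cball (c i) (q i))"
  proof
    fix x assume "x \<in> A"
    then consider p where "p \<in> C" "x \<in> ball (fst p) (snd p)" | p where "p \<in> C'" "x \<in> ball (fst p) (5 * snd p)"
      using C'(4) unfolding N_def by blast
    then show "x \<in> (\<Union>i. cball (c i) (q i))"
    proof cases
      case 1
      with ar(2)[of p] obtain i where "p = (a i, r i)" by auto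
      with 1 show ?thesis by (intro UN_I[of "2 * i"]) (auto simp: c_def q_def)
    next
      case 2
      with ar'(2)[of p] obtain i where "p = (a' i, r' i)" by auto
      with 2 show ?thesis by (intro UN_I[of "2 * i + 1"]) (auto simp: c_def q_def)
    qed
  qed
  have "(\<lambda>i. ennreal (?w * q i ^ ?d)) = (\<lambda>i. if even i then (\<lambda>i. ennreal (?w * r i ^ ?d)) (i div 2)
      else (\<lambda>i. ennreal (?w * (5 * r' i) ^ ?d)) (i div 2))"
    by (auto simp: q_def)
  then have "(\<Sum>i. ennreal (?w * q i ^ ?d)) \<le> (\<Sum>i. ennreal (?w * r i ^ ?d)) + (\<Sum>i. ennreal (?w * (5 * r' i) ^ ?d))"
    using suminf_interleave_le[of "\<lambda>i. ennreal (?w * r i ^ ?d)" "\<lambda>i. ennreal (?w * (5 * r' i) ^ ?d)"]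
    by (simp only:)
  also have "(\<Sum>i. ennreal (?w * (5 * r' i) ^ ?d)) = ennreal (5 ^ ?d) * (\<Sum>i. ennreal (?w * r' i ^ ?d))"
    by (subst ennreal_suminf_cmult[symmetric]) (simp add: power_mult_distrib mult_ac flip: ennreal_mult')
  also have "\<dots> \<le> ennreal (5 ^ ?d) * ennreal (\<eta> / (2 * 5 ^ ?d))"
    using ar'(3) W'(3) N0 by (intro mult_left_mono) auto
  also have "\<dots> = ennreal (\<eta> / 2)" by (simp flip: ennreal_mult')
  also have "(\<Sum>i. ennreal (?w * r i ^ ?d)) \<le> emeasure lborel A + ennreal (\<eta> / 2)"
    using ar(3) W(3) by simp
  finally have "(\<Sum>i. ennreal (?w * q i ^ ?d)) \<le> emeasure lborel A + ennreal (\<eta> / 2) + ennreal (\<eta> / 2)"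
    by (simp add: add_right_mono)
  also have "\<dots> = emeasure lborel A + ennreal \<eta>"
    using \<eta> by (simp add: add.assoc flip: ennreal_plus)
  finally show ?thesis using q cov by blast
qed

lemma hausdorff_weight_le:
  assumes "\<And>x y. x \<in> U \<Longrightarrow> y \<in> U \<Longrightarrow> norm (x - y) \<le> 2 * r" "0 \<le> r"
  shows "hausdorff_weight k (U :: 'a::real_normed_vector set) \<le> ennreal (unit_ball_vol (real k) * r ^ k)"
proof (cases "U = {}")
  case False
  have "diameter U \<le> 2 * r" by (rule diameter_le) (use False assms in auto)
  moreover have "0 \<le> diameter U"
  proof -
    obtain x where "x \<in> U" using False by auto
    moreover have "bounded U"
      using assms \<open>x \<in> U\<close> by (auto simp: bounded_def dist_norm)
    ultimately show ?thesis using diameter_bounded_bound[of U x x] by simp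
  qed
  ultimately show ?thesis
    using False unfolding hausdorff_weight_def
    by (auto intro!: ennreal_leI mult_left_mono power_mono)
qed (simp add: hausdorff_weight_def)

text \<open>The isodiametric inequality shows that no cover beats Lebesgue measure, and
  \<open>efficient_ball_cover\<close> provides covers that reach it.\<close>

lemma hausdorff_measure_full:
  fixes A :: "'a::euclidean_space set"
  assumes A: "compact A"
  shows "hausdorff_measure DIM('a) A = emeasure lborel A"
proof (rule antisym)
  let ?d = "DIM('a)"
  let ?w = "unit_ball_vol (real ?d)"
  have fin: "emeasure lborel A < \<infinity>" and Ab: "A \<in> sets borel"
    using A emeasure_compact_finite by (auto intro: borel_compact)
  show "hausdorff_measure ?d A \<le> emeasure lborel A"
  proof (rule hausdorff_measure_leI, rule ennreal_le_epsilon)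
    fix \<delta> e :: real assume \<delta>: "\<delta> > 0" and e: "e > 0"
    obtain a :: "nat \<Rightarrow> 'a" and r where r: "\<And>i. 0 \<le> r i \<and> r i \<le> \<delta>/2" "A \<subseteq> (\<Union>i. cball (a i) (r i))"
      and s: "(\<Sum>i. ennreal (?w * r i ^ ?d)) \<le> emeasure lborel A + ennreal e"
      using efficient_ball_cover[OF Ab fin, of "\<delta>/2" e] \<delta> e by auto
    have "hausdorff_premeasure ?d \<delta> A \<le> (\<Sum>i. hausdorff_weight ?d (cball (a i) (r i)))"
    proof (rule hausdorff_premeasure_le)
      fix i show "diameter (cball (a i) (r i)) \<le> \<delta>" using r(1)[of i] \<delta> by (auto simp: field_simps)
    qed (use r in auto)
    also have "\<dots> \<le> (\<Sum>i. ennreal (?w * r i ^ ?d))"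
      by (intro suminf_le summableI hausdorff_weight_le)
         (use r in \<open>auto simp: dist_norm[symmetric] intro: order_trans[OF dist_triangle2]\<close>,
          smt (verit) dist_commute dist_triangle)
    finally show "hausdorff_premeasure ?d \<delta> A \<le> emeasure lborel A + ennreal e"
      using s by (rule order_trans)
  qed
  have "emeasure lborel A \<le> hausdorff_premeasure ?d 1 A"
    unfolding hausdorff_premeasure_def
  proof (rule INF_greatest, clarify)
    fix U :: "nat \<Rightarrow> 'a set" assume U: "A \<subseteq> (\<Union>n. U n)" "\<forall>n. bounded (U n) \<and> diameter (U n) \<le> 1"
    have "emeasure lborel A \<le> emeasure lborel (\<Union>n. closure (U n))"
      using U(1) closure_subset by (intro emeasure_mono) (blast, auto)
    also have "\<dots> \<le> (\<Sum>n. emeasure lborel (closure (U n)))"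
      by (rule emeasure_subadditive_countably) auto
    also have "\<dots> \<le> (\<Sum>n. hausdorff_weight ?d (U n))"
    proof (intro suminf_le summableI)
      fix n
      show "emeasure lborel (closure (U n)) \<le> hausdorff_weight ?d (U n)"
      proof (cases "U n = {}")
        case False
        have b: "bounded (U n)" using U by auto
        have "emeasure lborel (closure (U n)) \<le> ennreal (?w * (diameter (U n) / 2) ^ ?d)"
        proof (rule isodiametric)
          show "0 \<le> diameter (U n) / 2" using diameter_ge_0[OF b] by simp
          fix x y assume "x \<in> closure (U n)" "y \<in> closure (U n)"
          then show "dist x y \<le> 2 * (diameter (U n) / 2)"
            using diameter_bounded_bound[OF bounded_closure[OF b]] diameter_closure[OF b] by simp
        qed auto
        then show ?thesis using False by (simp add: hausdorff_weight_def)
      qed simp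
    qed
    finally show "emeasure lborel A \<le> (\<Sum>n. hausdorff_weight ?d (U n))" .
  qed
  also have "\<dots> \<le> hausdorff_measure ?d A" by (rule hausdorff_premeasure_le_measure) simp
  finally show "emeasure lborel A \<le> hausdorff_measure ?d A" .
qed

lemma nn_integral_ball_slices:
  fixes n :: "'a::euclidean_space"
  assumes n: "norm n = 1" and q: "q \<ge> 0"
  shows "(\<integral>\<^sup>+s\<in>{-q..q}. ennreal (unit_ball_vol (real (DIM('a) - 1)) * sqrt (q\<^sup>2 - s\<^sup>2) ^ (DIM('a) - 1)) \<partial>lborel)
       = ennreal (unit_ball_vol (real DIM('a)) * q ^ DIM('a))"
proof (cases "q = 0")
  case True
  have "AE s in lborel. s \<notin> {0::real}"
    by (intro AE_not_in countable_imp_null_set_lborel) auto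
  then have "(\<integral>\<^sup>+s\<in>{-q..q}. ennreal (unit_ball_vol (real (DIM('a) - 1)) * sqrt (q\<^sup>2 - s\<^sup>2) ^ (DIM('a) - 1)) \<partial>lborel)
     = (\<integral>\<^sup>+s. 0 \<partial>(lborel::real measure))"
    by (intro nn_integral_cong_AE) (auto simp: True elim!: eventually_mono)
  then show ?thesis by (simp add: True)
next
  case False
  with q have q: "q > 0" by simp
  have "ennreal (unit_ball_vol (real DIM('a)) * q ^ DIM('a)) = (\<integral>\<^sup>+v\<in>cball 0 q. 1 \<partial>(lborel::'a measure))"
    using emeasure_cball[of q "0::'a"] q by simp
  also have "\<dots> = (\<integral>\<^sup>+s\<in>{-q..q}. 1 * disc_vol n (sqrt (q\<^sup>2 - s\<^sup>2)) \<partial>lborel)"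
    by (rule nn_integral_cball_height[OF n q]) auto
  also have "\<dots> = (\<integral>\<^sup>+s\<in>{-q..q}. ennreal (unit_ball_vol (real (DIM('a) - 1)) * sqrt (q\<^sup>2 - s\<^sup>2) ^ (DIM('a) - 1)) \<partial>lborel)"
  proof (intro nn_integral_cong_AE)
    have "AE s in lborel. s \<notin> {-q, q::real}"
      by (intro AE_not_in countable_imp_null_set_lborel) auto
    then show "AE s in lborel. 1 * disc_vol n (sqrt (q\<^sup>2 - s\<^sup>2)) * indicator {-q..q} s
      = ennreal (unit_ball_vol (real (DIM('a) - 1)) * sqrt (q\<^sup>2 - s\<^sup>2) ^ (DIM('a) - 1)) * indicator {-q..q} s"
    proof eventually_elim
      case (elim s)
      show ?case
      proof (cases "s \<in> {-q..q}")
        case True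
        with elim have "\<bar>s\<bar> < q" by auto
        then have "s\<^sup>2 < q\<^sup>2" by (metis abs_ge_zero power2_abs power_strict_mono zero_less_numeral)
        then have "sqrt (q\<^sup>2 - s\<^sup>2) > 0" by simp
        from disc_vol_eq[OF n this] show ?thesis by simp
      qed simp
    qed
  qed
  finally show ?thesis by simp
qed

text \<open>On a set that lies in a narrow cone around the hyperplane of \<open>n\<close>, the projection has a Lipschitz inverse. An
  efficient cover of the cylinder by balls of the full space is cut at height \<open>s\<close>; this covers
  the projection by discs, and pulled back it covers the set. Averaging the resulting bound
  over the height \<open>s \<in> {0..1}\<close> turns the sum of the slices into the sum of the volumes of the balls.\<close>

theorem hausdorff_le_shadow:
  fixes E :: "'a::euclidean_space set" and n :: 'a
  assumes n: "norm n = 1" and \<epsilon>: "0 \<le> \<epsilon>" "\<epsilon> < 1"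
    and cone: "\<And>z z'. z \<in> E \<Longrightarrow> z' \<in> E \<Longrightarrow> \<bar>(z - z') \<bullet> n\<bar> \<le> \<epsilon> * norm (z - z')"
    and meas[measurable]: "cyl n E \<in> sets borel"
  shows "hausdorff_measure (DIM('a) - 1) E \<le> ennreal ((1 / sqrt (1 - \<epsilon>\<^sup>2)) ^ (DIM('a) - 1)) * shadow n E"
proof -
  let ?k = "DIM('a) - 1"
  let ?w = "unit_ball_vol (real ?k)" and ?W = "unit_ball_vol (real DIM('a))"
  define c where "c = 1 / sqrt (1 - \<epsilon>\<^sup>2)"
  have nn: "n \<bullet> n = 1" using n by (simp add: dot_square_norm)
  have e2: "0 < 1 - \<epsilon>\<^sup>2" using \<epsilon> by (simp add: abs_square_less_1)
  then have c: "c > 0" by (simp add: c_def)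
  have lip: "norm (z - z') \<le> c * norm (pr n z - pr n z')" if "z \<in> E" "z' \<in> E" for z z'
  proof -
    have "((z - z') \<bullet> n)\<^sup>2 \<le> (\<epsilon> * norm (z - z'))\<^sup>2"
      using cone[OF that] \<epsilon> by (simp add: abs_le_square_iff[symmetric] abs_mult)
    with norm_pr_sq[OF n, of "z - z'"] have "(1 - \<epsilon>\<^sup>2) * (norm (z - z'))\<^sup>2 \<le> (norm (pr n z - pr n z'))\<^sup>2"
      by (simp add: pr_diff power_mult_distrib algebra_simps)
    then have "sqrt ((1 - \<epsilon>\<^sup>2) * (norm (z - z'))\<^sup>2) \<le> norm (pr n z - pr n z')"
      by (intro real_le_lsqrt) auto
    also have "sqrt ((1 - \<epsilon>\<^sup>2) * (norm (z - z'))\<^sup>2) = sqrt (1 - \<epsilon>\<^sup>2) * norm (z - z')"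
      by (simp only: real_sqrt_mult real_sqrt_abs abs_norm_cancel)
    finally show ?thesis using e2 by (simp add: c_def field_simps)
  qed
  have main: "hausdorff_premeasure ?k \<delta> E \<le> ennreal (c ^ ?k) * (shadow n E + ennreal \<eta>)"
    if \<delta>: "\<delta> > 0" and \<eta>: "\<eta> > 0" and fin: "shadow n E < \<infinity>" for \<delta> \<eta>
  proof -
    have \<delta>2: "\<delta> / (2 * c) > 0" using \<delta> c by simp
    obtain a :: "nat \<Rightarrow> 'a" and r where r: "\<And>i. 0 \<le> r i \<and> r i \<le> \<delta> / (2 * c)"
      and cov: "cyl n E \<subseteq> (\<Union>i. cball (a i) (r i))"
      and s: "(\<Sum>i. ennreal (?W * r i ^ DIM('a))) \<le> shadow n E + ennreal \<eta>"
      using efficient_ball_cover[OF meas _ \<delta>2 \<eta>] fin unfolding shadow_def by auto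
    \<comment> \<open>The weight of the part of the cover at height \<open>s\<close> that comes from the ball \<open>i\<close>: a disc of radius \<open>sqrt ((r i)\<^sup>2 - (s - a i \<bullet> n)\<^sup>2)\<close>, enlarged by the Lipschitz constant \<open>c\<close>.\<close>
    define g where "g i s = ennreal (c ^ ?k) * (ennreal (?w * sqrt ((r i)\<^sup>2 - (s - a i \<bullet> n)\<^sup>2) ^ ?k)
        * indicator {- r i..r i} (s - a i \<bullet> n))" for i s
    have slice: "hausdorff_premeasure ?k \<delta> E \<le> (\<Sum>i. g i s)" if s: "s \<in> {0..1}" for s
    proof -
      define U where "U i = {z \<in> E. pr n z + s *\<^sub>R n \<in> cball (a i) (r i)}" for i
      have pin: "pr n (pr n z + s *\<^sub>R n) = pr n z" for z
        using n by (simp add: pr_def inner_diff_left inner_add_left nn)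
      have EU: "E \<subseteq> (\<Union>i. U i)"
      proof
        fix z assume z: "z \<in> E"
        have "pr n z + s *\<^sub>R n \<in> cyl n E"
          using z s pin[of z] by (auto simp: cyl_def slab_def inner_add_left pr_inner[OF n] nn)
        then obtain i where "pr n z + s *\<^sub>R n \<in> cball (a i) (r i)" using cov by blast
        then show "z \<in> (\<Union>i. U i)" using z unfolding U_def by blast
      qed
      have key: "\<bar>s - a i \<bullet> n\<bar> \<le> r i \<and> (norm (pr n z - pr n (a i))) \<le> sqrt ((r i)\<^sup>2 - (s - a i \<bullet> n)\<^sup>2)"
        if "z \<in> U i" for i z
      proof -
        have "norm (pr n z + s *\<^sub>R n - a i) \<le> r i"
          using that by (simp add: U_def dist_norm norm_minus_commute)
        then have "(norm (pr n z + s *\<^sub>R n - a i))\<^sup>2 \<le> (r i)\<^sup>2" by (intro power_mono) auto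
        also have "(norm (pr n z + s *\<^sub>R n - a i))\<^sup>2 = (norm (pr n z - pr n (a i)))\<^sup>2 + (s - a i \<bullet> n)\<^sup>2"
          by (subst norm_pr_sq[OF n]) (simp add: pr_diff pin inner_diff_left inner_add_left pr_inner[OF n] nn)
        finally have le: "(norm (pr n z - pr n (a i)))\<^sup>2 + (s - a i \<bullet> n)\<^sup>2 \<le> (r i)\<^sup>2" .
        then have "(s - a i \<bullet> n)\<^sup>2 \<le> (r i)\<^sup>2" by (smt (verit) zero_le_power2)
        then have "\<bar>s - a i \<bullet> n\<bar> \<le> r i" using r[of i] abs_le_square_iff[of "s - a i \<bullet> n" "r i"] by simp
        moreover have "norm (pr n z - pr n (a i)) \<le> sqrt ((r i)\<^sup>2 - (s - a i \<bullet> n)\<^sup>2)"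
          using le by (intro real_le_rsqrt) simp
        ultimately show ?thesis by simp
      qed
      have dU: "norm (z - z') \<le> 2 * (c * sqrt ((r i)\<^sup>2 - (s - a i \<bullet> n)\<^sup>2))" if "z \<in> U i" "z' \<in> U i" for i z z'
      proof -
        have "norm (z - z') \<le> c * norm (pr n z - pr n z')"
          by (rule lip) (use that in \<open>auto simp: U_def\<close>)
        also have "norm (pr n z - pr n z') \<le> norm (pr n z - pr n (a i)) + norm (pr n z' - pr n (a i))"
          by (metis dist_norm dist_triangle2)
        also have "\<dots> \<le> 2 * sqrt ((r i)\<^sup>2 - (s - a i \<bullet> n)\<^sup>2)"
          using key[OF that(1)] key[OF that(2)] by simp
        finally show ?thesis using c by (simp add: mult_ac)
      qed
      have sq: "sqrt ((r i)\<^sup>2 - (s - a i \<bullet> n)\<^sup>2) \<le> r i" for i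
        using r[of i] by (intro real_le_lsqrt) auto
      have dd: "2 * (c * sqrt ((r i)\<^sup>2 - (s - a i \<bullet> n)\<^sup>2)) \<le> \<delta>" for i
      proof -
        have "c * sqrt ((r i)\<^sup>2 - (s - a i \<bullet> n)\<^sup>2) \<le> c * (\<delta> / (2 * c))"
          using sq[of i] r[of i] c by (intro mult_left_mono) auto
        then show ?thesis using c by simp
      qed
      have "hausdorff_premeasure ?k \<delta> E \<le> (\<Sum>i. hausdorff_weight ?k (U i))"
      proof (rule hausdorff_premeasure_le[OF EU])
        fix i
        show "bounded (U i)"
        proof (cases "U i = {}")
          case False
          then obtain z where "z \<in> U i" by auto
          then show ?thesis using dU[of z i] by (auto simp: bounded_def dist_norm)
        qed simp
        show "diameter (U i) \<le> \<delta>"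
        proof (rule diameter_le)
          show "U i \<noteq> {} \<or> 0 \<le> \<delta>" using \<delta> by simp
          show "norm (x - y) \<le> \<delta>" if "x \<in> U i" "y \<in> U i" for x y
            by (rule order_trans[OF dU[OF that] dd])
        qed
      qed
      also have "\<dots> \<le> (\<Sum>i. g i s)"
      proof (intro suminf_le summableI)
        fix i
        show "hausdorff_weight ?k (U i) \<le> g i s"
        proof (cases "U i = {}")
          case True then show ?thesis by (simp add: hausdorff_weight_def)
        next
          case False
          then obtain z where z: "z \<in> U i" by auto
          then have nonneg: "0 \<le> sqrt ((r i)\<^sup>2 - (s - a i \<bullet> n)\<^sup>2)" using key[OF z] by (meson norm_ge_zero order_trans)
          have "hausdorff_weight ?k (U i) \<le> ennreal (?w * (c * sqrt ((r i)\<^sup>2 - (s - a i \<bullet> n)\<^sup>2)) ^ ?k)"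
            by (rule hausdorff_weight_le) (use dU nonneg c in auto)
          also have "\<dots> = g i s"
            using key[OF z] c nonneg unfolding g_def
            by (simp add: power_mult_distrib abs_le_iff mult_ac flip: ennreal_mult)
          finally show ?thesis .
        qed
      qed
      finally show ?thesis .
    qed
    have gm[measurable]: "g i \<in> borel_measurable borel" for i unfolding g_def by measurable
    have gi: "(\<integral>\<^sup>+s. g i s \<partial>lborel) = ennreal (c ^ ?k) * ennreal (?W * r i ^ DIM('a))" for i
    proof -
      have "(\<integral>\<^sup>+s. g i s \<partial>lborel) = (\<integral>\<^sup>+s. g i (s + a i \<bullet> n) \<partial>lborel)"
        by (rule nn_integral_lborel_shift[symmetric]) measurable
      also have "\<dots> = (\<integral>\<^sup>+s. ennreal (c ^ ?k) * (ennreal (?w * sqrt ((r i)\<^sup>2 - s\<^sup>2) ^ ?k) * indicator {- r i..r i} s) \<partial>lborel)"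
        by (simp add: g_def)
      also have "\<dots> = ennreal (c ^ ?k) * ennreal (?W * r i ^ DIM('a))"
      proof -
        have "0 \<le> r i" using r by simp
        note slices = nn_integral_ball_slices[OF n this]
        show ?thesis unfolding slices[symmetric] by (rule nn_integral_cmult) measurable
      qed
      finally show ?thesis .
    qed
    \<comment> \<open>The left-hand side is constant in the height, so it equals its average.\<close>
    have "hausdorff_premeasure ?k \<delta> E = (\<integral>\<^sup>+s. hausdorff_premeasure ?k \<delta> E * indicator {0..1} s \<partial>(lborel::real measure))"
      by (subst nn_integral_cmult) auto
    also have "\<dots> \<le> (\<integral>\<^sup>+s. (\<Sum>i. g i s) \<partial>lborel)"
    proof (rule nn_integral_mono)
      fix s :: real
      show "hausdorff_premeasure ?k \<delta> E * indicator {0..1} s \<le> (\<Sum>i. g i s)"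
        using slice[of s] by (cases "s \<in> {0..1}") simp_all
    qed
    also have "\<dots> = (\<Sum>i. ennreal (c ^ ?k) * ennreal (?W * r i ^ DIM('a)))"
      by (subst nn_integral_suminf) (auto simp: gi)
    also have "\<dots> \<le> ennreal (c ^ ?k) * (shadow n E + ennreal \<eta>)"
      by (subst ennreal_suminf_cmult) (intro mult_left_mono s, simp)
    finally show ?thesis .
  qed
  show ?thesis
  proof (cases "shadow n E < \<infinity>")
    case True
    show ?thesis unfolding c_def[symmetric]
    proof (rule hausdorff_measure_leI, rule ennreal_le_epsilon)
      fix \<delta> e :: real assume "\<delta> > 0" "e > 0"
      then have "hausdorff_premeasure ?k \<delta> E \<le> ennreal (c ^ ?k) * (shadow n E + ennreal (e / c ^ ?k))"
        using c True by (intro main) auto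
      also have "\<dots> = ennreal (c ^ ?k) * shadow n E + ennreal e"
        using c by (simp add: distrib_left flip: ennreal_mult')
      finally show "hausdorff_premeasure ?k \<delta> E \<le> ennreal (c ^ ?k) * shadow n E + ennreal e" .
    qed
  next
    case False
    then have "shadow n E = \<infinity>" by (simp add: less_top[symmetric])
    then show ?thesis using c unfolding c_def[symmetric] by (simp add: ennreal_mult_top)
  qed
qed

section \<open>Crossing volume bounded by surface area\<close>

text \<open>A cover of \<open>S\<close> by short intervals is mapped to a cover of the image by intervals longer by a factor
  of at most \<open>C\<close>.\<close>

lemma emeasure_lipschitz_image_le:
  fixes g :: "real \<Rightarrow> real" and S F :: "real set"
  assumes S: "S \<in> sets borel" "emeasure lborel S < \<infinity>" and F: "F \<subseteq> g ` S" and C: "C \<ge> 0"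
    and lip: "\<And>x y. x \<in> S \<Longrightarrow> y \<in> S \<Longrightarrow> \<bar>g x - g y\<bar> \<le> C * \<bar>x - y\<bar>"
  shows "emeasure lborel F \<le> ennreal C * emeasure lborel S"
proof (rule ennreal_le_epsilon)
  fix e :: real assume e: "e > 0"
  obtain a r where r: "\<And>i::nat. 0 \<le> r i" "S \<subseteq> (\<Union>i. cball (a i) (r i))"
    and s: "(\<Sum>i. ennreal (2 * r i)) \<le> emeasure lborel S + ennreal (e / (C + 1))"
    using efficient_ball_cover[OF S, of 1 "e / (C + 1)"] e C by auto
  define m where "m i = Inf (g ` (S \<inter> cball (a i) (r i)))" for i
  have "F \<subseteq> (\<Union>i. {m i .. m i + C * (2 * r i)})"
  proof
    fix y assume "y \<in> F"
    then obtain x where x: "x \<in> S" "y = g x" using F by auto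
    then obtain i where i: "x \<in> cball (a i) (r i)" using r(2) by blast
    let ?G = "g ` (S \<inter> cball (a i) (r i))"
    have close: "\<bar>y' - y''\<bar> \<le> C * (2 * r i)" if yy: "y' \<in> ?G" "y'' \<in> ?G" for y' y''
    proof -
      obtain x' x'' where x': "x' \<in> S \<inter> cball (a i) (r i)" "y' = g x'" "x'' \<in> S \<inter> cball (a i) (r i)" "y'' = g x''"
        using yy by blast
      have "\<bar>x' - x''\<bar> \<le> 2 * r i" using x' by (auto simp: dist_real_def)
      then have "C * \<bar>x' - x''\<bar> \<le> C * (2 * r i)" using C by (rule mult_left_mono)
      then show ?thesis using lip[of x' x''] x' by auto
    qed
    have yG: "y \<in> ?G" using x i by blast
    have low: "y - C * (2 * r i) \<le> y'" if "y' \<in> ?G" for y' using close[OF that yG] by linarith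
    have "m i \<le> y" unfolding m_def
      by (rule cInf_lower[OF yG]) (rule bdd_belowI, rule low)
    moreover have "y - C * (2 * r i) \<le> m i" unfolding m_def
      by (rule cInf_greatest) (use yG in blast, rule low)
    ultimately show "y \<in> (\<Union>i. {m i .. m i + C * (2 * r i)})" by (intro UN_I[of i]) auto
  qed
  then have "emeasure lborel F \<le> emeasure lborel (\<Union>i. {m i .. m i + C * (2 * r i)})"
    by (rule emeasure_mono) auto
  also have "\<dots> \<le> (\<Sum>i. emeasure lborel {m i .. m i + C * (2 * r i)})"
    by (rule emeasure_subadditive_countably) auto
  also have "\<dots> = (\<Sum>i. ennreal C * ennreal (2 * r i))"
    using r C by (intro suminf_cong) (simp add: ennreal_mult)
  also have "\<dots> \<le> ennreal C * (emeasure lborel S + ennreal (e / (C + 1)))"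
    by (subst ennreal_suminf_cmult) (intro mult_left_mono s, simp)
  also have "\<dots> = ennreal C * emeasure lborel S + ennreal (C * (e / (C + 1)))"
    using C e by (simp add: distrib_left ennreal_mult[symmetric])
  also have "\<dots> \<le> ennreal C * emeasure lborel S + ennreal e"
  proof (intro add_left_mono ennreal_leI)
    show "C * (e / (C + 1)) \<le> e" using C e by (simp add: field_simps)
  qed
  finally show "emeasure lborel F \<le> ennreal C * emeasure lborel S + ennreal e" .
qed

lemma pr_pr: "norm n = 1 \<Longrightarrow> pr n (pr n x) = pr n x"
  by (simp add: pr_def inner_diff_left dot_square_norm)

lemma pr_eqD:
  assumes "pr n x = pr n z" shows "z = x + (z \<bullet> n - x \<bullet> n) *\<^sub>R n"
proof -
  have "z = pr n z + (z \<bullet> n) *\<^sub>R n" by (rule pr_decomp)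
  also have "pr n z = x - (x \<bullet> n) *\<^sub>R n" using assms by (simp only: pr_def)
  also have "x - (x \<bullet> n) *\<^sub>R n + (z \<bullet> n) *\<^sub>R n = x + (z \<bullet> n - x \<bullet> n) *\<^sub>R n"
    by (simp add: scaleR_left_diff_distrib)
  finally show ?thesis .
qed

lemma pr_add_along: "norm n = 1 \<Longrightarrow> pr n (x + s *\<^sub>R n) = pr n x"
  by (simp add: pr_add pr_scale pr_self)

lemma cyl_compact_borel: "compact U \<Longrightarrow> cyl n U \<in> sets borel"
proof -
  assume U: "compact U"
  have c: "closed (pr n ` U)"
    by (intro compact_imp_closed compact_continuous_image continuous_on_pr U)
  have "closed (pr n -` (pr n ` U))"
    using continuous_closed_vimage[OF c, of "pr n"] continuous_on_pr[of UNIV n]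
    by (auto simp: continuous_on_eq_continuous_at)
  then have "closed (slab n \<inter> pr n -` (pr n ` U))" by (intro closed_Int closed_slab)
  also have "slab n \<inter> pr n -` (pr n ` U) = cyl n U" by (auto simp: cyl_def)
  finally show ?thesis by simp
qed

text \<open>The set consists of the points \<open>t\<close> whose segment to \<open>t + v\<close> meets \<open>U\<close>. On a line in direction
  \<open>n\<close> the parameter of the meeting point determines the point of the line up to a
  Lipschitz constant, because \<open>U\<close> is a Lipschitz graph over the hyperplane. Hence the fibre is at most
  \<open>\<bar>v \<bullet> n\<bar> + \<kappa> * norm v\<close> times as long as the set of parameters whose projection lies in
  the projection of \<open>U\<close>; integrating over the lines leaves the shadow of \<open>U\<close>.\<close>

lemma emeasure_swept_le:
  fixes U :: "'a::euclidean_space set" and n v :: 'a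
  assumes n: "norm n = 1" and U: "compact U" and \<kappa>: "\<kappa> \<ge> 0"
    and graph: "\<And>z z'. z \<in> U \<Longrightarrow> z' \<in> U \<Longrightarrow> \<bar>(z - z') \<bullet> n\<bar> \<le> \<kappa> * norm (pr n (z - z'))"
  shows "emeasure lborel {t. \<exists>l\<in>{0..1}. t + l *\<^sub>R v \<in> U} \<le> ennreal (\<bar>v \<bullet> n\<bar> + \<kappa> * norm v) * shadow n U"
    and "{t. \<exists>l\<in>{0..1}. t + l *\<^sub>R v \<in> U} \<in> sets borel"
proof -
  have nn: "n \<bullet> n = 1" using n by (simp add: dot_square_norm)
  let ?W = "{t. \<exists>l\<in>{0..1}. t + l *\<^sub>R v \<in> U}"
  have "?W = (\<lambda>(z, l). z - l *\<^sub>R v) ` (U \<times> {0..1})"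
  proof safe
    fix t and l :: real assume "l \<in> {0..1}" "t + l *\<^sub>R v \<in> U"
    then show "t \<in> (\<lambda>(z, l). z - l *\<^sub>R v) ` (U \<times> {0..1})"
      by (intro image_eqI[of _ _ "(t + l *\<^sub>R v, l)"]) auto
  qed force
  moreover have "compact ((\<lambda>(z, l). z - l *\<^sub>R v) ` (U \<times> {0..1::real}))"
    by (intro compact_continuous_image compact_Times U compact_Icc)
       (auto simp: case_prod_unfold intro!: continuous_intros)
  ultimately have W: "compact ?W" by simp
  then show Wb: "?W \<in> sets borel" by (rule borel_compact)
  let ?K = "pr n ` U"
  have Kc: "closed ?K"
    by (intro compact_imp_closed compact_continuous_image continuous_on_pr U)
  then have [measurable]: "?K \<in> sets borel" by simp
  define C where "C = \<bar>v \<bullet> n\<bar> + \<kappa> * norm v"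
  have C: "C \<ge> 0" using \<kappa> by (simp add: C_def)
  \<comment> \<open>The parameters at which the segment issuing from the line through \<open>x\<close> lies over the projection of \<open>U\<close>.\<close>
  define Lam where "Lam x = {l \<in> {0..1}. pr n (x + l *\<^sub>R v) \<in> ?K}" for x
  have Lamb: "Lam x \<in> sets borel" for x unfolding Lam_def by measurable
  have fibre: "emeasure lborel {s. x + s *\<^sub>R n \<in> ?W} \<le> ennreal C * emeasure lborel (Lam x)" for x
  proof -
    define g where "g l = (SOME s. x + s *\<^sub>R n + l *\<^sub>R v \<in> U)" for l
    have g: "x + g l *\<^sub>R n + l *\<^sub>R v \<in> U" if l: "l \<in> Lam x" for l
    proof -
      obtain z where z: "z \<in> U" "pr n (x + l *\<^sub>R v) = pr n z" using l by (auto simp: Lam_def)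
      have "x + (z \<bullet> n - (x + l *\<^sub>R v) \<bullet> n) *\<^sub>R n + l *\<^sub>R v = x + l *\<^sub>R v + (z \<bullet> n - (x + l *\<^sub>R v) \<bullet> n) *\<^sub>R n"
        by (simp only: ac_simps)
      also have "\<dots> = z" by (rule pr_eqD[OF z(2), symmetric])
      finally have "x + (z \<bullet> n - (x + l *\<^sub>R v) \<bullet> n) *\<^sub>R n + l *\<^sub>R v \<in> U" using z(1) by simp
      then show ?thesis unfolding g_def by (rule someI)
    qed
    have gen: "\<bar>s - s'\<bar> \<le> C * \<bar>l - l'\<bar>"
      if "x + s *\<^sub>R n + l *\<^sub>R v \<in> U" "x + s' *\<^sub>R n + l' *\<^sub>R v \<in> U" for s s' l l'
    proof -
      let ?z = "x + s *\<^sub>R n + l *\<^sub>R v" and ?z' = "x + s' *\<^sub>R n + l' *\<^sub>R v"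
      have d: "?z - ?z' = (s - s') *\<^sub>R n + (l - l') *\<^sub>R v" by (simp add: algebra_simps)
      have "pr n (?z - ?z') = (l - l') *\<^sub>R pr n v"
        unfolding d pr_add pr_scale using pr_self[OF n] by simp
      moreover have "(?z - ?z') \<bullet> n = (s - s') + (l - l') * (v \<bullet> n)"
        unfolding d by (simp add: inner_add_left nn)
      ultimately have "\<bar>(s - s') + (l - l') * (v \<bullet> n)\<bar> \<le> \<kappa> * (\<bar>l - l'\<bar> * norm (pr n v))"
        using graph[OF that] by simp
      also have "\<dots> \<le> \<kappa> * (\<bar>l - l'\<bar> * norm v)"
        by (intro mult_left_mono norm_pr_le n \<kappa>) auto
      finally have 1: "\<bar>(s - s') + (l - l') * (v \<bullet> n)\<bar> \<le> \<kappa> * (\<bar>l - l'\<bar> * norm v)" .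
      have "\<bar>s - s'\<bar> \<le> \<bar>(s - s') + (l - l') * (v \<bullet> n)\<bar> + \<bar>(l - l') * (v \<bullet> n)\<bar>" by linarith
      also have "\<bar>(l - l') * (v \<bullet> n)\<bar> = \<bar>l - l'\<bar> * \<bar>v \<bullet> n\<bar>" by (rule abs_mult)
      also have "\<bar>(s - s') + (l - l') * (v \<bullet> n)\<bar> + \<bar>l - l'\<bar> * \<bar>v \<bullet> n\<bar> \<le> \<kappa> * (\<bar>l - l'\<bar> * norm v) + \<bar>l - l'\<bar> * \<bar>v \<bullet> n\<bar>"
        using 1 by simp
      also have "\<dots> = C * \<bar>l - l'\<bar>" by (simp add: C_def distrib_left distrib_right mult_ac)
      finally show ?thesis .
    qed
    show ?thesis
    proof (rule emeasure_lipschitz_image_le[where g=g])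
      show "Lam x \<in> sets borel" by (rule Lamb)
      have "emeasure lborel (Lam x) \<le> emeasure lborel {0..1::real}"
        by (rule emeasure_mono) (auto simp: Lam_def)
      then show "emeasure lborel (Lam x) < \<infinity>" by (auto intro: le_less_trans)
      show "0 \<le> C" by (rule C)
      show "\<bar>g l - g l'\<bar> \<le> C * \<bar>l - l'\<bar>" if "l \<in> Lam x" "l' \<in> Lam x" for l l'
        by (rule gen[OF g[OF that(1)] g[OF that(2)]])
      show "{s. x + s *\<^sub>R n \<in> ?W} \<subseteq> g ` Lam x"
      proof clarify
        fix s and l :: real assume l: "l \<in> {0..1}" and z: "x + s *\<^sub>R n + l *\<^sub>R v \<in> U"
        have "pr n (x + s *\<^sub>R n + l *\<^sub>R v) = pr n (x + l *\<^sub>R v)"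
          using pr_add_along[OF n, of "x + l *\<^sub>R v" s] by (simp add: add_ac)
        then have lL: "l \<in> Lam x" using l z unfolding Lam_def by (auto intro!: image_eqI[of _ _ "x + s *\<^sub>R n + l *\<^sub>R v"])
        have "\<bar>s - g l\<bar> \<le> C * \<bar>l - l\<bar>" by (rule gen[OF z g[OF lL]])
        then show "s \<in> g ` Lam x" using lL by auto
      qed
    qed
  qed
  have lamind: "emeasure lborel (Lam x) = (\<integral>\<^sup>+l. indicator {0..1} l * indicator ?K (pr n (x + l *\<^sub>R v)) \<partial>lborel)" for x
  proof -
    have "indicator {0..1} l * indicator ?K (pr n (x + l *\<^sub>R v)) = (indicator (Lam x) l :: ennreal)" for l
      by (simp add: Lam_def indicator_def)
    then show ?thesis using Lamb[of x] by simp
  qed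
  have "emeasure lborel ?W = (\<integral>\<^sup>+x. indicator (slab n) x * emeasure lborel {s. x + s *\<^sub>R n \<in> ?W} \<partial>lborel)"
    by (rule emeasure_along_direction[OF Wb n])
  also have "\<dots> \<le> (\<integral>\<^sup>+x. ennreal C * (\<integral>\<^sup>+l. indicator (slab n) x * (indicator {0..1} l * indicator ?K (pr n (x + l *\<^sub>R v))) \<partial>lborel) \<partial>lborel)"
  proof (rule nn_integral_mono)
    fix x
    have "indicator (slab n) x * emeasure lborel {s. x + s *\<^sub>R n \<in> ?W} \<le> indicator (slab n) x * (ennreal C * emeasure lborel (Lam x))"
      by (intro mult_left_mono fibre) auto
    also have "\<dots> = ennreal C * (indicator (slab n) x * (\<integral>\<^sup>+l. indicator {0..1} l * indicator ?K (pr n (x + l *\<^sub>R v)) \<partial>lborel))"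
      unfolding lamind by (simp add: mult_ac)
    also have "indicator (slab n) x * (\<integral>\<^sup>+l. indicator {0..1} l * indicator ?K (pr n (x + l *\<^sub>R v)) \<partial>lborel)
        = (\<integral>\<^sup>+l. indicator (slab n) x * (indicator {0..1} l * indicator ?K (pr n (x + l *\<^sub>R v))) \<partial>(lborel::real measure))"
      by (rule nn_integral_cmult[symmetric]) measurable
    finally show "indicator (slab n) x * emeasure lborel {s. x + s *\<^sub>R n \<in> ?W}
      \<le> ennreal C * (\<integral>\<^sup>+l. indicator (slab n) x * (indicator {0..1} l * indicator ?K (pr n (x + l *\<^sub>R v))) \<partial>lborel)" .
  qed
  also have "\<dots> = ennreal C * (\<integral>\<^sup>+x. (\<integral>\<^sup>+l. indicator (slab n) x * (indicator {0..1} l * indicator ?K (pr n (x + l *\<^sub>R v))) \<partial>(lborel::real measure)) \<partial>lborel)"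
    by (rule nn_integral_cmult) measurable
  also have "(\<integral>\<^sup>+x. (\<integral>\<^sup>+l. indicator (slab n) x * (indicator {0..1} l * indicator ?K (pr n (x + l *\<^sub>R v))) \<partial>(lborel::real measure)) \<partial>lborel)
     = (\<integral>\<^sup>+l. (\<integral>\<^sup>+x. indicator (slab n) x * (indicator {0..1} l * indicator ?K (pr n (x + l *\<^sub>R v))) \<partial>lborel) \<partial>(lborel::real measure))"
    by (rule lborel_pair.Fubini'[symmetric]) measurable
  also have "\<dots> = (\<integral>\<^sup>+l. indicator {0..1} l * shadow n U \<partial>(lborel::real measure))"
  proof (rule nn_integral_cong)
    fix l :: real
    have e: "indicator (slab n) x * (indicator {0..1} l * indicator ?K (pr n (x + l *\<^sub>R v)))
        = (indicator {0..1} l * indicator (cyl n U) (x + l *\<^sub>R pr n v) :: ennreal)" for x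
    proof -
      have "pr n (x + l *\<^sub>R pr n v) = pr n (x + l *\<^sub>R v)" by (simp add: pr_add pr_scale pr_pr[OF n])
      moreover have "(x + l *\<^sub>R pr n v) \<bullet> n = x \<bullet> n" by (simp add: inner_add_left pr_inner[OF n])
      ultimately show ?thesis by (simp add: indicator_def cyl_def slab_def)
    qed
    have "(\<integral>\<^sup>+x. indicator (slab n) x * (indicator {0..1} l * indicator ?K (pr n (x + l *\<^sub>R v))) \<partial>lborel)
       = (\<integral>\<^sup>+x. indicator {0..1} l * indicator (cyl n U) x \<partial>lborel)"
      unfolding e by (rule nn_integral_lborel_shift) (use cyl_compact_borel[OF U, of n] in measurable)
    also have "\<dots> = indicator {0..1} l * shadow n U"
      unfolding shadow_def using cyl_compact_borel[OF U, of n] by (subst nn_integral_cmult) auto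
    finally show "(\<integral>\<^sup>+x. indicator (slab n) x * (indicator {0..1} l * indicator ?K (pr n (x + l *\<^sub>R v))) \<partial>lborel)
       = indicator {0..1} l * shadow n U" .
  qed
  also have "\<dots> = shadow n U" by (subst nn_integral_multc) auto
  finally show "emeasure lborel ?W \<le> ennreal (\<bar>v \<bullet> n\<bar> + \<kappa> * norm v) * shadow n U"
    by (simp add: C_def)
qed

text \<open>The asymmetry between \<open>\<le>\<close> and \<open><\<close> makes this the disjoint union of an upcrossing and a
  downcrossing.\<close>

definition sep :: "real \<Rightarrow> real \<Rightarrow> real \<Rightarrow> bool" where
  "sep u x y \<longleftrightarrow> (x \<le> u \<and> u < y) \<or> (y \<le> u \<and> u < x)"

definition crossing_volume :: "('a::euclidean_space \<Rightarrow> real) \<Rightarrow> real \<Rightarrow> 'a set \<Rightarrow> real \<Rightarrow> ennreal" where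
  "crossing_volume f u V q = (\<integral>\<^sup>+v\<in>cball 0 q. emeasure lborel {t \<in> V. sep u (f t) (f (t + v))} \<partial>lborel)"

text \<open>The error is measured relative to the gradient, so that the level set in the ball lies in a cone of
  opening \<open>\<epsilon>\<close> around its tangent hyperplane (\<open>almost_linear_cone\<close>).\<close>

definition almost_linear :: "('a::euclidean_space \<Rightarrow> real) \<Rightarrow> ('a \<Rightarrow> 'a) \<Rightarrow> real \<Rightarrow> real \<Rightarrow> 'a \<Rightarrow> bool" where
  "almost_linear f G \<epsilon> \<delta> x \<longleftrightarrow> (\<forall>z\<in>cball x \<delta>. \<forall>z'\<in>cball x \<delta>.
     \<bar>f z' - f z - G x \<bullet> (z' - z)\<bar> \<le> \<epsilon> * norm (G x) * norm (z' - z))"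

text \<open>On a compact set without critical points the gradient is bounded away from zero and uniformly
  continuous, so one radius serves for all points.\<close>

lemma uniformly_almost_linear:
  fixes f :: "'a::euclidean_space \<Rightarrow> real"
  assumes K: "compact K" and f: "\<And>x. (f has_derivative (\<lambda>h. G x \<bullet> h)) (at x)"
    and G: "continuous_on UNIV G" and nz: "\<And>x. x \<in> K \<Longrightarrow> G x \<noteq> 0" and \<epsilon>: "\<epsilon> > 0"
  shows "\<exists>\<delta>>0. \<forall>x\<in>K. almost_linear f G \<epsilon> \<delta> x"
proof (cases "K = {}")
  case False
  have "continuous_on K (\<lambda>x. norm (G x))" by (intro continuous_intros continuous_on_subset[OF G]) auto
  from continuous_attains_inf[OF K False this] obtain x0 where
    x0: "x0 \<in> K" "\<And>y. y \<in> K \<Longrightarrow> norm (G x0) \<le> norm (G y)" by auto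
  define m where "m = norm (G x0)"
  have m: "m > 0" using nz[OF x0(1)] by (simp add: m_def)
  let ?B = "\<Union>x\<in>K. \<Union>y\<in>cball (0::'a) 1. {x + y}"
  have "compact ?B" by (rule compact_sums'[OF K]) simp
  then have "uniformly_continuous_on ?B G"
    by (intro compact_uniformly_continuous continuous_on_subset[OF G]) auto
  then obtain d where d: "d > 0" "\<And>x y. x \<in> ?B \<Longrightarrow> y \<in> ?B \<Longrightarrow> dist y x < d \<Longrightarrow> dist (G y) (G x) < \<epsilon> * m"
    using m \<epsilon> unfolding uniformly_continuous_on_def by (metis mult_pos_pos)
  define \<delta> where "\<delta> = min (d / 2) 1"
  have \<delta>: "\<delta> > 0" using d(1) by (simp add: \<delta>_def)
  have "almost_linear f G \<epsilon> \<delta> x" if x: "x \<in> K" for x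
    unfolding almost_linear_def
  proof (intro ballI)
    fix z z' assume z: "z \<in> cball x \<delta>" "z' \<in> cball x \<delta>"
    have inB: "y \<in> ?B" if "y \<in> cball x \<delta>" for y
    proof -
      have "y = x + (y - x)" "y - x \<in> cball 0 1" using that by (auto simp: \<delta>_def dist_norm norm_minus_commute)
      then show ?thesis using x by blast
    qed
    have "norm (f z' - f z - (\<lambda>h. G x \<bullet> h) (z' - z)) \<le> norm (z' - z) * (\<epsilon> * m)"
    proof (rule differentiable_bound_linearization[where S="cball x \<delta>" and f'="\<lambda>y h. G y \<bullet> h"])
      show "z + t *\<^sub>R (z' - z) \<in> cball x \<delta>" if "t \<in> {0..1}" for t
      proof -
        have "z + t *\<^sub>R (z' - z) = (1 - t) *\<^sub>R z + t *\<^sub>R z'" by (simp add: algebra_simps)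
        then show ?thesis using convexD_alt[OF convex_cball z, of t] that by simp
      qed
      show "(f has_derivative (\<lambda>h. G y \<bullet> h)) (at y within cball x \<delta>)" for y
        using f by (rule has_derivative_at_withinI)
      show "x \<in> cball x \<delta>" using \<delta> by simp
      fix y assume y: "y \<in> cball x \<delta>"
      have "dist (G y) (G x) < \<epsilon> * m"
        by (rule d(2)) (use inB[OF y] inB[of x] \<delta> y d(1) in \<open>auto simp: \<delta>_def dist_commute\<close>)
      then show "onorm ((\<lambda>h. G y \<bullet> h) - (\<lambda>h. G x \<bullet> h)) \<le> \<epsilon> * m"
      proof (intro onorm_bound)
        fix h
        have "\<bar>(G y - G x) \<bullet> h\<bar> \<le> norm (G y - G x) * norm h" by (rule Cauchy_Schwarz_ineq2)
        also have "\<dots> \<le> \<epsilon> * m * norm h"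
          using \<open>dist (G y) (G x) < \<epsilon> * m\<close> by (intro mult_right_mono) (auto simp: dist_norm)
        finally show "norm (((\<lambda>h. G y \<bullet> h) - (\<lambda>h. G x \<bullet> h)) h) \<le> \<epsilon> * m * norm h"
          by (simp add: inner_diff_left)
      qed (use m \<epsilon> in auto)
    qed
    also have "\<dots> \<le> norm (z' - z) * (\<epsilon> * norm (G x))"
      using x0(2)[OF x] \<epsilon> by (intro mult_left_mono) (auto simp: m_def)
    finally show "\<bar>f z' - f z - G x \<bullet> (z' - z)\<bar> \<le> \<epsilon> * norm (G x) * norm (z' - z)"
      by (simp add: mult_ac)
  qed
  then show ?thesis using \<delta> by blast
qed (auto intro: exI[of _ 1])

lemma almost_linear_cone:
  assumes al: "almost_linear f G \<epsilon> \<delta> x" and g: "G x \<noteq> 0"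
    and z: "z \<in> cball x \<delta>" "z' \<in> cball x \<delta>" "f z = f z'"
  shows "\<bar>(z - z') \<bullet> ((1 / norm (G x)) *\<^sub>R G x)\<bar> \<le> \<epsilon> * norm (z - z')"
proof -
  have "\<bar>f z - f z' - G x \<bullet> (z - z')\<bar> \<le> \<epsilon> * norm (G x) * norm (z - z')"
    using al z(1,2) unfolding almost_linear_def by blast
  then have "\<bar>G x \<bullet> (z - z')\<bar> \<le> norm (G x) * (\<epsilon> * norm (z - z'))" using z(3) by (simp add: mult_ac)
  then show ?thesis using g by (simp add: inner_commute field_simps)
qed

lemma cone_imp_graph:
  assumes n: "norm n = 1" and \<epsilon>: "0 \<le> \<epsilon>" "\<epsilon> \<le> 1/2" and c: "\<bar>z \<bullet> n\<bar> \<le> \<epsilon> * norm z"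
  shows "\<bar>z \<bullet> n\<bar> \<le> 2 * \<epsilon> * norm (pr n z)"
proof -
  have "norm z \<le> norm (pr n z) + norm ((z \<bullet> n) *\<^sub>R n)"
    by (metis norm_triangle_ineq pr_decomp)
  then have "norm z \<le> norm (pr n z) + \<epsilon> * norm z" using n c by simp
  also have "\<epsilon> * norm z \<le> 1/2 * norm z" using \<epsilon> by (intro mult_right_mono) auto
  finally have "norm z \<le> 2 * norm (pr n z)" by simp
  then have "\<epsilon> * norm z \<le> \<epsilon> * (2 * norm (pr n z))" using \<epsilon> by (intro mult_left_mono)
  then show ?thesis using c by simp
qed

lemma sep_segment_root:
  fixes f :: "'a::real_normed_vector \<Rightarrow> real"
  assumes f: "continuous_on UNIV f" and s: "sep u (f t) (f (t + v))"
  shows "\<exists>l\<in>{0..1}. f (t + l *\<^sub>R v) = u"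
proof -
  have c: "continuous_on {0..1} (\<lambda>l. f (t + l *\<^sub>R v))"
    by (rule continuous_on_compose2[OF f]) (auto intro!: continuous_intros)
  from s consider "f t \<le> u" "u \<le> f (t + v)" | "f (t + v) \<le> u" "u \<le> f t" by (auto simp: sep_def)
  then show ?thesis
  proof cases
    case 1
    then show ?thesis using IVT'[of "\<lambda>l. f (t + l *\<^sub>R v)" 0 u 1] c by auto
  next
    case 2
    then show ?thesis using IVT2'[of "\<lambda>l. f (t + l *\<^sub>R v)" 1 u 0] c by auto
  qed
qed

lemma nn_integral_cball_abs_inner_norm:
  fixes n :: "'a::euclidean_space"
  assumes n: "norm n = 1" and q: "q > 0" and c: "c \<ge> 0"
  shows "(\<integral>\<^sup>+v\<in>cball 0 q. ennreal (\<bar>v \<bullet> n\<bar> + c * norm v) \<partial>lborel)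
       = ennreal ((abs_proj_const DIM('a) + c * norm_const DIM('a)) * q ^ (DIM('a) + 1))"
proof -
  have "(\<integral>\<^sup>+v\<in>cball 0 q. ennreal (\<bar>v \<bullet> n\<bar> + c * norm v) \<partial>lborel)
    = (\<integral>\<^sup>+v. ennreal \<bar>v \<bullet> n\<bar> * indicator (cball 0 q) v + ennreal c * (ennreal (norm v) * indicator (cball 0 q) v) \<partial>lborel)"
    using c by (intro nn_integral_cong) (auto simp: ennreal_mult indicator_def)
  also have "\<dots> = (\<integral>\<^sup>+v\<in>cball 0 q. ennreal \<bar>v \<bullet> n\<bar> \<partial>lborel) + ennreal c * (\<integral>\<^sup>+v\<in>cball 0 q. ennreal (norm (v::'a)) \<partial>lborel)"
  proof -
    have [measurable]: "cball (0::'a) q \<in> sets borel" by simp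
    have m1: "(\<lambda>v::'a. ennreal \<bar>v \<bullet> n\<bar> * indicator (cball 0 q) v) \<in> borel_measurable lborel"
      and m2: "(\<lambda>v::'a. ennreal (norm v) * indicator (cball 0 q) v) \<in> borel_measurable lborel"
      by measurable
    show ?thesis
      unfolding nn_integral_cmult[OF m2, symmetric]
      by (rule nn_integral_add[OF m1]) measurable
  qed
  also have "\<dots> = ennreal ((abs_proj_const DIM('a) + c * norm_const DIM('a)) * q ^ (DIM('a) + 1))"
    unfolding nn_integral_cball_abs_inner[OF n q] nn_integral_cball_norm[OF q]
    using c q abs_proj_const_pos[of "DIM('a)"] norm_const_pos[of "DIM('a)"]
    by (simp add: distrib_right ennreal_mult'[symmetric] mult.assoc flip: ennreal_plus)
  finally show ?thesis .
qed

text \<open>A segment that crosses the level meets the level set. Take a cover of the level set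
  by small sets that is almost optimal for the Hausdorff measure. On each of them the path is almost
  linear, so by \<open>emeasure_swept_le\<close> the segments meeting it have volume of about \<open>\<bar>v \<bullet> n\<bar>\<close> times the shadow,
  and the isodiametric inequality bounds the shadow by the weight of the covering set.\<close>

theorem crossing_volume_le:
  fixes f :: "'a::euclidean_space \<Rightarrow> real" and G :: "'a \<Rightarrow> 'a"
  assumes d: "DIM('a) \<ge> 2" and T: "compact T"
    and f: "\<And>x. (f has_derivative (\<lambda>h. G x \<bullet> h)) (at x)" and G: "continuous_on UNIV G"
    and nz: "\<And>x. x \<in> T \<Longrightarrow> f x = u \<Longrightarrow> G x \<noteq> 0"
    and V: "\<And>t. t \<in> V \<Longrightarrow> cball t q \<subseteq> T" and q: "q > 0"
  shows "crossing_volume f u V q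
    \<le> ennreal (abs_proj_const DIM('a) * q ^ (DIM('a) + 1)) * hausdorff_measure (DIM('a) - 1) (T \<inter> {t. f t = u})"
proof -
  let ?k = "DIM('a) - 1"
  let ?c1 = "abs_proj_const DIM('a)" and ?c2 = "norm_const DIM('a)"
  have fc: "continuous_on UNIV f"
    using f by (meson differentiableI differentiable_imp_continuous_on differentiable_on_def has_derivative_at_withinI)
  define S where "S = T \<inter> {t. f t = u}"
  have "closed {t. f t = u}" using fc by (intro closed_Collect_eq) auto
  then have S: "compact S" unfolding S_def by (rule compact_Int_closed[OF T])
  have c1: "?c1 > 0" and c2: "?c2 > 0" using abs_proj_const_pos norm_const_pos by auto
  show ?thesis
  proof (cases "hausdorff_measure ?k S")
    case top
    then show ?thesis unfolding S_def[symmetric] using q c1 by (simp add: ennreal_mult_top)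
  next
    case (real h)
    have main: "crossing_volume f u V q \<le> ennreal ((?c1 + 2 * \<eta> * ?c2) * q ^ (DIM('a) + 1) * (h + \<eta>))"
      if \<eta>: "\<eta> > 0" "\<eta> \<le> 1/2" for \<eta>
    proof -
      obtain \<delta> where \<delta>: "\<delta> > 0" and al: "\<And>x. x \<in> S \<Longrightarrow> almost_linear f G \<eta> \<delta> x"
        using uniformly_almost_linear[OF S f G _ \<eta>(1)] nz by (auto simp: S_def)
      \<comment> \<open>An almost optimal cover by sets so small that the path is almost linear on each.\<close>
      have "hausdorff_premeasure ?k \<delta> S < ennreal (h + \<eta>)"
        using hausdorff_premeasure_le_measure[OF \<delta>, of ?k S] real \<eta>
        by (auto simp: ennreal_less_iff intro: le_less_trans)
      then obtain U :: "nat \<Rightarrow> 'a set" where U: "S \<subseteq> (\<Union>n. U n)" "\<And>n. bounded (U n)" "\<And>n. diameter (U n) \<le> \<delta>"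
        and Us: "(\<Sum>n. hausdorff_weight ?k (U n)) < ennreal (h + \<eta>)"
        unfolding hausdorff_premeasure_def INF_less_iff by auto
      let ?W = "\<lambda>j v. {t. \<exists>l\<in>{0..1}. t + l *\<^sub>R v \<in> closure (U j) \<inter> S}"
      define ok where "ok j n \<longleftrightarrow> norm n = 1 \<and> (\<forall>v. ?W j v \<in> sets borel \<and>
          emeasure lborel (?W j v) \<le> ennreal (\<bar>v \<bullet> n\<bar> + 2 * \<eta> * norm v) * hausdorff_weight ?k (U j))" for j and n :: 'a
      have "\<exists>n. norm n = 1 \<and> (\<forall>v. ?W j v \<in> sets borel \<and>
          emeasure lborel (?W j v) \<le> ennreal (\<bar>v \<bullet> n\<bar> + 2 * \<eta> * norm v) * hausdorff_weight ?k (U j))" for j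
      proof (cases "closure (U j) \<inter> S = {}")
        case True
        obtain b :: 'a where "b \<in> Basis" using nonempty_Basis by blast
        then show ?thesis using True by (intro exI[of _ b]) auto
      next
        case False
        then obtain x where x: "x \<in> closure (U j)" "x \<in> S" by auto
        then have Une: "U j \<noteq> {}" by auto
        let ?U = "closure (U j) \<inter> S"
        have gx: "G x \<noteq> 0" using nz x by (auto simp: S_def)
        define n where "n = (1 / norm (G x)) *\<^sub>R G x"
        have n: "norm n = 1" using gx by (simp add: n_def)
        have cU: "compact ?U"
          using S by (metis closed_closure compact_Int_closed inf_commute)
        have dia: "dist y z \<le> diameter (U j)" if "y \<in> closure (U j)" "z \<in> closure (U j)" for y z
          using that diameter_bounded_bound[OF bounded_closure[OF U(2)]] diameter_closure[OF U(2)] by metis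
        have sub: "?U \<subseteq> cball x \<delta>"
          using dia[OF x(1)] U(3)[of j] by force
        have graph: "\<bar>(z - z') \<bullet> n\<bar> \<le> 2 * \<eta> * norm (pr n (z - z'))" if "z \<in> ?U" "z' \<in> ?U" for z z'
        proof (rule cone_imp_graph[OF n])
          show "\<bar>(z - z') \<bullet> n\<bar> \<le> \<eta> * norm (z - z')" unfolding n_def
            by (rule almost_linear_cone[where \<delta>=\<delta> and f=f]) (use al x gx sub that in \<open>auto simp: S_def\<close>)
        qed (use \<eta> in auto)
        have "shadow n ?U \<le> ennreal (unit_ball_vol (real ?k) * (diameter (U j) / 2) ^ ?k)"
          by (rule isodiametric_shadow[OF n cyl_compact_borel[OF cU] _ d])
             (use dia diameter_ge_0[OF U(2)] in auto)
        also have "\<dots> = hausdorff_weight ?k (U j)" using Une by (simp add: hausdorff_weight_def)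
        finally have sh: "shadow n ?U \<le> hausdorff_weight ?k (U j)" .
        have k0: "0 \<le> 2 * \<eta>" using \<eta> by simp
        show ?thesis
        proof (rule exI[of _ n], intro conjI allI)
          show "norm n = 1" by (rule n)
          fix v
          show "?W j v \<in> sets borel" by (rule emeasure_swept_le(2)[OF n cU k0 graph])
          have "emeasure lborel (?W j v) \<le> ennreal (\<bar>v \<bullet> n\<bar> + 2 * \<eta> * norm v) * shadow n ?U"
            by (rule emeasure_swept_le(1)[OF n cU k0 graph])
          also have "\<dots> \<le> ennreal (\<bar>v \<bullet> n\<bar> + 2 * \<eta> * norm v) * hausdorff_weight ?k (U j)"
            by (rule mult_left_mono[OF sh]) simp
          finally show "emeasure lborel (?W j v) \<le> ennreal (\<bar>v \<bullet> n\<bar> + 2 * \<eta> * norm v) * hausdorff_weight ?k (U j)" .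
        qed
      qed
      then have "\<forall>j. \<exists>n. ok j n" unfolding ok_def by (rule allI)
      from choice[OF this] obtain n where okn: "\<And>j. ok j (n j)" by (elim exE) (rule that, blast)
      have n: "\<And>j. norm (n j) = 1" and Wm: "\<And>j v. ?W j v \<in> sets borel"
        and W: "\<And>j v. emeasure lborel (?W j v) \<le> ennreal (\<bar>v \<bullet> n j\<bar> + 2 * \<eta> * norm v) * hausdorff_weight ?k (U j)"
        using okn unfolding ok_def by blast+
      have pt: "emeasure lborel {t \<in> V. sep u (f t) (f (t + v))}
          \<le> (\<Sum>j. ennreal (\<bar>v \<bullet> n j\<bar> + 2 * \<eta> * norm v) * hausdorff_weight ?k (U j))"
        if v: "v \<in> cball 0 q" for v
      proof -
        have "{t \<in> V. sep u (f t) (f (t + v))} \<subseteq> (\<Union>j. ?W j v)"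
        proof clarify
          fix t assume t: "t \<in> V" "sep u (f t) (f (t + v))"
          obtain l where l: "l \<in> {0..1}" "f (t + l *\<^sub>R v) = u" using sep_segment_root[OF fc t(2)] by auto
          have "norm (l *\<^sub>R v) \<le> 1 * q" using l v unfolding norm_scaleR by (intro mult_mono) auto
          then have "t + l *\<^sub>R v \<in> cball t q" by (simp add: dist_norm)
          then have tS: "t + l *\<^sub>R v \<in> S" using V[OF t(1)] l by (auto simp: S_def)
          then obtain j where "t + l *\<^sub>R v \<in> U j" using U(1) by auto
          then show "t \<in> (\<Union>j. ?W j v)" using tS l closure_subset by blast
        qed
        then have "emeasure lborel {t \<in> V. sep u (f t) (f (t + v))} \<le> emeasure lborel (\<Union>j. ?W j v)"
          by (rule emeasure_mono) (use Wm in auto)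
        also have "\<dots> \<le> (\<Sum>j. emeasure lborel (?W j v))"
          by (rule emeasure_subadditive_countably) (use Wm in auto)
        also have "\<dots> \<le> (\<Sum>j. ennreal (\<bar>v \<bullet> n j\<bar> + 2 * \<eta> * norm v) * hausdorff_weight ?k (U j))"
          by (intro suminf_le summableI W)
        finally show ?thesis .
      qed
      have "crossing_volume f u V q
        \<le> (\<integral>\<^sup>+v. (\<Sum>j. ennreal (\<bar>v \<bullet> n j\<bar> + 2 * \<eta> * norm v) * indicator (cball 0 q) v * hausdorff_weight ?k (U j)) \<partial>lborel)"
        unfolding crossing_volume_def
      proof (rule nn_integral_mono)
        fix v :: 'a
        show "emeasure lborel {t \<in> V. sep u (f t) (f (t + v))} * indicator (cball 0 q) v
          \<le> (\<Sum>j. ennreal (\<bar>v \<bullet> n j\<bar> + 2 * \<eta> * norm v) * indicator (cball 0 q) v * hausdorff_weight ?k (U j))"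
          using pt[of v] by (cases "v \<in> cball 0 q") (auto simp del: mem_cball_0)
      qed
      also have "\<dots> = (\<Sum>j. (\<integral>\<^sup>+v\<in>cball 0 q. ennreal (\<bar>v \<bullet> n j\<bar> + 2 * \<eta> * norm v) \<partial>lborel) * hausdorff_weight ?k (U j))"
      proof -
        have [measurable]: "cball (0::'a) q \<in> sets borel" by simp
        have m: "(\<lambda>v. ennreal (\<bar>v \<bullet> n j\<bar> + 2 * \<eta> * norm v) * indicator (cball 0 q) v) \<in> borel_measurable lborel"
          and m': "(\<lambda>v. ennreal (\<bar>v \<bullet> n j\<bar> + 2 * \<eta> * norm v) * indicator (cball 0 q) v * hausdorff_weight ?k (U j)) \<in> borel_measurable lborel" for j
          by measurable
        show ?thesis unfolding nn_integral_suminf[OF m'] nn_integral_multc[OF m] ..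
      qed
      also have "\<dots> = (\<Sum>j. ennreal ((?c1 + 2 * \<eta> * ?c2) * q ^ (DIM('a) + 1)) * hausdorff_weight ?k (U j))"
        by (subst nn_integral_cball_abs_inner_norm[OF n q]) (use \<eta> in auto)
      also have "\<dots> = ennreal ((?c1 + 2 * \<eta> * ?c2) * q ^ (DIM('a) + 1)) * (\<Sum>j. hausdorff_weight ?k (U j))"
        by (rule ennreal_suminf_cmult)
      also have "\<dots> \<le> ennreal ((?c1 + 2 * \<eta> * ?c2) * q ^ (DIM('a) + 1)) * ennreal (h + \<eta>)"
        by (rule mult_left_mono[OF less_imp_le[OF Us]]) simp
      also have "\<dots> = ennreal ((?c1 + 2 * \<eta> * ?c2) * q ^ (DIM('a) + 1) * (h + \<eta>))"
        using \<eta> c1 c2 q real by (intro ennreal_mult[symmetric] mult_nonneg_nonneg add_nonneg_nonneg) auto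
      finally show ?thesis .
    qed
    define \<eta> where "\<eta> j = (1/2) * inverse (real (Suc j))" for j
    have \<eta>: "\<eta> j > 0" "\<eta> j \<le> 1/2" for j by (auto simp: \<eta>_def field_simps)
    have lim: "\<eta> \<longlonglongrightarrow> 0"
      unfolding \<eta>_def using tendsto_mult[OF tendsto_const LIMSEQ_inverse_real_of_nat, of "1/2"] by simp
    have "(\<lambda>j. ennreal ((?c1 + 2 * \<eta> j * ?c2) * q ^ (DIM('a) + 1) * (h + \<eta> j)))
       \<longlonglongrightarrow> ennreal ((?c1 + 2 * 0 * ?c2) * q ^ (DIM('a) + 1) * (h + 0))"
      by (intro tendsto_ennrealI tendsto_intros lim)
    then have "crossing_volume f u V q \<le> ennreal ((?c1 + 2 * 0 * ?c2) * q ^ (DIM('a) + 1) * (h + 0))"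
      by (rule LIMSEQ_le_const) (use main[OF \<eta>] in auto)
    also have "\<dots> = ennreal (?c1 * q ^ (DIM('a) + 1)) * hausdorff_measure ?k S"
      using real c1 q by (simp add: ennreal_mult)
    finally show ?thesis by (simp add: S_def)
  qed
qed

section \<open>Surface area bounded by crossing volumes\<close>

text \<open>A point that lies at distance \<open>s\<close> behind a point of the level set in normal direction is carried
  across the level by every step \<open>v\<close> whose normal component exceeds \<open>s\<close> by the error of linearisation.\<close>

lemma almost_linear_crossing:
  fixes f :: "'a::euclidean_space \<Rightarrow> real" and G :: "'a \<Rightarrow> 'a"
  assumes al: "almost_linear f G \<epsilon> \<delta> x" and g: "G x \<noteq> 0" and n: "n = (1 / norm (G x)) *\<^sub>R G x"
    and \<epsilon>: "0 \<le> \<epsilon>" "\<epsilon> < 1" and z: "z \<in> cball x (\<delta> / 2)" "f z = u" and v: "norm v \<le> \<delta> / 4"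
    and s: "0 < s" "s < \<bar>v \<bullet> n\<bar> - 2 * \<epsilon> * norm v"
    and t: "t = z - (sgn (v \<bullet> n) * s) *\<^sub>R n"
  shows "sep u (f t) (f (t + v))" "dist t z \<le> norm v"
proof -
  define \<sigma> where "\<sigma> = sgn (v \<bullet> n)"
  have nn: "norm n = 1" using g by (simp add: n)
  then have nn': "n \<bullet> n = 1" by (simp add: dot_square_norm)
  have Gn: "G x \<bullet> h = norm (G x) * (n \<bullet> h)" for h using g by (simp add: n)
  have en: "0 \<le> \<epsilon> * norm v" using \<epsilon> by simp
  have "\<bar>v \<bullet> n\<bar> > 0" using s en by linarith
  then have \<sigma>: "\<bar>\<sigma>\<bar> = 1" "\<sigma> * \<sigma> = 1" "\<sigma> * (v \<bullet> n) = \<bar>v \<bullet> n\<bar>"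
    by (auto simp: \<sigma>_def sgn_if)
  have vn: "\<bar>v \<bullet> n\<bar> \<le> norm v" using Cauchy_Schwarz_ineq2[of v n] nn by simp
  have sv: "s \<le> norm v" using s vn en by linarith
  have tz: "t - z = - ((\<sigma> * s) *\<^sub>R n)" by (simp add: t \<sigma>_def)
  have ntz: "norm (t - z) = s" unfolding tz using nn \<sigma> s by (simp add: abs_mult)
  then show "dist t z \<le> norm v" using sv by (simp add: dist_norm)
  have zx: "dist x z \<le> \<delta> / 2" using z by simp
  have in1: "z \<in> cball x \<delta>" using zx zero_le_dist[of x z] unfolding mem_cball by linarith
  have dzt: "dist z t = s" using ntz by (metis dist_commute dist_norm)
  have in2: "t \<in> cball x \<delta>"
    using dist_triangle[of x t z] zx dzt sv v s(1) unfolding mem_cball by linarith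
  have in3: "t + v \<in> cball x \<delta>"
  proof -
    have "dist t (t + v) = norm v" by (simp add: dist_norm)
    then show ?thesis
      using dist_triangle[of x "t + v" t] dist_triangle[of x t z] zx dzt sv v s(1) unfolding mem_cball by linarith
  qed
  have gp: "norm (G x) > 0" using g by simp
  have 1: "\<bar>f t - u - norm (G x) * (- (\<sigma> * s))\<bar> \<le> norm (G x) * (\<epsilon> * s)"
  proof -
    have le: "\<bar>f t - f z - G x \<bullet> (t - z)\<bar> \<le> \<epsilon> * norm (G x) * norm (t - z)"
      by (rule al[unfolded almost_linear_def, rule_format, OF in1 in2])
    have "G x \<bullet> (t - z) = norm (G x) * (- (\<sigma> * s))" unfolding Gn tz by (simp add: nn')
    then show ?thesis using le unfolding ntz z(2) by (simp only: mult.assoc mult.left_commute)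
  qed
  have 2: "\<bar>f (t + v) - u - norm (G x) * (v \<bullet> n - \<sigma> * s)\<bar> \<le> norm (G x) * (\<epsilon> * (2 * norm v))"
  proof -
    have "\<bar>f (t + v) - f z - G x \<bullet> (t + v - z)\<bar> \<le> \<epsilon> * norm (G x) * norm (t + v - z)"
      by (rule al[unfolded almost_linear_def, rule_format, OF in1 in3])
    also have "\<dots> \<le> \<epsilon> * norm (G x) * (2 * norm v)"
    proof (rule mult_left_mono)
      have "norm (t + v - z) \<le> norm (t - z) + norm v"
      proof -
        have e: "t + v - z = (t - z) + v" by simp
        show ?thesis unfolding e by (rule norm_triangle_ineq)
      qed
      then show "norm (t + v - z) \<le> 2 * norm v" using ntz sv by simp
    qed (use \<epsilon> in auto)
    finally have le: "\<bar>f (t + v) - f z - G x \<bullet> (t + v - z)\<bar> \<le> \<epsilon> * norm (G x) * (2 * norm v)" .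
    have "G x \<bullet> (t + v - z) = G x \<bullet> (t - z) + G x \<bullet> v" by (simp add: inner_add_right inner_diff_right)
    also have "\<dots> = norm (G x) * (v \<bullet> n - \<sigma> * s)"
      unfolding Gn tz by (simp add: nn' inner_commute[of n v] right_diff_distrib)
    finally have e: "G x \<bullet> (t + v - z) = norm (G x) * (v \<bullet> n - \<sigma> * s)" .
    have "\<epsilon> * norm (G x) * (2 * norm v) = norm (G x) * (\<epsilon> * (2 * norm v))" by (simp only: mult.assoc mult.left_commute)
    then show ?thesis using le unfolding z(2) e by (simp only:)
  qed
  have es: "\<epsilon> * s < s" using \<epsilon> s by simp
  have gs: "norm (G x) * (\<epsilon> * s) < norm (G x) * s" by (rule mult_strict_left_mono[OF es gp])
  have F: "f t - u \<le> norm (G x) * (\<epsilon> * s) - norm (G x) * (\<sigma> * s)"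
      "- (norm (G x) * (\<epsilon> * s)) - norm (G x) * (\<sigma> * s) \<le> f t - u"
      "f (t + v) - u \<le> norm (G x) * (\<epsilon> * (2 * norm v)) + norm (G x) * (v \<bullet> n - \<sigma> * s)"
      "norm (G x) * (v \<bullet> n - \<sigma> * s) - norm (G x) * (\<epsilon> * (2 * norm v)) \<le> f (t + v) - u"
    using 1 2 unfolding mult_minus_right abs_le_iff by linarith+
  consider "\<sigma> = 1" | "\<sigma> = -1" using \<sigma>(1) by linarith
  then show "sep u (f t) (f (t + v))"
  proof cases
    case 1
    have "norm (G x) * (\<epsilon> * (2 * norm v)) < norm (G x) * (v \<bullet> n - \<sigma> * s)"
    proof (rule mult_strict_left_mono[OF _ gp])
      have "v \<bullet> n = \<bar>v \<bullet> n\<bar>" using \<sigma>(3) unfolding 1 by linarith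
      then show "\<epsilon> * (2 * norm v) < v \<bullet> n - \<sigma> * s" unfolding 1 using s(2) by linarith
    qed
    with F(1) F(4) gs have "f t \<le> u" "u < f (t + v)" unfolding 1 by ((simp_all only: mult_1_left)?, (linarith+)?)
    then show ?thesis by (simp add: sep_def)
  next
    case 2
    have "norm (G x) * (\<epsilon> * (2 * norm v)) < norm (G x) * - (v \<bullet> n - \<sigma> * s)"
    proof (rule mult_strict_left_mono[OF _ gp])
      have "- (v \<bullet> n) = \<bar>v \<bullet> n\<bar>" using \<sigma>(3) unfolding 2 by linarith
      then show "\<epsilon> * (2 * norm v) < - (v \<bullet> n - \<sigma> * s)" unfolding 2 using s(2) by linarith
    qed
    with F(2) F(3) gs have "u < f t" "f (t + v) \<le> u" unfolding 2 by ((simp_all only: mult_minus_left mult_minus_right mult_1_left)?, (linarith+)?)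
    then show ?thesis by (simp add: sep_def)
  qed
qed

lemma sep_set_borel [measurable]:
  assumes [measurable]: "f \<in> borel_measurable borel" "V \<in> sets borel"
  shows "{t \<in> V. sep u (f t) (f (t + v :: 'a::euclidean_space))} \<in> sets borel"
  unfolding sep_def by measurable

text \<open>Over each point of the projection of \<open>E\<close> the points of \<open>almost_linear_crossing\<close> fill an interval of length
  \<open>\<bar>v \<bullet> n\<bar> - 2 * \<epsilon> * norm v\<close>.\<close>

lemma shadow_le_crossing:
  fixes f :: "'a::euclidean_space \<Rightarrow> real" and G :: "'a \<Rightarrow> 'a"
  assumes al: "almost_linear f G \<epsilon> \<delta> x" and g: "G x \<noteq> 0" and n: "n = (1 / norm (G x)) *\<^sub>R G x"
    and \<epsilon>: "0 \<le> \<epsilon>" "\<epsilon> < 1" and E: "compact E" "E \<subseteq> cball x (\<delta> / 2)" "\<And>z. z \<in> E \<Longrightarrow> f z = u"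
    and v: "norm v \<le> \<delta> / 4" and [measurable]: "f \<in> borel_measurable borel" "W \<in> sets borel"
    and W: "\<And>z. z \<in> E \<Longrightarrow> cball z (norm v) \<subseteq> W"
  shows "ennreal (\<bar>v \<bullet> n\<bar> - 2 * \<epsilon> * norm v) * shadow n E \<le> emeasure lborel {t \<in> W. sep u (f t) (f (t + v))}"
proof -
  let ?c = "\<bar>v \<bullet> n\<bar> - 2 * \<epsilon> * norm v"
  let ?A = "{t \<in> W. sep u (f t) (f (t + v))}"
  have nn: "norm n = 1" using g by (simp add: n)
  show ?thesis
  proof (cases "?c > 0")
    case c: True
    have "ennreal ?c * shadow n E = (\<integral>\<^sup>+x. ennreal ?c * indicator (cyl n E) x \<partial>lborel)"
      unfolding shadow_def using cyl_compact_borel[OF E(1), of n] by (subst nn_integral_cmult) auto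
    also have "\<dots> \<le> (\<integral>\<^sup>+y. indicator (slab n) y * emeasure lborel {s. y + s *\<^sub>R n \<in> ?A} \<partial>lborel)"
    proof (rule nn_integral_mono)
      fix y
      show "ennreal ?c * indicator (cyl n E) y \<le> indicator (slab n) y * emeasure lborel {s. y + s *\<^sub>R n \<in> ?A}"
      proof (cases "y \<in> cyl n E")
        case True
        then obtain z where z: "z \<in> E" "pr n y = pr n z" and ys: "y \<in> slab n" by (auto simp: cyl_def)
        define s0 where "s0 = z \<bullet> n - y \<bullet> n"
        have zy: "z = y + s0 *\<^sub>R n" using pr_eqD[OF z(2)] by (simp add: s0_def)
        define \<sigma> where "\<sigma> = sgn (v \<bullet> n)"
        have hit: "y + (s0 - \<sigma> * s) *\<^sub>R n \<in> ?A" if "0 < s" "s < ?c" for s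
        proof -
          have t: "y + (s0 - \<sigma> * s) *\<^sub>R n = z - (sgn (v \<bullet> n) * s) *\<^sub>R n"
            by (simp add: zy \<sigma>_def algebra_simps)
          have "z \<in> cball x (\<delta> / 2)" "f z = u" using z E by auto
          note A = almost_linear_crossing[OF al g n \<epsilon> this v that t]
          have "y + (s0 - \<sigma> * s) *\<^sub>R n \<in> cball z (norm v)" using A(2) by (simp add: dist_commute)
          then show ?thesis using A(1) W[OF z(1)] by auto
        qed
        have "0 \<le> \<epsilon> * norm v" using \<epsilon> by simp
        then have "\<bar>v \<bullet> n\<bar> > 0" using c by linarith
        then have "\<sigma> = 1 \<or> \<sigma> = -1" by (auto simp: \<sigma>_def sgn_if)
        then obtain a where a: "{a<..<a + ?c} \<subseteq> {s. y + s *\<^sub>R n \<in> ?A}"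
        proof
          assume "\<sigma> = 1"
          then have "{s0 - ?c<..<s0 - ?c + ?c} \<subseteq> {s. y + s *\<^sub>R n \<in> ?A}"
            using hit[of "s0 - s" for s] by force
          then show ?thesis using that by blast
        next
          assume "\<sigma> = -1"
          then have "{s0<..<s0 + ?c} \<subseteq> {s. y + s *\<^sub>R n \<in> ?A}"
            using hit[of "s - s0" for s] by force
          then show ?thesis using that by blast
        qed
        have "ennreal ?c = emeasure lborel {a<..<a + ?c}" using c by simp
        also have "\<dots> \<le> emeasure lborel {s. y + s *\<^sub>R n \<in> ?A}" by (rule emeasure_mono[OF a]) measurable
        finally show ?thesis using True ys by simp
      qed simp
    qed
    also have "\<dots> = emeasure lborel ?A"
      by (rule emeasure_along_direction[symmetric, OF _ nn]) measurable
    finally show ?thesis .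
  qed (simp add: ennreal_neg)
qed

lemma nn_integral_cball_abs_inner_minus:
  fixes n :: "'a::euclidean_space"
  assumes n: "norm n = 1" and q: "q > 0" and c: "c \<ge> 0"
  shows "ennreal ((abs_proj_const DIM('a) - c * norm_const DIM('a)) * q ^ (DIM('a) + 1))
     \<le> (\<integral>\<^sup>+v\<in>cball 0 q. ennreal (\<bar>v \<bullet> n\<bar> - c * norm v) \<partial>lborel)"
proof -
  have [measurable]: "cball (0::'a) q \<in> sets borel" by simp
  let ?I = "\<integral>\<^sup>+v\<in>cball 0 q. ennreal (\<bar>v \<bullet> n\<bar> - c * norm v) \<partial>lborel"
  have m1: "(\<lambda>v::'a. ennreal (\<bar>v \<bullet> n\<bar> - c * norm v) * indicator (cball 0 q) v) \<in> borel_measurable lborel"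
    and m2: "(\<lambda>v::'a. ennreal (norm v) * indicator (cball 0 q) v) \<in> borel_measurable lborel"
    by measurable
  have "ennreal (abs_proj_const DIM('a) * q ^ (DIM('a) + 1)) = (\<integral>\<^sup>+v\<in>cball 0 q. ennreal \<bar>v \<bullet> n\<bar> \<partial>lborel)"
    by (rule nn_integral_cball_abs_inner[OF n q, symmetric])
  also have "\<dots> \<le> (\<integral>\<^sup>+v. ennreal (\<bar>v \<bullet> n\<bar> - c * norm v) * indicator (cball 0 q) v
      + ennreal c * (ennreal (norm v) * indicator (cball 0 q) v) \<partial>lborel)"
  proof (rule nn_integral_mono)
    fix v :: 'a
    have "ennreal \<bar>v \<bullet> n\<bar> \<le> ennreal ((\<bar>v \<bullet> n\<bar> - c * norm v) + c * norm v)" by (rule ennreal_leI) simp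
    also have "\<dots> \<le> ennreal (\<bar>v \<bullet> n\<bar> - c * norm v) + ennreal (c * norm v)"
    proof (cases "\<bar>v \<bullet> n\<bar> - c * norm v \<ge> 0")
      case True
      then show ?thesis using c by (subst ennreal_plus) auto
    next
      case False
      then have "ennreal (\<bar>v \<bullet> n\<bar> - c * norm v + c * norm v) \<le> ennreal (c * norm v)" by (intro ennreal_leI) simp
      then show ?thesis by (rule order_trans) simp
    qed
    finally show "ennreal \<bar>v \<bullet> n\<bar> * indicator (cball 0 q) v \<le> ennreal (\<bar>v \<bullet> n\<bar> - c * norm v) * indicator (cball 0 q) v
      + ennreal c * (ennreal (norm v) * indicator (cball 0 q) v)"
      using c by (auto simp: indicator_def ennreal_mult)
  qed
  also have "\<dots> = ?I + ennreal c * (\<integral>\<^sup>+v\<in>cball 0 q. ennreal (norm (v::'a)) \<partial>lborel)"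
    unfolding nn_integral_cmult[OF m2, symmetric]
    by (rule nn_integral_add[OF m1]) measurable
  also have "\<dots> = ?I + ennreal (c * (norm_const DIM('a) * q ^ (DIM('a) + 1)))"
    unfolding nn_integral_cball_norm[OF q] using c by (simp add: ennreal_mult')
  finally have le: "ennreal (abs_proj_const DIM('a) * q ^ (DIM('a) + 1)) \<le> ?I + ennreal (c * (norm_const DIM('a) * q ^ (DIM('a) + 1)))" .
  have "c * (norm_const DIM('a) * q ^ (DIM('a) + 1)) \<ge> 0"
    using c q norm_const_pos[of "DIM('a)"] by (intro mult_nonneg_nonneg) auto
  then have "ennreal (abs_proj_const DIM('a) * q ^ (DIM('a) + 1) - c * (norm_const DIM('a) * q ^ (DIM('a) + 1)))
    = ennreal (abs_proj_const DIM('a) * q ^ (DIM('a) + 1)) - ennreal (c * (norm_const DIM('a) * q ^ (DIM('a) + 1)))"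
    by (rule ennreal_minus[symmetric])
  also have "\<dots> \<le> ?I" using le by (simp add: ennreal_minus_le_iff add.commute)
  finally show ?thesis by (simp add: algebra_simps)
qed

text \<open>The level set is cut into finitely many nearly flat pieces. By \<open>hausdorff_le_shadow\<close> the area
  of a piece is at most the area of its shadow, up to a factor close to one, and by
  \<open>shadow_le_crossing\<close> the shadow bounds the volume of the crossing segments near the piece from below. To add
  the contributions of the pieces, the crossing segments must not be counted twice; therefore the
  pieces are shrunk to compact sets with positive distance before the step size tends to zero.\<close>

theorem hausdorff_le_liminf_crossing_volume:
  fixes f :: "'a::euclidean_space \<Rightarrow> real" and G :: "'a \<Rightarrow> 'a"
  assumes K: "compact K" and V: "open V" "K \<subseteq> V"
    and f: "\<And>x. (f has_derivative (\<lambda>h. G x \<bullet> h)) (at x)" and G: "continuous_on UNIV G"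
    and nz: "\<And>x. x \<in> K \<Longrightarrow> f x = u \<Longrightarrow> G x \<noteq> 0"
  shows "ennreal (abs_proj_const DIM('a)) * hausdorff_measure (DIM('a) - 1) (K \<inter> {t. f t = u})
    \<le> liminf (\<lambda>m. ennreal (real (Suc m) ^ (DIM('a) + 1)) * crossing_volume f u V (1 / real (Suc m)))"
    (is "_ \<le> ?\<Lambda>")
proof -
  let ?k = "DIM('a) - 1"
  let ?c1 = "abs_proj_const DIM('a)" and ?c2 = "norm_const DIM('a)"
  have c1: "?c1 > 0" and c2: "?c2 > 0" using abs_proj_const_pos norm_const_pos by auto
  have fc: "continuous_on UNIV f"
    using f by (meson differentiableI differentiable_imp_continuous_on differentiable_on_def has_derivative_at_withinI)
  then have fm[measurable]: "f \<in> borel_measurable borel" by (rule borel_measurable_continuous_onI)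
  define S where "S = K \<inter> {t. f t = u}"
  have "closed {t. f t = u}" using fc by (intro closed_Collect_eq) auto
  then have S: "compact S" unfolding S_def by (rule compact_Int_closed[OF K])
  have SV: "S \<subseteq> V" using V by (auto simp: S_def)
  have main: "ennreal (?c1 - 2 * \<epsilon> * ?c2) * hausdorff_measure ?k S \<le> ennreal ((1 / sqrt (1 - \<epsilon>\<^sup>2)) ^ ?k) * ?\<Lambda>"
    if \<epsilon>: "0 < \<epsilon>" "\<epsilon> < 1" for \<epsilon>
  proof -
    define c where "c = (1 / sqrt (1 - \<epsilon>\<^sup>2)) ^ ?k"
    obtain \<delta> where \<delta>: "\<delta> > 0" and al: "\<And>x. x \<in> S \<Longrightarrow> almost_linear f G \<epsilon> \<delta> x"
      using uniformly_almost_linear[OF S f G _ \<epsilon>(1)] nz by (auto simp: S_def)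
    define r where "r = \<delta> / 4"
    have r: "r > 0" using \<delta> by (simp add: r_def)
    obtain C where C: "C \<subseteq> S" "finite C" "S \<subseteq> (\<Union>c\<in>C. ball c r)"
      by (rule compactE_image[OF S, of S "\<lambda>c. ball c r"]) (use r in auto)
    obtain N and cs :: "nat \<Rightarrow> 'a" where cs: "C = cs ` {i. i < N}"
      using C(2) finite_conv_nat_seg_image by metis
    have csS: "cs i \<in> S" if "i < N" for i using that cs C(1) by auto
    define n where "n i = (1 / norm (G (cs i))) *\<^sub>R G (cs i)" for i
    have Gnz: "G (cs i) \<noteq> 0" if "i < N" for i using nz csS[OF that] by (auto simp: S_def)
    have n1: "norm (n i) = 1" if "i < N" for i using Gnz[OF that] by (simp add: n_def)
    \<comment> \<open>The piece \<open>A i\<close> consists of the points of the ball around \<open>cs i\<close> that are not in an earlier ball; \<open>P i k\<close> is its compact part with distance at least \<open>gap k\<close> from the earlier balls.\<close>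
    define gap where "gap k = 1 / real (Suc k)" for k
    define P where "P i k = S \<inter> cball (cs i) r \<inter> (\<Inter>j\<in>{..<i}. {x. r + gap k \<le> dist x (cs j)})" for i k
    define A where "A i = (\<Union>k. P i k)" for i
    have Pc: "compact (P i k)" for i k
    proof -
      have "closed (cball (cs i) r \<inter> (\<Inter>j\<in>{..<i}. {x. r + gap k \<le> dist x (cs j)}))"
        by (intro closed_Int closed_INT closed_cball ballI closed_Collect_le continuous_intros)
      from compact_Int_closed[OF S this] show ?thesis by (simp add: P_def Int_assoc)
    qed
    have Pinc: "P i k \<subseteq> P i k'" if "k \<le> k'" for i k k'
    proof -
      have le: "gap k' \<le> gap k" unfolding gap_def using that by (intro divide_left_mono) auto
      show ?thesis
      proof
        fix x assume "x \<in> P i k"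
        then have x: "x \<in> S" "x \<in> cball (cs i) r" and "\<forall>j<i. r + gap k \<le> dist x (cs j)" by (auto simp: P_def)
        then have "\<forall>j<i. r + gap k' \<le> dist x (cs j)" using le by (meson add_left_mono order_trans)
        then show "x \<in> P i k'" using x by (auto simp: P_def)
      qed
    qed
    have SA: "S \<subseteq> (\<Union>i\<in>{..<N}. A i)"
    proof
      fix x assume x: "x \<in> S"
      then obtain c where "c \<in> C" "x \<in> ball c r" using C(3) by blast
      then have "\<exists>i. i < N \<and> dist (cs i) x \<le> r" using cs by auto
      then obtain i where i: "i < N" "dist (cs i) x \<le> r" "\<And>j. j < i \<Longrightarrow> \<not> (j < N \<and> dist (cs j) x \<le> r)"
        using exists_least_iff[of "\<lambda>i. i < N \<and> dist (cs i) x \<le> r"] by metis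
      define e where "e = Min (insert 1 ((\<lambda>j. dist x (cs j) - r) ` {..<i}))"
      have jr: "r < dist x (cs j)" if "j < i" for j
        using i(1) i(3)[OF that] that by (simp add: dist_commute)
      have "e > 0" unfolding e_def using jr by (subst Min_gr_iff) auto
      then obtain k where k: "inverse (real (Suc k)) < e" using reals_Archimedean by blast
      have "r + gap k \<le> dist x (cs j)" if "j < i" for j
      proof -
        have "e \<le> dist x (cs j) - r" unfolding e_def using that by (intro Min_le) auto
        then show ?thesis using k by (simp add: gap_def inverse_eq_divide)
      qed
      then have "x \<in> P i k" using x i by (auto simp: P_def)
      then show "x \<in> (\<Union>i\<in>{..<N}. A i)" using i(1) by (auto simp: A_def)
    qed
    have PA: "P i k \<subseteq> A i" for i k by (auto simp: A_def)
    have AS: "A i \<subseteq> S" "A i \<subseteq> cball (cs i) r" for i by (auto simp: A_def P_def)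
    have cylA: "cyl (n i) (A i) = (\<Union>k. cyl (n i) (P i k))" for i
      unfolding cyl_def A_def by blast
    have cylPm: "cyl (n i) (P i k) \<in> sets borel" for i k by (rule cyl_compact_borel[OF Pc])
    have cylAm: "cyl (n i) (A i) \<in> sets borel" for i
      unfolding cylA by (intro sets.countable_UN) (use cylPm in auto)
    have HA: "hausdorff_measure ?k (A i) \<le> ennreal c * shadow (n i) (A i)" if i: "i < N" for i
      unfolding c_def
    proof (rule hausdorff_le_shadow[OF n1[OF i] _ \<epsilon>(2) _ cylAm])
      fix z z' assume z: "z \<in> A i" "z' \<in> A i"
      show "\<bar>(z - z') \<bullet> n i\<bar> \<le> \<epsilon> * norm (z - z')"
        unfolding n_def
      proof (rule almost_linear_cone[OF al[OF csS[OF i]] Gnz[OF i]])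
        show "z \<in> cball (cs i) \<delta>" "z' \<in> cball (cs i) \<delta>" using z AS(2)[of i] \<delta> by (auto simp: r_def subset_eq)
        show "f z = f z'" using z AS(1)[of i] by (auto simp: S_def)
      qed
    qed (use \<epsilon> in simp)
    obtain \<rho> where \<rho>: "\<rho> > 0" "(\<Union>x\<in>S. cball x \<rho>) \<subseteq> V"
      by (rule compact_subset_open_imp_cball_epsilon_subset[OF S V(1) SV])
    have low: "ennreal (?c1 - 2 * \<epsilon> * ?c2) * (\<Sum>i<N. shadow (n i) (P i k)) \<le> ?\<Lambda>" for k
    proof (rule Liminf_bounded)
      have "eventually (\<lambda>m. 1 / real (Suc m) < min \<rho> (min (\<delta> / 4) (1 / (2 * real (Suc k) + 1)))) sequentially"
      proof (rule order_tendstoD(2)[where y=0])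
        show "(\<lambda>m. 1 / real (Suc m)) \<longlonglongrightarrow> 0"
          using LIMSEQ_inverse_real_of_nat by (simp add: inverse_eq_divide)
      qed (use \<rho> \<delta> in auto)
      then show "\<forall>\<^sub>F m in sequentially. ennreal (?c1 - 2 * \<epsilon> * ?c2) * (\<Sum>i<N. shadow (n i) (P i k))
        \<le> ennreal (real (Suc m) ^ (DIM('a) + 1)) * crossing_volume f u V (1 / real (Suc m))"
      proof eventually_elim
        case (elim m)
        define h where "h = 1 / real (Suc m)"
        have h: "h > 0" "h \<le> \<rho>" "h \<le> \<delta> / 4" "h < 1 / (2 * real (Suc k) + 1)" using elim by (auto simp: h_def)
        have h2: "2 * h < gap k"
        proof -
          have "h * (2 * real (Suc k) + 1) < 1" using h(4) by (simp add: field_simps)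
          then have "h * (2 * real (Suc k)) < 1" using h(1) by (simp add: algebra_simps)
          then show ?thesis by (simp add: gap_def field_simps)
        qed
        \<comment> \<open>A step of length at most \<open>h\<close> that crosses near \<open>P i k\<close> starts in this neighbourhood. As \<open>2 * h < gap k\<close>, different neighbourhoods are disjoint.\<close>
        define W where "W i = (\<Union>x\<in>P i k. \<Union>y\<in>cball 0 h. {x + y})" for i
        have Wc: "compact (W i)" for i unfolding W_def by (rule compact_sums'[OF Pc]) simp
        then have Wm: "W i \<in> sets borel" for i by (rule borel_compact)
        have Wcb: "cball z h \<subseteq> W i" if "z \<in> P i k" for z i
        proof
          fix t assume "t \<in> cball z h"
          then have "t = z + (t - z)" "t - z \<in> cball 0 h" by (auto simp: dist_norm norm_minus_commute)
          then show "t \<in> W i" using that unfolding W_def by blast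
        qed
        have WD: "\<exists>z\<in>P i k. dist z t \<le> h" if "t \<in> W i" for t i
          using that unfolding W_def by (force simp: dist_norm)
        have WV: "W i \<subseteq> V" for i
        proof
          fix t assume "t \<in> W i"
          then obtain z where "z \<in> P i k" "dist z t \<le> h" using WD by blast
          then have "z \<in> S" "t \<in> cball z \<rho>" using h by (auto simp: P_def)
          then show "t \<in> V" using \<rho>(2) by blast
        qed
        have sepd: False if ji: "j < i" and t: "t \<in> W i" "t \<in> W j" for i j t
        proof -
          obtain z z' where z: "z \<in> P i k" "dist z t \<le> h" "z' \<in> P j k" "dist z' t \<le> h" using WD t by blast
          have "r + gap k \<le> dist z (cs j)" using z(1) ji by (auto simp: P_def)
          moreover have "dist (cs j) z' \<le> r" using z(3) by (auto simp: P_def)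
          moreover have "dist z (cs j) \<le> dist z t + dist z' t + dist (cs j) z'"
            using dist_triangle[of z "cs j" t] dist_triangle[of t "cs j" z'] dist_commute[of t z'] dist_commute[of z' "cs j"]
            by linarith
          ultimately show False using z(2,4) h2 by linarith
        qed
        have disj: "disjoint_family_on (\<lambda>i. {t \<in> W i. sep u (f t) (f (t + v))}) {..<N}" for v
          unfolding disjoint_family_on_def
        proof (intro ballI impI)
          fix i j :: nat assume "i \<noteq> j"
          have "t \<notin> W j" if "t \<in> W i" for t
          proof
            assume "t \<in> W j"
            with that sepd[of j i t] sepd[of i j t] \<open>i \<noteq> j\<close> show False by (meson nat_neq_iff)
          qed
          then show "{t \<in> W i. sep u (f t) (f (t + v))} \<inter> {t \<in> W j. sep u (f t) (f (t + v))} = {}"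
            by auto
        qed
        have pt: "(\<Sum>i<N. ennreal (\<bar>v \<bullet> n i\<bar> - 2 * \<epsilon> * norm v) * shadow (n i) (P i k))
           \<le> emeasure lborel {t \<in> V. sep u (f t) (f (t + v))}" if v: "norm v \<le> h" for v
        proof -
          have "(\<Sum>i<N. ennreal (\<bar>v \<bullet> n i\<bar> - 2 * \<epsilon> * norm v) * shadow (n i) (P i k))
            \<le> (\<Sum>i<N. emeasure lborel {t \<in> W i. sep u (f t) (f (t + v))})"
          proof (rule sum_mono)
            fix i assume "i \<in> {..<N}"
            then have i: "i < N" by simp
            show "ennreal (\<bar>v \<bullet> n i\<bar> - 2 * \<epsilon> * norm v) * shadow (n i) (P i k)
              \<le> emeasure lborel {t \<in> W i. sep u (f t) (f (t + v))}"
            proof (rule shadow_le_crossing[OF al[OF csS[OF i]] Gnz[OF i] n_def _ _ Pc _ _ _ fm Wm])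
              show "P i k \<subseteq> cball (cs i) (\<delta> / 2)" using AS(2)[of i] PA[of i k] \<delta> by (force simp: r_def)
              show "f z = u" if "z \<in> P i k" for z using that by (auto simp: P_def S_def)
              show "cball z (norm v) \<subseteq> W i" if "z \<in> P i k" for z
                using Wcb[OF that] v by (auto simp: subset_eq)
            qed (use \<epsilon> v h in auto)
          qed
          also have "\<dots> = emeasure lborel (\<Union>i<N. {t \<in> W i. sep u (f t) (f (t + v))})"
            by (rule sum_emeasure) (use disj sep_set_borel[OF fm Wm] in auto)
          also have "\<dots> \<le> emeasure lborel {t \<in> V. sep u (f t) (f (t + v))}"
          proof (rule emeasure_mono)
            show "{t \<in> V. sep u (f t) (f (t + v))} \<in> sets lborel"
              unfolding sets_lborel by (rule sep_set_borel[OF fm borel_open[OF V(1)]])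
          qed (use WV in auto)
          finally show ?thesis .
        qed
        have mi: "(\<lambda>v. ennreal (\<bar>v \<bullet> n i\<bar> - 2 * \<epsilon> * norm v) * indicator (cball 0 h) v * shadow (n i) (P i k)) \<in> borel_measurable lborel" for i
        proof -
          have [measurable]: "cball (0::'a) h \<in> sets borel" by simp
          show ?thesis by measurable
        qed
        have mi': "(\<lambda>v. ennreal (\<bar>v \<bullet> n i\<bar> - 2 * \<epsilon> * norm v) * indicator (cball 0 h) v) \<in> borel_measurable lborel" for i
        proof -
          have [measurable]: "cball (0::'a) h \<in> sets borel" by simp
          show ?thesis by measurable
        qed
        have "ennreal ((?c1 - 2 * \<epsilon> * ?c2) * h ^ (DIM('a) + 1)) * (\<Sum>i<N. shadow (n i) (P i k))
          \<le> (\<Sum>i<N. (\<integral>\<^sup>+v\<in>cball 0 h. ennreal (\<bar>v \<bullet> n i\<bar> - 2 * \<epsilon> * norm v) \<partial>lborel) * shadow (n i) (P i k))"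
          unfolding sum_distrib_left
          by (intro sum_mono mult_right_mono nn_integral_cball_abs_inner_minus n1 h) (use \<epsilon> in auto)
        also have "\<dots> = (\<integral>\<^sup>+v. (\<Sum>i<N. ennreal (\<bar>v \<bullet> n i\<bar> - 2 * \<epsilon> * norm v) * indicator (cball 0 h) v * shadow (n i) (P i k)) \<partial>lborel)"
          by (subst nn_integral_sum[OF mi]) (intro sum.cong refl nn_integral_multc[OF mi', symmetric])
        also have "\<dots> \<le> crossing_volume f u V h"
          unfolding crossing_volume_def
        proof (rule nn_integral_mono)
          fix v :: 'a
          show "(\<Sum>i<N. ennreal (\<bar>v \<bullet> n i\<bar> - 2 * \<epsilon> * norm v) * indicator (cball 0 h) v * shadow (n i) (P i k))
            \<le> emeasure lborel {t \<in> V. sep u (f t) (f (t + v))} * indicator (cball 0 h) v"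
            using pt[of v] by (cases "norm v \<le> h") auto
        qed
        finally have le: "ennreal ((?c1 - 2 * \<epsilon> * ?c2) * h ^ (DIM('a) + 1)) * (\<Sum>i<N. shadow (n i) (P i k)) \<le> crossing_volume f u V h" .
        have hh: "real (Suc m) ^ (DIM('a) + 1) * h ^ (DIM('a) + 1) = 1"
          unfolding power_mult_distrib[symmetric] h_def by simp
        have "ennreal (?c1 - 2 * \<epsilon> * ?c2) = ennreal (real (Suc m) ^ (DIM('a) + 1) * ((?c1 - 2 * \<epsilon> * ?c2) * h ^ (DIM('a) + 1)))"
        proof -
          have "real (Suc m) ^ (DIM('a) + 1) * ((?c1 - 2 * \<epsilon> * ?c2) * h ^ (DIM('a) + 1))
            = (real (Suc m) ^ (DIM('a) + 1) * h ^ (DIM('a) + 1)) * (?c1 - 2 * \<epsilon> * ?c2)" by (simp only: mult_ac)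
          then show ?thesis by (simp only: hh mult_1_left)
        qed
        also have "\<dots> = ennreal (real (Suc m) ^ (DIM('a) + 1)) * ennreal ((?c1 - 2 * \<epsilon> * ?c2) * h ^ (DIM('a) + 1))"
          by (rule ennreal_mult') simp
        finally show ?case
          using mult_left_mono[OF le, of "ennreal (real (Suc m) ^ (DIM('a) + 1))"]
          unfolding h_def by (simp only: mult.assoc) auto
      qed
    qed
    have "(\<lambda>k. ennreal (?c1 - 2 * \<epsilon> * ?c2) * (\<Sum>i<N. shadow (n i) (P i k)))
       \<longlonglongrightarrow> ennreal (?c1 - 2 * \<epsilon> * ?c2) * (\<Sum>i<N. shadow (n i) (A i))"
    proof (rule ennreal_tendsto_cmult)
      show "(\<lambda>k. \<Sum>i<N. shadow (n i) (P i k)) \<longlonglongrightarrow> (\<Sum>i<N. shadow (n i) (A i))"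
        unfolding shadow_def cylA
        by (intro tendsto_sum Lim_emeasure_incseq)
           (use cylPm Pinc in \<open>auto simp: incseq_def cyl_def subset_eq image_iff Bex_def\<close>, use Pinc in blast)
    qed simp
    then have lowA: "ennreal (?c1 - 2 * \<epsilon> * ?c2) * (\<Sum>i<N. shadow (n i) (A i)) \<le> ?\<Lambda>"
      by (rule LIMSEQ_le_const2) (use low in auto)
    have "hausdorff_measure ?k S \<le> hausdorff_measure ?k (\<Union>i\<in>{..<N}. A i)"
      by (rule hausdorff_measure_mono[OF SA])
    also have "\<dots> \<le> (\<Sum>i<N. hausdorff_measure ?k (A i))"
      by (rule hausdorff_measure_UN) simp
    also have "\<dots> \<le> (\<Sum>i<N. ennreal c * shadow (n i) (A i))"
      by (intro sum_mono HA) simp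
    finally have "ennreal (?c1 - 2 * \<epsilon> * ?c2) * hausdorff_measure ?k S
      \<le> ennreal (?c1 - 2 * \<epsilon> * ?c2) * (ennreal c * (\<Sum>i<N. shadow (n i) (A i)))"
      unfolding sum_distrib_left[symmetric] by (intro mult_left_mono) auto
    also have "\<dots> = ennreal c * (ennreal (?c1 - 2 * \<epsilon> * ?c2) * (\<Sum>i<N. shadow (n i) (A i)))"
      by (simp only: mult_ac)
    also have "\<dots> \<le> ennreal c * ?\<Lambda>" by (intro mult_left_mono lowA) simp
    finally show ?thesis by (simp add: c_def)
  qed
  show ?thesis
  proof (cases ?\<Lambda>)
    case top
    then show ?thesis by simp
  next
    case (real l)
    \<comment> \<open>A sequence that tends to zero and keeps \<open>\<epsilon> j < 1\<close> and the factor \<open>?c1 - 2 * \<epsilon> j * ?c2\<close> positive.\<close>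
    define \<epsilon> where "\<epsilon> j = min 1 (?c1 / (4 * ?c2)) * inverse (real (Suc (Suc j)))" for j
    have \<epsilon>: "\<epsilon> j > 0" "\<epsilon> j < 1" "?c1 - 2 * \<epsilon> j * ?c2 > 0" for j
    proof -
      have i: "0 < inverse (real (Suc (Suc j)))" "inverse (real (Suc (Suc j))) < 1" by (auto simp: field_simps)
      have mm: "0 < min 1 (?c1 / (4 * ?c2))" using c1 c2 by simp
      show "\<epsilon> j > 0" unfolding \<epsilon>_def using i mm by (intro mult_pos_pos)
      have e1: "\<epsilon> j < min 1 (?c1 / (4 * ?c2))" using mult_strict_left_mono[OF i(2) mm] unfolding \<epsilon>_def mult_1_right .
      then show "\<epsilon> j < 1" by simp
      have "\<epsilon> j * (4 * ?c2) < ?c1" using e1 c2 by (simp add: field_simps)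
      then show "?c1 - 2 * \<epsilon> j * ?c2 > 0" using c1 by simp
    qed
    have lim0: "\<epsilon> \<longlonglongrightarrow> 0"
      unfolding \<epsilon>_def using tendsto_mult[OF tendsto_const LIMSEQ_Suc[OF LIMSEQ_inverse_real_of_nat], of "min 1 (?c1 / (4 * ?c2))"] by simp
    have bound: "hausdorff_measure ?k S \<le> ennreal ((1 / sqrt (1 - (\<epsilon> j)\<^sup>2)) ^ ?k * l / (?c1 - 2 * \<epsilon> j * ?c2))" for j
    proof -
      let ?a = "?c1 - 2 * \<epsilon> j * ?c2" and ?b = "(1 / sqrt (1 - (\<epsilon> j)\<^sup>2)) ^ ?k"
      have b: "?b \<ge> 0" using \<epsilon>[of j] by (auto intro!: zero_le_power simp: abs_square_le_1)
      have "hausdorff_measure ?k S = ennreal (1 / ?a) * (ennreal ?a * hausdorff_measure ?k S)"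
        using \<epsilon>(3)[of j] by (simp add: mult.assoc[symmetric] flip: ennreal_mult')
      also have "\<dots> \<le> ennreal (1 / ?a) * (ennreal ?b * ennreal l)"
        using main[OF \<epsilon>(1,2), of j] unfolding real(2) by (intro mult_left_mono) auto
      also have "\<dots> = ennreal (?b * l / ?a)"
        using b real(1) \<epsilon>(3)[of j] by (simp flip: ennreal_mult')
      finally show ?thesis .
    qed
    have "(\<lambda>j. ennreal ((1 / sqrt (1 - (\<epsilon> j)\<^sup>2)) ^ ?k * l / (?c1 - 2 * \<epsilon> j * ?c2)))
      \<longlonglongrightarrow> ennreal ((1 / sqrt (1 - 0\<^sup>2)) ^ ?k * l / (?c1 - 2 * 0 * ?c2))"
      by (intro tendsto_ennrealI tendsto_intros lim0) (use c1 in auto)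
    then have "hausdorff_measure ?k S \<le> ennreal ((1 / sqrt (1 - 0\<^sup>2)) ^ ?k * l / (?c1 - 2 * 0 * ?c2))"
      by (rule LIMSEQ_le_const) (use bound in auto)
    then have "hausdorff_measure ?k S \<le> ennreal (l / ?c1)" by simp
    then have "ennreal ?c1 * hausdorff_measure ?k S \<le> ennreal ?c1 * ennreal (l / ?c1)"
      by (intro mult_left_mono) auto
    also have "\<dots> = ennreal l" using c1 real(1) by (simp flip: ennreal_mult')
    finally show ?thesis unfolding real(2) S_def .
  qed
qed

section \<open>Isotropic fields with smooth paths\<close>

lemma difference_quotient_tendsto:
  fixes f :: "'a::euclidean_space \<Rightarrow> real"
  assumes f: "(f has_derivative (\<lambda>h. g \<bullet> h)) (at x)"
  shows "(\<lambda>k. real (Suc k) * (f (x + (1 / real (Suc k)) *\<^sub>R h) - f x)) \<longlonglongrightarrow> g \<bullet> h"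
proof -
  have f': "(f has_derivative (\<lambda>h. g \<bullet> h)) (at (x + 0 *\<^sub>R h))" using f by simp
  have "((\<lambda>r. x + r *\<^sub>R h) has_derivative (\<lambda>r. r *\<^sub>R h)) (at 0)"
    by (auto intro!: derivative_eq_intros)
  from has_derivative_compose[OF this f'] have "((\<lambda>r. f (x + r *\<^sub>R h)) has_derivative (\<lambda>r. g \<bullet> (r *\<^sub>R h))) (at 0)" .
  then have "((\<lambda>r. f (x + r *\<^sub>R h)) has_real_derivative (g \<bullet> h)) (at 0)"
    by (simp add: has_field_derivative_def mult_commute_abs mult.commute[of "g \<bullet> h"])
  then have lim: "((\<lambda>r. (f (x + r *\<^sub>R h) - f x) / r) \<longlongrightarrow> g \<bullet> h) (at 0)"
    by (simp add: DERIV_def)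
  have "filterlim (\<lambda>k. 1 / real (Suc k)) (at 0) sequentially"
    using LIMSEQ_inverse_real_of_nat by (intro filterlim_atI) (auto simp: inverse_eq_divide)
  from filterlim_compose[OF lim this] show ?thesis
    by (simp add: mult.commute)
qed

text \<open>The gradient at the origin as a measurable functional of the path, so that statements on the law of
  the field apply to the gradient.\<close>

definition path_grad :: "(real^'n \<Rightarrow> real) \<Rightarrow> real^'n" where
  "path_grad \<phi> = (\<chi> i. lim (\<lambda>k. real (Suc k) * (\<phi> ((1 / real (Suc k)) *\<^sub>R axis i 1) - \<phi> 0)))"

lemma measurable_vec_lambda:
  fixes f :: "'n::finite \<Rightarrow> 'a \<Rightarrow> real"
  assumes "\<And>i. f i \<in> borel_measurable N"
  shows "(\<lambda>x. \<chi> i. f i x) \<in> borel_measurable N"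
proof (subst borel_measurable_euclidean_space, intro ballI)
  fix b :: "real^'n" assume "b \<in> Basis"
  then obtain i where "b = axis i 1" by (auto simp: Basis_vec_def)
  then show "(\<lambda>x. (\<chi> i. f i x) \<bullet> b) \<in> borel_measurable N"
    using assms[of i] by (simp add: inner_axis)
qed

lemma path_grad_measurable [measurable]:
  "path_grad \<in> borel_measurable (Pi\<^sub>M UNIV (\<lambda>_. borel))"
proof -
  have "(\<lambda>\<phi>::real^'n \<Rightarrow> real. \<chi> i. lim (\<lambda>k. real (Suc k) * (\<phi> ((1 / real (Suc k)) *\<^sub>R axis i 1) - \<phi> 0)))
    \<in> borel_measurable (Pi\<^sub>M UNIV (\<lambda>_. borel))"
    by (intro measurable_vec_lambda borel_measurable_lim_metric borel_measurable_times borel_measurable_diff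
          borel_measurable_const measurable_component_singleton UNIV_I)
  then show ?thesis by (simp add: path_grad_def[abs_def])
qed

lemma path_grad_eq:
  assumes "\<And>i. (\<lambda>k. real (Suc k) * (\<phi> ((1 / real (Suc k)) *\<^sub>R axis i 1) - \<phi> 0)) \<longlonglongrightarrow> g $ i"
  shows "path_grad \<phi> = g"
  unfolding path_grad_def vec_eq_iff using limI[OF assms] by simp

text \<open>A version of the field for which all paths are regular, not only almost all. From the second derivatives
  only the local Lipschitz bound and the differentiability of the gradient are kept. The
  bounded density enters as a bound on the joint distribution of the value and the gradient.\<close>

locale c2_field = prob_space M for M :: "'w measure" +
  fixes X :: "real^'n \<Rightarrow> 'w \<Rightarrow> real" and G :: "'w \<Rightarrow> real^'n \<Rightarrow> real^'n" and B :: real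
  assumes X_meas[measurable]: "\<And>t. X t \<in> borel_measurable M"
    and law_shift: "\<And>s. field_law M (\<lambda>t. X (t + s)) = field_law M X"
    and law_rot: "\<And>Q::real^'n^'n. rotation_matrix Q \<Longrightarrow> field_law M (\<lambda>t. X (Q *v t)) = field_law M X"
    and X_deriv: "\<And>\<omega> x. ((\<lambda>t. X t \<omega>) has_derivative (\<lambda>h. G \<omega> x \<bullet> h)) (at x)"
    and G_diff: "\<And>\<omega> x. G \<omega> differentiable (at x)"
    and G_lip: "\<And>\<omega> R. \<exists>m. \<forall>x\<in>cball 0 R. \<forall>y\<in>cball 0 R. norm (G \<omega> x - G \<omega> y) \<le> m * norm (x - y)"
    and dens: "\<And>A. A \<in> sets borel \<Longrightarrow> emeasure M {\<omega> \<in> space M. (X 0 \<omega>, G \<omega> 0) \<in> A} \<le> ennreal B * emeasure lborel A"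
    and card2: "CARD('n) \<ge> 2"
begin

lemma X_cont: "continuous_on S (\<lambda>t. X t \<omega>)"
  using X_deriv by (meson differentiableI differentiable_imp_continuous_on differentiable_on_def has_derivative_at_withinI)

lemma G_cont: "continuous_on S (G \<omega>)"
  using G_diff by (meson differentiable_imp_continuous_on differentiable_on_def differentiable_at_withinI)

lemma law_nn_integral:
  assumes eq: "field_law M Y = field_law M X" and Y: "\<And>t. Y t \<in> borel_measurable M"
    and F: "F \<in> borel_measurable (Pi\<^sub>M UNIV (\<lambda>_. borel))"
  shows "(\<integral>\<^sup>+\<omega>. F (\<lambda>t. Y t \<omega>) \<partial>M) = (\<integral>\<^sup>+\<omega>. F (\<lambda>t. X t \<omega>) \<partial>M)"
proof -
  have m: "(\<lambda>\<omega> t. Z t \<omega>) \<in> M \<rightarrow>\<^sub>M Pi\<^sub>M UNIV (\<lambda>_. borel)"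
    if "\<And>t. Z t \<in> borel_measurable M" for Z :: "real^'n \<Rightarrow> 'w \<Rightarrow> real"
    using that by (intro measurable_PiM_single') auto
  have "(\<integral>\<^sup>+\<phi>. F \<phi> \<partial>field_law M Z) = (\<integral>\<^sup>+\<omega>. F (\<lambda>t. Z t \<omega>) \<partial>M)"
    if "\<And>t. Z t \<in> borel_measurable M" for Z
    unfolding field_law_def by (rule nn_integral_distr[OF m[OF that]]) (use F in simp)
  from this[of Y, OF Y] this[of X, OF X_meas] eq show ?thesis by simp
qed

lemma law_emeasure:
  assumes eq: "field_law M Y = field_law M X" and Y: "\<And>t. Y t \<in> borel_measurable M"
    and P: "Measurable.pred (Pi\<^sub>M UNIV (\<lambda>_. borel)) P"
  shows "emeasure M {\<omega>\<in>space M. P (\<lambda>t. Y t \<omega>)} = emeasure M {\<omega>\<in>space M. P (\<lambda>t. X t \<omega>)}"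
proof -
  have m: "(\<lambda>\<omega> t. Z t \<omega>) \<in> M \<rightarrow>\<^sub>M Pi\<^sub>M UNIV (\<lambda>_. borel)"
    if "\<And>t. Z t \<in> borel_measurable M" for Z :: "real^'n \<Rightarrow> 'w \<Rightarrow> real"
    using that by (intro measurable_PiM_single') auto
  have e: "emeasure M {\<omega>\<in>space M. P (\<lambda>t. Z t \<omega>)} = (\<integral>\<^sup>+\<omega>. indicator {\<phi>. P \<phi>} (\<lambda>t. Z t \<omega>) \<partial>M)"
    if "\<And>t. Z t \<in> borel_measurable M" for Z
  proof -
    have "{\<omega>\<in>space M. P (\<lambda>t. Z t \<omega>)} \<in> sets M"
      using measurable_compose[OF m[OF that] P] by simp
    then have "emeasure M {\<omega>\<in>space M. P (\<lambda>t. Z t \<omega>)} = (\<integral>\<^sup>+\<omega>. indicator {\<omega>\<in>space M. P (\<lambda>t. Z t \<omega>)} \<omega> \<partial>M)"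
      by simp
    also have "\<dots> = (\<integral>\<^sup>+\<omega>. indicator {\<phi>. P \<phi>} (\<lambda>t. Z t \<omega>) \<partial>M)"
      by (intro nn_integral_cong) (simp add: indicator_def)
    finally show ?thesis .
  qed
  have "(\<lambda>\<phi>. indicator {\<phi>. P \<phi>} \<phi> :: ennreal) \<in> borel_measurable (Pi\<^sub>M UNIV (\<lambda>_. borel))"
    using P by measurable
  from law_nn_integral[OF eq Y this] show ?thesis by (simp only: e[of Y, OF Y] e[of X, OF X_meas])
qed

lemma path_grad_shift: "path_grad (\<lambda>t. X (t + s) \<omega>) = G \<omega> s"
proof (rule path_grad_eq)
  fix i :: 'n
  show "(\<lambda>k. real (Suc k) * (X ((1 / real (Suc k)) *\<^sub>R axis i 1 + s) \<omega> - X (0 + s) \<omega>)) \<longlonglongrightarrow> G \<omega> s $ i"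
    using difference_quotient_tendsto[OF X_deriv[of \<omega> s], of "axis i 1"]
    by (simp add: add.commute inner_axis)
qed

lemma path_grad_zero: "path_grad (\<lambda>t. X t \<omega>) = G \<omega> 0"
  using path_grad_shift[of 0 \<omega>] by simp

lemma path_grad_rot:
  fixes Q :: "real^'n^'n"
  shows "path_grad (\<lambda>t. X (Q *v t) \<omega>) = G \<omega> 0 v* Q"
proof (rule path_grad_eq)
  fix i :: 'n
  have "(G \<omega> 0 v* Q) $ i = G \<omega> 0 \<bullet> (Q *v axis i 1)"
    by (metis cart_eq_inner_axis dot_lmul_matrix)
  then show "(\<lambda>k. real (Suc k) * (X (Q *v ((1 / real (Suc k)) *\<^sub>R axis i 1)) \<omega> - X (Q *v 0) \<omega>)) \<longlonglongrightarrow> (G \<omega> 0 v* Q) $ i"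
    using difference_quotient_tendsto[OF X_deriv[of \<omega> 0], of "Q *v axis i 1"]
    by (simp add: matrix_vector_mult_scaleR)
qed

lemma G_meas [measurable]: "(\<lambda>\<omega>. G \<omega> s) \<in> borel_measurable M"
proof -
  have "(\<lambda>\<omega> t. X (t + s) \<omega>) \<in> M \<rightarrow>\<^sub>M Pi\<^sub>M UNIV (\<lambda>_. borel)"
    by (intro measurable_PiM_single') auto
  from measurable_compose[OF this path_grad_measurable] show ?thesis
    by (simp add: path_grad_shift)
qed

lemma value_grad_pred:
  assumes "A \<in> sets borel"
  shows "Measurable.pred (Pi\<^sub>M UNIV (\<lambda>_. borel)) (\<lambda>\<phi>. (\<phi> (0::real^'n), path_grad \<phi>) \<in> A)"
proof -
  have "(\<lambda>\<phi>. (\<phi> (0::real^'n), path_grad \<phi>)) \<in> borel_measurable (Pi\<^sub>M UNIV (\<lambda>_. borel :: real measure))"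
    by (intro borel_measurable_Pair measurable_component_singleton path_grad_measurable UNIV_I)
  then show ?thesis using assms by simp
qed

lemma value_grad_shift:
  assumes "A \<in> sets borel"
  shows "emeasure M {\<omega>\<in>space M. (X s \<omega>, G \<omega> s) \<in> A} = emeasure M {\<omega>\<in>space M. (X 0 \<omega>, G \<omega> 0) \<in> A}"
  using law_emeasure[OF law_shift[of s] _ value_grad_pred[OF assms]]
  by (simp add: path_grad_shift path_grad_zero)

lemma value_grad_rot:
  assumes "A \<in> sets borel" "rotation_matrix Q"
  shows "emeasure M {\<omega>\<in>space M. (X 0 \<omega>, G \<omega> 0 v* Q) \<in> A} = emeasure M {\<omega>\<in>space M. (X 0 \<omega>, G \<omega> 0) \<in> A}"
  using law_emeasure[OF law_rot[OF assms(2)] _ value_grad_pred[OF assms(1)]]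
  by (simp add: path_grad_rot path_grad_zero)

lemma exists_rotation:
  fixes a b :: "real^'n"
  assumes "norm a = norm b"
  shows "\<exists>Q::real^'n^'n. rotation_matrix Q \<and> Q *v a = b"
proof -
  obtain f where f: "orthogonal_transformation f" "det (matrix f) = 1" "f a = b"
    using rotation_exists[OF card2 assms] by metis
  then have "rotation_matrix (matrix f)"
    by (simp add: rotation_matrix_def orthogonal_transformation_matrix)
  moreover have "matrix f *v a = b"
    using f by (simp add: matrix_works orthogonal_transformation_linear)
  ultimately show ?thesis by blast
qed

lemma norm_rot: "rotation_matrix Q \<Longrightarrow> norm (g v* Q) = norm (g :: real^'n)"
proof -
  assume "rotation_matrix Q"
  then have Q: "Q ** transpose Q = mat 1" by (simp add: rotation_matrix_def orthogonal_matrix_def)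
  have "Q *v (g v* Q) = Q *v (transpose Q *v g)" by simp
  also have "\<dots> = (Q ** transpose Q) *v g" by (simp only: matrix_vector_mul_assoc)
  also have "\<dots> = g" by (simp only: Q matrix_vector_mul_lid)
  finally have e: "Q *v (g v* Q) = g" .
  have "(g v* Q) \<bullet> (g v* Q) = g \<bullet> (Q *v (g v* Q))" by (rule dot_lmul_matrix)
  also have "\<dots> = g \<bullet> g" unfolding e ..
  finally show ?thesis by (simp add: norm_eq_sqrt_inner)
qed

text \<open>A field with continuous paths is the limit of fields that are constant on the cells of a lattice.\<close>

lemma X_joint_measurable [measurable]: "(\<lambda>p. X (fst p) (snd p)) \<in> borel_measurable (borel \<Otimes>\<^sub>M M)"
proof -
  define g :: "nat \<Rightarrow> real^'n \<Rightarrow> int^'n" where "g k t = (\<chi> i. \<lfloor>real (Suc k) * t $ i\<rfloor>)" for k t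
  define r :: "nat \<Rightarrow> int^'n \<Rightarrow> real^'n" where "r k a = (\<chi> i. of_int (a $ i) / real (Suc k))" for k a
  have comp: "(\<lambda>t::real^'n. t $ i) \<in> borel_measurable borel" for i
    by (intro borel_measurable_continuous_onI continuous_intros)
  have g: "g k \<in> borel \<rightarrow>\<^sub>M count_space UNIV" for k
  proof (subst measurable_count_space_eq2_countable, intro conjI ballI)
    fix a :: "int^'n"
    have "g k -` {a} \<inter> space borel = (\<Inter>i\<in>UNIV. {t. \<lfloor>real (Suc k) * t $ i\<rfloor> = a $ i})"
      by (auto simp: g_def vec_eq_iff)
    also have "\<dots> \<in> sets borel"
    proof (intro sets.finite_INT)
      fix i :: 'n
      note [measurable] = comp[of i]
      show "{t. \<lfloor>real (Suc k) * t $ i\<rfloor> = a $ i} \<in> sets borel"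
        unfolding floor_eq_iff by measurable
    qed auto
    finally show "g k -` {a} \<inter> space borel \<in> sets borel" .
  qed auto
  have m: "(\<lambda>p. X (r k (g k (fst p))) (snd p)) \<in> borel_measurable (borel \<Otimes>\<^sub>M M)" for k
  proof (rule measurable_compose_countable[where f="\<lambda>a p. X (r k a) (snd p)"])
    show "(\<lambda>p. X (r k a) (snd p)) \<in> borel_measurable (borel \<Otimes>\<^sub>M M)" for a by measurable
    show "(\<lambda>p. g k (fst p)) \<in> borel \<Otimes>\<^sub>M M \<rightarrow>\<^sub>M count_space UNIV"
      by (rule measurable_compose[OF measurable_fst g])
  qed
  have rlim: "(\<lambda>k. r k (g k t)) \<longlonglongrightarrow> t" for t
  proof (rule vec_tendstoI)
    fix i
    have "\<bar>r k (g k t) $ i - t $ i\<bar> \<le> inverse (real (Suc k))" for k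
    proof -
      define y where "y = real (Suc k) * t $ i"
      have "r k (g k t) $ i - t $ i = (of_int \<lfloor>y\<rfloor> - y) / real (Suc k)"
        by (simp add: r_def g_def y_def diff_divide_distrib)
      then have "\<bar>r k (g k t) $ i - t $ i\<bar> = \<bar>of_int \<lfloor>y\<rfloor> - y\<bar> / real (Suc k)"
        by (simp only: abs_divide abs_of_nat)
      also have "\<dots> \<le> 1 / real (Suc k)"
        by (rule divide_right_mono) (linarith, simp)
      finally show ?thesis by (simp only: inverse_eq_divide)
    qed
    then have "(\<lambda>k. r k (g k t) $ i - t $ i) \<longlonglongrightarrow> 0"
      by (intro tendsto_rabs_zero_cancel[OF tendsto_sandwich[OF _ _ tendsto_const LIMSEQ_inverse_real_of_nat]]) auto
    then show "(\<lambda>k. r k (g k t) $ i) \<longlonglongrightarrow> t $ i" by (simp add: LIM_zero_iff)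
  qed
  show ?thesis
  proof (rule borel_measurable_LIMSEQ_real)
    show "(\<lambda>p. X (r k (g k (fst p))) (snd p)) \<in> borel_measurable (borel \<Otimes>\<^sub>M M)" for k by (rule m)
    fix p :: "(real^'n) \<times> 'w"
    have "isCont (\<lambda>t. X t (snd p)) (fst p)"
      using X_deriv by (rule has_derivative_continuous)
    from isCont_tendsto_compose[OF this rlim]
    show "(\<lambda>k. X (r k (g k (fst p))) (snd p)) \<longlonglongrightarrow> X (fst p) (snd p)" .
  qed
qed

lemma emeasure_interval_ball:
  assumes "a \<ge> 0" "b \<ge> 0"
  shows "emeasure lborel ({u - a..u + a} \<times> cball (0::real^'n) b)
    = ennreal (2 * a * (unit_ball_vol (real CARD('n)) * b ^ CARD('n)))"
proof -
  have "emeasure lborel ({u - a..u + a} \<times> cball (0::real^'n) b)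
    = emeasure lborel {u - a..u + a} * emeasure lborel (cball (0::real^'n) b)"
    unfolding lborel_prod[symmetric] by (rule lborel.emeasure_pair_measure_Times) auto
  then show ?thesis using assms by (simp add: emeasure_cball ennreal_mult)
qed

lemma B_pos: "B > 0"
proof (rule ccontr)
  assume "\<not> B > 0"
  then have "ennreal B = 0" by (simp add: ennreal_neg)
  moreover have "emeasure M {\<omega> \<in> space M. (X 0 \<omega>, G \<omega> 0) \<in> UNIV} = 1" using emeasure_space_1 by simp
  ultimately show False using dens[of UNIV] by simp
qed

lemma dens_at:
  assumes "a \<ge> 0" "b \<ge> 0"
  shows "emeasure M {\<omega> \<in> space M. \<bar>X s \<omega> - u\<bar> \<le> a \<and> norm (G \<omega> s) \<le> b}
    \<le> ennreal (B * (2 * a * (unit_ball_vol (real CARD('n)) * b ^ CARD('n))))"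
proof -
  let ?A = "{u - a..u + a} \<times> cball (0::real^'n) b"
  have A: "?A \<in> sets borel" by (intro borel_closed closed_Times) auto
  have "{\<omega> \<in> space M. \<bar>X s \<omega> - u\<bar> \<le> a \<and> norm (G \<omega> s) \<le> b} = {\<omega> \<in> space M. (X s \<omega>, G \<omega> s) \<in> ?A}"
    by (auto simp: abs_le_iff)
  then have "emeasure M {\<omega> \<in> space M. \<bar>X s \<omega> - u\<bar> \<le> a \<and> norm (G \<omega> s) \<le> b}
     = emeasure M {\<omega>\<in>space M. (X 0 \<omega>, G \<omega> 0) \<in> ?A}" using value_grad_shift[OF A, of s] by simp
  also have "\<dots> \<le> ennreal B * emeasure lborel ?A" by (rule dens[OF A])
  also have "\<dots> = ennreal (B * (2 * a * (unit_ball_vol (real CARD('n)) * b ^ CARD('n))))"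
    unfolding emeasure_interval_ball[OF assms] using B_pos by (simp add: ennreal_mult')
  finally show ?thesis .
qed

lemma finite_net:
  assumes "L > 0"
  shows "\<exists>F::(real^'n) set. finite F \<and> card F \<le> (2 * (L * R) + 3) ^ CARD('n) \<and>
    (\<forall>x\<in>cball 0 (real R). \<exists>s\<in>F. norm (x - s) \<le> real CARD('n) / real L)"
proof -
  define I where "I = {- (int (L * R) + 1)..int (L * R) + 1}"
  define r :: "('n \<Rightarrow> int) \<Rightarrow> real^'n" where "r a = (\<chi> i. of_int (a i) / real L)" for a
  define F where "F = r ` (UNIV \<rightarrow>\<^sub>E I)"
  have fin: "finite (UNIV \<rightarrow>\<^sub>E I :: ('n \<Rightarrow> int) set)" by (intro finite_PiE) (auto simp: I_def)
  have "card F \<le> card (UNIV \<rightarrow>\<^sub>E I :: ('n \<Rightarrow> int) set)" unfolding F_def by (rule card_image_le[OF fin])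
  also have "\<dots> = card I ^ CARD('n)" by (subst card_PiE) auto
  also have "card I = 2 * (L * R) + 3" unfolding I_def card_atLeastAtMost_int by linarith
  finally have c: "card F \<le> (2 * (L * R) + 3) ^ CARD('n)" .
  have "\<exists>s\<in>F. norm (x - s) \<le> real CARD('n) / real L" if x: "x \<in> cball 0 (real R)" for x
  proof -
    define a where "a i = \<lfloor>real L * x $ i\<rfloor>" for i
    have "a i \<in> I" for i
    proof -
      have "\<bar>x $ i\<bar> \<le> real R" using component_le_norm_cart[of x i] x by simp
      then have "\<bar>real L * x $ i\<bar> \<le> real (L * R)"
        using assms by (simp add: abs_mult)
      then have "real_of_int (- (int (L * R) + 1)) \<le> real_of_int (a i)" "real_of_int (a i) \<le> real_of_int (int (L * R) + 1)"
        unfolding a_def of_int_add of_int_minus of_int_1 of_int_of_nat_eq by linarith+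
      then show ?thesis unfolding I_def of_int_le_iff by simp
    qed
    then have "r a \<in> F" unfolding F_def by (intro imageI) (auto simp: PiE_def)
    moreover have "norm (x - r a) \<le> real CARD('n) / real L"
    proof -
      have "\<bar>(x - r a) $ i\<bar> \<le> 1 / real L" for i
      proof -
        have "(x - r a) $ i = (real L * x $ i - of_int (a i)) / real L"
          using assms by (simp add: r_def diff_divide_distrib)
        moreover have "\<bar>real L * x $ i - of_int (a i)\<bar> \<le> 1" unfolding a_def by linarith
        ultimately show ?thesis using assms by (simp add: abs_divide divide_right_mono)
      qed
      then have "(\<Sum>i\<in>UNIV. \<bar>(x - r a) $ i\<bar>) \<le> (\<Sum>i\<in>(UNIV::'n set). 1 / real L)" by (intro sum_mono)
      then show ?thesis using norm_le_l1_cart[of "x - r a"] by simp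
    qed
    ultimately show ?thesis by blast
  qed
  then show ?thesis using fin c unfolding F_def by blast
qed

text \<open>A form of the Borel-Cantelli argument for which convergence to zero suffices, as only one avoided
  set is required.\<close>

lemma not_in_small_sets_AE:
  assumes "\<And>k::nat. E k \<in> sets M" "\<And>k. emeasure M (E k) \<le> ennreal (c k)" "c \<longlonglongrightarrow> 0"
  shows "AE \<omega> in M. \<exists>k. \<omega> \<notin> E k"
proof (rule AE_I)
  have "emeasure M (\<Inter>k. E k) \<le> ennreal (c k)" for k
    using emeasure_mono[of "\<Inter>k. E k" "E k" M] assms(1,2) by (auto intro: order_trans)
  moreover have "(\<lambda>k. ennreal (c k)) \<longlonglongrightarrow> ennreal 0" by (intro tendsto_ennrealI assms(3))
  ultimately have "emeasure M (\<Inter>k. E k) \<le> ennreal 0"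
    by (intro LIMSEQ_le_const[where X="\<lambda>k. ennreal (c k)"]) auto
  then show "emeasure M (\<Inter>k. E k) = 0" by simp
  show "(\<Inter>k. E k) \<in> sets M" using assms(1) by auto
  show "{\<omega> \<in> space M. \<not> (\<exists>k. \<omega> \<notin> E k)} \<subseteq> (\<Inter>k. E k)" by auto
qed

text \<open>Bulinskaya's argument. Suppose the gradient has Lipschitz constant \<open>m\<close> on a ball. Near a critical point on
  the level, a point of a net of mesh \<open>\<rho>\<close> has gradient of size at most \<open>m * \<rho>\<close> and value within
  \<open>m * \<rho>\<^sup>2\<close> of the level. By the bounded density this has probability of order \<open>\<rho> ^ (d + 2)\<close>, while the net
  has of order \<open>\<rho> ^ (- d)\<close> points. As \<open>\<rho>\<close> tends to zero, the total probability vanishes.\<close>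

theorem no_critical_points: "AE \<omega> in M. \<forall>x. X x \<omega> = u \<longrightarrow> G \<omega> x \<noteq> 0"
proof -
  let ?d = "CARD('n)"
  have "AE \<omega> in M. (\<forall>x\<in>cball 0 (real R + 1). \<forall>y\<in>cball 0 (real R + 1). norm (G \<omega> x - G \<omega> y) \<le> real m * norm (x - y))
       \<longrightarrow> (\<forall>x\<in>cball 0 (real R). X x \<omega> = u \<longrightarrow> G \<omega> x \<noteq> 0)" for R m :: nat
  proof -
    define L where "L k = Suc k + ?d" for k
    have L0: "L k > 0" for k by (simp add: L_def)
    define \<rho> where "\<rho> k = real ?d / real (L k)" for k
    have \<rho>: "0 < \<rho> k" "\<rho> k \<le> 1" for k by (auto simp: \<rho>_def L_def field_simps)
    define net where "net k F \<longleftrightarrow> finite F \<and> card F \<le> (2 * (L k * R) + 3) ^ ?d \<and>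
      (\<forall>x\<in>cball 0 (real R). \<exists>s\<in>F. norm (x - s) \<le> \<rho> k)" for k and F :: "(real^'n) set"
    have "\<forall>k. \<exists>F. net k F" unfolding net_def \<rho>_def by (intro allI finite_net L0)
    from choice[OF this] obtain F where net: "\<And>k. net k (F k)" by (elim exE) (rule that, blast)
    have F: "\<And>k. finite (F k)" "\<And>k. card (F k) \<le> (2 * (L k * R) + 3) ^ ?d"
      "\<And>k x. x \<in> cball 0 (real R) \<Longrightarrow> \<exists>s\<in>F k. norm (x - s) \<le> \<rho> k"
      using net unfolding net_def by auto
    define E1 where "E1 k s = {\<omega> \<in> space M. \<bar>X s \<omega> - u\<bar> \<le> real m * (\<rho> k)\<^sup>2 \<and> norm (G \<omega> s) \<le> real m * \<rho> k}" for k s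
    define E where "E k = (\<Union>s\<in>F k. E1 k s)" for k
    have E1m: "E1 k s \<in> sets M" for k s unfolding E1_def by measurable
    then have Em: "E k \<in> sets M" for k unfolding E_def using F(1) by (intro sets.finite_UN) auto
    define c where "c k = real ((2 * (L k * R) + 3) ^ ?d) *
      (B * (2 * (real m * (\<rho> k)\<^sup>2) * (unit_ball_vol (real ?d) * (real m * \<rho> k) ^ ?d)))" for k
    have Ec: "emeasure M (E k) \<le> ennreal (c k)" for k
    proof -
      let ?e = "B * (2 * (real m * (\<rho> k)\<^sup>2) * (unit_ball_vol (real ?d) * (real m * \<rho> k) ^ ?d))"
      have e0: "?e \<ge> 0" using B_pos \<rho>(1)[of k] by (intro mult_nonneg_nonneg) auto
      have "emeasure M (E k) \<le> (\<Sum>s\<in>F k. emeasure M (E1 k s))"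
        unfolding E_def by (rule emeasure_subadditive_finite) (use F(1) E1m in auto)
      also have "\<dots> \<le> (\<Sum>s\<in>F k. ennreal ?e)"
        unfolding E1_def by (intro sum_mono dens_at) (use \<rho>(1)[of k] in auto)
      also have "\<dots> = ennreal (real (card (F k)) * ?e)"
        using e0 by (simp add: ennreal_mult ennreal_of_nat_eq_real_of_nat)
      also have "\<dots> \<le> ennreal (c k)"
        unfolding c_def using F(2)[of k] e0 by (intro ennreal_leI mult_right_mono) (simp_all only: of_nat_le_iff)
      finally show ?thesis .
    qed
    have "c \<longlonglongrightarrow> 0"
    proof -
      \<comment> \<open>Since \<open>L k * \<rho> k\<close> is constant, the number of net points cancels the powers of \<open>\<rho>\<close> from the gradient and two powers remain.\<close>
      define C where "C = real (2 * R + 3) ^ ?d * (B * (2 * real m * (unit_ball_vol (real ?d) * (real m * real ?d) ^ ?d)))"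
      have C0: "C \<ge> 0" unfolding C_def using B_pos by (intro mult_nonneg_nonneg) auto
      have "c k \<le> C * (\<rho> k)\<^sup>2" for k
      proof -
        have "2 * (L k * R) + 3 \<le> L k * (2 * R + 3)" using L0[of k] by (simp add: algebra_simps)
        then have "(2 * (L k * R) + 3) ^ ?d \<le> (L k * (2 * R + 3)) ^ ?d" by (rule power_mono) simp
        then have "real ((2 * (L k * R) + 3) ^ ?d) \<le> (real (L k)) ^ ?d * real (2 * R + 3) ^ ?d"
          by (simp only: of_nat_le_iff[symmetric, where 'a=real] of_nat_power of_nat_mult power_mult_distrib)
        then have "c k \<le> ((real (L k)) ^ ?d * real (2 * R + 3) ^ ?d) * (B * (2 * (real m * (\<rho> k)\<^sup>2) * (unit_ball_vol (real ?d) * (real m * \<rho> k) ^ ?d)))"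
          unfolding c_def using B_pos \<rho>(1)[of k] by (intro mult_right_mono mult_nonneg_nonneg) auto
        also have "\<dots> = (real (2 * R + 3) ^ ?d * (B * (2 * real m * (unit_ball_vol (real ?d) * (real m * (real (L k) * \<rho> k)) ^ ?d)))) * (\<rho> k)\<^sup>2"
          by (simp only: power_mult_distrib mult_ac)
        also have "real (L k) * \<rho> k = real ?d" using L0[of k] by (simp add: \<rho>_def)
        finally show ?thesis by (simp only: C_def)
      qed
      moreover have "0 \<le> c k" for k
        unfolding c_def using B_pos \<rho>(1)[of k] by (intro mult_nonneg_nonneg) auto
      moreover have "(\<lambda>k. C * (\<rho> k)\<^sup>2) \<longlonglongrightarrow> C * 0\<^sup>2"
      proof (intro tendsto_intros)
        have "(\<lambda>k. real ?d * inverse (real (Suc k))) \<longlonglongrightarrow> real ?d * 0"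
          by (intro tendsto_mult tendsto_const LIMSEQ_inverse_real_of_nat)
        moreover have "\<rho> k \<le> real ?d * inverse (real (Suc k))" for k
          unfolding \<rho>_def L_def by (simp add: divide_inverse mult_left_mono le_imp_inverse_le)
        moreover have "0 \<le> \<rho> k" for k using \<rho>(1)[of k] by simp
        ultimately show "\<rho> \<longlonglongrightarrow> 0"
          by (intro tendsto_sandwich[of "\<lambda>_. 0" \<rho> sequentially "\<lambda>k. real ?d * inverse (real (Suc k))" 0]) auto
      qed
      ultimately show ?thesis
        by (intro tendsto_sandwich[of "\<lambda>_. 0" c sequentially "\<lambda>k. C * (\<rho> k)\<^sup>2" 0]) auto
    qed
    from not_in_small_sets_AE[OF Em Ec this] AE_space show ?thesis
    proof (eventually_elim, intro impI ballI notI)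
      fix \<omega> x
      assume sp: "\<omega> \<in> space M" and ex: "\<exists>k. \<omega> \<notin> E k" and lip: "\<forall>x\<in>cball 0 (real R + 1). \<forall>y\<in>cball 0 (real R + 1). norm (G \<omega> x - G \<omega> y) \<le> real m * norm (x - y)"
        and x: "x \<in> cball 0 (real R)" "X x \<omega> = u" "G \<omega> x = 0"
      obtain k where k: "\<omega> \<notin> E k" using ex by blast
      obtain s where s: "s \<in> F k" "norm (x - s) \<le> \<rho> k" using F(3)[OF x(1)] by blast
      let ?S = "cball x (norm (x - s))"
      have near: "norm (G \<omega> y) \<le> real m * \<rho> k" if y: "y \<in> ?S" for y
      proof -
        have ny: "norm (y - x) \<le> \<rho> k" using y s(2) norm_minus_commute[of y x] by (simp add: dist_norm)
        have "norm y \<le> norm x + norm (y - x)" using norm_triangle_ineq[of x "y - x"] by simp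
        then have "y \<in> cball 0 (real R + 1)" using x(1) ny \<rho>(2)[of k] by simp
        moreover have "x \<in> cball 0 (real R + 1)" using x(1) by simp
        ultimately have "norm (G \<omega> y - G \<omega> x) \<le> real m * norm (y - x)" using lip by blast
        also have "\<dots> \<le> real m * \<rho> k" using ny by (rule mult_left_mono) simp
        finally show ?thesis using x(3) by simp
      qed
      have "norm (X s \<omega> - X x \<omega>) \<le> (real m * \<rho> k) * norm (s - x)"
      proof (rule differentiable_bound[where S="?S" and f'="\<lambda>y h. G \<omega> y \<bullet> h"])
        show "((\<lambda>t. X t \<omega>) has_derivative (\<lambda>h. G \<omega> y \<bullet> h)) (at y within ?S)" for y
          using X_deriv by (rule has_derivative_at_withinI)
        show "onorm (\<lambda>h. G \<omega> y \<bullet> h) \<le> real m * \<rho> k" if y: "y \<in> ?S" for y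
        proof (rule onorm_bound)
          fix h
          have "norm (G \<omega> y \<bullet> h) \<le> norm (G \<omega> y) * norm h" by (simp add: Cauchy_Schwarz_ineq2)
          also have "\<dots> \<le> (real m * \<rho> k) * norm h" by (intro mult_right_mono near y) simp
          finally show "norm (G \<omega> y \<bullet> h) \<le> real m * \<rho> k * norm h" .
        qed (use \<rho>(1)[of k] in simp)
      qed (auto simp: dist_norm)
      also have "\<dots> \<le> (real m * \<rho> k) * \<rho> k"
        using s(2) \<rho>(1)[of k] norm_minus_commute[of s x] by (intro mult_left_mono) auto
      finally have "\<bar>X s \<omega> - u\<bar> \<le> real m * (\<rho> k)\<^sup>2" using x(2) by (simp add: power2_eq_square mult.assoc)
      moreover have "norm (G \<omega> s) \<le> real m * \<rho> k" by (rule near) (simp add: dist_norm)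
      ultimately have "\<omega> \<in> E1 k s" using sp by (simp add: E1_def)
      then show False using k s(1) by (auto simp: E_def)
    qed
  qed
  then have "AE \<omega> in M. \<forall>R m :: nat. (\<forall>x\<in>cball 0 (real R + 1). \<forall>y\<in>cball 0 (real R + 1). norm (G \<omega> x - G \<omega> y) \<le> real m * norm (x - y))
       \<longrightarrow> (\<forall>x\<in>cball 0 (real R). X x \<omega> = u \<longrightarrow> G \<omega> x \<noteq> 0)"
    unfolding AE_all_countable by blast
  then show ?thesis
  proof eventually_elim
    case (elim \<omega>)
    show ?case
    proof (intro allI impI)
      fix x assume x: "X x \<omega> = u"
      obtain R :: nat where R: "norm x \<le> real R" using real_arch_simple by blast
      obtain m where m: "\<forall>x\<in>cball 0 (real R + 1). \<forall>y\<in>cball 0 (real R + 1). norm (G \<omega> x - G \<omega> y) \<le> m * norm (x - y)"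
        using G_lip by blast
      obtain m' :: nat where m': "m \<le> real m'" using real_arch_simple by blast
      have "\<forall>x\<in>cball 0 (real R + 1). \<forall>y\<in>cball 0 (real R + 1). norm (G \<omega> x - G \<omega> y) \<le> real m' * norm (x - y)"
        using m m' by (meson mult_right_mono norm_ge_zero order_trans)
      then have "\<forall>x\<in>cball 0 (real R). X x \<omega> = u \<longrightarrow> G \<omega> x \<noteq> 0"
        by (rule mp[OF spec[OF spec[OF elim, of R], of m']])
      then show "G \<omega> x \<noteq> 0" using R x by simp
    qed
  qed
qed

end

section \<open>Upcrossing probabilities\<close>

context c2_field begin

definition up_prob :: "real \<Rightarrow> real^'n \<Rightarrow> real" where
  "up_prob u v = measure M {\<omega>\<in>space M. X 0 \<omega> \<le> u \<and> u < X v \<omega>}"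

text \<open>The supremum of the upcrossing quotients; subadditivity makes it their limit for small steps.\<close>

definition rate :: "real \<Rightarrow> ennreal" where
  "rate u = (SUP v\<in>-{0}. ennreal (up_prob u v / norm v))"

lemma up_prob_nonneg [simp]: "0 \<le> up_prob u v"
  by (simp add: up_prob_def)

lemma up_prob_zero [simp]: "up_prob u 0 = 0"
  unfolding up_prob_def by (rule trans[OF arg_cong[where f="measure M" and y="{}"]]) auto

lemma up_pred:
  "Measurable.pred (Pi\<^sub>M UNIV (\<lambda>_. borel)) (\<lambda>\<phi>. \<phi> a \<le> u \<and> u < (\<phi> b :: real))"
proof -
  have [measurable]: "(\<lambda>\<phi>. \<phi> c) \<in> borel_measurable (Pi\<^sub>M UNIV (\<lambda>_. borel :: real measure))" for c
    by (rule measurable_component_singleton) simp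
  show ?thesis by measurable
qed

lemma up_prob_shift: "measure M {\<omega>\<in>space M. X t \<omega> \<le> u \<and> u < X (t + v) \<omega>} = up_prob u v"
  using law_emeasure[OF law_shift[of t] _ up_pred[of 0 u v]]
  by (simp add: up_prob_def measure_def add.commute)

lemma up_prob_rot: "norm v = norm v' \<Longrightarrow> up_prob u v = up_prob u v'"
proof -
  assume "norm v = norm v'"
  then obtain Q where Q: "rotation_matrix Q" "Q *v v = v'" using exists_rotation by blast
  show ?thesis
    using law_emeasure[OF law_rot[OF Q(1)] _ up_pred[of 0 u v]]
    by (simp add: up_prob_def measure_def Q(2))
qed

lemma X_neq_AE: "AE \<omega> in M. X t \<omega> \<noteq> u"
proof -
  let ?A = "{u} \<times> (UNIV :: (real^'n) set)"
  have A: "?A \<in> sets borel" by (intro borel_closed closed_Times) auto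
  have "emeasure lborel ?A = emeasure lborel {u} * emeasure lborel (UNIV :: (real^'n) set)"
    unfolding lborel_prod[symmetric] by (rule lborel.emeasure_pair_measure_Times) auto
  then have "emeasure lborel ?A = 0" by simp
  then have "emeasure M {\<omega>\<in>space M. (X 0 \<omega>, G \<omega> 0) \<in> ?A} = 0" using dens[OF A] by simp
  then have "emeasure M {\<omega>\<in>space M. X t \<omega> = u} = 0" using value_grad_shift[OF A, of t] by simp
  then show ?thesis by (intro AE_I[of _ _ "{\<omega>\<in>space M. X t \<omega> = u}"]) auto
qed

text \<open>If \<open>X 0 \<le> u < X (v + v')\<close>, then one of the two steps of the path through \<open>v\<close> is an upcrossing.\<close>

lemma up_prob_subadd: "up_prob u (v + v') \<le> up_prob u v + up_prob u v'"
proof -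
  have "up_prob u (v + v') \<le> measure M ({\<omega>\<in>space M. X 0 \<omega> \<le> u \<and> u < X v \<omega>} \<union> {\<omega>\<in>space M. X v \<omega> \<le> u \<and> u < X (v + v') \<omega>})"
    unfolding up_prob_def by (rule finite_measure_mono) auto
  also have "\<dots> \<le> measure M {\<omega>\<in>space M. X 0 \<omega> \<le> u \<and> u < X v \<omega>} + measure M {\<omega>\<in>space M. X v \<omega> \<le> u \<and> u < X (v + v') \<omega>}"
    by (rule measure_Un_le) auto
  also have "\<dots> = up_prob u v + up_prob u v'" by (simp add: up_prob_shift) (simp add: up_prob_def)
  finally show ?thesis .
qed

lemma up_prob_multiple: "up_prob u (real m *\<^sub>R v + v') \<le> real m * up_prob u v + up_prob u v'"
proof (induction m)
  case (Suc m)
  have "real (Suc m) *\<^sub>R v + v' = v + (real m *\<^sub>R v + v')" by (simp add: scaleR_left_distrib)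
  then have "up_prob u (real (Suc m) *\<^sub>R v + v') \<le> up_prob u v + up_prob u (real m *\<^sub>R v + v')"
    by (simp only: up_prob_subadd)
  then show ?case using Suc by (simp add: distrib_right)
qed simp

text \<open>By continuity the value at \<open>q *\<^sub>R w\<close> exceeds \<open>u\<close> for arbitrarily small \<open>q\<close> only if \<open>X 0 \<ge> u\<close>; together
  with \<open>X 0 \<le> u\<close> this is the null event \<open>X 0 = u\<close>.\<close>

lemma up_prob_tendsto_0: "((\<lambda>q. up_prob u (q *\<^sub>R w)) \<longlongrightarrow> 0) (at_right 0)"
proof (rule tendsto_at_right_sequentially[of 0 1])
  fix S :: "nat \<Rightarrow> real" assume S: "S \<longlonglongrightarrow> 0"
  let ?A = "\<lambda>k. {\<omega>\<in>space M. X 0 \<omega> \<le> u \<and> u < X (S k *\<^sub>R w) \<omega>}"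
  have "(\<lambda>k. \<integral>\<omega>. indicator (?A k) \<omega> \<partial>M) \<longlonglongrightarrow> (\<integral>\<omega>. (0::real) \<partial>M)"
  proof (rule integral_dominated_convergence[where w="\<lambda>_. 1"])
    show "AE \<omega> in M. (\<lambda>k. indicator (?A k) \<omega> :: real) \<longlonglongrightarrow> 0"
      using X_neq_AE[of 0 u]
    proof eventually_elim
      case (elim \<omega>)
      have "eventually (\<lambda>k. \<omega> \<notin> ?A k) sequentially"
      proof (cases "X 0 \<omega> \<le> u")
        case True
        with elim have lt: "X 0 \<omega> < u" by simp
        have "isCont (\<lambda>t. X t \<omega>) 0" using X_deriv by (rule has_derivative_continuous)
        moreover have "(\<lambda>k. S k *\<^sub>R w) \<longlonglongrightarrow> 0"
          using tendsto_scaleR[OF S tendsto_const, of w] by simp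
        ultimately have "(\<lambda>k. X (S k *\<^sub>R w) \<omega>) \<longlonglongrightarrow> X 0 \<omega>" by (rule isCont_tendsto_compose)
        from order_tendstoD(2)[OF this lt] show ?thesis by eventually_elim auto
      qed simp
      then have "eventually (\<lambda>k. indicator (?A k) \<omega> = (0::real)) sequentially"
        by eventually_elim (simp add: indicator_def)
      then show ?case by (rule tendsto_eventually)
    qed
  qed auto
  then show "(\<lambda>k. up_prob u (S k *\<^sub>R w)) \<longlonglongrightarrow> 0" by (simp add: up_prob_def)
qed simp

lemma up_prob_le_rate: "ennreal (up_prob u v) \<le> rate u * ennreal (norm v)"
proof (cases "v = 0")
  case False
  have "ennreal (up_prob u v) = ennreal (up_prob u v / norm v) * ennreal (norm v)"
    using False by (simp flip: ennreal_mult)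
  also have "\<dots> \<le> rate u * ennreal (norm v)"
    unfolding rate_def by (intro mult_right_mono SUP_upper) (use False in auto)
  finally show ?thesis .
qed simp

lemma up_prob_div_le_rate:
  assumes "norm w = 1" "q > 0"
  shows "ennreal (1 / q * up_prob u (q *\<^sub>R w)) \<le> rate u"
proof -
  have "ennreal (up_prob u (q *\<^sub>R w) / norm (q *\<^sub>R w)) \<le> rate u"
    unfolding rate_def by (intro SUP_upper) (use assms in auto)
  then show ?thesis using assms by simp
qed

text \<open>Fekete's argument: a fixed step with a good quotient is divided into many short steps and a
  remainder, whose contribution is negligible; so the short steps have a quotient that is at least as
  good.\<close>

lemma up_prob_ge_near_0:
  assumes w: "norm w = 1" and a: "0 \<le> a" "ennreal a < rate u"
  shows "\<exists>b>0. \<forall>h. 0 < h \<and> h < b \<longrightarrow> a * h < up_prob u (h *\<^sub>R w)"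
proof -
  obtain v where v: "v \<noteq> 0" "ennreal a < ennreal (up_prob u v / norm v)"
    using a unfolding rate_def less_SUP_iff by auto
  define q where "q = norm v"
  have q: "q > 0" using v by (simp add: q_def)
  have "up_prob u v = up_prob u (q *\<^sub>R w)" by (rule up_prob_rot) (simp add: q_def w)
  then have "a < up_prob u (q *\<^sub>R w) / q" using v(2) a by (simp add: ennreal_less_iff q_def)
  then have pos: "up_prob u (q *\<^sub>R w) - a * q > 0" using q by (simp add: field_simps)
  from order_tendstoD(2)[OF up_prob_tendsto_0[of u w] pos]
  obtain b where b: "b > 0" "\<And>r. 0 < r \<Longrightarrow> r < b \<Longrightarrow> up_prob u (r *\<^sub>R w) < up_prob u (q *\<^sub>R w) - a * q"
    unfolding eventually_at_right_field by auto
  have "a * h < up_prob u (h *\<^sub>R w)" if h: "0 < h" "h < min b q" for h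
  proof -
    \<comment> \<open>\<open>q\<close> consists of \<open>m\<close> steps \<open>h\<close> and a remainder \<open>r < h\<close>.\<close>
    define m where "m = nat \<lfloor>q / h\<rfloor>"
    define r where "r = q - real m * h"
    have "q / h > 0" using q h by simp
    then have "real m \<le> q / h" "q / h < real m + 1" unfolding m_def by linarith+
    then have mh: "real m * h \<le> q" "q < real m * h + h" using h by (simp_all add: field_simps)
    have r: "0 \<le> r" "r < h" using mh by (auto simp: r_def)
    have "m > 0"
    proof (rule ccontr)
      assume "\<not> m > 0" then have "q < h" using mh by simp
      then show False using h by simp
    qed
    have pr: "up_prob u (r *\<^sub>R w) < up_prob u (q *\<^sub>R w) - a * q"
      using b(2)[of r] r h pos by (cases "r = 0") auto
    have "q *\<^sub>R w = real m *\<^sub>R (h *\<^sub>R w) + r *\<^sub>R w"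
      by (simp add: r_def scaleR_left_diff_distrib)
    then have "up_prob u (q *\<^sub>R w) \<le> real m * up_prob u (h *\<^sub>R w) + up_prob u (r *\<^sub>R w)"
      using up_prob_multiple by metis
    then have "a * q < real m * up_prob u (h *\<^sub>R w)" using pr by linarith
    moreover have "a * (real m * h) \<le> a * q" using mh a by (intro mult_left_mono)
    ultimately have "real m * (a * h) < real m * up_prob u (h *\<^sub>R w)" by (simp add: mult_ac)
    then show ?thesis using \<open>m > 0\<close> by simp
  qed
  then show ?thesis using b(1) q by (intro exI[of _ "min b q"]) auto
qed

lemma rate_tendsto:
  assumes w: "norm w = 1"
  shows "((\<lambda>q. ennreal (1 / q * up_prob u (q *\<^sub>R w))) \<longlongrightarrow> rate u) (at_right 0)"
proof (rule order_tendstoI)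
  fix a assume a: "a < rate u"
  then obtain a' where a': "a = ennreal a'" "a' \<ge> 0" by (cases a) auto
  obtain b where b: "b > 0" "\<And>h. 0 < h \<Longrightarrow> h < b \<Longrightarrow> a' * h < up_prob u (h *\<^sub>R w)"
    using up_prob_ge_near_0[OF w a'(2)] a a'(1) by blast
  show "eventually (\<lambda>q. a < ennreal (1 / q * up_prob u (q *\<^sub>R w))) (at_right 0)"
    unfolding eventually_at_right_field
  proof (intro exI[of _ b] conjI allI impI b(1))
    fix q :: real assume "0 < q" "q < b"
    then show "a < ennreal (1 / q * up_prob u (q *\<^sub>R w))"
      using b(2)[of q] a' by (simp add: ennreal_less_iff field_simps)
  qed
next
  fix a assume a: "rate u < a"
  show "eventually (\<lambda>q. ennreal (1 / q * up_prob u (q *\<^sub>R w)) < a) (at_right 0)"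
    unfolding eventually_at_right_field
    by (intro exI[of _ 1] conjI allI impI le_less_trans[OF up_prob_div_le_rate[OF w] a]) auto
qed

lemma X_comp [measurable (raw)]:
  "f \<in> N \<rightarrow>\<^sub>M borel \<Longrightarrow> g \<in> N \<rightarrow>\<^sub>M M \<Longrightarrow> (\<lambda>x. X (f x) (g x)) \<in> borel_measurable N"
  using measurable_compose[OF measurable_Pair X_joint_measurable, of f N g] by simp

text \<open>A separation is an upcrossing over \<open>v\<close> or, seen from the other end, one over \<open>- v\<close>; by isotropy both have
  the same probability.\<close>

lemma prob_sep: "emeasure M {\<omega>\<in>space M. sep u (X t \<omega>) (X (t + v) \<omega>)} = ennreal (2 * up_prob u v)"
proof -
  let ?A = "{\<omega>\<in>space M. X t \<omega> \<le> u \<and> u < X (t + v) \<omega>}"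
  let ?A' = "{\<omega>\<in>space M. X (t + v) \<omega> \<le> u \<and> u < X (t + v + - v) \<omega>}"
  have "{\<omega>\<in>space M. sep u (X t \<omega>) (X (t + v) \<omega>)} = ?A \<union> ?A'" by (auto simp: sep_def)
  also have "emeasure M \<dots> = emeasure M ?A + emeasure M ?A'"
    by (rule plus_emeasure[symmetric]) auto
  also have "\<dots> = ennreal (up_prob u v) + ennreal (up_prob u (- v))"
    unfolding emeasure_eq_measure up_prob_shift ..
  also have "up_prob u (- v) = up_prob u v" by (rule up_prob_rot) simp
  finally show ?thesis by (simp flip: ennreal_plus)
qed

lemma crossing_volume_eq:
  assumes [measurable]: "V \<in> sets borel"
  shows "crossing_volume (\<lambda>t. X t \<omega>) u V q
    = (\<integral>\<^sup>+v. (\<integral>\<^sup>+t. indicator (cball 0 q) v * indicator V t * (if sep u (X t \<omega>) (X (t + v) \<omega>) then 1 else 0) \<partial>lborel) \<partial>lborel)"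
  unfolding crossing_volume_def
proof (rule nn_integral_cong)
  fix v :: "real^'n"
  have fm[measurable]: "(\<lambda>t. X t \<omega>) \<in> borel_measurable borel" by (rule borel_measurable_continuous_onI[OF X_cont])
  have "emeasure lborel {t \<in> V. sep u (X t \<omega>) (X (t + v) \<omega>)} * indicator (cball 0 q) v
    = (\<integral>\<^sup>+t. indicator (cball 0 q) v * indicator {t \<in> V. sep u (X t \<omega>) (X (t + v) \<omega>)} t \<partial>lborel)"
    by (subst nn_integral_cmult_indicator) (use sep_set_borel[OF fm assms] in \<open>auto simp: mult.commute\<close>)
  also have "\<dots> = (\<integral>\<^sup>+t. indicator (cball 0 q) v * indicator V t * (if sep u (X t \<omega>) (X (t + v) \<omega>) then 1 else 0) \<partial>lborel)"
    by (intro nn_integral_cong) (simp add: indicator_def)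
  finally show "emeasure lborel {t \<in> V. sep u (X t \<omega>) (X (t + v) \<omega>)} * indicator (cball 0 q) v
    = (\<integral>\<^sup>+t. indicator (cball 0 q) v * indicator V t * (if sep u (X t \<omega>) (X (t + v) \<omega>) then 1 else 0) \<partial>lborel)" .
qed

lemma crossing_volume_measurable [measurable]:
  assumes [measurable]: "V \<in> sets borel"
  shows "(\<lambda>\<omega>. crossing_volume (\<lambda>t. X t \<omega>) u V q) \<in> borel_measurable M"
proof -
  have [measurable]: "cball (0::real^'n) q \<in> sets borel" by simp
  show ?thesis unfolding crossing_volume_eq[OF assms] sep_def by measurable
qed

lemma nn_integral_crossing_volume:
  assumes [measurable]: "V \<in> sets borel"
  shows "(\<integral>\<^sup>+\<omega>. crossing_volume (\<lambda>t. X t \<omega>) u V q \<partial>M)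
    = emeasure lborel V * (\<integral>\<^sup>+v\<in>cball 0 q. ennreal (2 * up_prob u v) \<partial>lborel)"
proof -
  have [measurable]: "cball (0::real^'n) q \<in> sets borel" by simp
  interpret P: pair_sigma_finite M "lborel :: (real^'n) measure"
    by (intro pair_sigma_finite.intro sigma_finite_measure_axioms lborel.sigma_finite_measure_axioms)
  let ?g = "\<lambda>\<omega> v t. indicator (cball 0 q) v * indicator V t * (if sep u (X t \<omega>) (X (t + v) \<omega>) then 1 else 0 :: ennreal)"
  have "(\<integral>\<^sup>+\<omega>. crossing_volume (\<lambda>t. X t \<omega>) u V q \<partial>M) = (\<integral>\<^sup>+\<omega>. (\<integral>\<^sup>+v. (\<integral>\<^sup>+t. ?g \<omega> v t \<partial>lborel) \<partial>lborel) \<partial>M)"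
    unfolding crossing_volume_eq[OF assms] ..
  also have "\<dots> = (\<integral>\<^sup>+v. (\<integral>\<^sup>+\<omega>. (\<integral>\<^sup>+t. ?g \<omega> v t \<partial>lborel) \<partial>M) \<partial>lborel)"
    by (rule P.Fubini'[symmetric]) (unfold sep_def, measurable)
  also have "\<dots> = (\<integral>\<^sup>+v. (\<integral>\<^sup>+t. (\<integral>\<^sup>+\<omega>. ?g \<omega> v t \<partial>M) \<partial>lborel) \<partial>lborel)"
    by (intro nn_integral_cong P.Fubini'[symmetric]) (unfold sep_def, measurable)
  also have "\<dots> = (\<integral>\<^sup>+v. (\<integral>\<^sup>+t. indicator (cball 0 q) v * ennreal (2 * up_prob u v) * indicator V t \<partial>lborel) \<partial>lborel)"
  proof (intro nn_integral_cong)
    fix v t :: "real^'n"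
    have "(\<integral>\<^sup>+\<omega>. ?g \<omega> v t \<partial>M) = (\<integral>\<^sup>+\<omega>. indicator (cball 0 q) v * indicator V t * indicator {\<omega>\<in>space M. sep u (X t \<omega>) (X (t + v) \<omega>)} \<omega> \<partial>M)"
      by (intro nn_integral_cong) (auto simp: indicator_def)
    also have "\<dots> = indicator (cball 0 q) v * indicator V t * emeasure M {\<omega>\<in>space M. sep u (X t \<omega>) (X (t + v) \<omega>)}"
      by (rule nn_integral_cmult_indicator) (unfold sep_def, measurable)
    finally show "(\<integral>\<^sup>+\<omega>. ?g \<omega> v t \<partial>M) = indicator (cball 0 q) v * ennreal (2 * up_prob u v) * indicator V t"
      unfolding prob_sep by (simp add: mult_ac)
  qed
  also have "\<dots> = (\<integral>\<^sup>+v. emeasure lborel V * (ennreal (2 * up_prob u v) * indicator (cball 0 q) v) \<partial>lborel)"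
    by (intro nn_integral_cong, subst nn_integral_cmult_indicator) (auto simp: mult_ac)
  also have "\<dots> = emeasure lborel V * (\<integral>\<^sup>+v\<in>cball 0 q. ennreal (2 * up_prob u v) \<partial>lborel)"
  proof (rule nn_integral_cmult)
    have "(\<lambda>v. emeasure M {\<omega>\<in>space M. sep u (X 0 \<omega>) (X (0 + v) \<omega>)}) \<in> borel_measurable borel"
      unfolding sep_def by measurable
    then have [measurable]: "(\<lambda>v. ennreal (2 * up_prob u v)) \<in> borel_measurable borel" unfolding prob_sep .
    show "(\<lambda>v. ennreal (2 * up_prob u v) * indicator (cball 0 q) v) \<in> borel_measurable lborel" by measurable
  qed
  finally show ?thesis .
qed

end

section \<open>Identification of the crossing rate\<close>

context c2_field begin

lemma nn_integral_up_prob_le: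
  assumes q: "q > 0"
  shows "(\<integral>\<^sup>+v\<in>cball (0::real^'n) q. ennreal (2 * up_prob u v) \<partial>lborel)
    \<le> ennreal (2 * norm_const CARD('n) * q ^ (CARD('n) + 1)) * rate u"
proof -
  have [measurable]: "cball (0::real^'n) q \<in> sets borel" by simp
  have "(\<integral>\<^sup>+v\<in>cball (0::real^'n) q. ennreal (2 * up_prob u v) \<partial>lborel)
    \<le> (\<integral>\<^sup>+v. (2 * rate u) * (ennreal (norm v) * indicator (cball (0::real^'n) q) v) \<partial>lborel)"
  proof (rule nn_integral_mono)
    fix v :: "real^'n"
    have "ennreal (2 * up_prob u v) = 2 * ennreal (up_prob u v)" by (simp add: ennreal_mult')
    also have "\<dots> \<le> 2 * (rate u * ennreal (norm v))" by (intro mult_left_mono up_prob_le_rate) simp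
    finally show "ennreal (2 * up_prob u v) * indicator (cball 0 q) v \<le> (2 * rate u) * (ennreal (norm v) * indicator (cball (0::real^'n) q) v)"
      by (simp add: indicator_def mult.assoc)
  qed
  also have "\<dots> = (2 * rate u) * (\<integral>\<^sup>+v\<in>cball (0::real^'n) q. ennreal (norm v) \<partial>lborel)"
    by (rule nn_integral_cmult) measurable
  also have "\<dots> = (2 * rate u) * ennreal (norm_const CARD('n) * q ^ (CARD('n) + 1))"
    using nn_integral_cball_norm[OF q, where 'a="real^'n"] by simp
  also have "\<dots> = ennreal (2 * norm_const CARD('n) * q ^ (CARD('n) + 1)) * rate u"
    using norm_const_pos[of "CARD('n)"] q by (simp add: ennreal_mult mult_ac)
  finally show ?thesis .
qed

lemma nn_integral_up_prob_ge:
  assumes q: "q > 0" and a: "a \<ge> 0" and le: "\<And>v. norm v \<le> q \<Longrightarrow> a * norm v \<le> up_prob u v"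
  shows "ennreal (2 * a * norm_const CARD('n) * q ^ (CARD('n) + 1))
    \<le> (\<integral>\<^sup>+v\<in>cball (0::real^'n) q. ennreal (2 * up_prob u v) \<partial>lborel)"
proof -
  have [measurable]: "cball (0::real^'n) q \<in> sets borel" by simp
  have "ennreal (2 * a * norm_const CARD('n) * q ^ (CARD('n) + 1))
     = ennreal (2 * a) * ennreal (norm_const CARD('n) * q ^ (CARD('n) + 1))"
    using a by (simp add: ennreal_mult'[symmetric] mult.assoc)
  also have "\<dots> = ennreal (2 * a) * (\<integral>\<^sup>+v\<in>cball (0::real^'n) q. ennreal (norm v) \<partial>lborel)"
    using nn_integral_cball_norm[OF q, where 'a="real^'n"] by simp
  also have "\<dots> = (\<integral>\<^sup>+v. ennreal (2 * a) * (ennreal (norm v) * indicator (cball (0::real^'n) q) v) \<partial>lborel)"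
    by (rule nn_integral_cmult[symmetric]) measurable
  also have "\<dots> \<le> (\<integral>\<^sup>+v\<in>cball (0::real^'n) q. ennreal (2 * up_prob u v) \<partial>lborel)"
  proof (rule nn_integral_mono)
    fix v :: "real^'n"
    show "ennreal (2 * a) * (ennreal (norm v) * indicator (cball (0::real^'n) q) v) \<le> ennreal (2 * up_prob u v) * indicator (cball 0 q) v"
    proof (cases "norm v \<le> q")
      case True
      then have "2 * a * norm v \<le> 2 * up_prob u v" using le[of v] by simp
      then have "ennreal (2 * a) * ennreal (norm v) \<le> ennreal (2 * up_prob u v)"
        using a by (subst ennreal_mult[symmetric]) (auto intro: ennreal_leI)
      then show ?thesis using True by simp
    qed simp
  qed
  finally show ?thesis .
qed

text \<open>Expectations are taken in \<open>hausdorff_le_liminf_crossing_volume\<close>, with Fatou's lemma. That theorem needs a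
  window \<open>V\<close> that is an open neighbourhood of \<open>T\<close>.\<close>

lemma C_star_le_rate_aux:
  assumes T: "compact T" and V: "open V" "T \<subseteq> V" and \<tau>: "emeasure lborel T = ennreal \<tau>" "\<tau> > 0"
  shows "C_star M X T u \<le> ennreal (beta_const CARD('n) / \<tau>) * (rate u * emeasure lborel V)"
proof -
  let ?d = "CARD('n)"
  let ?c1 = "abs_proj_const ?d" and ?c2 = "norm_const ?d"
  have c1: "?c1 > 0" and c2: "?c2 > 0" using abs_proj_const_pos norm_const_pos by auto
  have [measurable]: "V \<in> sets borel" using V by simp
  define F where "F m \<omega> = ennreal (real (Suc m) ^ (?d + 1)) * crossing_volume (\<lambda>t. X t \<omega>) u V (1 / real (Suc m))" for m \<omega>
  have Fm[measurable]: "F m \<in> borel_measurable M" for m unfolding F_def by measurable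
  have HT: "hausdorff_measure ?d T = ennreal \<tau>" using hausdorff_measure_full[OF T] \<tau> by simp
  have "AE \<omega> in M. C_dens X T u \<omega> \<le> ennreal (1 / (?c1 * \<tau>)) * liminf (\<lambda>m. F m \<omega>)"
    using no_critical_points[of u]
  proof eventually_elim
    case (elim \<omega>)
    let ?H = "hausdorff_measure (?d - 1) (T \<inter> {t. X t \<omega> = u})"
    have "ennreal ?c1 * ?H \<le> liminf (\<lambda>m. F m \<omega>)"
      using hausdorff_le_liminf_crossing_volume[where f="\<lambda>t. X t \<omega>" and u=u, OF T V X_deriv G_cont] elim
      by (simp add: F_def)
    then have "ennreal (1 / (?c1 * \<tau>)) * (ennreal ?c1 * ?H) \<le> ennreal (1 / (?c1 * \<tau>)) * liminf (\<lambda>m. F m \<omega>)"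
      by (intro mult_left_mono) auto
    moreover have "ennreal (1 / (?c1 * \<tau>)) * (ennreal ?c1 * ?H) = ?H / ennreal \<tau>"
    proof -
      have "ennreal (1 / (?c1 * \<tau>)) * ennreal ?c1 = ennreal (1 / \<tau>)"
        using c1 \<tau> by (simp flip: ennreal_mult')
      also have "\<dots> = inverse (ennreal \<tau>)" using \<tau> by (simp add: inverse_ennreal inverse_eq_divide)
      finally show ?thesis by (simp add: mult.assoc[symmetric] divide_ennreal_def mult.commute)
    qed
    ultimately show ?case by (simp add: C_dens_def level_set_def HT)
  qed
  then have "C_star M X T u \<le> (\<integral>\<^sup>+\<omega>. ennreal (1 / (?c1 * \<tau>)) * liminf (\<lambda>m. F m \<omega>) \<partial>M)"
    unfolding C_star_def by (rule nn_integral_mono_AE)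
  also have "\<dots> = ennreal (1 / (?c1 * \<tau>)) * (\<integral>\<^sup>+\<omega>. liminf (\<lambda>m. F m \<omega>) \<partial>M)"
    by (rule nn_integral_cmult) measurable
  also have "\<dots> \<le> ennreal (1 / (?c1 * \<tau>)) * liminf (\<lambda>m. \<integral>\<^sup>+\<omega>. F m \<omega> \<partial>M)"
    by (intro mult_left_mono nn_integral_liminf) auto
  also have "\<dots> \<le> ennreal (1 / (?c1 * \<tau>)) * (emeasure lborel V * (ennreal (2 * ?c2) * rate u))"
  proof (intro mult_left_mono)
    have "(\<integral>\<^sup>+\<omega>. F m \<omega> \<partial>M) \<le> emeasure lborel V * (ennreal (2 * ?c2) * rate u)" for m
    proof -
      let ?h = "1 / real (Suc m)"
      have hh: "real (Suc m) ^ (?d + 1) * ?h ^ (?d + 1) = 1"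
        unfolding power_mult_distrib[symmetric] by simp
      have "(\<integral>\<^sup>+\<omega>. F m \<omega> \<partial>M) = ennreal (real (Suc m) ^ (?d + 1)) * (emeasure lborel V * (\<integral>\<^sup>+v\<in>cball 0 ?h. ennreal (2 * up_prob u v) \<partial>lborel))"
        unfolding F_def by (subst nn_integral_cmult) (auto simp: nn_integral_crossing_volume)
      also have "\<dots> \<le> ennreal (real (Suc m) ^ (?d + 1)) * (emeasure lborel V * (ennreal (2 * ?c2 * ?h ^ (?d + 1)) * rate u))"
        by (intro mult_left_mono nn_integral_up_prob_le) auto
      also have "\<dots> = emeasure lborel V * ((ennreal (real (Suc m) ^ (?d + 1)) * ennreal (2 * ?c2 * ?h ^ (?d + 1))) * rate u)"
        by (simp only: mult_ac)
      also have "ennreal (real (Suc m) ^ (?d + 1)) * ennreal (2 * ?c2 * ?h ^ (?d + 1)) = ennreal (real (Suc m) ^ (?d + 1) * (2 * ?c2 * ?h ^ (?d + 1)))"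
        by (rule ennreal_mult'[symmetric]) simp
      also have "real (Suc m) ^ (?d + 1) * (2 * ?c2 * ?h ^ (?d + 1)) = (real (Suc m) ^ (?d + 1) * ?h ^ (?d + 1)) * (2 * ?c2)"
        by (simp only: mult_ac)
      finally show ?thesis unfolding hh by simp
    qed
    then show "liminf (\<lambda>m. \<integral>\<^sup>+\<omega>. F m \<omega> \<partial>M) \<le> emeasure lborel V * (ennreal (2 * ?c2) * rate u)"
      by (intro Liminf_le) (auto intro: always_eventually)
  qed simp
  also have "\<dots> = (ennreal (1 / (?c1 * \<tau>)) * ennreal (2 * ?c2)) * (rate u * emeasure lborel V)"
    by (simp only: mult_ac)
  also have "ennreal (1 / (?c1 * \<tau>)) * ennreal (2 * ?c2) = ennreal (beta_const ?d / \<tau>)"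
    using c1 \<tau> by (subst ennreal_mult'[symmetric]) (auto simp: beta_const_eq)
  finally show ?thesis .
qed

text \<open>The open neighbourhoods of \<open>T\<close> shrink to \<open>T\<close>, and their volumes converge.\<close>

lemma C_star_le_rate:
  assumes T: "compact T" "T \<noteq> {}" and \<tau>: "emeasure lborel T = ennreal \<tau>" "\<tau> > 0"
  shows "C_star M X T u \<le> ennreal (beta_const CARD('n)) * rate u"
proof (cases "rate u")
  case top
  then show ?thesis using beta_const_pos[of "CARD('n)"] by (simp add: ennreal_mult_top)
next
  case (real \<rho>)
  let ?\<beta> = "beta_const CARD('n)"
  have \<beta>: "?\<beta> > 0" by (simp add: beta_const_pos)
  define V where "V k = {x. infdist x T < 1 / real (Suc k)}" for k
  have Vo: "open (V k)" for k unfolding V_def by (intro open_Collect_less continuous_intros)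
  have TV: "T \<subseteq> V k" for k using T(2) by (auto simp: V_def)
  have dec: "decseq V"
  proof (rule decseq_SucI)
    fix k
    have "1 / real (Suc (Suc k)) \<le> 1 / real (Suc k)" by (intro divide_left_mono) auto
    then show "V (Suc k) \<subseteq> V k" unfolding V_def by (auto intro: less_le_trans)
  qed
  have int: "(\<Inter>k. V k) = T"
  proof
    show "(\<Inter>k. V k) \<subseteq> T"
    proof
      fix x assume x: "x \<in> (\<Inter>k. V k)"
      have "infdist x T \<le> 0"
      proof (rule field_le_epsilon)
        fix e :: real assume "e > 0"
        then obtain k where "inverse (real (Suc k)) < e" using reals_Archimedean by blast
        moreover have "infdist x T < 1 / real (Suc k)" using x by (auto simp: V_def)
        ultimately show "infdist x T \<le> 0 + e" by (simp add: inverse_eq_divide)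
      qed
      then have "infdist x T = 0" using infdist_nonneg[of x T] by simp
      then show "x \<in> T" using in_closed_iff_infdist_zero[OF compact_imp_closed[OF T(1)] T(2)] by simp
    qed
  qed (use TV in auto)
  obtain R where R: "\<And>x. x \<in> T \<Longrightarrow> norm x \<le> R" using compact_imp_bounded[OF T(1)] by (auto simp: bounded_iff)
  have Vfin: "emeasure lborel (V k) \<noteq> \<infinity>" for k
  proof -
    have "V k \<subseteq> cball 0 (R + 1)"
    proof
      fix x assume x: "x \<in> V k"
      have "infdist x T < 1"
      proof -
        have "infdist x T < 1 / real (Suc k)" using x unfolding V_def by (rule CollectD)
        also have "\<dots> \<le> 1" by simp
        finally show ?thesis .
      qed
      obtain y where y: "y \<in> T" "infdist x T = dist x y"
        by (rule infdist_attains_inf[OF compact_imp_closed[OF T(1)] T(2)])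
      from \<open>infdist x T < 1\<close> y have "y \<in> T" "dist x y < 1" by simp_all
      then have "norm x \<le> R + 1" using R[of y] norm_triangle_ineq[of y "x - y"] by (simp add: dist_norm)
      then show "x \<in> cball 0 (R + 1)" by simp
    qed
    then have "emeasure lborel (V k) \<le> emeasure lborel (cball (0::real^'n) (R + 1))" by (rule emeasure_mono) simp
    also have "\<dots> < \<infinity>" by (rule emeasure_bounded_finite) simp
    finally show ?thesis by simp
  qed
  have "(\<lambda>k. emeasure lborel (V k)) \<longlonglongrightarrow> emeasure lborel (\<Inter>k. V k)"
    by (rule Lim_emeasure_decseq) (use Vo dec Vfin in auto)
  then have lim: "(\<lambda>k. emeasure lborel (V k)) \<longlonglongrightarrow> ennreal \<tau>" unfolding int \<tau>(1) .
  have "(\<lambda>k. ennreal (?\<beta> * \<rho> / \<tau>) * emeasure lborel (V k)) \<longlonglongrightarrow> ennreal (?\<beta> * \<rho> / \<tau>) * ennreal \<tau>"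
    by (rule ennreal_tendsto_cmult[OF _ lim]) simp
  moreover have "C_star M X T u \<le> ennreal (?\<beta> * \<rho> / \<tau>) * emeasure lborel (V k)" for k
  proof -
    have "C_star M X T u \<le> ennreal (?\<beta> / \<tau>) * (ennreal \<rho> * emeasure lborel (V k))"
      using C_star_le_rate_aux[OF T(1) Vo TV \<tau>, of u k] real by simp
    also have "\<dots> = (ennreal (?\<beta> / \<tau>) * ennreal \<rho>) * emeasure lborel (V k)" by (simp only: mult.assoc)
    also have "ennreal (?\<beta> / \<tau>) * ennreal \<rho> = ennreal (?\<beta> * \<rho> / \<tau>)"
      using \<beta> \<tau> real by (subst ennreal_mult[symmetric]) auto
    finally show ?thesis .
  qed
  ultimately have "C_star M X T u \<le> ennreal (?\<beta> * \<rho> / \<tau>) * ennreal \<tau>"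
    by (intro LIMSEQ_le_const) auto
  also have "\<dots> = ennreal ?\<beta> * rate u"
    using \<beta> \<tau> real by (simp flip: ennreal_mult)
  finally show ?thesis .
qed

text \<open>Expectations are taken in \<open>crossing_volume_le\<close>, for the points whose ball of radius \<open>q\<close> is contained in \<open>T\<close>. As
  \<open>q\<close> tends to zero, these points exhaust the interior of \<open>T\<close>, whose complement in \<open>T\<close> is a null set by
  convexity.\<close>

lemma rate_le_C_star:
  assumes T: "compact T" "convex T" and \<tau>: "emeasure lborel T = ennreal \<tau>" "\<tau> > 0"
  shows "rate u \<le> C_star M X T u / ennreal (beta_const CARD('n))"
proof (rule dense_le)
  fix a assume a: "a < rate u"
  let ?d = "CARD('n)"
  let ?c1 = "abs_proj_const ?d" and ?c2 = "norm_const ?d" and ?\<beta> = "beta_const ?d"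
  have c1: "?c1 > 0" and c2: "?c2 > 0" using abs_proj_const_pos norm_const_pos by auto
  have \<beta>: "?\<beta> > 0" by (simp add: beta_const_pos)
  obtain r where r: "a = ennreal r" "r \<ge> 0" using a by (cases a) auto
  obtain e :: "real^'n" where e: "norm e = 1" using vector_choose_size[of 1] by auto
  obtain b where b: "b > 0" "\<And>h. 0 < h \<Longrightarrow> h < b \<Longrightarrow> r * h < up_prob u (h *\<^sub>R e)"
    using up_prob_ge_near_0[OF e r(2)] a r(1) by blast
  have low: "r * norm v \<le> up_prob u v" if "norm v < b" for v
  proof (cases "v = 0")
    case False
    have "up_prob u v = up_prob u (norm v *\<^sub>R e)" by (rule up_prob_rot) (simp add: e)
    then show ?thesis using b(2)[of "norm v"] that False by simp
  qed simp
  define V where "V q = {t. \<forall>v\<in>cball 0 q. t + v \<in> T}" for q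
  have Vc: "closed (V q)" for q
  proof -
    have "V q = (\<Inter>v\<in>cball 0 q. (\<lambda>t. t + v) -` T)" by (auto simp: V_def)
    moreover have "closed (\<Inter>v\<in>cball 0 q. (\<lambda>t. t + v) -` T)"
      by (intro closed_INT ballI continuous_closed_vimage[OF compact_imp_closed[OF T(1)]] continuous_intros)
    ultimately show ?thesis by simp
  qed
  then have Vm[measurable]: "V q \<in> sets borel" for q by simp
  have VT: "cball t q \<subseteq> T" if "t \<in> V q" for t q
  proof
    fix x assume "x \<in> cball t q"
    then have "x - t \<in> cball 0 q" by (simp add: dist_norm norm_minus_commute)
    then have "t + (x - t) \<in> T" using that unfolding V_def by blast
    then show "x \<in> T" by simp
  qed
  have HT: "hausdorff_measure ?d T = ennreal \<tau>" using hausdorff_measure_full[OF T(1)] \<tau> by simp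
  \<comment> \<open>The identity \<open>beta_const_eq\<close> turns the two ball constants into \<open>\<beta>\<close>.\<close>
  have bound: "ennreal (?\<beta> * r / \<tau>) * emeasure lborel (V q) \<le> C_star M X T u" if q: "0 < q" "q < b" for q
  proof -
    let ?k = "1 / (?c1 * q ^ (?d + 1) * \<tau>)"
    have k: "?k > 0" using c1 q \<tau> by simp
    have "AE \<omega> in M. ennreal ?k * crossing_volume (\<lambda>t. X t \<omega>) u (V q) q \<le> C_dens X T u \<omega>"
      using no_critical_points[of u]
    proof eventually_elim
      case (elim \<omega>)
      let ?H = "hausdorff_measure (?d - 1) (T \<inter> {t. X t \<omega> = u})"
      have "crossing_volume (\<lambda>t. X t \<omega>) u (V q) q \<le> ennreal (?c1 * q ^ (?d + 1)) * ?H"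
        using crossing_volume_le[where f="\<lambda>t. X t \<omega>" and u=u, OF _ T(1) X_deriv G_cont _ VT q(1)] card2 elim by simp
      then have "ennreal ?k * crossing_volume (\<lambda>t. X t \<omega>) u (V q) q \<le> ennreal ?k * (ennreal (?c1 * q ^ (?d + 1)) * ?H)"
        by (intro mult_left_mono) auto
      also have "\<dots> = (ennreal ?k * ennreal (?c1 * q ^ (?d + 1))) * ?H" by (simp only: mult.assoc)
      also have "ennreal ?k * ennreal (?c1 * q ^ (?d + 1)) = ennreal (1 / \<tau>)"
        using c1 q \<tau> k by (subst ennreal_mult'[symmetric]) auto
      also have "\<dots> = inverse (ennreal \<tau>)" using \<tau> by (simp add: inverse_ennreal inverse_eq_divide)
      finally show ?case by (simp add: C_dens_def level_set_def HT divide_ennreal_def mult.commute)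
    qed
    then have I1: "(\<integral>\<^sup>+\<omega>. ennreal ?k * crossing_volume (\<lambda>t. X t \<omega>) u (V q) q \<partial>M) \<le> C_star M X T u"
      unfolding C_star_def by (rule nn_integral_mono_AE)
    have I2: "(\<integral>\<^sup>+\<omega>. ennreal ?k * crossing_volume (\<lambda>t. X t \<omega>) u (V q) q \<partial>M)
      = ennreal ?k * (emeasure lborel (V q) * (\<integral>\<^sup>+v\<in>cball 0 q. ennreal (2 * up_prob u v) \<partial>lborel))"
      by (subst nn_integral_cmult) (auto simp: nn_integral_crossing_volume)
    have I3: "ennreal ?k * (emeasure lborel (V q) * ennreal (2 * r * ?c2 * q ^ (?d + 1)))
      \<le> ennreal ?k * (emeasure lborel (V q) * (\<integral>\<^sup>+v\<in>cball 0 q. ennreal (2 * up_prob u v) \<partial>lborel))"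
      by (intro mult_left_mono nn_integral_up_prob_ge q r low) (use q in auto)
    have I4: "ennreal ?k * (emeasure lborel (V q) * ennreal (2 * r * ?c2 * q ^ (?d + 1)))
      = ennreal (?\<beta> * r / \<tau>) * emeasure lborel (V q)"
    proof -
      have "ennreal ?k * ennreal (2 * r * ?c2 * q ^ (?d + 1)) = ennreal (?k * (2 * r * ?c2 * q ^ (?d + 1)))"
        using k by (simp only: ennreal_mult' less_imp_le)
      also have "?k * (2 * r * ?c2 * q ^ (?d + 1)) = ?\<beta> * r / \<tau>"
        using c1 q \<tau> by (simp add: beta_const_eq field_simps)
      finally have kk: "ennreal ?k * ennreal (2 * r * ?c2 * q ^ (?d + 1)) = ennreal (?\<beta> * r / \<tau>)" .
      have "ennreal ?k * (emeasure lborel (V q) * ennreal (2 * r * ?c2 * q ^ (?d + 1)))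
        = (ennreal ?k * ennreal (2 * r * ?c2 * q ^ (?d + 1))) * emeasure lborel (V q)" by (simp only: mult_ac)
      then show ?thesis unfolding kk .
    qed
    show ?thesis
      by (rule order_trans[OF eq_refl[OF I4[symmetric]] order_trans[OF I3 order_trans[OF eq_refl[OF I2[symmetric]] I1]]])
  qed
  define q where "q k = b / real (Suc (Suc k))" for k
  have q: "0 < q k" "q k < b" for k
  proof -
    have "b * 1 < b * real (Suc (Suc k))" by (rule mult_strict_left_mono[OF _ b(1)]) simp
    then have "b < b * real (Suc (Suc k))" by (simp only: mult_1_right)
    moreover have "0 < real (Suc (Suc k))" by simp
    ultimately show "0 < q k" "q k < b" unfolding q_def using b(1) by (simp_all only: divide_less_eq divide_pos_pos if_True simp_thms)
  qed
  have qlim: "q \<longlonglongrightarrow> 0"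
  proof -
    have "(\<lambda>k. b * inverse (real (Suc (Suc k)))) \<longlonglongrightarrow> b * 0"
      by (rule tendsto_mult[OF tendsto_const LIMSEQ_Suc[OF LIMSEQ_inverse_real_of_nat]])
    then show ?thesis by (simp add: q_def[abs_def] divide_inverse)
  qed
  have inc: "incseq (\<lambda>k. V (q k))"
  proof (rule incseq_SucI)
    fix k
    have "q (Suc k) \<le> q k" unfolding q_def using b(1) by (intro divide_left_mono) auto
    then show "V (q k) \<subseteq> V (q (Suc k))" unfolding V_def by auto
  qed
  have inter: "interior T \<subseteq> (\<Union>k. V (q k))"
  proof
    fix x assume "x \<in> interior T"
    then obtain \<rho> where \<rho>: "\<rho> > 0" "ball x \<rho> \<subseteq> T" by (auto simp: mem_interior)
    obtain k where k: "q k < \<rho>"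
      using order_tendstoD(2)[OF qlim \<rho>(1)] by (auto simp: eventually_sequentially)
    have "x \<in> V (q k)" unfolding V_def
    proof (clarify)
      fix v :: "real^'n" assume "v \<in> cball 0 (q k)"
      then have "x + v \<in> ball x \<rho>" using k by (simp add: dist_norm)
      then show "x + v \<in> T" using \<rho>(2) by blast
    qed
    then show "x \<in> (\<Union>k. V (q k))" by blast
  qed
  have "emeasure lborel (interior T) = emeasure lborel T"
  proof -
    have fr: "frontier T \<in> null_sets lborel"
      using negligible_convex_frontier[OF T(2)]
      unfolding negligible_iff_null_sets by (subst (asm) null_sets_completion_iff) auto
    have "T = interior T \<union> frontier T"
      using closure_closed[OF compact_imp_closed[OF T(1)]] interior_subset[of T] by (auto simp: frontier_def)
    then show ?thesis using emeasure_Un_null_set[OF _ fr, of "interior T"] by simp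
  qed
  then have "ennreal \<tau> \<le> emeasure lborel (\<Union>k. V (q k))"
    using emeasure_mono[OF inter, of lborel] \<tau>(1) by (simp add: sets.countable_UN)
  moreover have "(\<lambda>k. ennreal (?\<beta> * r / \<tau>) * emeasure lborel (V (q k))) \<longlonglongrightarrow> ennreal (?\<beta> * r / \<tau>) * emeasure lborel (\<Union>k. V (q k))"
    by (intro ennreal_tendsto_cmult Lim_emeasure_incseq inc) auto
  then have "ennreal (?\<beta> * r / \<tau>) * emeasure lborel (\<Union>k. V (q k)) \<le> C_star M X T u"
    by (rule LIMSEQ_le_const2) (use bound q in auto)
  ultimately have "ennreal (?\<beta> * r / \<tau>) * ennreal \<tau> \<le> C_star M X T u"
    by (meson mult_left_mono order_trans zero_le)
  then have le: "ennreal ?\<beta> * ennreal r \<le> C_star M X T u"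
    using \<tau> \<beta> r by (simp flip: ennreal_mult)
  have "a = (ennreal ?\<beta> * ennreal r) / ennreal ?\<beta>"
    using \<beta> r by (simp add: divide_ennreal flip: ennreal_mult)
  also have "\<dots> \<le> C_star M X T u / ennreal ?\<beta>"
    using le by (rule divide_right_mono_ennreal)
  finally show "a \<le> C_star M X T u / ennreal ?\<beta>" .
qed

theorem rate_eq:
  assumes T: "compact T" "convex T" and \<tau>: "emeasure lborel T = ennreal \<tau>" "\<tau> > 0"
  shows "rate u = C_star M X T u / ennreal (beta_const CARD('n))"
proof (rule antisym[OF rate_le_C_star[OF assms]])
  let ?\<beta> = "beta_const CARD('n)"
  have \<beta>: "?\<beta> > 0" by (simp add: beta_const_pos)
  have "T \<noteq> {}" using \<tau> by auto
  then have "C_star M X T u / ennreal ?\<beta> \<le> ennreal ?\<beta> * rate u / ennreal ?\<beta>"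
    using C_star_le_rate[OF T(1) _ \<tau>] by (intro divide_right_mono_ennreal)
  also have "\<dots> = rate u"
  proof -
    have "ennreal ?\<beta> * rate u / ennreal ?\<beta> = (ennreal ?\<beta> * inverse (ennreal ?\<beta>)) * rate u"
      by (simp only: divide_ennreal_def mult_ac)
    also have "ennreal ?\<beta> * inverse (ennreal ?\<beta>) = 1"
      using \<beta> by (simp add: inverse_ennreal flip: ennreal_mult)
    finally show ?thesis by simp
  qed
  finally show "C_star M X T u / ennreal ?\<beta> \<le> rate u" .
qed

end

lemma hypercube_props:
  fixes T :: "(real^'n) set"
  assumes "hypercube T"
  shows "compact T" "convex T" "\<exists>\<tau>>0. emeasure lborel T = ennreal \<tau>"
proof -
  obtain a :: "real^'n" and r and f :: "real^'n \<Rightarrow> real^'n" where r: "0 < r" and f: "orthogonal_transformation f"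
    and T: "T = (\<lambda>x. a + f x) ` cbox 0 (\<chi> i. r)"
    using assms unfolding hypercube_def by (elim exE conjE) (rule that, assumption+)
  have lin: "linear f" using f by (rule orthogonal_transformation_linear)
  have T': "T = (+) a ` (f ` cbox 0 (\<chi> i. r))" unfolding T by auto
  show c: "compact T" unfolding T'
    by (intro compact_translation compact_continuous_image linear_continuous_on compact_cbox)
       (use lin linear_conv_bounded_linear in blast)
  show "convex T" unfolding T'
    by (intro convex_translation convex_linear_image lin convex_box)
  define c0 :: "real^'n" where "c0 = (\<chi> i. r / 2)"
  have sub: "cball (a + f c0) (r / 2) \<subseteq> T"
  proof
    fix y assume y: "y \<in> cball (a + f c0) (r / 2)"
    obtain x where x: "y - a = f x" using orthogonal_transformation_surj[OF f] by (metis surjD)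
    have "norm (x - c0) = norm (f (x - c0))" using f by (simp add: orthogonal_transformation_norm)
    also have "f (x - c0) = y - (a + f c0)" using x linear_diff[OF lin] by (simp add: algebra_simps)
    also have "norm \<dots> \<le> r / 2" using y by (simp add: dist_norm norm_minus_commute[of "a + f c0" y])
    finally have n: "norm (x - c0) \<le> r / 2" .
    have "x \<in> cbox 0 (\<chi> i. r)"
      unfolding mem_box_cart
    proof
      fix i
      have "\<bar>(x - c0) $ i\<bar> \<le> r / 2" using component_le_norm_cart[of "x - c0" i] n by linarith
      then have "x $ i - r / 2 \<le> r / 2" "- (x $ i - r / 2) \<le> r / 2" unfolding abs_le_iff by (simp_all add: c0_def)
      then show "0 $ i \<le> x $ i \<and> x $ i \<le> (\<chi> i. r) $ i" by simp
    qed
    then have "a + f x \<in> T" unfolding T by blast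
    then show "y \<in> T" using x by (metis add.commute diff_add_cancel)
  qed
  have "0 < emeasure lborel (cball (a + f c0) (r / 2))"
    using r by (simp add: emeasure_cball)
  also have "\<dots> \<le> emeasure lborel T"
    by (rule emeasure_mono[OF sub]) (use borel_compact[OF c] in simp)
  finally have pos: "0 < emeasure lborel T" .
  have "emeasure lborel T < \<infinity>" using emeasure_compact_finite[OF c] by simp
  then show "\<exists>\<tau>>0. emeasure lborel T = ennreal \<tau>"
    using pos by (cases "emeasure lborel T") auto
qed

section \<open>Small components of an isotropic gradient\<close>

text \<open>Directions are averaged over a ring, not over the sphere, so that Lebesgue measure can be used. The
  length of the directions varies by a factor of two only.\<close>

definition ring :: "'a::euclidean_space set" where
  "ring = {v. 1 \<le> norm v \<and> norm v \<le> 2}"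

text \<open>The directions in the ring that are orthogonal to \<open>g\<close> up to an error \<open>y\<close>.\<close>

definition band_vol :: "real \<Rightarrow> 'a::euclidean_space \<Rightarrow> ennreal" where
  "band_vol y g = emeasure lborel {v \<in> ring. \<bar>g \<bullet> v\<bar> \<le> y}"

lemma ring_borel [measurable]: "ring \<in> sets borel"
  unfolding ring_def by measurable

lemma band_vol_le:
  fixes n :: "'a::euclidean_space"
  assumes n: "norm n = 1" and s: "s > 0"
  shows "band_vol s n \<le> ennreal (2 * s * (unit_ball_vol (real (DIM('a) - 1)) * 2 ^ (DIM('a) - 1)))"
proof -
  have [measurable]: "cball (0::'a) 2 \<in> sets borel" by simp
  have "band_vol s n \<le> emeasure lborel {v. pr n v \<in> cball 0 2 \<and> -s \<le> v \<bullet> n \<and> v \<bullet> n \<le> s}"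
    unfolding band_vol_def
  proof (rule emeasure_mono)
    show "{v \<in> ring. \<bar>n \<bullet> v\<bar> \<le> s} \<subseteq> {v. pr n v \<in> cball 0 2 \<and> -s \<le> v \<bullet> n \<and> v \<bullet> n \<le> s}"
      using norm_pr_le[OF n] by (auto simp: ring_def inner_commute abs_le_iff intro: order_trans)
  qed measurable
  also have "\<dots> = ennreal (s - - s) * emeasure lborel {x \<in> slab n. pr n x \<in> cball 0 2}"
    by (rule emeasure_layer[OF n]) (use s in auto)
  also have "emeasure lborel {x \<in> slab n. pr n x \<in> cball 0 2} = disc_vol n 2" by (simp add: disc_vol_def)
  also have "\<dots> = ennreal (unit_ball_vol (real (DIM('a) - 1)) * 2 ^ (DIM('a) - 1))"
    by (rule disc_vol_eq[OF n]) simp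
  finally show ?thesis using s by (simp add: ennreal_mult')
qed

text \<open>In the band of width \<open>s\<close>, the part whose projection to the hyperplane has length between \<open>1\<close> and
  \<open>sqrt 3\<close> is contained in the ring.\<close>

lemma band_vol_ge:
  assumes d: "DIM('a::euclidean_space) \<ge> 2"
  shows "\<exists>c>0. \<forall>(n::'a) s. norm n = 1 \<and> 0 < s \<and> s \<le> 1 \<longrightarrow> ennreal (c * s) \<le> band_vol s n"
proof -
  let ?k = "DIM('a) - 1"
  let ?w = "unit_ball_vol (real ?k)"
  define c where "c = 2 * (?w * sqrt 3 ^ ?k - ?w * 1 ^ ?k)"
  have "1 < sqrt 3 ^ ?k" using d by (intro one_less_power) auto
  then have c: "c > 0" unfolding c_def by simp
  have "ennreal (c * s) \<le> band_vol s n" if n: "norm n = 1" and s: "0 < s" "s \<le> 1" for n :: 'a and s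
  proof -
    let ?C = "{z::'a. 1 \<le> norm z \<and> norm z \<le> sqrt 3}"
    have [measurable]: "?C \<in> sets borel" by measurable
    have fin: "disc_vol n 1 < \<infinity>" using disc_vol_eq[OF n, of 1] by simp
    have "disc_vol n (sqrt 3) - disc_vol n 1
      = emeasure lborel ({x \<in> slab n. norm (pr n x) \<le> sqrt 3} - {x \<in> slab n. norm (pr n x) \<le> 1})"
      unfolding disc_vol_def
    proof (rule emeasure_Diff[symmetric])
      show "{x \<in> slab n. norm (pr n x) \<le> 1} \<subseteq> {x \<in> slab n. norm (pr n x) \<le> sqrt 3}"
        by (auto intro: order_trans[of _ 1])
    qed (use fin in \<open>auto simp: disc_vol_def\<close>)
    also have "\<dots> \<le> emeasure lborel {x \<in> slab n. pr n x \<in> ?C}"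
      by (rule emeasure_mono) auto
    finally have 1: "disc_vol n (sqrt 3) - disc_vol n 1 \<le> emeasure lborel {x \<in> slab n. pr n x \<in> ?C}" .
    have "ennreal (c * s) = ennreal (s - - s) * ennreal (?w * sqrt 3 ^ ?k - ?w * 1 ^ ?k)"
      using s by (subst ennreal_mult'[symmetric]) (auto simp: c_def algebra_simps)
    also have "ennreal (?w * sqrt 3 ^ ?k - ?w * 1 ^ ?k) = disc_vol n (sqrt 3) - disc_vol n 1"
      using disc_vol_eq[OF n, of "sqrt 3"] disc_vol_eq[OF n, of 1] by (simp add: ennreal_minus)
    also have "ennreal (s - - s) * \<dots> \<le> ennreal (s - - s) * emeasure lborel {x \<in> slab n. pr n x \<in> ?C}"
      by (rule mult_left_mono[OF 1]) simp
    also have "\<dots> = emeasure lborel {v. pr n v \<in> ?C \<and> -s \<le> v \<bullet> n \<and> v \<bullet> n \<le> s}"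
      by (rule emeasure_layer[symmetric, OF n]) (use s in auto)
    also have "\<dots> \<le> band_vol s n"
      unfolding band_vol_def
    proof (rule emeasure_mono)
      show "{v. pr n v \<in> ?C \<and> -s \<le> v \<bullet> n \<and> v \<bullet> n \<le> s} \<subseteq> {v \<in> ring. \<bar>n \<bullet> v\<bar> \<le> s}"
      proof (intro subsetI CollectI conjI)
        fix v assume v: "v \<in> {v. pr n v \<in> ?C \<and> -s \<le> v \<bullet> n \<and> v \<bullet> n \<le> s}"
        then show "\<bar>n \<bullet> v\<bar> \<le> s" by (auto simp: inner_commute abs_le_iff)
        then have "(v \<bullet> n)\<^sup>2 \<le> 1" using s by (simp add: abs_square_le_1 inner_commute)
        moreover have "(norm (pr n v))\<^sup>2 \<le> (sqrt 3)\<^sup>2" using v by (intro power_mono) auto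
        ultimately have "(norm v)\<^sup>2 \<le> 2\<^sup>2" using norm_pr_sq[OF n, of v] by simp
        then have "norm v \<le> 2" by (rule power2_le_imp_le) simp
        moreover have "1 \<le> norm v" using v norm_pr_le[OF n, of v] by auto
        ultimately show "v \<in> ring" by (simp add: ring_def)
      qed
    qed measurable
    finally show ?thesis .
  qed
  then show ?thesis using c by blast
qed

lemma ring_finite: "emeasure lborel (ring :: 'a::euclidean_space set) < \<infinity>"
proof -
  have "emeasure lborel (ring :: 'a set) \<le> emeasure lborel (cball (0::'a) 2)"
    by (rule emeasure_mono) (auto simp: ring_def)
  also have "\<dots> < \<infinity>" by (rule emeasure_bounded_finite) simp
  finally show ?thesis .
qed

lemma band_vol_normalize:
  assumes "g \<noteq> 0" shows "band_vol y g = band_vol (y / norm g) ((1 / norm g) *\<^sub>R g)"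
proof -
  have "\<bar>((1 / norm g) *\<^sub>R g) \<bullet> v\<bar> \<le> y / norm g \<longleftrightarrow> \<bar>g \<bullet> v\<bar> \<le> y" for v
    using assms by (simp add: divide_le_cancel)
  then show ?thesis unfolding band_vol_def by simp
qed

lemma band_vol_mono: "y \<le> y' \<Longrightarrow> band_vol y g \<le> band_vol y' g"
  unfolding band_vol_def by (rule emeasure_mono) auto

text \<open>For a fixed \<open>g\<close> the volume of the band is comparable with the smaller of the normalised width \<open>y / norm g\<close> and
  one. Hence it grows at most linearly in \<open>y\<close>, with a constant that does not depend on \<open>g\<close>.\<close>

lemma band_vol_scale:
  assumes d: "DIM('a::euclidean_space) \<ge> 2"
  shows "\<exists>K>0. \<forall>(g::'a) \<delta> y. 0 < \<delta> \<and> \<delta> \<le> y \<longrightarrow> band_vol y g \<le> ennreal (K * (y / \<delta>)) * band_vol \<delta> g"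
proof -
  obtain c where c: "c > 0" and low: "\<And>(n::'a) s. norm n = 1 \<Longrightarrow> 0 < s \<Longrightarrow> s \<le> 1 \<Longrightarrow> ennreal (c * s) \<le> band_vol s n"
    using band_vol_ge[OF d] by blast
  define Z where "Z = unit_ball_vol (real (DIM('a) - 1)) * 2 ^ (DIM('a) - 1)"
  have Z: "Z > 0" unfolding Z_def by simp
  obtain vR where vR: "emeasure lborel (ring :: 'a set) = ennreal vR" "vR \<ge> 0"
    using ring_finite[where 'a='a] by (cases "emeasure lborel (ring :: 'a set)") auto
  have bR: "band_vol y g \<le> ennreal vR" for y and g :: 'a
    unfolding band_vol_def vR(1)[symmetric] by (rule emeasure_mono) auto
  define K where "K = 1 + 2 * Z / c + vR / c"
  have K: "K > 0" unfolding K_def using c Z vR by (intro add_pos_nonneg) auto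
  have "band_vol y g \<le> ennreal (K * (y / \<delta>)) * band_vol \<delta> g" if \<delta>: "0 < \<delta>" "\<delta> \<le> y" for g :: 'a and \<delta> y
  proof (cases "g = 0")
    case True
    have "1 \<le> K * (y / \<delta>)"
    proof -
      have "1 * 1 \<le> K * (y / \<delta>)"
        using \<delta> c Z vR by (intro mult_mono) (auto simp: K_def)
      then show ?thesis by simp
    qed
    then have "1 * band_vol \<delta> g \<le> ennreal (K * (y / \<delta>)) * band_vol \<delta> g"
      by (intro mult_right_mono) (auto simp: ennreal_ge_1)
    moreover have "band_vol y g = band_vol \<delta> g" using \<delta> by (simp add: band_vol_def True)
    ultimately show ?thesis by simp
  next
    case False
    define n where "n = (1 / norm g) *\<^sub>R g"
    define s where "s = y / norm g"
    define s1 where "s1 = \<delta> / norm g"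
    have n: "norm n = 1" using False by (simp add: n_def)
    have ss: "0 < s1" "s1 \<le> s" using \<delta> False by (auto simp: s_def s1_def divide_right_mono)
    have ratio: "y / \<delta> = s / s1" using False by (simp add: s_def s1_def)
    have e: "band_vol y g = band_vol s n" "band_vol \<delta> g = band_vol s1 n"
      unfolding s_def s1_def n_def by (rule band_vol_normalize[OF False])+
    have K0: "0 \<le> K * (s / s1)" using K ss by simp
    show ?thesis
    proof (cases "s1 \<le> 1")
      case True
      have "band_vol s n \<le> ennreal (2 * s * Z)" unfolding Z_def by (rule band_vol_le[OF n]) (use ss in simp)
      also have "\<dots> \<le> ennreal (K * (s / s1) * (c * s1))"
      proof (rule ennreal_leI)
        have "2 * Z \<le> K * c" using c Z vR by (simp add: K_def distrib_right)
        then have "s * (2 * Z) \<le> s * (K * c)" using ss by (intro mult_left_mono) auto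
        also have "s * (K * c) = K * (s / s1) * (c * s1)" using ss by simp
        finally show "2 * s * Z \<le> K * (s / s1) * (c * s1)" by (simp add: mult_ac)
      qed
      also have "\<dots> = ennreal (K * (s / s1)) * ennreal (c * s1)" by (rule ennreal_mult'[OF K0])
      also have "\<dots> \<le> ennreal (K * (s / s1)) * band_vol s1 n"
        by (intro mult_left_mono low n ss True) simp
      finally show ?thesis unfolding e ratio .
    next
      case False
      have "band_vol s n \<le> ennreal vR" by (rule bR)
      also have "\<dots> \<le> ennreal (K * (s / s1) * (c * 1))"
      proof (rule ennreal_leI)
        have a: "vR \<le> K * c" using c Z vR by (simp add: K_def distrib_right)
        have "K * c * 1 \<le> K * c * (s / s1)" using K c ss by (intro mult_left_mono) auto
        then show "vR \<le> K * (s / s1) * (c * 1)" using a by (simp add: mult_ac)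
      qed
      also have "\<dots> = ennreal (K * (s / s1)) * ennreal (c * 1)" by (rule ennreal_mult'[OF K0])
      also have "\<dots> \<le> ennreal (K * (s / s1)) * band_vol 1 n"
        by (intro mult_left_mono low n) auto
      also have "\<dots> \<le> ennreal (K * (s / s1)) * band_vol s1 n"
        using False by (intro mult_left_mono band_vol_mono) auto
      finally show ?thesis unfolding e ratio .
    qed
  qed
  then show ?thesis using K by blast
qed

context c2_field begin

text \<open>The set \<open>A\<close> constrains only quantities that are invariant under rotations of the field about the
  origin; this gives \<open>dir_prob_rot\<close>.\<close>

definition dir_prob :: "(real \<times> real) set \<Rightarrow> real^'n \<Rightarrow> real \<Rightarrow> real" where
  "dir_prob A v y = measure M {\<omega>\<in>space M. (X 0 \<omega>, norm (G \<omega> 0)) \<in> A \<and> \<bar>G \<omega> 0 \<bullet> v\<bar> \<le> y}"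

lemma dir_prob_rot:
  assumes A[measurable]: "A \<in> sets borel" and v: "norm v = norm v'"
  shows "dir_prob A v y = dir_prob A v' y"
proof -
  obtain Q where Q: "rotation_matrix Q" "Q *v v = v'" using exists_rotation[OF v] by blast
  let ?A = "{p::real \<times> (real^'n). (fst p, norm (snd p)) \<in> A \<and> \<bar>snd p \<bullet> v\<bar> \<le> y}"
  have m: "(\<lambda>p::real \<times> (real^'n). (fst p, norm (snd p))) \<in> borel_measurable borel"
    by (intro borel_measurable_continuous_onI continuous_intros)
  then have "(\<lambda>p::real \<times> (real^'n). (fst p, norm (snd p))) -` A \<inter> space borel \<in> sets borel"
    by (rule measurable_sets[OF _ A])
  moreover have "{p::real \<times> (real^'n). \<bar>snd p \<bullet> v\<bar> \<le> y} \<in> sets borel"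
    by (intro borel_closed closed_Collect_le continuous_intros)
  ultimately have "(\<lambda>p::real \<times> (real^'n). (fst p, norm (snd p))) -` A \<inter> space borel \<inter> {p. \<bar>snd p \<bullet> v\<bar> \<le> y} \<in> sets borel"
    by (rule sets.Int)
  also have "(\<lambda>p::real \<times> (real^'n). (fst p, norm (snd p))) -` A \<inter> space borel \<inter> {p. \<bar>snd p \<bullet> v\<bar> \<le> y} = ?A"
    by auto
  finally have "?A \<in> sets borel" .
  from value_grad_rot[OF this Q(1)] show ?thesis
    by (simp add: dir_prob_def measure_def norm_rot[OF Q(1)] dot_lmul_matrix Q(2))
qed

lemma dir_prob_mono: "A \<in> sets borel \<Longrightarrow> y \<le> y' \<Longrightarrow> dir_prob A v y \<le> dir_prob A v y'"
  unfolding dir_prob_def by (rule finite_measure_mono) auto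

lemma dir_prob_scale: "r > 0 \<Longrightarrow> dir_prob A (r *\<^sub>R v) y = dir_prob A v (y / r)"
proof -
  assume r: "r > 0"
  have "\<bar>G \<omega> 0 \<bullet> (r *\<^sub>R v)\<bar> \<le> y \<longleftrightarrow> \<bar>G \<omega> 0 \<bullet> v\<bar> \<le> y / r" for \<omega>
    using r by (simp add: abs_mult field_simps)
  then show ?thesis unfolding dir_prob_def by simp
qed

lemma nn_integral_band:
  assumes A[measurable]: "A \<in> sets borel"
  shows "(\<integral>\<^sup>+v\<in>ring. ennreal (dir_prob A v y) \<partial>lborel)
    = (\<integral>\<^sup>+\<omega>. indicator {\<omega>. (X 0 \<omega>, norm (G \<omega> 0)) \<in> A} \<omega> * band_vol y (G \<omega> 0) \<partial>M)"
proof -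
  interpret P: pair_sigma_finite M "lborel :: (real^'n) measure"
    by (intro pair_sigma_finite.intro sigma_finite_measure_axioms lborel.sigma_finite_measure_axioms)
  have Am[measurable]: "Measurable.pred M (\<lambda>\<omega>. (X 0 \<omega>, norm (G \<omega> 0)) \<in> A)" by measurable
  let ?g = "\<lambda>\<omega> v. indicator ring v * (if (X 0 \<omega>, norm (G \<omega> 0)) \<in> A \<and> \<bar>G \<omega> 0 \<bullet> v\<bar> \<le> y then 1 else 0 :: ennreal)"
  have "(\<integral>\<^sup>+v\<in>ring. ennreal (dir_prob A v y) \<partial>lborel) = (\<integral>\<^sup>+v. (\<integral>\<^sup>+\<omega>. ?g \<omega> v \<partial>M) \<partial>lborel)"
  proof (rule nn_integral_cong)
    fix v :: "real^'n"
    have S: "{\<omega>\<in>space M. (X 0 \<omega>, norm (G \<omega> 0)) \<in> A \<and> \<bar>G \<omega> 0 \<bullet> v\<bar> \<le> y} \<in> sets M" by measurable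
    have "ennreal (dir_prob A v y) * indicator ring v
      = indicator ring v * emeasure M {\<omega>\<in>space M. (X 0 \<omega>, norm (G \<omega> 0)) \<in> A \<and> \<bar>G \<omega> 0 \<bullet> v\<bar> \<le> y}"
      by (simp add: dir_prob_def emeasure_eq_measure mult.commute)
    also have "\<dots> = (\<integral>\<^sup>+\<omega>. indicator ring v * indicator {\<omega>\<in>space M. (X 0 \<omega>, norm (G \<omega> 0)) \<in> A \<and> \<bar>G \<omega> 0 \<bullet> v\<bar> \<le> y} \<omega> \<partial>M)"
      by (rule nn_integral_cmult_indicator[symmetric, OF S])
    also have "\<dots> = (\<integral>\<^sup>+\<omega>. ?g \<omega> v \<partial>M)"
      by (intro nn_integral_cong) (auto simp: indicator_def)
    finally show "ennreal (dir_prob A v y) * indicator ring v = (\<integral>\<^sup>+\<omega>. ?g \<omega> v \<partial>M)" .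
  qed
  also have "\<dots> = (\<integral>\<^sup>+\<omega>. (\<integral>\<^sup>+v. ?g \<omega> v \<partial>lborel) \<partial>M)"
    by (rule P.Fubini') measurable
  also have "\<dots> = (\<integral>\<^sup>+\<omega>. indicator {\<omega>. (X 0 \<omega>, norm (G \<omega> 0)) \<in> A} \<omega> * band_vol y (G \<omega> 0) \<partial>M)"
  proof (rule nn_integral_cong)
    fix \<omega>
    have "(\<integral>\<^sup>+v. ?g \<omega> v \<partial>lborel) = (\<integral>\<^sup>+v. indicator {\<omega>. (X 0 \<omega>, norm (G \<omega> 0)) \<in> A} \<omega> * indicator {v \<in> ring. \<bar>G \<omega> 0 \<bullet> v\<bar> \<le> y} v \<partial>lborel)"
      by (intro nn_integral_cong) (auto simp: indicator_def)
    also have "\<dots> = indicator {\<omega>. (X 0 \<omega>, norm (G \<omega> 0)) \<in> A} \<omega> * band_vol y (G \<omega> 0)"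
      unfolding band_vol_def by (rule nn_integral_cmult_indicator) measurable
    finally show "(\<integral>\<^sup>+v. ?g \<omega> v \<partial>lborel) = indicator {\<omega>. (X 0 \<omega>, norm (G \<omega> 0)) \<in> A} \<omega> * band_vol y (G \<omega> 0)" .
  qed
  finally show ?thesis .
qed

text \<open>Averaging over the ring replaces the condition on the component along \<open>w\<close> by the volume of a band;
  the factor \<open>2\<close> accounts for the length of the directions in the ring.\<close>

lemma band_average:
  assumes A: "A \<in> sets borel" and w: "norm w = 1" and y: "y > 0"
  shows "emeasure lborel (ring :: (real^'n) set) * ennreal (dir_prob A w (y / 2))
      \<le> (\<integral>\<^sup>+\<omega>. indicator {\<omega>. (X 0 \<omega>, norm (G \<omega> 0)) \<in> A} \<omega> * band_vol y (G \<omega> 0) \<partial>M)"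
    and "(\<integral>\<^sup>+\<omega>. indicator {\<omega>. (X 0 \<omega>, norm (G \<omega> 0)) \<in> A} \<omega> * band_vol y (G \<omega> 0) \<partial>M)
      \<le> emeasure lborel (ring :: (real^'n) set) * ennreal (dir_prob A w y)"
proof -
  have e: "dir_prob A v y = dir_prob A w (y / norm v)" if "v \<in> ring" for v :: "real^'n"
  proof -
    have nv: "norm v > 0" using that by (auto simp: ring_def)
    have "dir_prob A v y = dir_prob A (norm v *\<^sub>R w) y" by (rule dir_prob_rot[OF A]) (simp add: w)
    then show ?thesis using dir_prob_scale[OF nv] by simp
  qed
  have le1: "dir_prob A w (y / 2) \<le> dir_prob A v y" and le2: "dir_prob A v y \<le> dir_prob A w y"
    if v: "v \<in> ring" for v :: "real^'n"
  proof -
    have "1 \<le> norm v" "norm v \<le> 2" using v by (auto simp: ring_def)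
    then have nv: "norm v > 0" by linarith
    have "y / 2 \<le> y / norm v" by (rule divide_left_mono) (use y \<open>norm v \<le> 2\<close> nv in auto)
    moreover have "y / norm v \<le> y / 1" by (rule divide_left_mono) (use y \<open>1 \<le> norm v\<close> nv in auto)
    ultimately have "y / 2 \<le> y / norm v" "y / norm v \<le> y" by simp_all
    then show "dir_prob A w (y / 2) \<le> dir_prob A v y" "dir_prob A v y \<le> dir_prob A w y"
      unfolding e[OF v] by (auto intro!: dir_prob_mono[OF A])
  qed
  have c: "emeasure lborel (ring :: (real^'n) set) * ennreal r = (\<integral>\<^sup>+v\<in>(ring :: (real^'n) set). ennreal r \<partial>lborel)" for r
    by (subst nn_integral_cmult_indicator) (auto simp: mult.commute)
  show "emeasure lborel (ring :: (real^'n) set) * ennreal (dir_prob A w (y / 2))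
      \<le> (\<integral>\<^sup>+\<omega>. indicator {\<omega>. (X 0 \<omega>, norm (G \<omega> 0)) \<in> A} \<omega> * band_vol y (G \<omega> 0) \<partial>M)"
    unfolding nn_integral_band[OF A, symmetric] c
    by (intro nn_integral_mono) (auto simp: indicator_def le1 intro!: ennreal_leI)
  show "(\<integral>\<^sup>+\<omega>. indicator {\<omega>. (X 0 \<omega>, norm (G \<omega> 0)) \<in> A} \<omega> * band_vol y (G \<omega> 0) \<partial>M)
      \<le> emeasure lborel (ring :: (real^'n) set) * ennreal (dir_prob A w y)"
    unfolding nn_integral_band[OF A, symmetric] c
    by (intro nn_integral_mono) (auto simp: indicator_def le2 intro!: ennreal_leI)
qed

lemma ring_vol: "\<exists>r>0. emeasure lborel (ring :: (real^'n) set) = ennreal r"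
proof -
  have d: "DIM(real^'n) \<ge> 2" using card2 by simp
  obtain c where c: "c > 0" "\<And>(n::real^'n) s. norm n = 1 \<Longrightarrow> 0 < s \<Longrightarrow> s \<le> 1 \<Longrightarrow> ennreal (c * s) \<le> band_vol s n"
    using band_vol_ge[OF d] by blast
  obtain e :: "real^'n" where e: "norm e = 1" using vector_choose_size[of 1] by auto
  have "ennreal (c * 1) \<le> band_vol 1 e" by (rule c(2)) (use e in auto)
  also have "\<dots> \<le> emeasure lborel (ring :: (real^'n) set)"
    unfolding band_vol_def by (rule emeasure_mono) auto
  finally have le: "ennreal c \<le> emeasure lborel (ring :: (real^'n) set)" by simp
  obtain r where r: "r \<ge> 0" "emeasure lborel (ring :: (real^'n) set) = ennreal r"
    using ring_finite[where 'a="real^'n"] by (cases "emeasure lborel (ring :: (real^'n) set)") auto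
  have "c \<le> r" using le r by simp
  then show ?thesis using c(1) r(2) by (intro exI[of _ r]) simp
qed

text \<open>The linear growth of \<open>band_vol\<close> holds path by path, so it passes to the averages.\<close>

lemma dir_prob_quasi_linear:
  assumes w: "norm w = 1"
  shows "\<exists>K>0. \<forall>A\<in>sets borel. \<forall>\<delta> y. 0 < \<delta> \<and> \<delta> \<le> y \<longrightarrow> dir_prob A w (y / 2) \<le> K * (y / \<delta>) * dir_prob A w \<delta>"
proof -
  have d: "DIM(real^'n) \<ge> 2" using card2 by simp
  obtain K where K: "K > 0" and sc: "\<And>(g::real^'n) \<delta> y. 0 < \<delta> \<Longrightarrow> \<delta> \<le> y \<Longrightarrow> band_vol y g \<le> ennreal (K * (y / \<delta>)) * band_vol \<delta> g"
    using band_vol_scale[OF d] by blast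
  obtain r where r: "r > 0" "emeasure lborel (ring :: (real^'n) set) = ennreal r" using ring_vol by blast
  have "dir_prob A w (y / 2) \<le> K * (y / \<delta>) * dir_prob A w \<delta>"
    if A[measurable]: "A \<in> sets borel" and \<delta>: "0 < \<delta>" "\<delta> \<le> y" for A \<delta> y
  proof -
    let ?I = "\<lambda>y. \<integral>\<^sup>+\<omega>. indicator {\<omega>. (X 0 \<omega>, norm (G \<omega> 0)) \<in> A} \<omega> * band_vol y (G \<omega> 0) \<partial>M"
    have k0: "0 \<le> K * (y / \<delta>)" using K \<delta> by simp
    have bm: "(\<lambda>\<omega>. band_vol \<delta> (G \<omega> 0)) \<in> borel_measurable M"
    proof -
      have e: "band_vol \<delta> (G \<omega> 0) = (\<integral>\<^sup>+v. indicator ring v * (if \<bar>G \<omega> 0 \<bullet> v\<bar> \<le> \<delta> then 1 else 0) \<partial>lborel)" for \<omega>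
      proof -
        have i: "indicator ring v * (if \<bar>G \<omega> 0 \<bullet> v\<bar> \<le> \<delta> then 1 else 0) = (indicator {v \<in> ring. \<bar>G \<omega> 0 \<bullet> v\<bar> \<le> \<delta>} v :: ennreal)"
          for v by (simp add: indicator_def)
        have [measurable]: "{v \<in> ring. \<bar>G \<omega> 0 \<bullet> v\<bar> \<le> \<delta>} \<in> sets borel" by measurable
        show ?thesis unfolding band_vol_def i by simp
      qed
      show ?thesis unfolding e by measurable
    qed
    have "ennreal r * ennreal (dir_prob A w (y / 2)) \<le> ?I y"
      using band_average(1)[OF A w, of y] \<delta> r by simp
    also have "\<dots> \<le> (\<integral>\<^sup>+\<omega>. ennreal (K * (y / \<delta>)) * (indicator {\<omega>. (X 0 \<omega>, norm (G \<omega> 0)) \<in> A} \<omega> * band_vol \<delta> (G \<omega> 0)) \<partial>M)"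
      by (intro nn_integral_mono) (use sc[OF \<delta>] in \<open>simp add: indicator_def\<close>)
    also have "\<dots> = ennreal (K * (y / \<delta>)) * ?I \<delta>"
    proof (rule nn_integral_cmult)
      have [measurable]: "Measurable.pred M (\<lambda>\<omega>. (X 0 \<omega>, norm (G \<omega> 0)) \<in> A)" by measurable
      show "(\<lambda>\<omega>. indicator {\<omega>. (X 0 \<omega>, norm (G \<omega> 0)) \<in> A} \<omega> * band_vol \<delta> (G \<omega> 0)) \<in> borel_measurable M"
        using bm by measurable
    qed
    also have "\<dots> \<le> ennreal (K * (y / \<delta>)) * (ennreal r * ennreal (dir_prob A w \<delta>))"
      using band_average(2)[OF A w \<delta>(1)] r by (intro mult_left_mono) auto
    also have "\<dots> = ennreal (K * (y / \<delta>) * (r * dir_prob A w \<delta>))"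
        using k0 r(1) by (simp only: ennreal_mult'[OF k0] ennreal_mult'[OF less_imp_le])
    finally have "ennreal (r * dir_prob A w (y / 2)) \<le> ennreal (K * (y / \<delta>) * (r * dir_prob A w \<delta>))"
      using r by (simp add: ennreal_mult')
    then have "r * dir_prob A w (y / 2) \<le> K * (y / \<delta>) * (r * dir_prob A w \<delta>)"
    proof (subst (asm) ennreal_le_iff)
      show "0 \<le> K * (y / \<delta>) * (r * dir_prob A w \<delta>)" by (rule mult_nonneg_nonneg[OF k0 mult_nonneg_nonneg[OF less_imp_le[OF r(1)]]]) (simp add: dir_prob_def)
    qed
    then have "r * dir_prob A w (y / 2) \<le> r * (K * (y / \<delta>) * dir_prob A w \<delta>)" by (simp only: mult_ac)
    then show ?thesis using r(1) by (simp only: mult_le_cancel_left_pos)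
  qed
  then show ?thesis using K by blast
qed

text \<open>For gradients of length at most one the bounded density applies directly; for longer gradients
  the band has volume of order \<open>\<delta>\<close>.\<close>

lemma dir_prob_linear:
  assumes w: "norm w = 1" and x: "x \<ge> 0"
  shows "\<exists>C>0. \<forall>\<delta>>0. dir_prob ({u - x..u + x} \<times> UNIV) w \<delta> \<le> C * \<delta>"
proof -
  let ?k = "DIM(real^'n) - 1"
  let ?w = "unit_ball_vol (real ?k)"
  obtain r where r: "r > 0" "emeasure lborel (ring :: (real^'n) set) = ennreal r" using ring_vol by blast
  define Z where "Z = ?w * 2 ^ ?k"
  have Z: "Z > 0" by (simp add: Z_def)
  define C where "C = B * (2 * x) * (2 * ?w) + 4 * Z / r"
  have C: "C > 0" unfolding C_def using B_pos x Z r by (intro add_nonneg_pos) auto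
  have "dir_prob ({u - x..u + x} \<times> UNIV) w \<delta> \<le> C * \<delta>" if \<delta>: "\<delta> > 0" for \<delta>
  proof -
    let ?A0 = "{u - x..u + x} \<times> {..1::real}" and ?A1 = "{u - x..u + x} \<times> {1::real..}"
    have A0: "?A0 \<in> sets borel" by (intro borel_closed closed_Times) simp_all
    have A1: "?A1 \<in> sets borel" by (intro borel_closed closed_Times) simp_all
    have "dir_prob ({u - x..u + x} \<times> UNIV) w \<delta> \<le> measure M
       ({\<omega>\<in>space M. (X 0 \<omega>, norm (G \<omega> 0)) \<in> ?A0 \<and> \<bar>G \<omega> 0 \<bullet> w\<bar> \<le> \<delta>} \<union> {\<omega>\<in>space M. (X 0 \<omega>, norm (G \<omega> 0)) \<in> ?A1 \<and> \<bar>G \<omega> 0 \<bullet> w\<bar> \<le> \<delta>})"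
      unfolding dir_prob_def by (rule finite_measure_mono) (use A0 A1 in auto)
    also have "\<dots> \<le> dir_prob ?A0 w \<delta> + dir_prob ?A1 w \<delta>"
      unfolding dir_prob_def by (rule measure_Un_le) (use A0 A1 in measurable)
    finally have split: "dir_prob ({u - x..u + x} \<times> UNIV) w \<delta> \<le> dir_prob ?A0 w \<delta> + dir_prob ?A1 w \<delta>" .
    have 0: "dir_prob ?A0 w \<delta> \<le> B * (2 * x) * (2 * ?w) * \<delta>"
    proof -
      let ?D = "{g::real^'n. pr w g \<in> cball 0 1 \<and> - \<delta> \<le> g \<bullet> w \<and> g \<bullet> w \<le> \<delta>}"
      have D: "closed ?D"
        unfolding mem_cball
        by (intro closed_Collect_conj closed_Collect_le continuous_intros)
      have S: "{u - x..u + x} \<times> ?D \<in> sets borel" using D by (intro borel_closed closed_Times) auto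
      have vD: "emeasure lborel ?D = ennreal (2 * \<delta> * ?w)"
      proof -
        have "emeasure lborel ?D = ennreal (\<delta> - - \<delta>) * emeasure lborel {x \<in> slab w. pr w x \<in> cball 0 1}"
          by (rule emeasure_layer[OF w]) (use \<delta> in auto)
        also have "emeasure lborel {x \<in> slab w. pr w x \<in> cball 0 1} = disc_vol w 1" by (simp add: disc_vol_def)
        also have "\<dots> = ennreal ?w" using disc_vol_eq[OF w, of 1] by simp
        finally show ?thesis using \<delta> by (simp add: ennreal_mult')
      qed
      have "ennreal (dir_prob ?A0 w \<delta>) \<le> emeasure M {\<omega>\<in>space M. (X 0 \<omega>, G \<omega> 0) \<in> {u - x..u + x} \<times> ?D}"
        unfolding dir_prob_def emeasure_eq_measure[symmetric]
        using norm_pr_le[OF w]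
        by (intro emeasure_mono) (use S in \<open>auto simp: abs_le_iff intro: order_trans\<close>)
      also have "\<dots> \<le> ennreal B * emeasure lborel ({u - x..u + x} \<times> ?D)" by (rule dens[OF S])
      also have "emeasure lborel ({u - x..u + x} \<times> ?D) = emeasure lborel {u - x..u + x} * emeasure lborel ?D"
        unfolding lborel_prod[symmetric] by (rule lborel.emeasure_pair_measure_Times) (use D in auto)
      also have "\<dots> = ennreal (2 * x) * ennreal (2 * \<delta> * ?w)" unfolding vD using x by simp
      also have "\<dots> = ennreal (2 * x * (2 * \<delta> * ?w))" by (rule ennreal_mult'[symmetric]) (use x in simp)
      also have "ennreal B * \<dots> = ennreal (B * (2 * x * (2 * \<delta> * ?w)))"
        using B_pos by (simp add: ennreal_mult')
      finally have "dir_prob ?A0 w \<delta> \<le> B * (2 * x * (2 * \<delta> * ?w))"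
        using B_pos x \<delta> by (subst (asm) ennreal_le_iff) (auto intro!: mult_nonneg_nonneg)
      then show ?thesis by (simp add: mult_ac)
    qed
    have 1: "dir_prob ?A1 w \<delta> \<le> 4 * Z / r * \<delta>"
    proof -
      have "ennreal r * ennreal (dir_prob ?A1 w \<delta>)
        \<le> (\<integral>\<^sup>+\<omega>. indicator {\<omega>. (X 0 \<omega>, norm (G \<omega> 0)) \<in> ?A1} \<omega> * band_vol (2 * \<delta>) (G \<omega> 0) \<partial>M)"
        using band_average(1)[OF A1 w, of "2 * \<delta>"] \<delta> r by simp
      also have "\<dots> \<le> (\<integral>\<^sup>+\<omega>. ennreal (2 * (2 * \<delta>) * Z) \<partial>M)"
      proof (rule nn_integral_mono)
        fix \<omega>
        show "indicator {\<omega>. (X 0 \<omega>, norm (G \<omega> 0)) \<in> ?A1} \<omega> * band_vol (2 * \<delta>) (G \<omega> 0) \<le> ennreal (2 * (2 * \<delta>) * Z)"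
        proof (cases "1 \<le> norm (G \<omega> 0)")
          case True
          then have g: "G \<omega> 0 \<noteq> 0" by auto
          have "2 * \<delta> / norm (G \<omega> 0) \<le> 2 * \<delta> / 1" using \<delta> True by (intro divide_left_mono) auto
          then have "band_vol (2 * \<delta>) (G \<omega> 0) \<le> band_vol (2 * \<delta>) ((1 / norm (G \<omega> 0)) *\<^sub>R G \<omega> 0)"
            unfolding band_vol_normalize[OF g] by (intro band_vol_mono) simp
          also have "\<dots> \<le> ennreal (2 * (2 * \<delta>) * Z)"
            unfolding Z_def by (rule band_vol_le) (use g \<delta> in auto)
          finally show ?thesis by (simp add: indicator_def)
        qed (simp add: indicator_def)
      qed
      also have "\<dots> = ennreal (2 * (2 * \<delta>) * Z)" using emeasure_space_1 by simp
      finally have "ennreal (r * dir_prob ?A1 w \<delta>) \<le> ennreal (2 * (2 * \<delta>) * Z)"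
        using r by (simp add: ennreal_mult')
      then have "r * dir_prob ?A1 w \<delta> \<le> 2 * (2 * \<delta>) * Z"
        using \<delta> Z by (subst (asm) ennreal_le_iff) auto
      then show ?thesis using r(1) by (simp add: field_simps)
    qed
    show ?thesis using split 0 1 by (simp add: C_def distrib_right)
  qed
  then show ?thesis using C by blast
qed

end

section \<open>Small ball probabilities on a line\<close>

context c2_field begin

text \<open>By \<open>dir_prob_quasi_linear\<close> the probability of \<open>\<bar>X - u\<bar> \<le> x\<close> together with a component of the gradient of
  size at most \<open>y\<close> is bounded by \<open>y / \<delta>\<close> times the one for \<open>\<delta>\<close>. As \<open>\<delta>\<close> tends to zero, the latter is
  the conditional probability, of order \<open>x\<close>, times the probability of the condition. This last probability is of order
  \<open>\<delta>\<close>: conditionally the value lies with probability at least \<open>1 / 2\<close> in some bounded interval,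
  and for such values \<open>dir_prob_linear\<close> applies.\<close>

theorem small_ball:
  assumes w: "norm w = 1"
    and cd: "has_cond_density M (X 0) (\<lambda>\<omega>. G \<omega> 0 \<bullet> w) 0 p" and pB: "\<And>x. p x \<le> ennreal b"
  shows "\<exists>C>0. \<forall>t x y. 0 < x \<and> 0 < y \<longrightarrow>
    measure M {\<omega>\<in>space M. \<bar>X t \<omega> - u\<bar> \<le> x \<and> \<bar>G \<omega> t \<bullet> w\<bar> \<le> y} \<le> C * (x * y)"
proof -
  define N where "N = density lborel p"
  have pm[measurable]: "p \<in> borel_measurable borel" and "prob_space N"
    using cd by (auto simp: has_cond_density_def N_def)
  interpret N: prob_space N by fact
  have sN[simp]: "sets N = sets borel" "space N = UNIV" by (auto simp: N_def)
  define b1 where "b1 = max b 0"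
  have b1: "b1 \<ge> 0" "\<And>x. p x \<le> ennreal b1"
    using pB by (auto simp: b1_def intro: order_trans[OF _ ennreal_leI])
  define \<kappa> where "\<kappa> \<delta> = measure M {\<omega>\<in>space M. \<bar>G \<omega> 0 \<bullet> w\<bar> \<le> \<delta>}" for \<delta>
  \<comment> \<open>The ratio \<open>D a c \<delta> / \<kappa> \<delta>\<close> is the conditional probability of a value in \<open>{a<..c}\<close>.\<close>
  define D where "D a c \<delta> = measure M {\<omega>\<in>space M. (a < X 0 \<omega> \<and> X 0 \<omega> \<le> c) \<and> \<bar>G \<omega> 0 \<bullet> w\<bar> \<le> \<delta>}" for a c \<delta>
  have inner_meas[measurable]: "(\<lambda>\<omega>. G \<omega> t \<bullet> w) \<in> borel_measurable M" for t by measurable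
  have N_diff: "measure N {..c} - measure N {..a} = measure N {a<..c}" if "a \<le> c" for a c
  proof -
    have "measure N ({..c} - {..a}) = measure N {..c} - measure N {..a}"
      by (rule N.finite_measure_Diff) (use that in auto)
    moreover have "{..c} - {..a} = {a<..c}" by auto
    ultimately show ?thesis by simp
  qed
  have lim: "((\<lambda>\<delta>. D a c \<delta> / \<kappa> \<delta>) \<longlongrightarrow> measure N {a<..c}) (at_right 0)" if ac: "a \<le> c" for a c
  proof -
    have "D a c \<delta> / \<kappa> \<delta> = cond_prob M (\<lambda>\<omega>. X 0 \<omega> \<le> c) (\<lambda>\<omega>. \<bar>G \<omega> 0 \<bullet> w - 0\<bar> \<le> \<delta>)
        - cond_prob M (\<lambda>\<omega>. X 0 \<omega> \<le> a) (\<lambda>\<omega>. \<bar>G \<omega> 0 \<bullet> w - 0\<bar> \<le> \<delta>)" for \<delta>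
    proof -
      let ?S = "\<lambda>c. {\<omega>\<in>space M. X 0 \<omega> \<le> c \<and> \<bar>G \<omega> 0 \<bullet> w\<bar> \<le> \<delta>}"
      have "measure M (?S c - ?S a) = measure M (?S c) - measure M (?S a)"
        by (rule finite_measure_Diff) (use ac in auto)
      moreover have "?S c - ?S a = {\<omega>\<in>space M. (a < X 0 \<omega> \<and> X 0 \<omega> \<le> c) \<and> \<bar>G \<omega> 0 \<bullet> w\<bar> \<le> \<delta>}" by auto
      ultimately have "D a c \<delta> = measure M (?S c) - measure M (?S a)" by (simp only: D_def)
      then show ?thesis by (simp add: cond_prob_def \<kappa>_def diff_divide_distrib)
    qed
    moreover have "((\<lambda>\<delta>. cond_prob M (\<lambda>\<omega>. X 0 \<omega> \<le> c) (\<lambda>\<omega>. \<bar>G \<omega> 0 \<bullet> w - 0\<bar> \<le> \<delta>)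
        - cond_prob M (\<lambda>\<omega>. X 0 \<omega> \<le> a) (\<lambda>\<omega>. \<bar>G \<omega> 0 \<bullet> w - 0\<bar> \<le> \<delta>)) \<longlongrightarrow> measure N {..c} - measure N {..a}) (at_right 0)"
      using cd by (intro tendsto_diff) (auto simp: has_cond_density_def N_def)
    ultimately show ?thesis by (simp only: N_diff[OF ac])
  qed
  have N_le: "measure N {a<..c} \<le> b1 * (c - a)" if ac: "a \<le> c" for a c
  proof -
    have "emeasure N {a<..c} = (\<integral>\<^sup>+x. p x * indicator {a<..c} x \<partial>lborel)"
      unfolding N_def by (rule emeasure_density) auto
    also have "\<dots> \<le> (\<integral>\<^sup>+x. ennreal b1 * indicator {a<..c} x \<partial>lborel)"
      by (intro nn_integral_mono mult_right_mono b1) auto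
    also have "\<dots> = ennreal b1 * emeasure lborel {a<..c}"
      by (rule nn_integral_cmult_indicator) simp
    also have "\<dots> = ennreal (b1 * (c - a))"
      using ac b1(1) by (simp add: ennreal_mult')
    finally show ?thesis using ac b1(1) by (simp add: N.emeasure_eq_measure)
  qed
  obtain n :: nat where n: "measure N {u - real n<..u + real n} > 1 / 2"
  proof -
    have "(\<lambda>n. measure N {u - real n<..u + real n}) \<longlonglongrightarrow> measure N (\<Union>n. {u - real n<..u + real n})"
      by (rule N.finite_Lim_measure_incseq) (auto simp: incseq_def)
    moreover have "(\<Union>n. {u - real n<..u + real n}) = UNIV"
    proof (rule UNIV_eq_I[symmetric], rule UN_I[OF UNIV_I])
      fix z :: real
      have "\<bar>z - u\<bar> < real (nat \<lfloor>\<bar>z - u\<bar>\<rfloor> + 1)" by linarith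
      then show "z \<in> {u - real (nat \<lfloor>\<bar>z - u\<bar>\<rfloor> + 1)<..u + real (nat \<lfloor>\<bar>z - u\<bar>\<rfloor> + 1)}" by (auto simp: abs_less_iff)
    qed
    moreover have "measure N UNIV = 1" using N.prob_space by simp
    ultimately have "(\<lambda>n. measure N {u - real n<..u + real n}) \<longlonglongrightarrow> 1" by simp
    from order_tendstoD(1)[OF this, of "1/2"] obtain n where "measure N {u - real n<..u + real n} > 1 / 2"
      by (auto simp: eventually_sequentially)
    then show ?thesis by (rule that)
  qed
  obtain C where C: "C > 0" "\<And>\<delta>. \<delta> > 0 \<Longrightarrow> dir_prob ({u - real n..u + real n} \<times> UNIV) w \<delta> \<le> C * \<delta>"
    using dir_prob_linear[OF w, of "real n" u] by auto
  obtain K where K: "K > 0" "\<And>A \<delta> y. A \<in> sets borel \<Longrightarrow> 0 < \<delta> \<Longrightarrow> \<delta> \<le> y \<Longrightarrow>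
      dir_prob A w (y / 2) \<le> K * (y / \<delta>) * dir_prob A w \<delta>"
    using dir_prob_quasi_linear[OF w] by blast
  have box[measurable]: "{a..c} \<times> (UNIV::real set) \<in> sets borel" for a c :: real
    by (intro borel_closed closed_Times) auto
  have ev1: "eventually (\<lambda>\<delta>. 0 < \<kappa> \<delta> \<and> \<kappa> \<delta> \<le> 2 * C * \<delta>) (at_right 0)"
  proof -
    have "eventually (\<lambda>\<delta>. 1 / 2 < D (u - real n) (u + real n) \<delta> / \<kappa> \<delta>) (at_right 0)"
      by (rule order_tendstoD(1)[OF lim n]) simp
    moreover have "eventually (\<lambda>\<delta>::real. 0 < \<delta>) (at_right 0)" by (simp add: eventually_at_filter)
    ultimately show ?thesis
    proof eventually_elim
      case (elim \<delta>)
      have "\<kappa> \<delta> \<noteq> 0" using elim(1) by auto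
      moreover have "\<kappa> \<delta> \<ge> 0" by (simp add: \<kappa>_def)
      ultimately have k: "\<kappa> \<delta> > 0" by simp
      then have "\<kappa> \<delta> < 2 * D (u - real n) (u + real n) \<delta>" using elim(1) by (simp add: field_simps)
      also have "D (u - real n) (u + real n) \<delta> \<le> dir_prob ({u - real n..u + real n} \<times> UNIV) w \<delta>"
        unfolding D_def dir_prob_def by (rule finite_measure_mono) auto
      also have "\<dots> \<le> C * \<delta>" by (rule C(2)[OF elim(2)])
      finally show ?case using k by simp
    qed
  qed
  \<comment> \<open>The interval from \<open>u - 2 * x\<close> contains \<open>{u - x..u + x}\<close> although it is open on the left; its length \<open>3 * x\<close> and the factors \<open>2\<close> from \<open>y / 2\<close> and from \<open>ev1\<close> make up \<open>12\<close>.\<close>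
  define C1 where "C1 = 12 * K * C * b1 + 1"
  have C1: "C1 > 0" unfolding C1_def using K C b1 by (intro add_nonneg_pos) auto
  have at0: "dir_prob ({u - x..u + x} \<times> UNIV) w y \<le> C1 * (x * y)" if x: "0 < x" and y: "0 < y" for x y
  proof -
    let ?J = "{u - x..u + x} \<times> (UNIV::real set)"
    have "eventually (\<lambda>\<delta>. dir_prob ?J w y \<le> 4 * K * C * y * (D (u - 2 * x) (u + x) \<delta> / \<kappa> \<delta>)) (at_right 0)"
    proof -
      have "eventually (\<lambda>\<delta>. \<delta> \<in> {0<..<2 * y}) (at_right 0)"
        by (rule eventually_at_right_real) (use y in simp)
      with ev1 show ?thesis
      proof eventually_elim
        case (elim \<delta>)
        have k: "0 < \<kappa> \<delta>" "\<kappa> \<delta> \<le> 2 * C * \<delta>" and d: "0 < \<delta>" "\<delta> \<le> 2 * y" using elim by auto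
        have "dir_prob ?J w (2 * y / 2) \<le> K * (2 * y / \<delta>) * dir_prob ?J w \<delta>" by (rule K(2)[OF box d])
        also have "\<dots> \<le> K * (2 * y / \<delta>) * D (u - 2 * x) (u + x) \<delta>"
        proof (rule mult_left_mono)
          show "dir_prob ?J w \<delta> \<le> D (u - 2 * x) (u + x) \<delta>"
            unfolding D_def dir_prob_def by (rule finite_measure_mono) (use x in auto)
        qed (use K d y in simp)
        also have "\<dots> = K * 2 * y * (D (u - 2 * x) (u + x) \<delta> / \<kappa> \<delta>) * (\<kappa> \<delta> / \<delta>)"
          using k d by simp
        also have "\<dots> \<le> K * 2 * y * (D (u - 2 * x) (u + x) \<delta> / \<kappa> \<delta>) * (2 * C)"
        proof (rule mult_left_mono)
          show "\<kappa> \<delta> / \<delta> \<le> 2 * C" using k d by (simp add: field_simps)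
          show "0 \<le> K * 2 * y * (D (u - 2 * x) (u + x) \<delta> / \<kappa> \<delta>)"
            using K y k by (simp add: D_def)
        qed
        finally show ?case by (simp add: mult_ac)
      qed
    qed
    moreover have "((\<lambda>\<delta>. 4 * K * C * y * (D (u - 2 * x) (u + x) \<delta> / \<kappa> \<delta>)) \<longlongrightarrow> 4 * K * C * y * measure N {u - 2 * x<..u + x}) (at_right 0)"
      by (intro tendsto_mult_left lim) (use x in simp)
    ultimately have "dir_prob ?J w y \<le> 4 * K * C * y * measure N {u - 2 * x<..u + x}"
      by (intro tendsto_lowerbound[where F="at_right (0::real)"]) auto
    also have "\<dots> \<le> 4 * K * C * y * (b1 * (u + x - (u - 2 * x)))"
      using K C y x by (intro mult_left_mono N_le) auto
    also have "\<dots> = 12 * K * C * b1 * (x * y)" by (simp add: algebra_simps)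
    also have "\<dots> \<le> C1 * (x * y)" using x y by (intro mult_right_mono) (auto simp: C1_def)
    finally show ?thesis .
  qed
  have "measure M {\<omega>\<in>space M. \<bar>X t \<omega> - u\<bar> \<le> x \<and> \<bar>G \<omega> t \<bullet> w\<bar> \<le> y} \<le> C1 * (x * y)"
    if x: "0 < x" and y: "0 < y" for t x y
  proof -
    let ?A = "{u - x..u + x} \<times> {g::real^'n. \<bar>g \<bullet> w\<bar> \<le> y}"
    have A: "?A \<in> sets borel"
      by (intro borel_closed closed_Times closed_Collect_le continuous_intros)
    have e: "{\<omega>\<in>space M. \<bar>X t \<omega> - u\<bar> \<le> x \<and> \<bar>G \<omega> t \<bullet> w\<bar> \<le> y} = {\<omega>\<in>space M. (X t \<omega>, G \<omega> t) \<in> ?A}"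
      for t by auto
    have "measure M {\<omega>\<in>space M. \<bar>X t \<omega> - u\<bar> \<le> x \<and> \<bar>G \<omega> t \<bullet> w\<bar> \<le> y}
      = measure M {\<omega>\<in>space M. \<bar>X 0 \<omega> - u\<bar> \<le> x \<and> \<bar>G \<omega> 0 \<bullet> w\<bar> \<le> y}"
      unfolding e measure_def value_grad_shift[OF A, of t] ..
    also have "\<dots> = dir_prob ({u - x..u + x} \<times> UNIV) w y"
      unfolding dir_prob_def by (rule arg_cong[where f="measure M"]) auto
    also have "\<dots> \<le> C1 * (x * y)" by (rule at0[OF x y])
    finally show ?thesis .
  qed
  then show ?thesis using C1 by blast
qed

end

section \<open>Upcrossings of a smooth function on a grid\<close>

definition upcross :: "real \<Rightarrow> (nat \<Rightarrow> real) \<Rightarrow> nat \<Rightarrow> real" where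
  "upcross u v n = (if v n \<le> u \<and> u < v (Suc n) then 1 else 0)"

lemma sum_upcross: "finite A \<Longrightarrow> (\<Sum>n\<in>A. upcross u v n) = real (card {n\<in>A. v n \<le> u \<and> u < v (Suc n)})"
  by (simp add: upcross_def sum.If_cases Int_def)

text \<open>If there are more upcrossings in single steps than over the whole range, then the sequence changes sides at
  least twice: an upcrossing in a single step is followed or preceded by a value on the wrong side, which is found at
  one of the two ends or at another upcrossing.\<close>

lemma two_turns:
  fixes v :: "nat \<Rightarrow> real"
  assumes "(if v a \<le> u \<and> u < v c then 1 else 0) < card {n\<in>{a..<c}. v n \<le> u \<and> u < v (Suc n)}"
  shows "\<exists>i j k. a \<le> i \<and> i < j \<and> j < k \<and> k \<le> c \<and>
    ((v i \<le> u \<and> u < v j \<and> v k \<le> u) \<or> (u < v i \<and> v j \<le> u \<and> u < v k))"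
    and "\<exists>n. a \<le> n \<and> n < c \<and> v n \<le> u \<and> u < v (Suc n)"
proof -
  let ?S = "{n\<in>{a..<c}. v n \<le> u \<and> u < v (Suc n)}"
  have fS: "finite ?S" by simp
  have "card ?S > 0" using assms by linarith
  then have "?S \<noteq> {}" by (metis card.empty less_irrefl)
  then obtain n where n: "a \<le> n" "n < c" "v n \<le> u" "u < v (Suc n)" by auto
  then show "\<exists>n. a \<le> n \<and> n < c \<and> v n \<le> u \<and> u < v (Suc n)" by blast
  consider "v c \<le> u" | "u < v c" "u < v a" | "u < v c" "v a \<le> u" by linarith
  then show "\<exists>i j k. a \<le> i \<and> i < j \<and> j < k \<and> k \<le> c \<and>
    ((v i \<le> u \<and> u < v j \<and> v k \<le> u) \<or> (u < v i \<and> v j \<le> u \<and> u < v k))"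
  proof cases
    case 1
    then have "Suc n \<noteq> c" using n by auto
    then show ?thesis using 1 n by (intro exI[of _ n] exI[of _ "Suc n"] exI[of _ c]) auto
  next
    case 2
    then have "a \<noteq> n" using n by auto
    then show ?thesis using 2 n by (intro exI[of _ a] exI[of _ n] exI[of _ "Suc n"]) auto
  next
    case 3
    have "1 < card ?S" using assms 3 by simp
    then have "\<exists>i\<in>?S. \<exists>j\<in>?S. i \<noteq> j"
      by (metis (no_types, lifting) card_le_Suc0_iff_eq fS not_less One_nat_def)
    then obtain i j where "i \<in> ?S" "j \<in> ?S" "i \<noteq> j" by blast
    then obtain i j where ij: "i \<in> ?S" "j \<in> ?S" "i < j" by (metis (no_types, lifting) linorder_neqE_nat)
    then have "Suc i \<noteq> j" by auto
    then show ?thesis using ij by (intro exI[of _ i] exI[of _ "Suc i"] exI[of _ j]) auto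
  qed
qed

text \<open>The maximum on the interval is attained in its interior.\<close>

lemma interior_critical:
  fixes f f' :: "real \<Rightarrow> real"
  assumes f: "\<And>s. (f has_real_derivative f' s) (at s)"
    and t: "t1 < t2" "t2 < t3" "f t1 < f t2" "f t3 < f t2"
  shows "\<exists>\<tau>. t1 < \<tau> \<and> \<tau> < t3 \<and> f' \<tau> = 0"
proof -
  have c: "continuous_on {t1..t3} f"
    using f by (intro DERIV_continuous_on) (rule has_field_derivative_at_within)
  have "compact {t1..t3}" "{t1..t3} \<noteq> {}" using t by auto
  from continuous_attains_sup[OF this c] obtain \<tau> where
    \<tau>: "\<tau> \<in> {t1..t3}" "\<And>y. y \<in> {t1..t3} \<Longrightarrow> f y \<le> f \<tau>" by blast
  have "f t2 \<le> f \<tau>" using t by (intro \<tau>(2)) auto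
  then have "\<tau> \<noteq> t1" "\<tau> \<noteq> t3" using t by auto
  then have in': "t1 < \<tau>" "\<tau> < t3" using \<tau>(1) by auto
  have "f' \<tau> = 0"
  proof (rule DERIV_local_max[OF f[of \<tau>]])
    show "0 < min (\<tau> - t1) (t3 - \<tau>)" using in' by simp
    show "\<forall>y. \<bar>\<tau> - y\<bar> < min (\<tau> - t1) (t3 - \<tau>) \<longrightarrow> f y \<le> f \<tau>"
      by (intro allI impI \<tau>(2)) auto
  qed
  then show ?thesis using in' by blast
qed

text \<open>The path turns in the interval and meets the level in it. The derivative vanishes at the turning
  point, so it is small on the whole interval, and therefore the value is everywhere close to \<open>u\<close>.\<close>

lemma excess_small:
  fixes f f' :: "real \<Rightarrow> real"
  assumes f: "\<And>s. (f has_real_derivative f' s) (at s)"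
    and h: "h > 0" and m: "m > 0"
    and lip: "\<And>s t. s \<in> {real a * h..real (a + m) * h} \<Longrightarrow> t \<in> {real a * h..real (a + m) * h}
      \<Longrightarrow> \<bar>f' s - f' t\<bar> \<le> L * \<bar>s - t\<bar>"
    and L: "L \<ge> 0"
    and ex: "(if f (real a * h) \<le> u \<and> u < f (real (a + m) * h) then 1 else 0)
      < (\<Sum>n\<in>{a..<a + m}. upcross u (\<lambda>n. f (real n * h)) n)"
  shows "\<bar>f (real a * h) - u\<bar> \<le> L * (real m * h)\<^sup>2 \<and> \<bar>f' (real a * h)\<bar> \<le> L * (real m * h)"
proof -
  let ?v = "\<lambda>n. f (real n * h)"
  let ?I = "{real a * h..real (a + m) * h}"
  let ?q = "real m * h"
  have ex': "(if ?v a \<le> u \<and> u < ?v (a + m) then 1 else 0) < card {n\<in>{a..<a+m}. ?v n \<le> u \<and> u < ?v (Suc n)}"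
    using ex by (subst (asm) sum_upcross) (auto split: if_splits)
  obtain i j k where ijk: "a \<le> i" "i < j" "j < k" "k \<le> a + m"
    "(?v i \<le> u \<and> u < ?v j \<and> ?v k \<le> u) \<or> (u < ?v i \<and> ?v j \<le> u \<and> u < ?v k)"
    using two_turns(1)[OF ex'] by blast
  obtain n where n: "a \<le> n" "n < a + m" "?v n \<le> u" "u < ?v (Suc n)"
    using two_turns(2)[OF ex'] by blast
  have tm: "real x * h \<le> real y * h \<longleftrightarrow> x \<le> y" "real x * h < real y * h \<longleftrightarrow> x < y" for x y
    using h by simp_all
  have "\<exists>\<tau>. real i * h < \<tau> \<and> \<tau> < real k * h \<and> f' \<tau> = 0"
  proof (cases "u < ?v j \<and> ?v i \<le> u \<and> ?v k \<le> u")
    case True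
    then show ?thesis by (intro interior_critical[OF f, of _ "real j * h"]) (use ijk(2,3) tm in auto)
  next
    case False
    then have g: "u < ?v i" "?v j \<le> u" "u < ?v k" using ijk(5) by auto
    have "((\<lambda>s. - f s) has_real_derivative (- f' s)) (at s)" for s by (rule DERIV_minus[OF f])
    then have "\<exists>\<tau>. real i * h < \<tau> \<and> \<tau> < real k * h \<and> - f' \<tau> = 0"
      by (intro interior_critical[where f="\<lambda>s. - f s" and ?t2.0="real j * h"]) (use ijk(2,3) tm g in auto)
    then show ?thesis by simp
  qed
  then obtain \<tau> where \<tau>: "real i * h < \<tau>" "\<tau> < real k * h" "f' \<tau> = 0" by blast
  have \<tau>I: "\<tau> \<in> ?I" using \<tau> ijk(1,4) tm(1)[of a i] tm(1)[of k "a + m"] by auto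
  have aI: "real a * h \<in> ?I" using tm(1)[of a "a + m"] by simp
  have len: "\<bar>s - t\<bar> \<le> ?q" if "s \<in> ?I" "t \<in> ?I" for s t
    using that by (auto simp: algebra_simps abs_le_iff)
  have small: "\<bar>f' s\<bar> \<le> L * ?q" if s: "s \<in> ?I" for s
  proof -
    have "\<bar>f' s - f' \<tau>\<bar> \<le> L * \<bar>s - \<tau>\<bar>" by (rule lip[OF s \<tau>I])
    also have "\<dots> \<le> L * ?q" using L len[OF s \<tau>I] by (rule mult_left_mono[rotated])
    finally show ?thesis using \<tau>(3) by simp
  qed
  have "\<exists>z. real n * h \<le> z \<and> z \<le> real (Suc n) * h \<and> f z = u"
  proof (rule IVT')
    show "f (real n * h) \<le> u" "u \<le> f (real (Suc n) * h)" using n by linarith+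
    show "real n * h \<le> real (Suc n) * h" unfolding tm by simp
    show "continuous_on {real n * h..real (Suc n) * h} f"
      by (rule DERIV_continuous_on) (rule has_field_derivative_at_within[OF f])
  qed
  then obtain z where z: "real n * h \<le> z" "z \<le> real (Suc n) * h" "f z = u" by blast
  have zI: "z \<in> ?I" using z(1,2) n(1,2) tm(1)[of a n] tm(1)[of "Suc n" "a + m"] by auto
  have "norm (f (real a * h) - f z) \<le> L * ?q * norm (real a * h - z)"
  proof (rule field_differentiable_bound[of ?I])
    show "(f has_field_derivative f' s) (at s within ?I)" for s
      by (rule has_field_derivative_at_within[OF f])
  qed (use small aI zI in auto)
  also have "\<dots> \<le> L * ?q * ?q" using L h len[OF aI zI] by (intro mult_left_mono) auto
  finally show ?thesis using small[OF aI] z(3) by (simp add: power2_eq_square mult.assoc)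
qed

lemma lipschitz_from_grid:
  fixes g :: "real \<Rightarrow> real"
  assumes g: "continuous_on UNIV g"
    and grid: "\<And>n i j. i \<le> Suc n \<Longrightarrow> j \<le> Suc n \<Longrightarrow>
      \<bar>g (real i / real (Suc n)) - g (real j / real (Suc n))\<bar> \<le> L * \<bar>real i / real (Suc n) - real j / real (Suc n)\<bar>"
    and st: "s \<in> {0..1}" "t \<in> {0..1}"
  shows "\<bar>g s - g t\<bar> \<le> L * \<bar>s - t\<bar>"
proof -
  define r where "r s n = real (nat \<lfloor>real (Suc n) * s\<rfloor>) / real (Suc n)" for s n
  have le: "nat \<lfloor>real (Suc n) * s\<rfloor> \<le> Suc n" if "s \<in> {0..1}" for s n
  proof -
    have "real (Suc n) * s \<le> real (Suc n) * 1" using that by (intro mult_left_mono) auto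
    then have "\<lfloor>real (Suc n) * s\<rfloor> \<le> \<lfloor>real (Suc n)\<rfloor>" by (intro floor_mono) simp
    then show ?thesis by simp
  qed
  have lim: "r s \<longlonglongrightarrow> s" if s: "s \<in> {0..1}" for s
  proof -
    have "\<bar>r s n - s\<bar> \<le> inverse (real (Suc n))" for n
    proof -
      define y where "y = real (Suc n) * s"
      have "y \<ge> 0" using s by (simp add: y_def)
      then have "r s n - s = (of_int \<lfloor>y\<rfloor> - y) / real (Suc n)"
        by (simp add: r_def y_def diff_divide_distrib)
      then have "\<bar>r s n - s\<bar> = \<bar>of_int \<lfloor>y\<rfloor> - y\<bar> / real (Suc n)"
        by (simp only: abs_divide abs_of_nat)
      also have "\<dots> \<le> 1 / real (Suc n)"
        by (rule divide_right_mono) (linarith, simp)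
      finally show ?thesis by (simp only: inverse_eq_divide)
    qed
    then have "(\<lambda>n. r s n - s) \<longlonglongrightarrow> 0"
      by (intro tendsto_rabs_zero_cancel[OF tendsto_sandwich[OF _ _ tendsto_const LIMSEQ_inverse_real_of_nat]]) auto
    then show ?thesis by (simp add: LIM_zero_iff)
  qed
  have gl: "(\<lambda>n. g (r s n)) \<longlonglongrightarrow> g s" if "s \<in> {0..1}" for s
    using g lim[OF that] by (intro isCont_tendsto_compose[of s g]) (auto simp: continuous_on_eq_continuous_at)
  have "\<bar>g (r s n) - g (r t n)\<bar> \<le> L * \<bar>r s n - r t n\<bar>" for n
    unfolding r_def by (rule grid) (use le st in auto)
  moreover have "(\<lambda>n. \<bar>g (r s n) - g (r t n)\<bar>) \<longlonglongrightarrow> \<bar>g s - g t\<bar>"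
    by (intro tendsto_intros gl st)
  moreover have "(\<lambda>n. L * \<bar>r s n - r t n\<bar>) \<longlonglongrightarrow> L * \<bar>s - t\<bar>"
    by (intro tendsto_intros lim st)
  ultimately show ?thesis by (intro LIMSEQ_le) auto
qed

lemma powr_cut:
  fixes x :: real
  assumes x: "0 \<le> x" and l: "\<Lambda> > 0" "\<Lambda> < x" and p: "p \<ge> 1"
  shows "x \<le> \<Lambda> powr (1 - p) * x powr p"
proof -
  have "1 \<le> (x / \<Lambda>) powr (p - 1)" using l p by (intro ge_one_powr_ge_zero) auto
  then have "x * 1 \<le> x * (x / \<Lambda>) powr (p - 1)" using x by (intro mult_left_mono) auto
  also have "\<dots> = \<Lambda> powr (1 - p) * x powr p"
  proof -
    have "(x / \<Lambda>) powr (p - 1) = x powr (p - 1) * \<Lambda> powr (1 - p)"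
      using l by (simp add: powr_divide powr_minus_divide[of \<Lambda> "p - 1", simplified])
    moreover have "x * x powr (p - 1) = x powr p" using l x by (simp add: powr_mult_base)
    ultimately show ?thesis by (simp add: mult_ac)
  qed
  finally show ?thesis by simp
qed

text \<open>The number of upcrossings on the fine grid, compared with that on the coarse grid of \<open>k\<close> blocks of \<open>m\<close>
  steps. If the total exceeds \<open>\<Lambda>\<close>, it is bounded by its power of order \<open>p\<close>. Otherwise it is at most \<open>\<Lambda>\<close>,
  and so is the number in each block; and by \<open>excess_small\<close> a block with an excess either starts near a
  critical point or the derivative is rough.\<close>

lemma path_excess_bound:
  fixes f f' :: "real \<Rightarrow> real"
  assumes f: "\<And>s. (f has_real_derivative f' s) (at s)"
    and h: "h > 0" and m: "m > 0" and k1: "real (k * m) * h \<le> 1"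
    and l: "\<Lambda> > 0" and p: "p \<ge> 1" and L: "L \<ge> 0"
    and W: "W = (\<Sum>n<k * m. upcross u (\<lambda>n. f (real n * h)) n)"
  shows "W \<le> (\<Sum>i<k. if f (real (i * m) * h) \<le> u \<and> u < f (real (i * m + m) * h) then 1 else 0)
    + \<Lambda> * ((if \<exists>s\<in>{0..1}. \<exists>t\<in>{0..1}. L * \<bar>s - t\<bar> < \<bar>f' s - f' t\<bar> then 1 else 0)
       + (\<Sum>i<k. if \<bar>f (real (i * m) * h) - u\<bar> \<le> L * (real m * h)\<^sup>2 \<and> \<bar>f' (real (i * m) * h)\<bar> \<le> L * (real m * h) then 1 else 0))
    + \<Lambda> powr (1 - p) * W powr p"
    (is "_ \<le> sum ?b _ + \<Lambda> * (?E + sum ?c _) + ?R")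
proof -
  let ?v = "\<lambda>n. f (real n * h)"
  define U where "U i = (\<Sum>n\<in>{i * m..<i * m + m}. upcross u ?v n)" for i
  have up0: "0 \<le> upcross u ?v n" for n by (simp add: upcross_def)
  have U0: "0 \<le> U i" for i unfolding U_def by (intro sum_nonneg up0)
  have WU: "W = (\<Sum>i<k. U i)" unfolding W U_def by (rule sum.nat_group[symmetric])
  have W0: "0 \<le> W" unfolding WU by (intro sum_nonneg U0)
  have b0: "0 \<le> sum ?b {..<k}" by (intro sum_nonneg) auto
  have c0: "0 \<le> sum ?c {..<k}" by (intro sum_nonneg) auto
  have R0: "0 \<le> ?R" by simp
  show ?thesis
  proof (cases "\<Lambda> < W")
    case True
    have lc: "0 \<le> \<Lambda> * (?E + sum ?c {..<k})" using l c0 by (intro mult_nonneg_nonneg add_nonneg_nonneg) auto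
    have "W \<le> ?R" by (rule powr_cut[OF W0 l True p])
    then show ?thesis using b0 lc by linarith
  next
    case False
    show ?thesis
    proof (cases "\<exists>s\<in>{0..1}. \<exists>t\<in>{0..1}. L * \<bar>s - t\<bar> < \<bar>f' s - f' t\<bar>")
      case True
      have "W \<le> \<Lambda> * 1" using False by simp
      also have "\<dots> \<le> \<Lambda> * (?E + sum ?c {..<k})" using l c0 True by (intro mult_left_mono) auto
      finally show ?thesis using b0 R0 by linarith
    next
      case nl: False
      have lip: "\<bar>f' s - f' t\<bar> \<le> L * \<bar>s - t\<bar>" if "s \<in> {0..1}" "t \<in> {0..1}" for s t
        using nl that by (meson not_le_imp_less)
      have "U i \<le> ?b i + \<Lambda> * ?c i" if i: "i < k" for i
      proof (cases "?b i < U i")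
        case True
        have sub: "{real (i * m) * h..real (i * m + m) * h} \<subseteq> {0..1}"
        proof -
          have "i * m + m \<le> k * m" using i by (metis add.commute mult_Suc mult_le_mono1 Suc_leI)
          then have "real (i * m + m) * h \<le> real (k * m) * h" using h by (intro mult_right_mono) (simp_all only: of_nat_le_iff less_imp_le)
          then have "real (i * m + m) * h \<le> 1" using k1 by linarith
          moreover have "0 \<le> real (i * m) * h" using h by simp
          ultimately show ?thesis by auto
        qed
        have "?c i = 1"
          using excess_small[OF f h m lip L True[unfolded U_def]] sub by (simp add: subset_iff)
        moreover have "U i \<le> W" unfolding WU using i U0 by (intro member_le_sum) auto
        moreover have "0 \<le> ?b i" by simp
        ultimately show ?thesis using \<open>\<not> \<Lambda> < W\<close> by simp
      next
        case False
        then show ?thesis using l by (simp add: not_less) (smt (verit))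
      qed
      then have "W \<le> (\<Sum>i<k. ?b i + \<Lambda> * ?c i)" unfolding WU by (intro sum_mono) simp
      also have "\<dots> = sum ?b {..<k} + \<Lambda> * sum ?c {..<k}" by (simp add: sum.distrib sum_distrib_left)
      also have "\<Lambda> * sum ?c {..<k} \<le> \<Lambda> * (?E + sum ?c {..<k})" using l by (intro mult_left_mono) auto
      finally show ?thesis using R0 by linarith
    qed
  qed
qed

section \<open>Rate of convergence\<close>

context c2_field begin

lemma line_deriv: "((\<lambda>s. X (s *\<^sub>R w) \<omega>) has_real_derivative (G \<omega> (s *\<^sub>R w) \<bullet> w)) (at s)"
proof -
  have "((\<lambda>r. r *\<^sub>R w) has_derivative (\<lambda>r. r *\<^sub>R w)) (at s)" by (auto intro!: derivative_eq_intros)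
  from has_derivative_compose[OF this X_deriv]
  have "((\<lambda>r. X (r *\<^sub>R w) \<omega>) has_derivative (\<lambda>r. G \<omega> (s *\<^sub>R w) \<bullet> (r *\<^sub>R w))) (at s)" .
  then show ?thesis
    by (simp add: has_field_derivative_def mult_commute_abs mult.commute[of "G \<omega> (s *\<^sub>R w) \<bullet> w"])
qed

text \<open>The iterated \<open>deriv\<close> is a genuine second derivative, because the gradient is differentiable.\<close>

lemma line_deriv2:
  "((\<lambda>s. G \<omega> (s *\<^sub>R w) \<bullet> w) has_real_derivative deriv (deriv (\<lambda>s. X (s *\<^sub>R w) \<omega>)) s) (at s)"
proof -
  have d: "deriv (\<lambda>s. X (s *\<^sub>R w) \<omega>) = (\<lambda>s. G \<omega> (s *\<^sub>R w) \<bullet> w)"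
    by (intro ext DERIV_imp_deriv line_deriv)
  obtain D where D: "(G \<omega> has_derivative D) (at (s *\<^sub>R w))" using G_diff by (auto simp: differentiable_def)
  have "((\<lambda>r. r *\<^sub>R w) has_derivative (\<lambda>r. r *\<^sub>R w)) (at s)" by (auto intro!: derivative_eq_intros)
  from has_derivative_compose[OF this D]
  have "((\<lambda>s. G \<omega> (s *\<^sub>R w)) has_derivative (\<lambda>r. D (r *\<^sub>R w))) (at s)" .
  then have "((\<lambda>s. G \<omega> (s *\<^sub>R w) \<bullet> w) has_derivative (\<lambda>r. D (r *\<^sub>R w) \<bullet> w)) (at s)"
    by (rule has_derivative_inner_left)
  then have "(\<lambda>s. G \<omega> (s *\<^sub>R w) \<bullet> w) differentiable (at s)" by (auto simp: differentiable_def)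
  then have "(\<lambda>s. G \<omega> (s *\<^sub>R w) \<bullet> w) field_differentiable (at s)"
    by (auto simp: real_differentiable_def field_differentiable_def)
  then show ?thesis unfolding d by (rule field_differentiable_derivI)
qed

lemma nn_integral_sum_if:
  assumes "finite I" and [measurable]: "\<And>i. Measurable.pred M (P i)"
  shows "(\<integral>\<^sup>+\<omega>. ennreal (\<Sum>i\<in>I. if P i \<omega> then 1 else 0) \<partial>M) = ennreal (\<Sum>i\<in>I. measure M {\<omega>\<in>space M. P i \<omega>})"
proof -
  have "(\<integral>\<^sup>+\<omega>. ennreal (\<Sum>i\<in>I. if P i \<omega> then 1 else 0) \<partial>M) = (\<integral>\<^sup>+\<omega>. (\<Sum>i\<in>I. indicator {\<omega>\<in>space M. P i \<omega>} \<omega>) \<partial>M)"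
  proof (rule nn_integral_cong)
    fix \<omega> assume "\<omega> \<in> space M"
    then have "(\<Sum>i\<in>I. indicator {\<omega>\<in>space M. P i \<omega>} \<omega>) = (\<Sum>i\<in>I. ennreal (if P i \<omega> then 1 else 0))"
      by (intro sum.cong) (auto simp: indicator_def)
    also have "\<dots> = ennreal (\<Sum>i\<in>I. if P i \<omega> then 1 else 0)" by (rule sum_ennreal) simp
    finally show "ennreal (\<Sum>i\<in>I. if P i \<omega> then 1 else 0) = (\<Sum>i\<in>I. indicator {\<omega>\<in>space M. P i \<omega>} \<omega>)" ..
  qed
  also have "\<dots> = (\<Sum>i\<in>I. \<integral>\<^sup>+\<omega>. indicator {\<omega>\<in>space M. P i \<omega>} \<omega> \<partial>M)"
    by (rule nn_integral_sum) measurable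
  also have "\<dots> = (\<Sum>i\<in>I. ennreal (measure M {\<omega>\<in>space M. P i \<omega>}))"
    by (intro sum.cong refl, subst nn_integral_indicator) (auto simp: emeasure_eq_measure)
  also have "\<dots> = ennreal (\<Sum>i\<in>I. measure M {\<omega>\<in>space M. P i \<omega>})" by (rule sum_ennreal) simp
  finally show ?thesis .
qed

abbreviation grid_count :: "real \<Rightarrow> real^'n \<Rightarrow> nat \<Rightarrow> real \<Rightarrow> 'w \<Rightarrow> real" where
  "grid_count u w N h \<omega> \<equiv> (\<Sum>n<N. upcross u (\<lambda>n. X ((real n * h) *\<^sub>R w) \<omega>) n)"

lemma nn_integral_grid_count:
  "(\<integral>\<^sup>+\<omega>. ennreal (grid_count u w N h \<omega>) \<partial>M) = ennreal (real N * up_prob u (h *\<^sub>R w))"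
proof -
  have "measure M {\<omega>\<in>space M. X ((real n * h) *\<^sub>R w) \<omega> \<le> u \<and> u < X ((real (Suc n) * h) *\<^sub>R w) \<omega>} = up_prob u (h *\<^sub>R w)" for n
  proof -
    have e: "(real (Suc n) * h) *\<^sub>R w = (real n * h) *\<^sub>R w + h *\<^sub>R w" by (simp add: algebra_simps)
    show ?thesis unfolding e by (rule up_prob_shift)
  qed
  then have "ennreal (\<Sum>n<N. measure M {\<omega>\<in>space M. X ((real n * h) *\<^sub>R w) \<omega> \<le> u \<and> u < X ((real (Suc n) * h) *\<^sub>R w) \<omega>})
    = ennreal (real N * up_prob u (h *\<^sub>R w))" by simp
  then show ?thesis unfolding upcross_def by (subst nn_integral_sum_if) auto
qed

lemma grid_rate_tendsto:
  assumes w: "norm w = 1" and q: "q > 0"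
  shows "(\<lambda>m. ennreal (real (Suc m) / q * up_prob u ((q / real (Suc m)) *\<^sub>R w))) \<longlonglongrightarrow> rate u"
proof -
  have "filterlim (\<lambda>m. q / real (Suc m)) (at_right 0) sequentially"
  proof (rule tendsto_imp_filterlim_at_right)
    have "(\<lambda>m. q * inverse (real (Suc m))) \<longlonglongrightarrow> q * 0"
      by (intro tendsto_mult tendsto_const LIMSEQ_inverse_real_of_nat)
    then show "(\<lambda>m. q / real (Suc m)) \<longlonglongrightarrow> 0" by (simp add: divide_inverse)
  qed (use q in auto)
  from filterlim_compose[OF rate_tendsto[OF w] this] show ?thesis by simp
qed

text \<open>Markov's inequality. By the mean value theorem the supremum of the second derivative exceeds \<open>L\<close> whenever the
  Lipschitz condition fails. The exceptional event is defined by the points of the grids \<open>i / (n + 1)\<close>, which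
  makes it measurable; by continuity the condition extends from there to all points.\<close>

lemma rough_probability:
  assumes m2: "(\<integral>\<^sup>+ \<omega>. (SUP t \<in> {0..1}. ennreal \<bar>deriv (deriv (\<lambda>s. X (s *\<^sub>R w) \<omega>)) t\<bar>)\<^sup>2 \<partial>M) \<le> ennreal m2" "0 \<le> m2"
    and L: "L > 0"
  shows "\<exists>E\<in>sets M. measure M E \<le> m2 / L\<^sup>2 \<and>
    (\<forall>\<omega>\<in>space M - E. \<forall>s\<in>{0..1}. \<forall>t\<in>{0..1}. \<bar>G \<omega> (s *\<^sub>R w) \<bullet> w - G \<omega> (t *\<^sub>R w) \<bullet> w\<bar> \<le> L * \<bar>s - t\<bar>)"
proof -
  let ?g = "\<lambda>\<omega> s. G \<omega> (s *\<^sub>R w) \<bullet> w"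
  let ?r = "\<lambda>i n. real i / real (Suc n)"
  define E where "E = {\<omega>\<in>space M. \<exists>n. \<exists>i\<in>{..Suc n}. \<exists>j\<in>{..Suc n}. L * \<bar>?r i n - ?r j n\<bar> < \<bar>?g \<omega> (?r i n) - ?g \<omega> (?r j n)\<bar>}"
  have [measurable]: "(\<lambda>\<omega>. ?g \<omega> s) \<in> borel_measurable M" for s by measurable
  have E[measurable]: "E \<in> sets M" unfolding E_def by measurable
  have sup: "ennreal (L\<^sup>2) \<le> (SUP t \<in> {0..1}. ennreal \<bar>deriv (deriv (\<lambda>s. X (s *\<^sub>R w) \<omega>)) t\<bar>)\<^sup>2" if w_in: "\<omega> \<in> E" for \<omega>
  proof -
    let ?d = "deriv (deriv (\<lambda>s. X (s *\<^sub>R w) \<omega>))"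
    have ordered: "\<exists>z\<in>{0..1}. L < \<bar>?d z\<bar>" if st: "s \<in> {0..1}" "t \<in> {0..1}" "s < t" "L * \<bar>s - t\<bar> < \<bar>?g \<omega> s - ?g \<omega> t\<bar>" for s t
    proof -
      obtain z where z: "s < z" "z < t" "?g \<omega> t - ?g \<omega> s = (t - s) * ?d z"
        using MVT2[OF st(3), of "?g \<omega>" ?d] line_deriv2 by blast
      have "\<bar>?g \<omega> s - ?g \<omega> t\<bar> = \<bar>?d z\<bar> * \<bar>s - t\<bar>" 
      proof -
        have "\<bar>?g \<omega> s - ?g \<omega> t\<bar> = \<bar>(t - s) * ?d z\<bar>" using z(3) by (simp only: abs_minus_commute[of "?g \<omega> s"])
        then show ?thesis by (simp only: abs_mult abs_minus_commute[of t] mult.commute)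
      qed
      then have "L * \<bar>s - t\<bar> < \<bar>?d z\<bar> * \<bar>s - t\<bar>" using st(4) by simp
      then have "L < \<bar>?d z\<bar>" by (rule mult_right_less_imp_less) simp
      then show ?thesis using z st by (intro bexI[of _ z]) auto
    qed
    obtain n i j where nij: "i \<le> Suc n" "j \<le> Suc n" "L * \<bar>?r i n - ?r j n\<bar> < \<bar>?g \<omega> (?r i n) - ?g \<omega> (?r j n)\<bar>"
      using w_in unfolding E_def by (elim CollectE conjE exE bexE) (rule that, auto)
    have r: "?r i n \<in> {0..1}" "?r j n \<in> {0..1}" using nij(1,2) by (auto simp: divide_le_eq_1)
    have "\<exists>z\<in>{0..1}. L < \<bar>?d z\<bar>"
    proof (cases "?r i n" "?r j n" rule: linorder_cases)
      case less then show ?thesis by (rule ordered[OF r _ nij(3)])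
    next
      case equal then show ?thesis using nij(3) by simp
    next
      case greater
      show ?thesis by (rule ordered[OF r(2,1) greater]) (use nij(3) in \<open>simp add: abs_minus_commute\<close>)
    qed
    then obtain z where z: "z \<in> {0..1}" "L < \<bar>?d z\<bar>" by blast
    have "ennreal L \<le> ennreal \<bar>?d z\<bar>" using z(2) by (intro ennreal_leI) simp
    also have "\<dots> \<le> (SUP t \<in> {0..1}. ennreal \<bar>?d t\<bar>)" by (rule SUP_upper[OF z(1)])
    finally have "(ennreal L)\<^sup>2 \<le> (SUP t \<in> {0..1}. ennreal \<bar>?d t\<bar>)\<^sup>2" by (rule power_mono) simp
    then show ?thesis using L by (simp add: ennreal_power)
  qed
  have "ennreal (L\<^sup>2) * emeasure M E = (\<integral>\<^sup>+\<omega>. ennreal (L\<^sup>2) * indicator E \<omega> \<partial>M)"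
    by (rule nn_integral_cmult_indicator[symmetric]) (rule E)
  also have "\<dots> \<le> (\<integral>\<^sup>+ \<omega>. (SUP t \<in> {0..1}. ennreal \<bar>deriv (deriv (\<lambda>s. X (s *\<^sub>R w) \<omega>)) t\<bar>)\<^sup>2 \<partial>M)"
    by (intro nn_integral_mono) (use sup in \<open>auto simp: indicator_def\<close>)
  also have "\<dots> \<le> ennreal m2" by (rule m2(1))
  finally have "ennreal (L\<^sup>2 * measure M E) \<le> ennreal m2" using L by (simp add: emeasure_eq_measure ennreal_mult')
  then have "L\<^sup>2 * measure M E \<le> m2" using m2(2) by (simp add: ennreal_le_iff)
  then have 1: "measure M E \<le> m2 / L\<^sup>2" using L by (simp add: field_simps)
  have 2: "\<bar>?g \<omega> s - ?g \<omega> t\<bar> \<le> L * \<bar>s - t\<bar>" if "\<omega> \<in> space M - E" "s \<in> {0..1}" "t \<in> {0..1}" for \<omega> s t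
  proof (rule lipschitz_from_grid[OF _ _ that(2,3)])
    show "continuous_on UNIV (?g \<omega>)"
      using line_deriv2 by (intro DERIV_continuous_on) (rule has_field_derivative_at_within)
    show "\<bar>?g \<omega> (?r i n) - ?g \<omega> (?r j n)\<bar> \<le> L * \<bar>?r i n - ?r j n\<bar>" if "i \<le> Suc n" "j \<le> Suc n" for n i j
    proof (rule ccontr)
      assume "\<not> \<bar>?g \<omega> (?r i n) - ?g \<omega> (?r j n)\<bar> \<le> L * \<bar>?r i n - ?r j n\<bar>"
      then have lt: "L * \<bar>?r i n - ?r j n\<bar> < \<bar>?g \<omega> (?r i n) - ?g \<omega> (?r j n)\<bar>" by (rule not_le_imp_less)
      have "\<omega> \<in> E"
        unfolding E_def
        by (rule CollectI, intro conjI exI[of _ n] bexI[of _ i] bexI[of _ j], rule DiffD1[OF \<open>\<omega> \<in> space M - E\<close>])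
           (use that in \<open>simp_all add: lt del: of_nat_Suc\<close>)
      then show False using \<open>\<omega> \<in> space M - E\<close> by blast
    qed
  qed
  show ?thesis using E 1 2 by blast
qed

text \<open>The expectation of \<open>path_excess_bound\<close> with \<open>L = q powr (- 1 / 2)\<close> and \<open>\<Lambda> = q powr (- \<epsilon>)\<close>. These choices make
  the three errors of the same order \<open>q powr (1 - \<epsilon>)\<close>.\<close>

lemma grid_excess:
  assumes w: "norm w = 1" and \<epsilon>: "0 < \<epsilon>" "\<epsilon> < 1" and q: "0 < q" "real k * q \<le> 1" and m: "m > 0"
    and sb: "\<And>t x y. 0 < x \<Longrightarrow> 0 < y \<Longrightarrow>
      measure M {\<omega>\<in>space M. \<bar>X t \<omega> - u\<bar> \<le> x \<and> \<bar>G \<omega> t \<bullet> w\<bar> \<le> y} \<le> C1 * (x * y)"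
    and m2: "(\<integral>\<^sup>+ \<omega>. (SUP t \<in> {0..1}. ennreal \<bar>deriv (deriv (\<lambda>s. X (s *\<^sub>R w) \<omega>)) t\<bar>)\<^sup>2 \<partial>M) \<le> ennreal m2"
    and C0: "(\<integral>\<^sup>+\<omega>. ennreal (grid_count u w (k * m) (q / real m) \<omega> powr (1 / \<epsilon>)) \<partial>M) \<le> ennreal C0"
    and pos: "0 \<le> C1" "0 \<le> m2" "0 \<le> C0"
  shows "real k * (real m * up_prob u ((q / real m) *\<^sub>R w) - up_prob u (q *\<^sub>R w))
    \<le> (m2 + C1 + C0) * q powr (1 - \<epsilon>)"
proof -
  define h where "h = q / real m"
  define p where "p = 1 / \<epsilon>"
  define l where "l = q powr (- \<epsilon>)"
  define L where "L = q powr (- (1 / 2))"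
  have h: "h > 0" "real m * h = q" using q m by (auto simp: h_def)
  have p: "p \<ge> 1" using \<epsilon> by (simp add: p_def)
  have l: "l > 0" and L: "L > 0" using q by (auto simp: l_def L_def)
  have L2: "L\<^sup>2 = 1 / q"
    using q by (simp add: L_def powr_minus_divide powr_half_sqrt power_divide)
  let ?t = "\<lambda>i. (real (i * m) * h) *\<^sub>R w"
  let ?B = "\<lambda>i \<omega>. X (?t i) \<omega> \<le> u \<and> u < X ((real (i * m + m) * h) *\<^sub>R w) \<omega>"
  let ?C = "\<lambda>i \<omega>. \<bar>X (?t i) \<omega> - u\<bar> \<le> L * q\<^sup>2 \<and> \<bar>G \<omega> (?t i) \<bullet> w\<bar> \<le> L * q"
  let ?W = "grid_count u w (k * m) h"
  obtain E where E[measurable]: "E \<in> sets M" and PE: "measure M E \<le> m2 / L\<^sup>2"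
    and nE: "\<And>\<omega> s t. \<omega> \<in> space M \<Longrightarrow> \<omega> \<notin> E \<Longrightarrow> s \<in> {0..1} \<Longrightarrow> t \<in> {0..1} \<Longrightarrow> \<bar>G \<omega> (s *\<^sub>R w) \<bullet> w - G \<omega> (t *\<^sub>R w) \<bullet> w\<bar> \<le> L * \<bar>s - t\<bar>"
    using rough_probability[OF m2 pos(2) L] by (elim bexE conjE) (rule that, assumption+, blast)
  have path: "?W \<omega> \<le> (\<Sum>i<k. if ?B i \<omega> then 1 else 0) + l * (indicator E \<omega> + (\<Sum>i<k. if ?C i \<omega> then 1 else 0)) + l powr (1 - p) * ?W \<omega> powr p"
    if sp: "\<omega> \<in> space M" for \<omega>
  proof -
    let ?e = "if \<exists>s\<in>{0..1}. \<exists>t\<in>{0..1}. L * \<bar>s - t\<bar> < \<bar>G \<omega> (s *\<^sub>R w) \<bullet> w - G \<omega> (t *\<^sub>R w) \<bullet> w\<bar> then 1 else (0::real)"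
    have "?W \<omega> \<le> (\<Sum>i<k. if ?B i \<omega> then 1 else 0) + l * (?e + (\<Sum>i<k. if ?C i \<omega> then 1 else 0)) + l powr (1 - p) * ?W \<omega> powr p"
      unfolding h(2)[symmetric]
    proof (rule path_excess_bound[where f="\<lambda>s. X (s *\<^sub>R w) \<omega>" and f'="\<lambda>s. G \<omega> (s *\<^sub>R w) \<bullet> w", OF line_deriv h(1) m _ l p _ refl])
      show "real (k * m) * h \<le> 1" using q(2) h(2) by (simp add: mult.assoc)
    qed (use L in simp)
    also have "?e \<le> indicator E \<omega>"
    proof (cases "\<omega> \<in> E")
      case False
      then have "\<not> (\<exists>s\<in>{0..1}. \<exists>t\<in>{0..1}. L * \<bar>s - t\<bar> < \<bar>G \<omega> (s *\<^sub>R w) \<bullet> w - G \<omega> (t *\<^sub>R w) \<bullet> w\<bar>)"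
        using nE[OF sp] by (intro notI) (elim bexE, fastforce simp: not_less[symmetric])
      then show ?thesis by simp
    qed simp
    finally show ?thesis using l by simp
  qed
  have Cm: "Measurable.pred M (?C i)" for i by measurable
  have Bm: "Measurable.pred M (?B i)" for i by measurable
  have Wm: "(\<lambda>\<omega>. ennreal (?W \<omega> powr p)) \<in> borel_measurable M"
    unfolding upcross_def by measurable
  have sm: "(\<lambda>\<omega>. ennreal (\<Sum>i<k. if P i \<omega> then 1 else 0)) \<in> borel_measurable M"
    if [measurable]: "\<And>i. Measurable.pred M (P i)" for P :: "nat \<Rightarrow> 'w \<Rightarrow> bool"
    by measurable
  have "ennreal (real (k * m) * up_prob u (h *\<^sub>R w)) = (\<integral>\<^sup>+\<omega>. ennreal (?W \<omega>) \<partial>M)"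
    by (rule nn_integral_grid_count[symmetric])
  also have "\<dots> \<le> (\<integral>\<^sup>+\<omega>. ennreal (\<Sum>i<k. if ?B i \<omega> then 1 else 0)
      + (ennreal l * (indicator E \<omega> + ennreal (\<Sum>i<k. if ?C i \<omega> then 1 else 0)) + ennreal (l powr (1 - p)) * ennreal (?W \<omega> powr p)) \<partial>M)"
  proof (rule nn_integral_mono)
    fix \<omega> assume sp: "\<omega> \<in> space M"
    define b where "b = (\<Sum>i<k. if ?B i \<omega> then 1 else 0 :: real)"
    define c where "c = (\<Sum>i<k. if ?C i \<omega> then 1 else 0 :: real)"
    define e :: real where "e = indicator E \<omega>"
    have bc: "0 \<le> b" "0 \<le> c" "0 \<le> e" unfolding b_def c_def e_def by (auto intro!: sum_nonneg)
    have "ennreal (?W \<omega>) \<le> ennreal (b + l * (e + c) + l powr (1 - p) * ?W \<omega> powr p)"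
      unfolding b_def c_def e_def by (rule ennreal_leI[OF path[OF sp]])
    also have "\<dots> = ennreal b + (ennreal l * (ennreal e + ennreal c) + ennreal (l powr (1 - p)) * ennreal (?W \<omega> powr p))"
    proof -
      have "0 \<le> l * (e + c)" using bc l by simp
      then show ?thesis using bc l by (simp add: ennreal_plus ennreal_mult' add.assoc del: ennreal_plus[symmetric])
    qed
    also have "ennreal e = indicator E \<omega>" by (simp add: e_def ennreal_indicator)
    finally show "ennreal (?W \<omega>) \<le> ennreal (\<Sum>i<k. if ?B i \<omega> then 1 else 0)
      + (ennreal l * (indicator E \<omega> + ennreal (\<Sum>i<k. if ?C i \<omega> then 1 else 0)) + ennreal (l powr (1 - p)) * ennreal (?W \<omega> powr p))"
      unfolding b_def c_def .
  qed
  also have "\<dots> = (\<integral>\<^sup>+\<omega>. ennreal (\<Sum>i<k. if ?B i \<omega> then 1 else 0) \<partial>M)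
      + (ennreal l * (emeasure M E + (\<integral>\<^sup>+\<omega>. ennreal (\<Sum>i<k. if ?C i \<omega> then 1 else 0) \<partial>M))
      + ennreal (l powr (1 - p)) * (\<integral>\<^sup>+\<omega>. ennreal (?W \<omega> powr p) \<partial>M))"
    using sm[of ?B, OF Bm] sm[of ?C, OF Cm] Wm E
    by (simp add: nn_integral_add nn_integral_cmult del: sum_ennreal ennreal_plus)
  also have "(\<integral>\<^sup>+\<omega>. ennreal (\<Sum>i<k. if ?B i \<omega> then 1 else 0) \<partial>M) = ennreal (\<Sum>i<k. measure M {\<omega>\<in>space M. ?B i \<omega>})"
    by (rule nn_integral_sum_if) (simp, rule Bm)
  also have "(\<integral>\<^sup>+\<omega>. ennreal (\<Sum>i<k. if ?C i \<omega> then 1 else 0) \<partial>M) = ennreal (\<Sum>i<k. measure M {\<omega>\<in>space M. ?C i \<omega>})"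
    by (rule nn_integral_sum_if) (simp, rule Cm)
  also have "(\<Sum>i<k. measure M {\<omega>\<in>space M. ?B i \<omega>}) = real k * up_prob u (q *\<^sub>R w)"
  proof -
    have "measure M {\<omega>\<in>space M. ?B i \<omega>} = up_prob u (q *\<^sub>R w)" for i
    proof -
      have e: "(real (i * m + m) * h) *\<^sub>R w = ?t i + q *\<^sub>R w"
        by (simp add: h(2)[symmetric] algebra_simps)
      show ?thesis unfolding e by (rule up_prob_shift)
    qed
    then show ?thesis by simp
  qed
  also have "ennreal (real k * up_prob u (q *\<^sub>R w)) + (ennreal l * (emeasure M E + ennreal (\<Sum>i<k. measure M {\<omega>\<in>space M. ?C i \<omega>}))
      + ennreal (l powr (1 - p)) * (\<integral>\<^sup>+\<omega>. ennreal (?W \<omega> powr p) \<partial>M))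
    \<le> ennreal (real k * up_prob u (q *\<^sub>R w)) + (ennreal l * (ennreal (m2 * q) + ennreal (C1 * q))
      + ennreal (l powr (1 - p)) * ennreal C0)"
  proof (intro add_mono mult_left_mono order_refl)
    show "emeasure M E \<le> ennreal (m2 * q)"
      using PE unfolding L2 emeasure_eq_measure by (intro ennreal_leI) simp
    show "(\<integral>\<^sup>+\<omega>. ennreal (?W \<omega> powr p) \<partial>M) \<le> ennreal C0" using C0 by (simp add: h_def p_def)
    show "ennreal (\<Sum>i<k. measure M {\<omega>\<in>space M. ?C i \<omega>}) \<le> ennreal (C1 * q)"
    proof (rule ennreal_leI)
      have "measure M {\<omega>\<in>space M. ?C i \<omega>} \<le> C1 * (L * q\<^sup>2 * (L * q))" for i
        by (rule sb) (use L q in auto)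
      also have "C1 * (L * q\<^sup>2 * (L * q)) = C1 * q\<^sup>2 * (L\<^sup>2 * q)" by (simp add: power2_eq_square mult_ac)
      also have "\<dots> = C1 * q\<^sup>2" using q by (simp add: L2)
      finally have "(\<Sum>i<k. measure M {\<omega>\<in>space M. ?C i \<omega>}) \<le> (\<Sum>i<k. C1 * q\<^sup>2)" by (intro sum_mono)
      also have "\<dots> = C1 * q * (real k * q)" by (simp add: power2_eq_square mult_ac)
      also have "\<dots> \<le> C1 * q * 1" using pos q by (intro mult_left_mono) auto
      finally show "(\<Sum>i<k. measure M {\<omega>\<in>space M. ?C i \<omega>}) \<le> C1 * q" by simp
    qed
  qed auto
  also have "\<dots> = ennreal (real k * up_prob u (q *\<^sub>R w) + (l * (m2 * q + C1 * q) + l powr (1 - p) * C0))"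
  proof -
    have "0 \<le> m2 * q" "0 \<le> C1 * q" "0 \<le> real k * up_prob u (q *\<^sub>R w)" "0 \<le> l" "0 \<le> l powr (1 - p)" "0 \<le> l * (m2 * q + C1 * q)" "0 \<le> l powr (1 - p) * C0"
      using pos q l by auto
    then show ?thesis using pos by (simp only: ennreal_plus ennreal_mult' add_nonneg_nonneg)
  qed
  finally have "real (k * m) * up_prob u (h *\<^sub>R w) \<le> real k * up_prob u (q *\<^sub>R w) + (l * (m2 * q + C1 * q) + l powr (1 - p) * C0)"
    using pos q l by (subst (asm) ennreal_le_iff) (auto intro!: add_nonneg_nonneg mult_nonneg_nonneg)
  moreover have "l * (m2 * q + C1 * q) + l powr (1 - p) * C0 = (m2 + C1 + C0) * q powr (1 - \<epsilon>)"
  proof -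
    have "l * q = q powr (1 - \<epsilon>)" using q by (simp add: l_def powr_mult_base mult.commute)
    moreover have "l powr (1 - p) = q powr (1 - \<epsilon>)" using \<epsilon> by (simp add: l_def p_def powr_powr right_diff_distrib)
    moreover have "l * (m2 * q + C1 * q) = (m2 + C1) * (l * q)" by (simp add: algebra_simps)
    ultimately show ?thesis by (simp add: algebra_simps)
  qed
  ultimately show ?thesis by (simp add: h_def algebra_simps)
qed

text \<open>As many segments of length \<open>q\<close> as possible are placed in one of length \<open>r\<close>. In \<open>grid_excess\<close> the
  number of steps per segment tends to infinity, and the bound is divided by the number of segments, which is at least
  \<open>r / (2 * q)\<close>. For \<open>q > r\<close> the bound holds trivially with a large constant.\<close>

theorem refined_rate:
  assumes w: "norm w = 1" and \<epsilon>: "0 < \<epsilon>" "\<epsilon> < 1" and r: "0 < r" "r \<le> 1"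
    and sb: "\<And>t x y. 0 < x \<Longrightarrow> 0 < y \<Longrightarrow>
      measure M {\<omega>\<in>space M. \<bar>X t \<omega> - u\<bar> \<le> x \<and> \<bar>G \<omega> t \<bullet> w\<bar> \<le> y} \<le> C1 * (x * y)"
    and m2: "(\<integral>\<^sup>+ \<omega>. (SUP t \<in> {0..1}. ennreal \<bar>deriv (deriv (\<lambda>s. X (s *\<^sub>R w) \<omega>)) t\<bar>)\<^sup>2 \<partial>M) \<le> ennreal m2"
    and C0: "\<And>N h. 0 < h \<Longrightarrow> real N * h \<le> r \<Longrightarrow>
      (\<integral>\<^sup>+\<omega>. ennreal (grid_count u w N h \<omega> powr (1 / \<epsilon>)) \<partial>M) \<le> ennreal C0"
    and pos: "0 \<le> C1" "0 \<le> m2" "0 \<le> C0"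
  shows "rate u < \<infinity>"
    and "\<exists>K>0. \<forall>q>0. enn2real (rate u) * q - up_prob u (q *\<^sub>R w) \<le> K * q powr (2 - \<epsilon>)"
proof -
  have "rate u \<le> ennreal ((1 + C0) / r)"
  proof (rule LIMSEQ_le_const2[OF grid_rate_tendsto[OF w r(1)]], intro exI allI impI)
    fix m :: nat
    let ?h = "r / real (Suc m)"
    have h: "?h > 0" "real (Suc m) * ?h \<le> r" using r by auto
    have "ennreal (real (Suc m) * up_prob u (?h *\<^sub>R w)) = (\<integral>\<^sup>+\<omega>. ennreal (grid_count u w (Suc m) ?h \<omega>) \<partial>M)"
      by (rule nn_integral_grid_count[symmetric])
    also have "\<dots> \<le> (\<integral>\<^sup>+\<omega>. 1 + ennreal (grid_count u w (Suc m) ?h \<omega> powr (1 / \<epsilon>)) \<partial>M)"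
    proof (rule nn_integral_mono)
      fix \<omega>
      have g0: "0 \<le> grid_count u w (Suc m) ?h \<omega>" by (intro sum_nonneg) (simp add: upcross_def)
      have "grid_count u w (Suc m) ?h \<omega> \<le> 1 + grid_count u w (Suc m) ?h \<omega> powr (1 / \<epsilon>)"
      proof (cases "1 < grid_count u w (Suc m) ?h \<omega>")
        case True
        have "1 / \<epsilon> \<ge> 1" using \<epsilon> by simp
        from powr_cut[OF g0 zero_less_one True this] show ?thesis by simp
      next
        case False
        have "0 \<le> grid_count u w (Suc m) ?h \<omega> powr (1 / \<epsilon>)" by simp
        then show ?thesis using False by linarith
      qed
      then have "ennreal (grid_count u w (Suc m) ?h \<omega>) \<le> ennreal (1 + grid_count u w (Suc m) ?h \<omega> powr (1 / \<epsilon>))"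
        by (rule ennreal_leI)
      then show "ennreal (grid_count u w (Suc m) ?h \<omega>) \<le> 1 + ennreal (grid_count u w (Suc m) ?h \<omega> powr (1 / \<epsilon>))"
        by (subst (asm) ennreal_plus) auto
    qed
    also have "\<dots> = 1 + (\<integral>\<^sup>+\<omega>. ennreal (grid_count u w (Suc m) ?h \<omega> powr (1 / \<epsilon>)) \<partial>M)"
      by (subst nn_integral_add) (auto simp: upcross_def emeasure_space_1)
    also have "\<dots> \<le> 1 + ennreal C0" by (intro add_left_mono C0 h)
    also have "\<dots> = ennreal (1 + C0)" using pos by (simp add: ennreal_plus)
    finally have "real (Suc m) * up_prob u (?h *\<^sub>R w) \<le> 1 + C0" using pos by (subst (asm) ennreal_le_iff) auto
    then have "real (Suc m) / r * up_prob u (?h *\<^sub>R w) \<le> (1 + C0) / r"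
      using r by (simp add: divide_right_mono)
    then show "ennreal (real (Suc m) / r * up_prob u (?h *\<^sub>R w)) \<le> ennreal ((1 + C0) / r)" by (rule ennreal_leI)
  qed
  also have "\<dots> < \<infinity>" by simp
  finally show fin: "rate u < \<infinity>" .
  define \<rho> where "\<rho> = enn2real (rate u)"
  have \<rho>: "rate u = ennreal \<rho>" "\<rho> \<ge> 0" using fin by (auto simp: \<rho>_def ennreal_enn2real_if)
  define K1 where "K1 = 2 * (m2 + C1 + C0) / r"
  have K1: "K1 \<ge> 0" using pos r by (simp add: K1_def)
  have short: "\<rho> * q - up_prob u (q *\<^sub>R w) \<le> K1 * q powr (2 - \<epsilon>)" if q: "0 < q" "q \<le> r" for q
  proof -
    have lim: "(\<lambda>m. real (Suc m) / q * up_prob u ((q / real (Suc m)) *\<^sub>R w)) \<longlonglongrightarrow> \<rho>"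
      by (rule tendsto_ennrealD[OF grid_rate_tendsto[OF w q(1), of u, unfolded \<rho>(1)]]) (use \<rho> q in auto)
    have "(\<lambda>m. q * (real (Suc m) / q * up_prob u ((q / real (Suc m)) *\<^sub>R w)) - up_prob u (q *\<^sub>R w)) \<longlonglongrightarrow> q * \<rho> - up_prob u (q *\<^sub>R w)"
      by (intro tendsto_intros lim)
    moreover have "q * (real (Suc m) / q * up_prob u ((q / real (Suc m)) *\<^sub>R w)) - up_prob u (q *\<^sub>R w) \<le> K1 * q powr (2 - \<epsilon>)" for m
    proof -
      define k where "k = nat \<lfloor>r / q\<rfloor>"
      have lq: "1 \<le> r / q" using q by simp
      have k: "real k \<le> r / q" "r / q < real k + 1" "1 \<le> real k"
      proof -
        have f1: "1 \<le> \<lfloor>r / q\<rfloor>" using lq by (simp add: le_floor_iff)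
        then have "real k = of_int \<lfloor>r / q\<rfloor>" by (simp add: k_def)
        then show "real k \<le> r / q" "r / q < real k + 1" "1 \<le> real k" using f1 by linarith+
      qed
      have kq: "real k * q \<le> r" using k(1) q by (simp add: pos_le_divide_eq)
      have k2: "r / (2 * q) \<le> real k" 
      proof -
        have "y / 2 \<le> real k" if "y < real k + 1" for y using that k(3) by linarith
        from this[OF k(2)] have "r / q / 2 \<le> real k" .
        moreover have "r / (2 * q) = r / q / 2" by simp
        ultimately show ?thesis by (simp only:)
      qed
      let ?d = "real (Suc m) * up_prob u ((q / real (Suc m)) *\<^sub>R w) - up_prob u (q *\<^sub>R w)"
      have "real k * ?d \<le> (m2 + C1 + C0) * q powr (1 - \<epsilon>)"
      proof (rule grid_excess[OF w \<epsilon> q(1) _ _ sb m2 _ pos])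
        show "real k * q \<le> 1" using kq r by simp
        show "(\<integral>\<^sup>+\<omega>. ennreal (grid_count u w (k * Suc m) (q / real (Suc m)) \<omega> powr (1 / \<epsilon>)) \<partial>M) \<le> ennreal C0"
        proof (rule C0)
          show "0 < q / real (Suc m)" using q by simp
          have "real (k * Suc m) * (q / real (Suc m)) = real k * q" unfolding of_nat_mult by (simp del: of_nat_Suc)
          then show "real (k * Suc m) * (q / real (Suc m)) \<le> r" using kq by (simp only:)
        qed
      qed auto
      moreover have "r / (2 * q) * ?d \<le> max 0 (real k * ?d)"
      proof (cases "0 \<le> ?d")
        case True
        have "r / (2 * q) * ?d \<le> real k * ?d" by (rule mult_right_mono[OF k2 True])
        then show ?thesis by linarith
      next
        case False
        have "r / (2 * q) * ?d \<le> 0" by (rule mult_nonneg_nonpos) (use r q False in auto)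
        then show ?thesis by linarith
      qed
      moreover have "0 \<le> (m2 + C1 + C0) * q powr (1 - \<epsilon>)" using pos by simp
      ultimately have "r / (2 * q) * ?d \<le> (m2 + C1 + C0) * q powr (1 - \<epsilon>)" by linarith
      then have "r * ?d \<le> 2 * q * ((m2 + C1 + C0) * q powr (1 - \<epsilon>))" using q by (simp add: pos_divide_le_eq mult.commute)
      then have "?d \<le> 2 * q * ((m2 + C1 + C0) * q powr (1 - \<epsilon>)) / r" using r by (simp only: pos_le_divide_eq mult.commute[of r])
      also have "\<dots> = K1 * (q * q powr (1 - \<epsilon>))" by (simp add: K1_def mult_ac)
      finally have "?d \<le> K1 * (q * q powr (1 - \<epsilon>))" .
      also have "q * q powr (1 - \<epsilon>) = q powr (2 - \<epsilon>)" using q by (simp add: powr_mult_base)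
      finally show ?thesis using q by simp
    qed
    ultimately have "q * \<rho> - up_prob u (q *\<^sub>R w) \<le> K1 * q powr (2 - \<epsilon>)"
      by (intro LIMSEQ_le_const2) auto
    then show ?thesis by (simp add: mult.commute)
  qed
  define K where "K = K1 + \<rho> * r powr (\<epsilon> - 1) + 1"
  have K: "K > 0" "K1 \<le> K" "\<rho> * r powr (\<epsilon> - 1) \<le> K"
    using K1 \<rho>(2) by (auto simp: K_def intro!: add_nonneg_pos)
  have "\<rho> * q - up_prob u (q *\<^sub>R w) \<le> K * q powr (2 - \<epsilon>)" if q: "q > 0" for q
  proof (cases "q \<le> r")
    case True
    have "K1 * q powr (2 - \<epsilon>) \<le> K * q powr (2 - \<epsilon>)" using K by (intro mult_right_mono) auto
    then show ?thesis using short[OF q True] by linarith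
  next
    case False
    have "1 \<le> (q / r) powr (1 - \<epsilon>)" using False r \<epsilon> by (intro ge_one_powr_ge_zero) auto
    then have "\<rho> * q * 1 \<le> \<rho> * q * (q / r) powr (1 - \<epsilon>)" using \<rho>(2) q by (intro mult_left_mono) auto
    also have "(q / r) powr (1 - \<epsilon>) = q powr (1 - \<epsilon>) * r powr (\<epsilon> - 1)"
      using q r by (simp add: powr_divide powr_minus_divide[of r "1 - \<epsilon>", simplified])
    also have "\<rho> * q * (q powr (1 - \<epsilon>) * r powr (\<epsilon> - 1)) = (\<rho> * r powr (\<epsilon> - 1)) * (q * q powr (1 - \<epsilon>))" by (simp only: mult_ac)
    also have "q * q powr (1 - \<epsilon>) = q powr (2 - \<epsilon>)" using q by (simp add: powr_mult_base)
    also have "(\<rho> * r powr (\<epsilon> - 1)) * q powr (2 - \<epsilon>) \<le> K * q powr (2 - \<epsilon>)" using K by (intro mult_right_mono) auto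
    finally show ?thesis using up_prob_nonneg[of u "q *\<^sub>R w"] by linarith
  qed
  then show "\<exists>K>0. \<forall>q>0. enn2real (rate u) * q - up_prob u (q *\<^sub>R w) \<le> K * q powr (2 - \<epsilon>)"
    using K(1) unfolding \<rho>_def by blast
qed

end

section \<open>From the assumptions to the estimates\<close>

text \<open>A cover by sets whose diameter is smaller than all distances in \<open>F\<close> has at least as many nonempty members as \<open>F\<close> has
  points, and each of them has weight one.\<close>

lemma card_le_hausdorff_measure_0:
  fixes S :: "'a::metric_space set"
  assumes F: "finite F" "F \<subseteq> S"
  shows "of_nat (card F) \<le> hausdorff_measure 0 S"
proof -
  let ?P = "{p \<in> F \<times> F. fst p \<noteq> snd p}"
  define \<delta> where "\<delta> = Min (insert 1 ((\<lambda>p. dist (fst p) (snd p)) ` ?P)) / 2"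
  have fP: "finite (insert 1 ((\<lambda>p. dist (fst p) (snd p)) ` ?P))" using F(1) by simp
  have \<delta>: "\<delta> > 0" unfolding \<delta>_def using fP by (auto simp: Min_gr_iff)
  have sepF: "\<delta> < dist x y" if "x \<in> F" "y \<in> F" "x \<noteq> y" for x y
  proof -
    have "dist x y \<in> insert 1 ((\<lambda>p. dist (fst p) (snd p)) ` ?P)"
      by (rule insertI2, rule image_eqI[of _ _ "(x, y)"]) (use that in auto)
    then have "Min (insert 1 ((\<lambda>p. dist (fst p) (snd p)) ` ?P)) \<le> dist x y" using fP by (intro Min_le) auto
    then show ?thesis using \<delta> by (simp add: \<delta>_def)
  qed
  have "of_nat (card F) \<le> hausdorff_premeasure 0 \<delta> S"
    unfolding hausdorff_premeasure_def
  proof (rule INF_greatest)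
    fix U :: "nat \<Rightarrow> 'a set"
    assume "U \<in> {U. S \<subseteq> (\<Union>n. U n) \<and> (\<forall>n. bounded (U n) \<and> diameter (U n) \<le> \<delta>)}"
    then have U: "S \<subseteq> (\<Union>n. U n)" "\<And>n. bounded (U n)" "\<And>n. diameter (U n) \<le> \<delta>" by auto
    have "\<forall>x. \<exists>n. x \<in> F \<longrightarrow> x \<in> U n" using U(1) F(2) by blast
    from choice[OF this] obtain n where n: "\<And>x. x \<in> F \<Longrightarrow> x \<in> U (n x)" by (elim exE) (rule that, blast)
    have inj: "inj_on n F"
    proof (rule inj_onI, rule ccontr)
      fix x y assume xy: "x \<in> F" "y \<in> F" "n x = n y" "x \<noteq> y"
      have y: "y \<in> U (n x)" unfolding xy(3) by (rule n[OF xy(2)])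
      have "dist x y \<le> \<delta>"
        by (rule order_trans[OF diameter_bounded_bound[OF U(2) n[OF xy(1)] y] U(3)])
      then show False using sepF[OF xy(1,2,4)] by simp
    qed
    have "of_nat (card F) = (\<Sum>i\<in>n ` F. (1::ennreal))" by (simp add: card_image[OF inj])
    also have "\<dots> \<le> (\<Sum>i\<in>n ` F. hausdorff_weight 0 (U i))"
    proof (rule sum_mono)
      fix i assume "i \<in> n ` F"
      then have "U i \<noteq> {}" using n by auto
      then show "1 \<le> hausdorff_weight 0 (U i)" by (simp add: hausdorff_weight_def)
    qed
    also have "\<dots> \<le> (\<Sum>i. hausdorff_weight 0 (U i))"
      by (rule sum_le_suminf) (use F(1) in auto)
    finally show "of_nat (card F) \<le> (\<Sum>i. hausdorff_weight 0 (U i))" .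
  qed
  also have "\<dots> \<le> hausdorff_measure 0 S"
    unfolding hausdorff_measure_def by (rule SUP_upper) (use \<delta> in simp)
  finally show ?thesis .
qed

text \<open>Each upcrossing has a root in its step. The root differs from the right end, where the value exceeds
  \<open>u\<close>, so the roots of different steps are distinct.\<close>

lemma upcross_roots:
  fixes f :: "real \<Rightarrow> real"
  assumes f: "continuous_on UNIV f" and h: "h > 0"
  shows "\<exists>F. finite F \<and> F \<subseteq> {z \<in> {a..a + real N * h}. f z = u} \<and>
    (\<Sum>n<N. upcross u (\<lambda>n. f (a + real n * h)) n) = real (card F)"
proof -
  let ?t = "\<lambda>n. a + real n * h"
  let ?S = "{n\<in>{..<N}. f (?t n) \<le> u \<and> u < f (?t (Suc n))}"
  have "\<exists>z. n \<in> ?S \<longrightarrow> ?t n \<le> z \<and> z < ?t (Suc n) \<and> f z = u" for n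
  proof (cases "n \<in> ?S")
    case True
    have "\<exists>z. ?t n \<le> z \<and> z \<le> ?t (Suc n) \<and> f z = u"
    proof (rule IVT')
      show "continuous_on {?t n..?t (Suc n)} f" by (rule continuous_on_subset[OF f]) simp
      show "?t n \<le> ?t (Suc n)" using h by (intro add_left_mono mult_right_mono) auto
    qed (use True in auto)
    then obtain z where z: "?t n \<le> z" "z \<le> ?t (Suc n)" "f z = u" by blast
    have "z \<noteq> ?t (Suc n)" using z(3) True by auto
    then show ?thesis using z by (intro exI[of _ z]) simp
  next
    case False
    then show ?thesis by blast
  qed
  then have "\<forall>n. \<exists>z. n \<in> ?S \<longrightarrow> ?t n \<le> z \<and> z < ?t (Suc n) \<and> f z = u" by blast
  from choice[OF this] obtain z where z: "\<And>n. n \<in> ?S \<Longrightarrow> ?t n \<le> z n \<and> z n < ?t (Suc n) \<and> f (z n) = u"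
    by (elim exE) (rule that, blast)
  have tm: "?t m \<le> ?t n" if "m \<le> n" for m n using that h by (intro add_left_mono mult_right_mono) auto
  have inj: "inj_on z ?S"
  proof (rule linorder_inj_onI)
    fix m n assume mn: "m < n" "m \<in> ?S" "n \<in> ?S"
    have "z m < ?t (Suc m)" "?t (Suc m) \<le> ?t n" "?t n \<le> z n" using z mn tm[of "Suc m" n] by auto
    then show "z m \<noteq> z n" by linarith
  qed auto
  have "z ` ?S \<subseteq> {y \<in> {a..a + real N * h}. f y = u}"
  proof (rule image_subsetI)
    fix n assume n: "n \<in> ?S"
    then have "?t 0 \<le> ?t n" "?t (Suc n) \<le> ?t N" by (intro tm; simp)+
    then show "z n \<in> {y \<in> {a..a + real N * h}. f y = u}" using z[OF n] by simp
  qed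
  moreover have "finite (z ` ?S)" by simp
  moreover have "(\<Sum>n<N. upcross u (\<lambda>n. f (?t n)) n) = real (card (z ` ?S))"
    unfolding card_image[OF inj] by (rule sum_upcross) simp
  ultimately show ?thesis by blast
qed

lemma segment_in_convex:
  fixes w :: "real^'n"
  assumes Q: "convex Q" and ne: "\<not> (\<exists>x. line0 w \<inter> Q \<subseteq> {x})"
  shows "\<exists>a b. a < b \<and> (\<forall>l\<in>{a..b}. l *\<^sub>R w \<in> Q)"
proof -
  obtain p where p: "p \<in> line0 w" "p \<in> Q" using ne by blast
  obtain p' where p': "p' \<in> line0 w" "p' \<in> Q" "p' \<noteq> p" using ne by blast
  obtain l l' where l: "p = l *\<^sub>R w" "p' = l' *\<^sub>R w" using p p' by (auto simp: line0_def)
  have seg: "\<forall>l\<in>{a..b}. l *\<^sub>R w \<in> Q" if ab: "a < b" "a *\<^sub>R w \<in> Q" "b *\<^sub>R w \<in> Q" for a b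
  proof
    fix l assume l: "l \<in> {a..b}"
    define s where "s = (l - a) / (b - a)"
    have s: "0 \<le> s" "s \<le> 1" "l = (1 - s) * a + s * b"
    proof -
      show "0 \<le> s" "s \<le> 1" using l ab by (auto simp: s_def)
      have "s * (b - a) = l - a" using ab by (simp add: s_def)
      then show "l = (1 - s) * a + s * b" by (simp add: algebra_simps)
    qed
    have "(1 - s) *\<^sub>R (a *\<^sub>R w) + s *\<^sub>R (b *\<^sub>R w) \<in> Q"
      by (rule convexD[OF Q ab(2,3)]) (use s in auto)
    then show "l *\<^sub>R w \<in> Q" by (simp add: s(3) scaleR_left_distrib)
  qed
  have "l \<noteq> l'" using l p'(3) by auto
  then consider "l < l'" | "l' < l" by linarith
  then show ?thesis
    by cases (use seg p p' l in blast)+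
qed

lemma field_law_cong_AE:
  assumes [measurable]: "\<And>t. X t \<in> borel_measurable M" "\<And>t. Y t \<in> borel_measurable M"
    and "AE \<omega> in M. \<forall>t. X t \<omega> = Y t \<omega>"
  shows "field_law M X = field_law M Y"
  unfolding field_law_def
proof (rule distr_cong_AE)
  show "AE \<omega> in M. (\<lambda>t. X t \<omega>) = (\<lambda>t. Y t \<omega>)" using assms(3) by eventually_elim auto
  show "(\<lambda>\<omega> t. X t \<omega>) \<in> M \<rightarrow>\<^sub>M Pi\<^sub>M UNIV (\<lambda>_. borel)" by (intro measurable_PiM_single') auto
  show "(\<lambda>\<omega> t. Y t \<omega>) \<in> M \<rightarrow>\<^sub>M Pi\<^sub>M UNIV (\<lambda>_. borel)" by (intro measurable_PiM_single') auto
qed auto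

lemma has_cond_density_cong_AE:
  assumes [measurable]: "V \<in> borel_measurable M" "V' \<in> borel_measurable M" "W \<in> borel_measurable M" "W' \<in> borel_measurable M"
    and ae: "AE \<omega> in M. V \<omega> = V' \<omega>" "AE \<omega> in M. W \<omega> = W' \<omega>"
    and cd: "has_cond_density M V W c p"
  shows "has_cond_density M V' W' c p"
proof -
  have "cond_prob M (\<lambda>\<omega>. V \<omega> \<le> x) (\<lambda>\<omega>. \<bar>W \<omega> - c\<bar> \<le> \<delta>) = cond_prob M (\<lambda>\<omega>. V' \<omega> \<le> x) (\<lambda>\<omega>. \<bar>W' \<omega> - c\<bar> \<le> \<delta>)" for x \<delta>
  proof -
    have "measure M {\<omega>\<in>space M. V \<omega> \<le> x \<and> \<bar>W \<omega> - c\<bar> \<le> \<delta>} = measure M {\<omega>\<in>space M. V' \<omega> \<le> x \<and> \<bar>W' \<omega> - c\<bar> \<le> \<delta>}"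
      by (rule measure_eq_AE) (use ae in \<open>eventually_elim, simp\<close>, measurable)
    moreover have "measure M {\<omega>\<in>space M. \<bar>W \<omega> - c\<bar> \<le> \<delta>} = measure M {\<omega>\<in>space M. \<bar>W' \<omega> - c\<bar> \<le> \<delta>}"
      by (rule measure_eq_AE) (use ae in \<open>eventually_elim, simp\<close>, measurable)
    ultimately show ?thesis by (simp add: cond_prob_def)
  qed
  then show ?thesis using cd by (simp add: has_cond_density_def)
qed

lemma class_C2_locally_lipschitz:
  fixes G :: "real^'n \<Rightarrow> real^'n" and H :: "real^'n \<Rightarrow> real^'n^'n"
  assumes G: "\<And>x. (G has_derivative (\<lambda>h. H x *v h)) (at x)" and H: "continuous_on UNIV H"
  shows "\<exists>m. \<forall>x\<in>cball 0 R. \<forall>y\<in>cball 0 R. norm (G x - G y) \<le> m * norm (x - y)"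
proof -
  have "compact (H ` cball 0 R)"
    by (rule compact_continuous_image) (auto intro: continuous_on_subset[OF H])
  from compact_imp_bounded[OF this] obtain b where b: "\<And>x. x \<in> cball 0 R \<Longrightarrow> norm (H x) \<le> b"
    unfolding bounded_iff by (elim exE) (rule that, blast)
  have "norm (G x - G y) \<le> (real CARD('n) * \<bar>b\<bar>) * norm (x - y)" if xy: "x \<in> cball 0 R" "y \<in> cball 0 R" for x y
  proof (rule differentiable_bound[of "cball 0 R" G "\<lambda>x h. H x *v h"])
    show "(G has_derivative (\<lambda>h. H x *v h)) (at x within cball 0 R)" for x
      by (rule has_derivative_at_withinI[OF G])
    show "onorm (\<lambda>h. H x *v h) \<le> real CARD('n) * \<bar>b\<bar>" if x: "x \<in> cball 0 R" for x
    proof (rule onorm_bound)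
      fix h
      have "\<bar>(H x *v h) $ i\<bar> \<le> \<bar>b\<bar> * norm h" for i
      proof -
        have "\<bar>(H x *v h) $ i\<bar> \<le> norm (H x $ i) * norm h"
          unfolding matrix_vector_mul_component by (rule Cauchy_Schwarz_ineq2)
        also have "norm (H x $ i) \<le> norm (H x)" by (rule Finite_Cartesian_Product.norm_nth_le)
        also have "norm (H x) \<le> \<bar>b\<bar>" using b[OF x] by linarith
        finally show ?thesis by (simp add: mult_right_mono)
      qed
      then have "(\<Sum>i\<in>UNIV. \<bar>(H x *v h) $ i\<bar>) \<le> (\<Sum>i\<in>(UNIV::'n set). \<bar>b\<bar> * norm h)" by (intro sum_mono)
      then show "norm (H x *v h) \<le> real CARD('n) * \<bar>b\<bar> * norm h"
        using norm_le_l1_cart[of "H x *v h"] by (simp add: mult.assoc)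
    qed simp
  qed (use xy in auto)
  then show ?thesis by blast
qed

text \<open>The field is replaced by zero on a null set that contains all irregular paths. This changes neither the law nor any
  of the quantities in the theorem.\<close>

theorem exists_c2_version:
  fixes X :: "real^'n \<Rightarrow> 'w \<Rightarrow> real"
  assumes card: "CARD('n) \<ge> 2" and iso: "isotropic_field M X" and A0: "assumption_A0 M X"
  shows "\<exists>Y G B. c2_field M Y G B \<and> (AE \<omega> in M. \<forall>t. Y t \<omega> = X t \<omega>)"
proof -
  have PM: "prob_space M" and Xm[measurable]: "\<And>t. X t \<in> borel_measurable M"
    and stat: "\<And>s. field_law M (\<lambda>t. X (t + s)) = field_law M X" and c2: "AE \<omega> in M. class_C2 (\<lambda>t. X t \<omega>)"
    using A0 by (auto simp: assumption_A0_def random_field_def stationary_field_def)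
  obtain Z and p :: "real \<times> (real^'n) \<Rightarrow> ennreal" and B :: real where Zm[measurable]: "Z \<in> borel_measurable M" and Z: "AE \<omega> in M. GDERIV (\<lambda>t. X t \<omega>) 0 :> Z \<omega>"
    and p: "distributed M lborel (\<lambda>\<omega>. (X 0 \<omega>, Z \<omega>)) p" "\<And>z. p z \<le> ennreal B"
    using A0 unfolding assumption_A0_def by (elim conjE bexE exE) (rule that, assumption+, blast)
  obtain N where N: "{\<omega> \<in> space M. \<not> class_C2 (\<lambda>t. X t \<omega>)} \<subseteq> N" "emeasure M N = 0" "N \<in> sets M"
    using c2 by (rule AE_E)
  define Y where "Y t \<omega> = (if \<omega> \<in> space M - N then X t \<omega> else 0)" for t \<omega>
  have Ym[measurable]: "Y t \<in> borel_measurable M" for t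
    unfolding Y_def by (rule measurable_If_set) (use N(3) in auto)
  have "AE \<omega> in M. \<omega> \<notin> N" by (rule AE_not_in) (use N in \<open>simp add: null_sets_def\<close>)
  then have eq: "AE \<omega> in M. \<forall>t. Y t \<omega> = X t \<omega>" using AE_space by eventually_elim (simp add: Y_def)
  have Yc2: "class_C2 (\<lambda>t. Y t \<omega>)" for \<omega>
  proof (cases "\<omega> \<in> space M - N")
    case True
    then have "class_C2 (\<lambda>t. X t \<omega>)" using N(1) by blast
    then show ?thesis using True by (simp add: Y_def)
  next
    case False
    then have "(\<lambda>t. Y t \<omega>) = (\<lambda>t. 0)" by (auto simp: Y_def)
    moreover have "class_C2 (\<lambda>t::real^'n. 0)"
    proof -
      have z: "(\<lambda>h. (0 :: real^'n^'n) *v h) = (\<lambda>_. 0)" by (rule ext) simp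
      show ?thesis
        unfolding class_C2_def
        by (rule exI[of _ "\<lambda>_. 0"], rule exI[of _ "\<lambda>_. 0"]) (auto simp only: z GDERIV_const has_derivative_const continuous_on_const)
    qed
    ultimately show ?thesis by simp
  qed
  define ok where "ok \<omega> G \<longleftrightarrow> (\<exists>H :: real^'n \<Rightarrow> real^'n^'n. (\<forall>x. GDERIV (\<lambda>t. Y t \<omega>) x :> G x) \<and>
      (\<forall>x. (G has_derivative (\<lambda>h. H x *v h)) (at x)) \<and> continuous_on UNIV H)" for \<omega> G
  have "\<forall>\<omega>. \<exists>G. ok \<omega> G" using Yc2 unfolding class_C2_def ok_def by blast
  from choice[OF this] obtain G where G: "\<And>\<omega>. ok \<omega> (G \<omega>)" by (elim exE) (rule that, blast)
  have Gd: "GDERIV (\<lambda>t. Y t \<omega>) x :> G \<omega> x" for \<omega> x using G[of \<omega>] unfolding ok_def by blast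
  have GZ: "AE \<omega> in M. (Y 0 \<omega>, G \<omega> 0) = (X 0 \<omega>, Z \<omega>)"
    using eq Z
  proof eventually_elim
    case (elim \<omega>)
    then have "(\<lambda>t. Y t \<omega>) = (\<lambda>t. X t \<omega>)" by auto
    then have "((\<lambda>t. X t \<omega>) has_derivative (\<lambda>h. h \<bullet> G \<omega> 0)) (at 0)" using Gd[of \<omega> 0] by (simp add: gderiv_def)
    moreover have "((\<lambda>t. X t \<omega>) has_derivative (\<lambda>h. h \<bullet> Z \<omega>)) (at 0)" using elim by (simp add: gderiv_def)
    ultimately have "(\<lambda>h. h \<bullet> G \<omega> 0) = (\<lambda>h. h \<bullet> Z \<omega>)" by (rule has_derivative_unique)
    then have "\<forall>h. h \<bullet> G \<omega> 0 = h \<bullet> Z \<omega>" by (simp add: fun_eq_iff)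
    then have "G \<omega> 0 = Z \<omega>" by (simp only: vector_eq_ldot)
    then show ?case using elim by simp
  qed
  have law: "field_law M (\<lambda>t. Y (s t)) = field_law M (\<lambda>t. X (s t))" for s :: "real^'n \<Rightarrow> real^'n"
    by (rule field_law_cong_AE) (use eq in \<open>auto elim: eventually_mono\<close>)
  have "c2_field M Y G B"
  proof (intro c2_field.intro[OF PM] c2_field_axioms.intro)
    show "Y t \<in> borel_measurable M" for t by (rule Ym)
    show "field_law M (\<lambda>t. Y (t + s)) = field_law M Y" for s
      using law[of "\<lambda>t. t + s"] law[of "\<lambda>t. t"] stat by simp
    show "field_law M (\<lambda>t. Y (Q *v t)) = field_law M Y" if "rotation_matrix Q" for Q
      using law[of "\<lambda>t. Q *v t"] law[of "\<lambda>t. t"] iso that by (simp add: isotropic_field_def)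
    show "((\<lambda>t. Y t \<omega>) has_derivative (\<lambda>h. G \<omega> x \<bullet> h)) (at x)" for \<omega> x
      using Gd[of \<omega> x] by (simp add: gderiv_def inner_commute)
    show "G \<omega> differentiable (at x)" for \<omega> x
      using G[of \<omega>] unfolding ok_def differentiable_def by blast
    show "\<exists>m. \<forall>x\<in>cball 0 R. \<forall>y\<in>cball 0 R. norm (G \<omega> x - G \<omega> y) \<le> m * norm (x - y)" for \<omega> R
    proof -
      obtain H :: "real^'n \<Rightarrow> real^'n^'n" where "\<And>x. (G \<omega> has_derivative (\<lambda>h. H x *v h)) (at x)" "continuous_on UNIV H"
        using G[of \<omega>] unfolding ok_def by blast
      then show ?thesis by (rule class_C2_locally_lipschitz)
    qed
    show "emeasure M {\<omega> \<in> space M. (Y 0 \<omega>, G \<omega> 0) \<in> A} \<le> ennreal B * emeasure lborel A" if A: "A \<in> sets borel" for A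
    \<comment> \<open>Measurability of the gradient is a consequence of the locale and not yet available. A set that is not measurable has \<open>emeasure\<close> zero.\<close>
    proof (cases "{\<omega> \<in> space M. (Y 0 \<omega>, G \<omega> 0) \<in> A} \<in> sets M")
      case True
      have XZ: "{\<omega> \<in> space M. (X 0 \<omega>, Z \<omega>) \<in> A} = (\<lambda>\<omega>. (X 0 \<omega>, Z \<omega>)) -` A \<inter> space M" by auto
      have "(\<lambda>\<omega>. (X 0 \<omega>, Z \<omega>)) \<in> M \<rightarrow>\<^sub>M borel" by measurable
      then have m: "{\<omega> \<in> space M. (X 0 \<omega>, Z \<omega>) \<in> A} \<in> sets M" unfolding XZ by (rule measurable_sets) (rule A)
      have "emeasure M {\<omega> \<in> space M. (Y 0 \<omega>, G \<omega> 0) \<in> A} = emeasure M {\<omega> \<in> space M. (X 0 \<omega>, Z \<omega>) \<in> A}"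
      proof (rule emeasure_eq_AE[OF _ True m])
        show "AE \<omega> in M. \<omega> \<in> {\<omega> \<in> space M. (Y 0 \<omega>, G \<omega> 0) \<in> A} \<longleftrightarrow> \<omega> \<in> {\<omega> \<in> space M. (X 0 \<omega>, Z \<omega>) \<in> A}"
          using GZ by eventually_elim (simp only: mem_Collect_eq)
      qed
      also have "\<dots> = (\<integral>\<^sup>+z. p z * indicator A z \<partial>lborel)"
        unfolding XZ by (rule distributed_emeasure[OF p(1)]) (use A in simp)
      also have "\<dots> \<le> (\<integral>\<^sup>+z. ennreal B * indicator A z \<partial>lborel)"
        by (intro nn_integral_mono mult_right_mono p(2)) auto
      also have "\<dots> = ennreal B * emeasure lborel A" by (rule nn_integral_cmult_indicator) (use A in simp)
      finally show ?thesis .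
    qed (simp add: emeasure_notin_sets)
  qed (rule card)
  then show ?thesis using eq by blast
qed

context c2_field begin

text \<open>The segment in which the line meets \<open>Q\<close> need not start at the origin. By stationarity the grid may be
  shifted along the line to its beginning.\<close>

lemma grid_count_moment:
  assumes w: "w \<noteq> 0" and ab: "a < b" "\<And>l. l \<in> {a..b} \<Longrightarrow> l *\<^sub>R w \<in> Q" and \<epsilon>: "\<epsilon> > 0" and h: "h > 0" "real N * h \<le> b - a"
  shows "(\<integral>\<^sup>+\<omega>. ennreal (grid_count u w N h \<omega> powr (1 / \<epsilon>)) \<partial>M)
    \<le> (\<integral>\<^sup>+ \<omega>. ennpowr (hausdorff_measure 0 (level_set (\<lambda>t. X t \<omega>) u \<inter> line0 w \<inter> Q)) (1 / \<epsilon>) \<partial>M)"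
proof -
  let ?F = "\<lambda>\<phi>::real^'n \<Rightarrow> real. ennreal ((\<Sum>n<N. upcross u (\<lambda>n. \<phi> ((real n * h) *\<^sub>R w)) n) powr (1 / \<epsilon>))"
  have [measurable]: "(\<lambda>\<phi>. \<phi> c) \<in> borel_measurable (Pi\<^sub>M UNIV (\<lambda>_. borel :: real measure))" for c :: "real^'n"
    by (rule measurable_component_singleton) simp
  have "?F \<in> borel_measurable (Pi\<^sub>M UNIV (\<lambda>_. borel))" unfolding upcross_def by measurable
  from law_nn_integral[where Y="\<lambda>t. X (t + a *\<^sub>R w)", OF law_shift X_meas this]
  have "(\<integral>\<^sup>+\<omega>. ennreal (grid_count u w N h \<omega> powr (1 / \<epsilon>)) \<partial>M)
    = (\<integral>\<^sup>+\<omega>. ennreal ((\<Sum>n<N. upcross u (\<lambda>n. X ((real n * h) *\<^sub>R w + a *\<^sub>R w) \<omega>) n) powr (1 / \<epsilon>)) \<partial>M)" by simp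
  also have "\<dots> = (\<integral>\<^sup>+\<omega>. ennreal ((\<Sum>n<N. upcross u (\<lambda>n. X ((a + real n * h) *\<^sub>R w) \<omega>) n) powr (1 / \<epsilon>)) \<partial>M)"
    by (simp add: scaleR_left_distrib add.commute)
  also have "\<dots> \<le> (\<integral>\<^sup>+ \<omega>. ennpowr (hausdorff_measure 0 (level_set (\<lambda>t. X t \<omega>) u \<inter> line0 w \<inter> Q)) (1 / \<epsilon>) \<partial>M)"
  proof (rule nn_integral_mono)
    fix \<omega>
    let ?S = "level_set (\<lambda>t. X t \<omega>) u \<inter> line0 w \<inter> Q"
    have "continuous_on UNIV (\<lambda>s. X (s *\<^sub>R w) \<omega>)"
      by (rule DERIV_continuous_on) (rule has_field_derivative_at_within[OF line_deriv])
    from upcross_roots[OF this h(1), of a N u] obtain F where F: "finite F"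
      "F \<subseteq> {z \<in> {a..a + real N * h}. X (z *\<^sub>R w) \<omega> = u}"
      "(\<Sum>n<N. upcross u (\<lambda>n. X ((a + real n * h) *\<^sub>R w) \<omega>) n) = real (card F)" by blast
    have inj: "inj_on (\<lambda>z. z *\<^sub>R w) F" using w by (intro inj_onI) simp
    have "(\<lambda>z. z *\<^sub>R w) ` F \<subseteq> ?S"
    proof (rule image_subsetI)
      fix z assume "z \<in> F"
      then have z: "z \<in> {a..a + real N * h}" "X (z *\<^sub>R w) \<omega> = u" using F(2) by auto
      then have "z *\<^sub>R w \<in> Q" using h(2) by (intro ab(2)) auto
      then show "z *\<^sub>R w \<in> ?S" using z(2) by (auto simp: level_set_def line0_def)
    qed
    then have le: "of_nat (card F) \<le> hausdorff_measure 0 ?S"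
      using card_le_hausdorff_measure_0[of "(\<lambda>z. z *\<^sub>R w) ` F" ?S] F(1) by (simp add: card_image[OF inj])
    show "ennreal ((\<Sum>n<N. upcross u (\<lambda>n. X ((a + real n * h) *\<^sub>R w) \<omega>) n) powr (1 / \<epsilon>)) \<le> ennpowr (hausdorff_measure 0 ?S) (1 / \<epsilon>)"
      unfolding F(3)
    proof (cases "hausdorff_measure 0 ?S")
      case (real r)
      have "real (card F) \<le> r" using le real by (simp add: ennreal_of_nat_eq_real_of_nat)
      then have "real (card F) powr (1 / \<epsilon>) \<le> r powr (1 / \<epsilon>)" using \<epsilon> by (intro powr_mono2) auto
      then show "ennreal (real (card F) powr (1 / \<epsilon>)) \<le> ennpowr (hausdorff_measure 0 ?S) (1 / \<epsilon>)"
        using real by (simp add: ennpowr_def ennreal_leI)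
    next
      case top
      then show "ennreal (real (card F) powr (1 / \<epsilon>)) \<le> ennpowr (hausdorff_measure 0 ?S) (1 / \<epsilon>)"
        by (simp add: ennpowr_def)
    qed
  qed
  finally show ?thesis .
qed

theorem refined_rate_A1_A2:
  assumes w: "norm w = 1" and \<epsilon>: "0 < \<epsilon>" "\<epsilon> < 1"
    and A1: "assumption_A1 M X w" and A2: "assumption_A2 M X Q w \<epsilon> u"
    and Q: "convex Q" "\<not> (\<exists>x. line0 w \<inter> Q \<subseteq> {x})"
  shows "rate u < \<infinity> \<and> (\<exists>K>0. \<forall>q>0. enn2real (rate u) * q - up_prob u (q *\<^sub>R w) \<le> K * q powr (2 - \<epsilon>))"
proof -
  obtain Z p b where Zm[measurable]: "Z \<in> borel_measurable M"
    and Z: "AE \<omega> in M. ((\<lambda>t. X (t *\<^sub>R w) \<omega>) has_real_derivative Z \<omega>) (at 0)"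
    and cd: "has_cond_density M (X 0) Z 0 p" and pb: "\<And>x. p x \<le> ennreal b"
    and D: "(\<integral>\<^sup>+ \<omega>. (SUP t \<in> {0..1}. ennreal \<bar>deriv (deriv (\<lambda>s. X (s *\<^sub>R w) \<omega>)) t\<bar>)\<^sup>2 \<partial>M) < \<infinity>"
  proof -
    have e: "line_process X w 0 = X 0" by (rule ext) (simp add: line_process_def)
    from A1 show thesis
      unfolding assumption_A1_def Let_def e unfolding line_process_def
      by (elim conjE bexE exE) (rule that, assumption+, blast, assumption)
  qed
  have "AE \<omega> in M. Z \<omega> = G \<omega> 0 \<bullet> w"
    using Z
  proof eventually_elim
    case (elim \<omega>)
    from DERIV_unique[OF elim line_deriv] show ?case by simp
  qed
  then have cd': "has_cond_density M (X 0) (\<lambda>\<omega>. G \<omega> 0 \<bullet> w) 0 p"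
    by (intro has_cond_density_cong_AE[OF _ _ _ _ _ _ cd]) auto
  obtain C1 where C1: "C1 > 0" "\<And>t x y. 0 < x \<Longrightarrow> 0 < y \<Longrightarrow>
      measure M {\<omega>\<in>space M. \<bar>X t \<omega> - u\<bar> \<le> x \<and> \<bar>G \<omega> t \<bullet> w\<bar> \<le> y} \<le> C1 * (x * y)"
    using small_ball[OF w cd' pb, of u] by (elim exE conjE) (rule that, assumption, blast)
  obtain m2 where m2: "0 \<le> m2" "(\<integral>\<^sup>+ \<omega>. (SUP t \<in> {0..1}. ennreal \<bar>deriv (deriv (\<lambda>s. X (s *\<^sub>R w) \<omega>)) t\<bar>)\<^sup>2 \<partial>M) = ennreal m2"
    using D by (cases "\<integral>\<^sup>+ \<omega>. (SUP t \<in> {0..1}. ennreal \<bar>deriv (deriv (\<lambda>s. X (s *\<^sub>R w) \<omega>)) t\<bar>)\<^sup>2 \<partial>M") auto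
  let ?J = "\<integral>\<^sup>+ \<omega>. ennpowr (hausdorff_measure 0 (level_set (\<lambda>t. X t \<omega>) u \<inter> line0 w \<inter> Q)) (1 / \<epsilon>) \<partial>M"
  obtain C0 where C0: "0 \<le> C0" "?J = ennreal C0"
    using A2 unfolding assumption_A2_def by (cases ?J) auto
  obtain a b where ab: "a < b" "\<And>l. l \<in> {a..b} \<Longrightarrow> l *\<^sub>R w \<in> Q" using segment_in_convex[OF Q] by blast
  have w0: "w \<noteq> 0" using w by auto
  have r: "0 < min 1 (b - a)" "min 1 (b - a) \<le> 1" using ab by auto
  have mom: "(\<integral>\<^sup>+\<omega>. ennreal (grid_count u w N h \<omega> powr (1 / \<epsilon>)) \<partial>M) \<le> ennreal C0"
    if "0 < h" "real N * h \<le> min 1 (b - a)" for N h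
    unfolding C0(2)[symmetric] by (rule grid_count_moment[OF w0 ab \<epsilon>(1) that(1)]) (use that in auto)
  show ?thesis
    using refined_rate[OF w \<epsilon> r C1(2) eq_refl[OF m2(2)] mom less_imp_le[OF C1(1)] m2(1) C0(1)] by blast
qed

end

lemma assumption_A1_cong_AE:
  fixes X Y :: "real^'n \<Rightarrow> 'w \<Rightarrow> real"
  assumes [measurable]: "\<And>t. X t \<in> borel_measurable M" "\<And>t. Y t \<in> borel_measurable M"
    and eq: "AE \<omega> in M. \<forall>t. Y t \<omega> = X t \<omega>" and A1: "assumption_A1 M X w"
  shows "assumption_A1 M Y w"
proof -
  have eql: "AE \<omega> in M. (\<lambda>t. line_process Y w t \<omega>) = (\<lambda>t. line_process X w t \<omega>)"
    using eq by eventually_elim (simp add: line_process_def)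
  have lm: "line_process X w 0 \<in> borel_measurable M" "line_process Y w 0 \<in> borel_measurable M"
    unfolding line_process_def[abs_def] by simp_all
  obtain Z p b where Z: "Z \<in> borel_measurable M" "AE \<omega> in M. ((\<lambda>t. line_process X w t \<omega>) has_real_derivative Z \<omega>) (at 0)"
    "has_cond_density M (line_process X w 0) Z 0 p" "\<forall>x. p x \<le> ennreal b"
    and D: "(\<integral>\<^sup>+ \<omega>. (SUP t \<in> {0..1}. ennreal \<bar>deriv (deriv (\<lambda>s. line_process X w s \<omega>)) t\<bar>)\<^sup>2 \<partial>M) < \<infinity>"
    using A1 unfolding assumption_A1_def Let_def by (elim conjE bexE exE) (rule that, assumption+)
  have "AE \<omega> in M. ((\<lambda>t. line_process Y w t \<omega>) has_real_derivative Z \<omega>) (at 0)"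
    using eql Z(2) by eventually_elim simp
  moreover have "has_cond_density M (line_process Y w 0) Z 0 p"
    by (rule has_cond_density_cong_AE[OF lm Z(1,1) _ _ Z(3)]) (use eq in \<open>auto simp: line_process_def elim: eventually_mono\<close>)
  moreover have "(\<integral>\<^sup>+ \<omega>. (SUP t \<in> {0..1}. ennreal \<bar>deriv (deriv (\<lambda>s. line_process Y w s \<omega>)) t\<bar>)\<^sup>2 \<partial>M)
    = (\<integral>\<^sup>+ \<omega>. (SUP t \<in> {0..1}. ennreal \<bar>deriv (deriv (\<lambda>s. line_process X w s \<omega>)) t\<bar>)\<^sup>2 \<partial>M)"
    by (rule nn_integral_cong_AE) (use eql in \<open>eventually_elim, simp only:\<close>)
  ultimately show ?thesis using Z(1,4) D unfolding assumption_A1_def Let_def by auto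
qed

theorem theorem2p1:
  fixes M :: "'w measure" and X :: "real^'n \<Rightarrow> 'w \<Rightarrow> real"
    and w :: "real^'n" and u :: real and T :: "(real^'n) set"
  assumes "CARD('n) \<ge> 2"
    and "isotropic_field M X"
    and "assumption_A0 M X"
    and "w \<in> sphere 0 1"
    and "hypercube T"
  shows "((\<lambda>q. ennreal (1 / q * cross_prob M X w u q))
            \<longlongrightarrow> C_star M X T u / ennreal (beta_const CARD('n))) (at_right 0) \<and>
    (\<forall>q>0. ennreal (1 / q * cross_prob M X w u q) \<le> C_star M X T u / ennreal (beta_const CARD('n))) \<and>
    (\<forall>\<epsilon> Q. 0 < \<epsilon> \<and> \<epsilon> < 1 \<and> assumption_A1 M X w \<and>
        hypercube Q \<and> \<not> (\<exists>x. line0 w \<inter> Q \<subseteq> {x}) \<and> assumption_A2 M X Q w \<epsilon> u \<longrightarrow>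
      C_star M X T u < \<infinity> \<and>
      (\<exists>K>0. \<forall>q>0.
        0 \<le> enn2real (C_star M X T u) / beta_const CARD('n) * q - cross_prob M X w u q \<and>
        enn2real (C_star M X T u) / beta_const CARD('n) * q - cross_prob M X w u q
          \<le> K * q powr (2 - \<epsilon>)))"
proof -
  obtain Y G B where "c2_field M Y G B" and eq: "AE \<omega> in M. \<forall>t. Y t \<omega> = X t \<omega>"
    using exists_c2_version[OF assms(1,2,3)] by blast
  interpret F: c2_field M Y G B by fact
  let ?\<beta> = "beta_const CARD('n)"
  have Xm[measurable]: "X t \<in> borel_measurable M" for t
    using assms(3) by (simp add: assumption_A0_def random_field_def)
  have w: "norm w = 1" using assms(4) by simp
  have \<beta>: "?\<beta> > 0" by (simp add: beta_const_pos)
  have cross: "cross_prob M X w u q = F.up_prob u (q *\<^sub>R w)" for q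
    unfolding cross_prob_def F.up_prob_def
  proof (rule measure_eq_AE)
    show "AE \<omega> in M. \<omega> \<in> {\<omega> \<in> space M. X 0 \<omega> \<le> u \<and> u < X (q *\<^sub>R w) \<omega>} \<longleftrightarrow> \<omega> \<in> {\<omega> \<in> space M. Y 0 \<omega> \<le> u \<and> u < Y (q *\<^sub>R w) \<omega>}"
      using eq by eventually_elim simp
  qed measurable
  have "C_star M X T u = C_star M Y T u"
    unfolding C_star_def C_dens_def by (rule nn_integral_cong_AE) (use eq in \<open>eventually_elim, simp\<close>)
  moreover obtain \<tau> where "\<tau> > 0" "emeasure lborel T = ennreal \<tau>" using hypercube_props(3)[OF assms(5)] by blast
  ultimately have rate: "F.rate u = C_star M X T u / ennreal ?\<beta>"
    using F.rate_eq[OF hypercube_props(1,2)[OF assms(5)]] by simp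
  have 1: "((\<lambda>q. ennreal (1 / q * cross_prob M X w u q)) \<longlongrightarrow> C_star M X T u / ennreal ?\<beta>) (at_right 0)"
    unfolding cross rate[symmetric] by (rule F.rate_tendsto[OF w])
  have 2: "ennreal (1 / q * cross_prob M X w u q) \<le> C_star M X T u / ennreal ?\<beta>" if "q > 0" for q
    unfolding cross rate[symmetric] by (rule F.up_prob_div_le_rate[OF w that])
  have 3: "C_star M X T u < \<infinity> \<and> (\<exists>K>0. \<forall>q>0.
        0 \<le> enn2real (C_star M X T u) / ?\<beta> * q - cross_prob M X w u q \<and>
        enn2real (C_star M X T u) / ?\<beta> * q - cross_prob M X w u q \<le> K * q powr (2 - \<epsilon>))"
    if \<epsilon>: "0 < \<epsilon>" "\<epsilon> < 1" and A1: "assumption_A1 M X w" and Q: "hypercube Q" "\<not> (\<exists>x. line0 w \<inter> Q \<subseteq> {x})"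
      and A2: "assumption_A2 M X Q w \<epsilon> u" for \<epsilon> Q
  proof -
    have A1': "assumption_A1 M Y w" by (rule assumption_A1_cong_AE[OF Xm F.X_meas eq A1])
    have "(\<integral>\<^sup>+ \<omega>. ennpowr (hausdorff_measure 0 (level_set (\<lambda>t. Y t \<omega>) u \<inter> line0 w \<inter> Q)) (1 / \<epsilon>) \<partial>M)
      = (\<integral>\<^sup>+ \<omega>. ennpowr (hausdorff_measure 0 (level_set (\<lambda>t. X t \<omega>) u \<inter> line0 w \<inter> Q)) (1 / \<epsilon>) \<partial>M)"
      by (rule nn_integral_cong_AE) (use eq in \<open>eventually_elim, simp\<close>)
    then have A2': "assumption_A2 M Y Q w \<epsilon> u" using A2 by (simp add: assumption_A2_def)
    have "F.rate u < \<infinity>" and ex: "\<exists>K>0. \<forall>q>0. enn2real (F.rate u) * q - F.up_prob u (q *\<^sub>R w) \<le> K * q powr (2 - \<epsilon>)"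
      using F.refined_rate_A1_A2[OF w \<epsilon> A1' A2' hypercube_props(2)[OF Q(1)] Q(2)] by blast+
    then have "C_star M X T u \<noteq> \<top>" using \<beta> by (auto simp: rate ennreal_top_divide)
    then obtain c where c: "c \<ge> 0" "C_star M X T u = ennreal c" by (cases "C_star M X T u") auto
    have r: "F.rate u = ennreal (c / ?\<beta>)" using c \<beta> by (simp add: rate divide_ennreal)
    have er: "enn2real (F.rate u) = c / ?\<beta>" using c \<beta> by (simp add: r)
    have low: "0 \<le> c / ?\<beta> * q - cross_prob M X w u q" if q: "q > 0" for q
    proof -
      have "ennreal (1 / q * cross_prob M X w u q) \<le> ennreal (c / ?\<beta>)" using 2[OF q] by (simp add: rate[symmetric] r)
      then have "1 / q * cross_prob M X w u q \<le> c / ?\<beta>" using c \<beta> by (subst (asm) ennreal_le_iff) auto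
      then have "q * (1 / q * cross_prob M X w u q) \<le> q * (c / ?\<beta>)" using q by (intro mult_left_mono) auto
      then show ?thesis using q by (simp add: mult.commute)
    qed
    show ?thesis using ex low c \<beta> by (simp add: er cross)
  qed
  show ?thesis using 1 2 3 by blast
qed

end
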